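(* Let $N\ge2$, $0<\alpha<1$, let $\Omega\subset\mathbb{R}^N$ be a bounded domain with connected boundary $\Gamma$ of class $C^{2,\alpha}$, let $H$ be the mean curvature of $\Gamma$ and suppose there is a constant $\underline H>0$ with $H\ge\underline H$ on $\Gamma$. Let $H_0=\frac{|\Gamma|}{N|\Omega|}$, $u$ the solution of $\Delta u=N$ in $\Omega$, $u=0$ on $\Gamma$, and $M=\max_{\overline\Omega}|\nabla u|$. There exist constants $k_N,\alpha_N>0$ depending only on $N$ and a point $z\in\Omega$ such that, with $\rho_i=\min_{x\in\Gamma}|x-z|$, $\rho_e=\max_{x\in\Gamma}|x-z|$ and $\mu_0(\Omega)$ computed with respect to $x_0=z$: (i) if $N=2$ or $3$, $\rho_e-\rho_i\le C\|H_0-H\|_{L^\infty(\Gamma)}^{1/2}$ with $C=k_N\,c\,\frac{d_\Omega^\gamma|\Omega|^{\frac12-\frac1N}}{\underline H^{1/2}}\frac{1+\mu_0(\Omega)}{\mu_0(\Omega)}$; (ii) if $N\ge4$, $\rho_e-\rho_i\le C\|H_0-H\|_{L^\infty(\Gamma)}^{1/(N+2)}$ whenever $\|H_0-H\|_{L^\infty(\Gamma)}<\varepsilon$, with $C=k_N\frac{M^{N/(N+2)}}{\mu_0(\Omega)^{2/(N+2)}|\Omega|^{\frac1N-\frac1{N+2}}\underline H^{1/(N+2)}}$ and $\varepsilon=\alpha_N\frac{\underline H}{|\Omega|}\mu_0(\Omega)^2M^2r_i^{N+2}$.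
   Context: $|\Omega|$ volume, $|\Gamma|$ surface measure, $d_\Omega$ diameter. $H=\frac1{N-1}\mathrm{div}\,\nu$ with $\nu$ the outward normal (sphere of radius $\rho$ has $H=1/\rho$). $r_i>0$ is a radius of the uniform interior sphere condition (for every $p\in\Gamma$ a ball of radius $r_i$ in $\Omega$ has closure meeting $\Gamma$ only at $p$). For $x_0\in\Omega$, $\mu_0(\Omega)=\inf\{\int_\Omega|\nabla v|^2:\ v\in W^{1,2}(\Omega),\ \Delta v=0,\ \int_\Omega v^2=1,\ v(x_0)=0\}>0$. For $N=2$, $\gamma\in(0,1)$ is fixed; for $N=3$, $\gamma=1/2$; $c$ satisfies $|v(x)-v(y)|\le c\|v\|_{W^{2,2}(\Omega)}|x-y|^\gamma$ for all $v\in W^{2,2}(\Omega)$, $x,y\in\overline\Omega$. *)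

theory Defs
  imports "HOL-Analysis.Analysis"
begin

definition has_pd :: "'a::euclidean_space \<Rightarrow> ('a \<Rightarrow> real) \<Rightarrow> 'a \<Rightarrow> bool" where
  "has_pd b f x \<longleftrightarrow> (\<exists>d. ((\<lambda>t. f (x + t *\<^sub>R b)) has_real_derivative d) (at 0))"

definition pd :: "'a::euclidean_space \<Rightarrow> ('a \<Rightarrow> real) \<Rightarrow> 'a \<Rightarrow> real" where
  "pd b f x = (THE d. ((\<lambda>t. f (x + t *\<^sub>R b)) has_real_derivative d) (at 0))"

fun ipd :: "'a::euclidean_space list \<Rightarrow> ('a \<Rightarrow> real) \<Rightarrow> 'a \<Rightarrow> real" where
  "ipd [] f = f"
| "ipd (b # bs) f = pd b (ipd bs f)"

definition grad :: "('a::euclidean_space \<Rightarrow> real) \<Rightarrow> 'a \<Rightarrow> 'a" where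
  "grad f x = (\<Sum>b\<in>Basis. pd b f x *\<^sub>R b)"

definition laplacian :: "('a::euclidean_space \<Rightarrow> real) \<Rightarrow> 'a \<Rightarrow> real" where
  "laplacian f x = (\<Sum>b\<in>Basis. pd b (pd b f) x)"

definition divergence :: "('a::euclidean_space \<Rightarrow> 'a) \<Rightarrow> 'a \<Rightarrow> real" where
  "divergence F x = (\<Sum>b\<in>Basis. pd b (\<lambda>y. F y \<bullet> b) x)"

definition C2_on :: "'a::euclidean_space set \<Rightarrow> ('a \<Rightarrow> real) \<Rightarrow> bool" where
  "C2_on U f \<longleftrightarrow> continuous_on U f
     \<and> (\<forall>b\<in>Basis. \<forall>x\<in>U. has_pd b f x) \<and> (\<forall>b\<in>Basis. continuous_on U (pd b f))
     \<and> (\<forall>b\<in>Basis. \<forall>c\<in>Basis. \<forall>x\<in>U. has_pd c (pd b f) x)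
     \<and> (\<forall>b\<in>Basis. \<forall>c\<in>Basis. continuous_on U (pd c (pd b f)))"

definition C2alpha_on :: "real \<Rightarrow> 'a::euclidean_space set \<Rightarrow> ('a \<Rightarrow> real) \<Rightarrow> bool" where
  "C2alpha_on \<alpha> U f \<longleftrightarrow> C2_on U f \<and>
     (\<exists>L. \<forall>b\<in>Basis. \<forall>c\<in>Basis. \<forall>x\<in>U. \<forall>y\<in>U.
        \<bar>pd c (pd b f) x - pd c (pd b f) y\<bar> \<le> L * dist x y powr \<alpha>)"

definition smooth_on :: "'a::euclidean_space set \<Rightarrow> ('a \<Rightarrow> real) \<Rightarrow> bool" where
  "smooth_on U f \<longleftrightarrow> (\<forall>bs. set bs \<subseteq> Basis \<longrightarrow>
      continuous_on U (ipd bs f) \<and> (\<forall>b\<in>Basis. \<forall>x\<in>U. has_pd b (ipd bs f) x))"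

definition test_fun :: "'a::euclidean_space set \<Rightarrow> ('a \<Rightarrow> real) \<Rightarrow> bool" where
  "test_fun \<Omega> \<phi> \<longleftrightarrow> smooth_on UNIV \<phi> \<and> compact (closure {x. \<phi> x \<noteq> 0})
      \<and> closure {x. \<phi> x \<noteq> 0} \<subseteq> \<Omega>"

definition L2_on :: "'a::euclidean_space set \<Rightarrow> ('a \<Rightarrow> real) \<Rightarrow> bool" where
  "L2_on \<Omega> f \<longleftrightarrow> f \<in> borel_measurable (lebesgue_on \<Omega>)
      \<and> integrable (lebesgue_on \<Omega>) (\<lambda>x. (f x)\<^sup>2)"

definition weak_pd :: "'a::euclidean_space set \<Rightarrow> 'a list \<Rightarrow> ('a \<Rightarrow> real) \<Rightarrow> ('a \<Rightarrow> real) \<Rightarrow> bool" where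
  "weak_pd \<Omega> bs v g \<longleftrightarrow> (\<forall>\<phi>. test_fun \<Omega> \<phi> \<longrightarrow>
      (\<integral>x. v x * ipd bs \<phi> x \<partial>lebesgue_on \<Omega>) = (-1) ^ length bs * (\<integral>x. g x * \<phi> x \<partial>lebesgue_on \<Omega>))"

text \<open>c is a constant in the embedding |v(x)-v(y)| \<le> c \<parallel>v\<parallel>_{W^{2,2}} |x-y|^gamma for all v in W^{2,2}
  (continuous representative on the closure), with
  \<parallel>v\<parallel>^2 = \<parallel>v\<parallel>_2^2 + \<Sum>_i \<parallel>D_i v\<parallel>_2^2 + \<Sum>_{i,j} \<parallel>D_ij v\<parallel>_2^2.\<close>
definition sobolev_holder_const :: "'a::euclidean_space set \<Rightarrow> real \<Rightarrow> real \<Rightarrow> bool" where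
  "sobolev_holder_const \<Omega> \<gamma> c \<longleftrightarrow>
    (\<forall>v g h. continuous_on (closure \<Omega>) v \<and> L2_on \<Omega> v
      \<and> (\<forall>b\<in>Basis. L2_on \<Omega> (g b) \<and> weak_pd \<Omega> [b] v (g b))
      \<and> (\<forall>b\<in>Basis. \<forall>b'\<in>Basis. L2_on \<Omega> (h b b') \<and> weak_pd \<Omega> [b, b'] v (h b b'))
      \<longrightarrow> (\<forall>x\<in>closure \<Omega>. \<forall>y\<in>closure \<Omega>.
            \<bar>v x - v y\<bar> \<le> c * sqrt ((\<integral>z. (v z)\<^sup>2 \<partial>lebesgue_on \<Omega>)
                 + (\<Sum>b\<in>Basis. \<integral>z. (g b z)\<^sup>2 \<partial>lebesgue_on \<Omega>)
                 + (\<Sum>b\<in>Basis. \<Sum>b'\<in>Basis. \<integral>z. (h b b' z)\<^sup>2 \<partial>lebesgue_on \<Omega>))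
               * dist x y powr \<gamma>))"

definition hausdorff_const :: "real \<Rightarrow> real" where
  "hausdorff_const s = pi powr (s / 2) / (Gamma (s / 2 + 1) * 2 powr s)"

definition hausdorff_measure :: "real \<Rightarrow> 'a::euclidean_space set \<Rightarrow> ennreal" where
  "hausdorff_measure s A = (SUP \<delta>\<in>{0<..}.
      INF C\<in>{C :: nat \<Rightarrow> 'a set. A \<subseteq> (\<Union>i. C i) \<and> (\<forall>i. bounded (C i) \<and> diameter (C i) \<le> \<delta>)}.
        (\<Sum>i. ennreal (hausdorff_const s * diameter (C i) powr s)))"

definition surface_area :: "'a::euclidean_space set \<Rightarrow> real" where
  "surface_area \<Gamma> = enn2real (hausdorff_measure (real DIM('a) - 1) \<Gamma>)"

definition local_defining_fun ::
    "real \<Rightarrow> 'a::euclidean_space set \<Rightarrow> 'a \<Rightarrow> real \<Rightarrow> ('a \<Rightarrow> real) \<Rightarrow> bool" where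
  "local_defining_fun \<alpha> \<Omega> p r \<phi> \<longleftrightarrow> 0 < r \<and> C2alpha_on \<alpha> (ball p r) \<phi>
     \<and> (\<forall>x\<in>ball p r. grad \<phi> x \<noteq> 0)
     \<and> \<Omega> \<inter> ball p r = {x\<in>ball p r. \<phi> x < 0}
     \<and> frontier \<Omega> \<inter> ball p r = {x\<in>ball p r. \<phi> x = 0}"

definition C2alpha_boundary :: "real \<Rightarrow> 'a::euclidean_space set \<Rightarrow> bool" where
  "C2alpha_boundary \<alpha> \<Omega> \<longleftrightarrow> (\<forall>p\<in>frontier \<Omega>. \<exists>r \<phi>. local_defining_fun \<alpha> \<Omega> p r \<phi>)"

text \<open>H = (1/(N-1)) div \<nu>, \<nu> = \<nabla>\<phi>/|\<nabla>\<phi>| the outward unit normal field.\<close>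
definition is_mean_curvature :: "real \<Rightarrow> 'a::euclidean_space set \<Rightarrow> ('a \<Rightarrow> real) \<Rightarrow> bool" where
  "is_mean_curvature \<alpha> \<Omega> H \<longleftrightarrow> (\<forall>p\<in>frontier \<Omega>. \<forall>r \<phi>. local_defining_fun \<alpha> \<Omega> p r \<phi> \<longrightarrow>
      H p = divergence (\<lambda>x. (1 / norm (grad \<phi> x)) *\<^sub>R grad \<phi> x) p / (real DIM('a) - 1))"

definition interior_sphere_cond :: "'a::euclidean_space set \<Rightarrow> real \<Rightarrow> bool" where
  "interior_sphere_cond \<Omega> r \<longleftrightarrow> (\<forall>p\<in>frontier \<Omega>. \<exists>x. ball x r \<subseteq> \<Omega> \<and> cball x r \<inter> frontier \<Omega> = {p})"

definition mu0 :: "'a::euclidean_space set \<Rightarrow> 'a \<Rightarrow> real" where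
  "mu0 \<Omega> x0 = Inf {\<integral>x. (norm (grad v x))\<^sup>2 \<partial>lebesgue_on \<Omega> | v.
      C2_on \<Omega> v \<and> (\<forall>x\<in>\<Omega>. laplacian v x = 0) \<and> L2_on \<Omega> v
      \<and> integrable (lebesgue_on \<Omega>) (\<lambda>x. (norm (grad v x))\<^sup>2)
      \<and> (\<integral>x. (v x)\<^sup>2 \<partial>lebesgue_on \<Omega>) = 1 \<and> v x0 = 0}"

end

theory Submission
 imports Defs
begin

text \<open>
  Let h(x) = |x - z|^2/2 - u(x), a harmonic function whose oscillation on the boundary is that of |x - z|^2/2.
  Integrating |D^2 h|^2 against cutoffs that are functions of rho/eps, where rho is a global defining function,
  replaces boundary integrals by integrals over thin strips. There the tangential part of grad u is
  negligible, by a barrier comparison for difference quotients of u; its normal part q enters as a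
  quadratic polynomial whose leading coefficient is the mean curvature, and is removed by completing the square.
  What remains is the flux of the field grad rho/|grad rho| through the strips; cutting the boundary into
  small pieces, the isodiametric inequality bounds it by the Hausdorff measure. Thus the integral of |D^2 h|^2 is at
  most N(N-1) |Omega| sup|H_0 - H| / inf H. If z is a critical point of u, then h - h(z) and the derivatives
  of h vanish at z, so mu_0 bounds h - h(z) in W^{2,2}. The oscillation of h is then controlled by the Sobolev
  embedding (N = 2, 3), or by mean values over interior balls of optimal radius (N >= 4).
\<close>

section \<open>Differentiation and integration by parts\<close>

text \<open>The solution \<open>u\<close> is only C^2 inside and continuous up to the boundary, and
  the area is a Hausdorff measure, so neither a trace of \<open>grad u\<close> nor a divergence
  theorem with boundary term is at hand. The argument survives because it asks for inequalities in
  one direction only: the strips must carry at most the boundary area, and the completed square has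
  a sign. For the same reason only a lower bound of H enters, the larger of \<open>Hl\<close> and
  \<open>H0 - \<delta>\<close>.

  The exponent 3/4 of the barrier lies between 1/2 and 1: at distance s the tangential gradient is
  of order s^(3/4), its derivatives are of order s^(-1/4), and the product s^(1/2) vanishes at the
  boundary.

  The exponent 1/(N+2) in high dimension balances sqrt(D) / (\<mu> \<sigma>^(N/2)), the mean value
  bound over a ball of radius \<sigma>, against M \<sigma>, the oscillation between its centre and
  the boundary. The smallness condition makes this \<sigma> fit into the interior spheres. The
  factor |\<Omega>|^(1/N) in the denominators comes from comparing \<Omega> with a ball of radius
  \<rho>_e about z.\<close>

lemma pd_eqI:
 assumes "((\<lambda>t. f (x + t *\<^sub>R b)) has_real_derivative d) (at 0)"
 shows "pd b f x = d"
 unfolding pd_def using assms by (intro the_equality) (auto intro: DERIV_unique)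

lemma has_pdI:
 assumes "((\<lambda>t. f (x + t *\<^sub>R b)) has_real_derivative d) (at 0)"
 shows "has_pd b f x"
 using assms by (auto simp: has_pd_def)

lemma gderiv_line:
 assumes "GDERIV f (x + t *\<^sub>R b) :> D"
 shows "((\<lambda>t. f (x + t *\<^sub>R b)) has_real_derivative (D \<bullet> b)) (at t)"
proof -
 have g: "(f has_derivative (\<lambda>h. h \<bullet> D)) (at (x + t *\<^sub>R b))"
  using assms by (simp add: gderiv_def)
 have "((\<lambda>t. x + t *\<^sub>R b) has_derivative (\<lambda>s. s *\<^sub>R b)) (at t)"
  by (auto intro!: derivative_eq_intros)
 from has_derivative_compose[OF this g]
 show ?thesis by (simp add: has_field_derivative_def inner_commute mult_commute_abs)
qed

lemma gderiv_has_pd: "GDERIV f x :> D ==> has_pd b f x"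
 using gderiv_line[of f x 0 b D] by (auto intro: has_pdI)

lemma gderiv_pd: "GDERIV f x :> D ==> pd b f x = D \<bullet> b"
 using gderiv_line[of f x 0 b D] by (auto intro: pd_eqI)

lemma gderiv_grad: "GDERIV f x :> D ==> grad f x = D"
 unfolding grad_def by (simp add: gderiv_pd euclidean_representation)

lemma pd_eq_grad: "b \<in> Basis ==> pd b f x = grad f x \<bullet> b"
 unfolding grad_def by (simp add: inner_sum_left inner_Basis if_distrib cong: if_cong)

lemma gderiv_unique:
 fixes D E :: "'a::euclidean_space"
 shows "GDERIV f x :> D ==> GDERIV f x :> E ==> D = E"
 by (metis gderiv_grad)

lemma gderiv_cong:
 assumes "open U" "x \<in> U" "\<And>y. y \<in> U ==> f y = g y" "GDERIV f x :> D"
 shows "GDERIV g x :> D"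
 using has_derivative_transform_within_open[OF assms(4)[unfolded gderiv_def] assms(1,2)] assms(3)
 by (simp add: gderiv_def)

lemma line_eventually_cong:
 fixes x :: "'a::euclidean_space"
 assumes "open U" "x \<in> U" "\<And>y. y \<in> U ==> f y = g y"
 shows "((\<lambda>t. f (x + t *\<^sub>R b)) has_real_derivative d) (at 0) \<longleftrightarrow>
     ((\<lambda>t. g (x + t *\<^sub>R b)) has_real_derivative d) (at 0)"
proof (rule DERIV_cong_ev)
 have "((\<lambda>t. x + t *\<^sub>R b) \<longlongrightarrow> x + 0 *\<^sub>R b) (nhds (0::real))"
  by (intro tendsto_intros filterlim_ident)
 then have "\<forall>\<^sub>F t in nhds 0. x + t *\<^sub>R b \<in> U"
  using assms(1,2) by (intro topological_tendstoD) auto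
 then show "\<forall>\<^sub>F t in nhds 0. f (x + t *\<^sub>R b) = g (x + t *\<^sub>R b)"
  by eventually_elim (use assms(3) in auto)
qed auto

lemma pd_cong:
 assumes "open U" "x \<in> U" "\<And>y. y \<in> U ==> f y = g y"
 shows "pd b f x = pd b g x"
 unfolding pd_def using line_eventually_cong[OF assms(1,2), of f g] assms(3) by simp

lemma grad_cong:
 assumes "open U" "x \<in> U" "\<And>y. y \<in> U ==> f y = g y"
 shows "grad f x = grad g x"
 unfolding grad_def using pd_cong[OF assms(1,2), of f g] assms(3) by simp

lemma has_pd_line:
 assumes "has_pd b f (x + t *\<^sub>R b)"
 shows "((\<lambda>t. f (x + t *\<^sub>R b)) has_real_derivative pd b f (x + t *\<^sub>R b)) (at t)"
proof -
 obtain d where d: "((\<lambda>s. f (x + t *\<^sub>R b + s *\<^sub>R b)) has_real_derivative d) (at 0)"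
  using assms by (auto simp: has_pd_def)
 have "pd b f (x + t *\<^sub>R b) = d" by (rule pd_eqI[OF d])
 moreover have "((\<lambda>t. f (x + t *\<^sub>R b)) has_real_derivative d) (at (0 + t))"
  using d unfolding DERIV_shift by (simp add: algebra_simps)
 ultimately show ?thesis by simp
qed

text \<open>The notions in the statement differentiate along lines only, while chain and product
  rules need Frechet gradients. The increment is decomposed into one coordinate step per basis
  vector, and the mean value theorem together with continuity of the partial derivatives controls
  each step.\<close>

lemma gderiv_from_partials:
 fixes f :: "'a::euclidean_space \<Rightarrow> real"
 assumes U: "open U" and hp: "\<And>b y. b \<in> Basis ==> y \<in> U ==> has_pd b f y"
  and cp: "\<And>b. b \<in> Basis ==> continuous_on U (pd b f)" and x: "x \<in> U"
 shows "GDERIV f x :> grad f x"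
 unfolding gderiv_def has_derivative_at_alt
proof (intro conjI allI impI)
 show "bounded_linear (\<lambda>h. h \<bullet> grad f x)" by (rule bounded_linear_inner_left)
 fix e :: real assume e: "e > 0"
 define N where "N = real DIM('a)"
 have N: "N > 0" unfolding N_def by simp
 have "\<exists>d>0. \<forall>y. norm (y - x) < d \<longrightarrow> y \<in> U \<and> \<bar>pd b f y - pd b f x\<bar> < e / N" if b: "b \<in> Basis" for b
 proof -
  from U x obtain d1 where d1: "d1 > 0" "ball x d1 \<subseteq> U" by (auto simp: open_contains_ball)
  have "isCont (pd b f) x" using cp[OF b] U x by (simp add: continuous_on_eq_continuous_at)
  then obtain d2 where "d2 > 0" "\<And>y. dist y x < d2 ==> dist (pd b f y) (pd b f x) < e / N"
   unfolding continuous_at_eps_delta using e N by (metis divide_pos_pos)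
  then show ?thesis using d1
   by (intro exI[of _ "min d1 d2"]) (auto simp: dist_norm norm_minus_commute subset_iff)
 qed
 then obtain d where d: "\<And>b. b \<in> Basis ==> d b > 0"
   "\<And>b y. b \<in> Basis ==> norm (y - x) < d b ==> y \<in> U \<and> \<bar>pd b f y - pd b f x\<bar> < e / N" by metis
 \<comment> \<open>Division by the dimension: a point reached after some of the coordinate steps is
   at distance at most \<open>N * norm v\<close> from x, so all intermediate points stay in the
   neighbourhood.\<close>
 define D where "D = Min (d ` Basis) / N"
 have D0: "D > 0" unfolding D_def using d N by simp
 have DN: "\<And>b. b \<in> Basis ==> D * N \<le> d b" unfolding D_def using N by simp
 show "\<exists>D>0. \<forall>y. norm (y - x) < D \<longrightarrow> norm (f y - f x - (y - x) \<bullet> grad f x) \<le> e * norm (y - x)"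
 proof (intro exI[of _ D] conjI allI impI D0)
  fix y assume y: "norm (y - x) < D"
  define v where "v = y - x"
  have tele: "B \<subseteq> Basis ==> \<bar>f (x + (\<Sum>b\<in>B. (v \<bullet> b) *\<^sub>R b)) - f x - (\<Sum>b\<in>B. (v \<bullet> b) * pd b f x)\<bar> \<le> real (card B) * (e / N) * norm v" if "finite B" for B
   using that
  proof (induction B)
   case empty then show ?case by simp
  next
   case (insert c B)
   have c: "c \<in> Basis" and BB: "B \<subseteq> Basis" using insert by auto
   define p where "p = x + (\<Sum>b\<in>B. (v \<bullet> b) *\<^sub>R b)"
   have close: "norm (p + s *\<^sub>R c - x) < d c" if s: "\<bar>s\<bar> \<le> \<bar>v \<bullet> c\<bar>" for s
   proof -
    have "norm (p + s *\<^sub>R c - x) \<le> norm (\<Sum>b\<in>B. (v \<bullet> b) *\<^sub>R b) + \<bar>s\<bar>"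
     unfolding p_def using norm_triangle_ineq[of "\<Sum>b\<in>B. (v \<bullet> b) *\<^sub>R b" "s *\<^sub>R c"] c by simp
    also have "\<dots> \<le> (\<Sum>b\<in>B. \<bar>v \<bullet> b\<bar>) + \<bar>v \<bullet> c\<bar>"
     using s BB by (intro add_mono order_trans[OF norm_sum] sum_mono) auto
    also have "\<dots> = (\<Sum>b\<in>insert c B. \<bar>v \<bullet> b\<bar>)" using insert by simp
    also have "\<dots> \<le> (\<Sum>b\<in>Basis. \<bar>v \<bullet> b\<bar>)" using insert by (intro sum_mono2) auto
    also have "\<dots> \<le> (\<Sum>b\<in>(Basis::'a set). norm v)" by (intro sum_mono Basis_le_norm)
    also have "\<dots> = N * norm v" by (simp add: N_def)
    also have "\<dots> < N * D" using y N by (simp add: v_def)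
    also have "\<dots> \<le> d c" using DN[OF c] by (simp add: mult.commute)
    finally show ?thesis .
   qed
   have e1: "x + (\<Sum>b\<in>insert c B. (v \<bullet> b) *\<^sub>R b) = p + (v \<bullet> c) *\<^sub>R c" using insert by (simp add: p_def algebra_simps)
   define S where "S = closed_segment 0 (v \<bullet> c)"
   have S: "\<bar>s\<bar> \<le> \<bar>v \<bullet> c\<bar>" if "s \<in> S" for s using that by (auto simp: S_def closed_segment_eq_real_ivl split: if_splits)
   have "norm ((f (p + (v \<bullet> c) *\<^sub>R c) - (v \<bullet> c) * pd c f x) - (f (p + 0 *\<^sub>R c) - 0 * pd c f x)) \<le> e / N * norm (v \<bullet> c - 0)"
   proof (rule field_differentiable_bound[of S _ "\<lambda>s. pd c f (p + s *\<^sub>R c) - pd c f x"])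
    fix s assume s: "s \<in> S"
    show "((\<lambda>s. f (p + s *\<^sub>R c) - s * pd c f x) has_field_derivative pd c f (p + s *\<^sub>R c) - pd c f x) (at s within S)"
     by (rule has_field_derivative_at_within[OF DERIV_diff[OF has_pd_line DERIV_cmult_right[OF DERIV_ident, simplified]]])
      (use d(2)[OF c close[OF S[OF s]]] hp[OF c] in auto)
    show "norm (pd c f (p + s *\<^sub>R c) - pd c f x) \<le> e / N" using d(2)[OF c close[OF S[OF s]]] by simp
   qed (auto simp: S_def)
   moreover have "e / N * \<bar>v \<bullet> c\<bar> \<le> e / N * norm v" using e N by (intro mult_left_mono Basis_le_norm c) auto
   moreover have "\<bar>f p - f x - (\<Sum>b\<in>B. (v \<bullet> b) * pd b f x)\<bar> \<le> real (card B) * (e / N) * norm v"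
    using insert BB by (simp add: p_def)
   ultimately show ?case unfolding e1 unfolding sum.insert[OF insert(1,2)] card_insert_disjoint[OF insert(1,2)]
    by (simp add: distrib_right abs_le_iff algebra_simps)
  qed
  have "x + (\<Sum>b\<in>Basis. (v \<bullet> b) *\<^sub>R b) = y" by (simp add: euclidean_representation v_def)
  moreover have "(\<Sum>b\<in>Basis. (v \<bullet> b) * pd b f x) = v \<bullet> grad f x"
   unfolding grad_def by (simp add: inner_sum_right mult.commute)
  ultimately show "norm (f y - f x - (y - x) \<bullet> grad f x) \<le> e * norm (y - x)"
   using tele[OF finite_Basis order_refl] N by (simp add: v_def N_def)
 qed
qed

text \<open>\<open>grad\<close> is total and carries no information where partial derivatives fail
  to exist, so differentiability is stated through \<open>GDERIV\<close> with
  \<open>grad f x\<close> as the derivative.\<close>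

definition C1_on :: "'a::euclidean_space set \<Rightarrow> ('a \<Rightarrow> real) \<Rightarrow> bool" where
 "C1_on U f \<longleftrightarrow> (\<forall>x\<in>U. GDERIV f x :> grad f x) \<and> continuous_on U (grad f)"

lemma C1_onD: "C1_on U f ==> x \<in> U ==> GDERIV f x :> grad f x"
 by (simp add: C1_on_def)

lemma C1_on_continuous_grad: "C1_on U f ==> continuous_on U (grad f)"
 by (simp add: C1_on_def)

lemma C1_onI:
 assumes "\<And>x. x \<in> U ==> GDERIV f x :> G x" "continuous_on U G"
 shows "C1_on U f"
proof -
 have *: "\<And>x. x \<in> U ==> grad f x = G x" using assms(1) gderiv_grad by blast
 then have "continuous_on U (grad f)" using assms(2) by (simp cong: continuous_on_cong)
 then show ?thesis using * assms(1) by (simp add: C1_on_def)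
qed

lemma C1_on_subset: "C1_on U f ==> V \<subseteq> U ==> C1_on V f"
 by (auto simp: C1_on_def intro: continuous_on_subset)

lemma gderiv_isCont: "GDERIV f x :> D ==> isCont f x"
 unfolding gderiv_def by (rule has_derivative_continuous)

lemma C1_on_continuous: "C1_on U f ==> continuous_on U f"
 by (meson C1_onD continuous_at_imp_continuous_on gderiv_isCont)

lemma C1_on_continuous_pd: "C1_on U f ==> b \<in> Basis ==> continuous_on U (pd b f)"
 using C1_on_continuous_grad[of U f] by (simp add: pd_eq_grad continuous_on_inner)

lemma C1_on_cong:
 assumes "open U" "\<And>y. y \<in> U ==> f y = g y" "C1_on U f"
 shows "C1_on U g"
 using assms by (intro C1_onI[of U g "grad f"]) (auto intro: gderiv_cong C1_onD simp: C1_on_def)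

lemma C1_on_const[simp]: "C1_on U (\<lambda>x. c)"
 by (rule C1_onI[where G="\<lambda>_. 0"]) (auto intro: GDERIV_const)

lemma C1_on_add: "C1_on U f ==> C1_on U g ==> C1_on U (\<lambda>x. f x + g x)"
 by (rule C1_onI[where G="\<lambda>x. grad f x + grad g x"])
   (auto intro!: GDERIV_add continuous_intros dest: C1_onD C1_on_continuous_grad)

lemma C1_on_diff: "C1_on U f ==> C1_on U g ==> C1_on U (\<lambda>x. f x - g x)"
 by (rule C1_onI[where G="\<lambda>x. grad f x - grad g x"])
   (auto intro!: GDERIV_diff continuous_intros dest: C1_onD C1_on_continuous_grad)

lemma C1_on_mult: "C1_on U f ==> C1_on U g ==> C1_on U (\<lambda>x. f x * g x)"
 by (rule C1_onI[where G="\<lambda>x. f x *\<^sub>R grad g x + g x *\<^sub>R grad f x"])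
   (auto intro!: GDERIV_mult continuous_intros dest: C1_onD C1_on_continuous_grad C1_on_continuous)

lemma C1_on_sum: "(\<And>i. i \<in> I ==> C1_on U (f i)) ==> C1_on U (\<lambda>x. \<Sum>i\<in>I. f i x)"
 by (induction I rule: infinite_finite_induct) (auto intro: C1_on_add)

lemma gderiv_sum: "(\<And>i. i \<in> I ==> GDERIV (f i) x :> D i) ==> GDERIV (\<lambda>x. \<Sum>i\<in>I. f i x) x :> (\<Sum>i\<in>I. D i)"
 by (induction I rule: infinite_finite_induct) (auto intro: GDERIV_add GDERIV_const)

lemma gderiv_inner_left: "GDERIV (\<lambda>x. x \<bullet> a) x :> a"
 unfolding gderiv_def by (auto intro!: derivative_eq_intros)

lemma C1_on_inner_left[simp]: "C1_on U (\<lambda>x. x \<bullet> a)"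
 by (rule C1_onI[where G="\<lambda>x. a"]) (simp_all only: gderiv_inner_left continuous_on_const)

lemma C1_on_compose:
 assumes "C1_on U f" "\<And>x. x \<in> U ==> (\<phi> has_real_derivative \<phi>' (f x)) (at (f x))"
  "continuous_on (f ` U) \<phi>'"
 shows "C1_on U (\<lambda>x. \<phi> (f x))"
proof (rule C1_onI[where G="\<lambda>x. \<phi>' (f x) *\<^sub>R grad f x"])
 show "continuous_on U (\<lambda>x. \<phi>' (f x) *\<^sub>R grad f x)"
  by (rule continuous_on_scaleR[OF continuous_on_compose2[OF assms(3) C1_on_continuous[OF assms(1)]] C1_on_continuous_grad[OF assms(1)]]) simp
qed (rule GDERIV_DERIV_compose[OF C1_onD[OF assms(1)] assms(2)])

text \<open>Turns a second-order statement into first-order statements about the function and its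
  partial derivatives, so that the calculus of \<open>C1_on\<close> can be used twice.\<close>

lemma C2_on_iff:
 assumes "open U"
 shows "C2_on U f \<longleftrightarrow> C1_on U f \<and> (\<forall>b\<in>Basis. C1_on U (pd b f))"
proof
 assume *: "C2_on U f"
 have f: "C1_on U f"
  using * assms unfolding C2_on_def grad_def[abs_def]
  by (intro C1_onI[where G="grad f"] gderiv_from_partials[OF assms]) (auto simp: grad_def[abs_def] intro!: continuous_intros)
 have "C1_on U (pd b f)" if "b \<in> Basis" for b
  using * assms that unfolding C2_on_def
  by (intro C1_onI[where G="grad (pd b f)"] gderiv_from_partials[OF assms]) (auto simp: grad_def[abs_def] intro!: continuous_intros)
 with f show "C1_on U f \<and> (\<forall>b\<in>Basis. C1_on U (pd b f))" by blast
next
 assume *: "C1_on U f \<and> (\<forall>b\<in>Basis. C1_on U (pd b f))"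
 then show "C2_on U f"
  unfolding C2_on_def
  by (auto intro: C1_on_continuous C1_on_continuous_pd gderiv_has_pd C1_onD)
qed

lemma C1_on_pd:
 assumes "open U" "\<And>b x. b \<in> Basis ==> x \<in> U ==> has_pd b f x" "\<And>b. b \<in> Basis ==> continuous_on U (pd b f)"
 shows "C1_on U f"
 by (intro C1_onI[where G="grad f"] gderiv_from_partials[OF assms(1)]) (auto simp: assms grad_def[abs_def] intro!: continuous_intros)

lemma differentiable_bound_gderiv:
 fixes f :: "'a::euclidean_space \<Rightarrow> real"
 assumes "convex S" "\<And>x. x \<in> S ==> GDERIV f x :> G x" "\<And>x. x \<in> S ==> norm (G x) \<le> B" "x \<in> S" "y \<in> S"
 shows "\<bar>f x - f y\<bar> \<le> B * norm (x - y)"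
proof -
 have B: "0 \<le> B" using assms(3,4) norm_ge_zero order_trans by blast
 have "norm (f x - f y) \<le> B * norm (x - y)"
 proof (rule differentiable_bound[OF assms(1), of f "\<lambda>x h. h \<bullet> G x"])
  fix z assume z: "z \<in> S"
  show "(f has_derivative (\<lambda>h. h \<bullet> G z)) (at z within S)"
   using assms(2)[OF z] unfolding gderiv_def by (rule has_derivative_at_withinI)
  show "onorm (\<lambda>h. h \<bullet> G z) \<le> B"
   using assms(3)[OF z] B
   by (intro onorm_bound) (auto intro!: order_trans[OF Cauchy_Schwarz_ineq2] simp: mult.commute[of B] mult_left_mono)
 qed (use assms in auto)
 then show ?thesis by simp
qed

section \<open>Integration by parts for compactly supported functions\<close>

lemma integral_translate:
 fixes f :: "'a::euclidean_space \<Rightarrow> real"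
 assumes "f \<in> borel_measurable borel"
 shows "(LBINT x. f (x + a)) = integral\<^sup>L lborel f"
proof -
 have "integral\<^sup>L lborel f = integral\<^sup>L (distr lborel borel ((+) a)) f" by (simp add: lborel_distr_plus)
 also have "\<dots> = (LBINT x. f (a + x))" using assms by (intro integral_distr) auto
 finally show ?thesis by (simp add: add.commute)
qed

lemma integrable_continuous_compact_support:
 fixes f :: "'a::euclidean_space \<Rightarrow> real"
 assumes "continuous_on UNIV f" "compact K" "\<And>x. x \<notin> K ==> f x = 0"
 shows "integrable lborel f"
proof -
 have "integrable lborel (\<lambda>x. indicator K x *\<^sub>R f x)"
  using assms by (intro borel_integrable_compact) (auto intro: continuous_on_subset)
 moreover have "(\<lambda>x. indicator K x *\<^sub>R f x) = f" using assms(3) by (intro ext) (auto simp: indicator_def)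
 ultimately show ?thesis by simp
qed

lemma bounded_on_compact:
 fixes G :: "'a::topological_space \<Rightarrow> 'b::real_normed_vector"
 assumes "continuous_on U G" "compact K" "K \<subseteq> U"
 obtains B where "B > 0" "\<And>z. z \<in> K ==> norm (G z) \<le> B"
proof -
 have "bounded (G ` K)"
  using continuous_on_subset[OF assms(1,3)] assms(2) by (intro compact_imp_bounded compact_continuous_image)
 then show thesis using that unfolding bounded_pos by blast
qed

lemma has_derivative_under_integral:
 fixes F :: "real \<Rightarrow> 'a::euclidean_space \<Rightarrow> real"
 assumes e: "e > 0" and int: "\<And>t. \<bar>t\<bar> < e ==> integrable lborel (F t)"
  and der: "\<And>t v. \<bar>t\<bar> < e ==> ((\<lambda>t. F t v) has_real_derivative D t v) (at t)"
  and bd: "\<And>t v. \<bar>t\<bar> < e ==> \<bar>D t v\<bar> \<le> g v" and g: "integrable lborel g"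
 shows "((\<lambda>t. integral\<^sup>L lborel (F t)) has_real_derivative integral\<^sup>L lborel (D 0)) (at 0)"
proof -
 have "((\<lambda>h. (integral\<^sup>L lborel (F h) - integral\<^sup>L lborel (F 0)) / h) \<longlongrightarrow> integral\<^sup>L lborel (D 0)) (at 0)"
  unfolding tendsto_at_iff_sequentially comp_def
 proof (intro allI impI)
  fix X :: "nat \<Rightarrow> real" assume X: "\<forall>i. X i \<in> UNIV - {0}" "X \<longlonglongrightarrow> 0"
  from X(2) e have "\<forall>\<^sub>F i in sequentially. dist (X i) 0 < e" by (rule tendstoD)
  then obtain k where k: "\<And>i. i \<ge> k ==> \<bar>X i\<bar> < e" by (auto simp: eventually_sequentially)
  \<comment> \<open>Dropping finitely many terms makes the bounds hold for every index, as dominated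
    convergence asks.\<close>
  define Y where "Y i = X (i + k)" for i
  have Y: "Y i \<noteq> 0" "\<bar>Y i\<bar> < e" for i using X(1) k by (auto simp: Y_def)
  have Y0: "Y \<longlonglongrightarrow> 0" unfolding Y_def using X(2) by (rule LIMSEQ_ignore_initial_segment)
  define Q where "Q i v = (F (Y i) v - F 0 v) / Y i" for i v
  have Qm: "Q i \<in> borel_measurable lborel" for i
   unfolding Q_def using int[OF Y(2)[of i]] int[of 0] e
   by (intro borel_measurable_divide borel_measurable_diff borel_measurable_const) auto
  have lim: "(\<lambda>i. Q i v) \<longlonglongrightarrow> D 0 v" for v
  proof -
   have "((\<lambda>h. (F (0 + h) v - F 0 v) / h) \<longlongrightarrow> D 0 v) (at 0)"
    using der[of 0 v] e by (simp add: DERIV_def)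
   moreover have "filterlim Y (at 0) sequentially"
    using Y0 Y(1) by (intro filterlim_atI) auto
   ultimately have "(\<lambda>i. (F (0 + Y i) v - F 0 v) / Y i) \<longlonglongrightarrow> D 0 v" by (rule filterlim_compose)
   then show ?thesis by (simp add: Q_def)
  qed
  have bQ: "norm (Q i v) \<le> g v" for i v
  proof -
   have "norm (F (Y i) v - F 0 v) \<le> g v * norm (Y i - 0)"
    by (rule field_differentiable_bound[where S="{-e<..<e}" and f'="\<lambda>t. D t v"])
      (use der bd Y(2)[of i] e in \<open>auto simp: abs_less_iff intro: has_field_derivative_at_within\<close>)
   then show ?thesis using Y(1)[of i] by (simp add: Q_def divide_simps)
  qed
  have "(\<lambda>i. integral\<^sup>L lborel (Q i)) \<longlonglongrightarrow> integral\<^sup>L lborel (D 0)"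
  proof (rule integral_dominated_convergence[where w=g])
   show "D 0 \<in> borel_measurable lborel" by (rule borel_measurable_LIMSEQ_real[OF lim Qm])
  qed (use Qm lim bQ g in auto)
  moreover have "integral\<^sup>L lborel (Q i) = (integral\<^sup>L lborel (F (Y i)) - integral\<^sup>L lborel (F 0)) / Y i" for i
   unfolding Q_def using int[OF Y(2)[of i]] int[of 0] e by simp
  ultimately have "(\<lambda>i. (integral\<^sup>L lborel (F (X (i + k))) - integral\<^sup>L lborel (F 0)) / X (i + k)) \<longlonglongrightarrow> integral\<^sup>L lborel (D 0)"
   by (simp add: Y_def)
  then show "(\<lambda>i. (integral\<^sup>L lborel (F (X i)) - integral\<^sup>L lborel (F 0)) / X i) \<longlonglongrightarrow> integral\<^sup>L lborel (D 0)"
   by (rule LIMSEQ_offset)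
 qed
 then show ?thesis by (simp add: DERIV_def)
qed

text \<open>The integral of a translate of f by t b does not depend on t; differentiating under the
  integral at t = 0 produces the integral of the directional derivative.\<close>

lemma integral_gderiv_compact_support:
 fixes f :: "'a::euclidean_space \<Rightarrow> real"
 assumes d: "\<And>x. GDERIV f x :> G x" and c: "continuous_on UNIV G" and K: "compact K" "\<And>x. x \<notin> K ==> f x = 0"
 shows "(LBINT x. G x \<bullet> b) = 0"
proof -
 have cf: "continuous_on UNIV f" using d by (auto intro: continuous_at_imp_continuous_on gderiv_isCont)
 have G0: "G x = 0" if "x \<notin> K" for x
 proof -
  have "GDERIV f x :> 0"
   by (rule gderiv_cong[OF open_Compl[OF compact_imp_closed[OF K(1)]], of x "\<lambda>_. 0"]) (use that K(2) GDERIV_const in auto)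
  then show ?thesis using gderiv_unique d by blast
 qed
 obtain B where B: "B > 0" "\<And>x. x \<in> K ==> norm (G x) \<le> B" using bounded_on_compact[OF c K(1) subset_UNIV] by blast
 obtain R where R: "K \<subseteq> cball 0 R" using bounded_subset_ballD[OF compact_imp_bounded[OF K(1)], of 0] ball_subset_cball by blast
 have ft: "integrable lborel (\<lambda>x. f (x + a))" for a
 proof (rule integrable_continuous_compact_support)
  show "continuous_on UNIV (\<lambda>x. f (x + a))" by (intro continuous_on_compose2[OF cf]) (auto intro!: continuous_intros)
  show "compact ((\<lambda>x. x - a) ` K)" using K by (intro compact_continuous_image) (auto intro!: continuous_intros)
  show "f (x + a) = 0" if "x \<notin> (\<lambda>x. x - a) ` K" for x
   using that by (intro K(2)) (auto simp: image_iff)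
 qed
 have "((\<lambda>t. (LBINT x. f (x + t *\<^sub>R b))) has_real_derivative (LBINT x. G (x + 0 *\<^sub>R b) \<bullet> b)) (at 0)"
 proof (rule has_derivative_under_integral[where e=1 and g="\<lambda>x. indicator (cball 0 (R + norm b)) x *\<^sub>R (B * norm b)"])
  fix t :: real and x assume t: "\<bar>t\<bar> < 1"
  show "((\<lambda>t. f (x + t *\<^sub>R b)) has_real_derivative G (x + t *\<^sub>R b) \<bullet> b) (at t)" by (rule gderiv_line[OF d])
  show "\<bar>G (x + t *\<^sub>R b) \<bullet> b\<bar> \<le> indicator (cball 0 (R + norm b)) x *\<^sub>R (B * norm b)"
  proof (cases "x + t *\<^sub>R b \<in> K")
   case True
   have "norm x \<le> norm (x + t *\<^sub>R b) + norm (t *\<^sub>R b)" using norm_triangle_ineq4[of "x + t *\<^sub>R b" "t *\<^sub>R b"] by simp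
   also have "\<dots> \<le> R + norm b" using True R t by (intro add_mono) (auto intro: mult_left_le_one_le)
   finally show ?thesis using order_trans[OF Cauchy_Schwarz_ineq2 mult_right_mono[OF B(2)[OF True]]] by simp
  qed (use B in \<open>simp add: G0\<close>)
  show "integrable lborel (\<lambda>x. f (x + t *\<^sub>R b))" by (rule ft)
 next
  show "integrable lborel (\<lambda>x. indicator (cball 0 (R + norm b)) x *\<^sub>R (B * norm b))" by (intro borel_integrable_compact) auto
 qed simp
 then have "((\<lambda>t::real. integral\<^sup>L lborel f) has_real_derivative (LBINT x. G x \<bullet> b)) (at 0)"
  using integral_translate[OF borel_measurable_continuous_onI[OF cf]] by simp
 then show ?thesis using DERIV_unique DERIV_const by blast
qed

text \<open>The statement integrates over \<open>lebesgue_on\<close>, whereas translations and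
  dilations are handled for \<open>lborel\<close>; extension by zero moves between the two.\<close>

lemma lebesgue_on_lborel:
 fixes f :: "'a::euclidean_space \<Rightarrow> real"
 assumes "S \<in> sets lebesgue" "(\<lambda>x. if x \<in> S then f x else 0) \<in> borel_measurable borel"
 shows "integral\<^sup>L (lebesgue_on S) f = (LBINT x. if x \<in> S then f x else 0)"
  "integrable (lebesgue_on S) f \<longleftrightarrow> integrable lborel (\<lambda>x. if x \<in> S then f x else 0)"
proof -
 have e: "(\<lambda>x. indicator S x * f x) = (\<lambda>x. if x \<in> S then f x else 0)" by (auto simp: indicator_def)
 show "integral\<^sup>L (lebesgue_on S) f = (LBINT x. if x \<in> S then f x else 0)"
  using assms by (simp add: integral_restrict_space e integral_completion)
 show "integrable (lebesgue_on S) f \<longleftrightarrow> integrable lborel (\<lambda>x. if x \<in> S then f x else 0)"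
  using assms by (simp add: integrable_restrict_space e integrable_completion)
qed

lemma continuous_on_extend_0:
 fixes f :: "'a::euclidean_space \<Rightarrow> 'b::real_normed_vector"
 assumes "open W" "compact K" "K \<subseteq> W" "continuous_on W f" "\<And>x. x \<in> W - K ==> f x = 0"
 shows "continuous_on UNIV (\<lambda>x. if x \<in> W then f x else 0)"
proof -
 have "continuous_on (W \<union> - K) (\<lambda>x. if x \<in> W then f x else 0)"
 proof (rule continuous_on_open_Un[OF assms(1)])
  show "open (- K)" using assms compact_imp_closed by blast
  show "continuous_on W (\<lambda>x. if x \<in> W then f x else 0)" using assms(4) by (simp cong: continuous_on_cong)
  have "continuous_on (-K) (\<lambda>x. 0::'b)" by simp
  then show "continuous_on (- K) (\<lambda>x. if x \<in> W then f x else 0)"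
   by (rule continuous_on_eq) (use assms in auto)
 qed
 moreover have "W \<union> - K = UNIV" using assms by auto
 ultimately show ?thesis by simp
qed

lemma integrable_on_compact_support:
 fixes f :: "'a::euclidean_space \<Rightarrow> real"
 assumes "open W" "compact K" "K \<subseteq> W" "continuous_on W f" "\<And>x. x \<in> W - K ==> f x = 0"
 shows "integrable (lebesgue_on W) f"
proof -
 have c: "continuous_on UNIV (\<lambda>x. if x \<in> W then f x else 0)"
  by (rule continuous_on_extend_0[OF assms])
 show ?thesis
  using assms c
  by (subst lebesgue_on_lborel)
    (auto intro!: integrable_continuous_compact_support[OF c assms(2)] borel_measurable_continuous_onI)
qed

lemma integral_lborel_compact_support:
 fixes f :: "'a::euclidean_space \<Rightarrow> real"
 assumes "open W" "compact K" "K \<subseteq> W" "continuous_on W f" "\<And>x. x \<notin> K ==> f x = 0"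
 shows "integral\<^sup>L (lebesgue_on W) f = integral\<^sup>L lborel f"
proof -
 have e: "(\<lambda>x. if x \<in> W then f x else 0) = f" using assms(3,5) by (auto simp: fun_eq_iff)
 have "continuous_on UNIV f" using continuous_on_extend_0[OF assms(1-4)] assms(5) unfolding e by simp
 then show ?thesis using lebesgue_on_lborel(1)[of W f] assms(1) unfolding e by (auto intro: borel_open borel_measurable_continuous_onI)
qed

lemma integral_pd_compact_support:
 fixes f :: "'a::euclidean_space \<Rightarrow> real"
 assumes W: "open W" and K: "compact K" "K \<subseteq> W" and f: "C1_on W f" and f0: "\<And>x. x \<in> W - K ==> f x = 0"
  and b: "b \<in> Basis"
 shows "integral\<^sup>L (lebesgue_on W) (pd b f) = 0" "integrable (lebesgue_on W) (pd b f)"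
  "\<And>x. x \<in> W - K ==> pd b f x = 0"
proof -
 have op: "open (W - K)" using W K compact_imp_closed by blast
 have g0: "grad f x = 0" if "x \<in> W - K" for x
  using gderiv_cong[OF op that, of "\<lambda>_. 0" f 0] f0 GDERIV_const by (metis gderiv_grad)
 show p0: "\<And>x. x \<in> W - K ==> pd b f x = 0" using g0 b by (simp add: pd_eq_grad)
 show "integrable (lebesgue_on W) (pd b f)"
  by (rule integrable_on_compact_support[OF W K]) (use f b p0 in \<open>auto intro: C1_on_continuous_pd\<close>)
 define F where "F x = (if x \<in> W then f x else 0)" for x
 define G where "G x = (if x \<in> W then grad f x else 0)" for x
 have d: "GDERIV F x :> G x" for x
 proof (cases "x \<in> W")
  case True
  then show ?thesis using gderiv_cong[OF W True, of f F] C1_onD[OF f True] by (simp add: F_def G_def)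
 next
  case False
  have "open (-K)" using K compact_imp_closed by blast
  then have "GDERIV F x :> 0"
   by (rule gderiv_cong[of _ x "\<lambda>_. 0"]) (use False f0 K(2) GDERIV_const in \<open>auto simp: F_def\<close>)
  then show ?thesis using False by (simp add: G_def)
 qed
 have c: "continuous_on UNIV G"
  unfolding G_def by (rule continuous_on_extend_0[OF W K]) (use f g0 in \<open>auto intro: C1_on_continuous_grad\<close>)
 have "(LBINT x. G x \<bullet> b) = 0"
  by (rule integral_gderiv_compact_support[OF d c K(1)]) (use K f0 in \<open>auto simp: F_def\<close>)
 moreover have "(\<lambda>x. if x \<in> W then pd b f x else 0) = (\<lambda>x. G x \<bullet> b)"
  using b by (auto simp: G_def pd_eq_grad)
 ultimately show "integral\<^sup>L (lebesgue_on W) (pd b f) = 0"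
  using W c by (subst lebesgue_on_lborel) (auto intro!: borel_measurable_continuous_onI continuous_intros)
qed

lemma integral_by_parts:
 fixes f g :: "'a::euclidean_space \<Rightarrow> real"
 assumes W: "open W" and K: "compact K" "K \<subseteq> W" and f: "C1_on W f" and g: "C1_on W g"
  and f0: "\<And>x. x \<in> W - K ==> f x = 0" and b: "b \<in> Basis"
 shows "(LINT x|lebesgue_on W. f x * pd b g x) = - (LINT x|lebesgue_on W. pd b f x * g x)"
proof -
 have e: "pd b (\<lambda>x. f x * g x) x = f x * pd b g x + pd b f x * g x" if "x \<in> W" for x
  using gderiv_pd[OF GDERIV_mult[OF C1_onD[OF f that] C1_onD[OF g that]], of b] b
  by (simp add: inner_add_left pd_eq_grad mult.commute)
 have pf: "\<And>x. x \<in> W - K ==> pd b f x = 0" by (rule integral_pd_compact_support[OF W K f f0 b])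
 have "0 = integral\<^sup>L (lebesgue_on W) (pd b (\<lambda>x. f x * g x))"
  using integral_pd_compact_support(1)[OF W K C1_on_mult[OF f g] _ b] f0 by simp
 also have "\<dots> = (LINT x|lebesgue_on W. f x * pd b g x + pd b f x * g x)"
  using e by (intro Bochner_Integration.integral_cong) auto
 also have "\<dots> = (LINT x|lebesgue_on W. f x * pd b g x) + (LINT x|lebesgue_on W. pd b f x * g x)"
  by (intro Bochner_Integration.integral_add integrable_on_compact_support[OF W K])
    (use f g b f0 pf in \<open>auto intro!: continuous_intros intro: C1_on_continuous_pd C1_on_continuous\<close>)
 finally show ?thesis by simp
qed

text \<open>Green's formula with a cutoff \<eta> in place of a boundary term. Vector fields are
  given as families of component functions indexed by \<open>Basis\<close>.\<close>

lemma divergence_parts: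
 fixes \<eta> :: "'a::euclidean_space \<Rightarrow> real"
 assumes W: "open W" and K: "compact K" "K \<subseteq> W" and \<eta>: "C1_on W \<eta>" "\<forall>x\<in>W - K. \<eta> x = 0"
  and F': "\<forall>b\<in>Basis. C1_on W (F b)"
 shows "(LINT x|lebesgue_on W. \<eta> x * (\<Sum>b\<in>Basis. pd b (F b) x)) = - (LINT x|lebesgue_on W. (\<Sum>b\<in>Basis. pd b \<eta> x * F b x))"
  and "integrable (lebesgue_on W) (\<lambda>x. \<eta> x * (\<Sum>b\<in>Basis. pd b (F b) x))"
  and "integrable (lebesgue_on W) (\<lambda>x. \<Sum>b\<in>Basis. pd b \<eta> x * F b x)"
proof -
 note F = F'[rule_format] and \<eta>0 = \<eta>(2)[rule_format]
 have i1: "integrable (lebesgue_on W) (\<lambda>x. \<eta> x * pd b (F b) x)" if "b \<in> Basis" for b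
  by (intro integrable_on_compact_support[OF W K] continuous_on_mult C1_on_continuous[OF \<eta>(1)] C1_on_continuous_pd[OF F[OF that] that])
   (use \<eta>(2) in auto)
 have i2: "integrable (lebesgue_on W) (\<lambda>x. pd b \<eta> x * F b x)" if "b \<in> Basis" for b
  by (intro integrable_on_compact_support[OF W K] continuous_on_mult C1_on_continuous[OF F[OF that]] C1_on_continuous_pd[OF \<eta>(1) that])
   (use integral_pd_compact_support(3)[OF W K \<eta>(1) \<eta>0 that] in auto)
 show "integrable (lebesgue_on W) (\<lambda>x. \<eta> x * (\<Sum>b\<in>Basis. pd b (F b) x))"
  unfolding sum_distrib_left using i1 by auto
 show "integrable (lebesgue_on W) (\<lambda>x. \<Sum>b\<in>Basis. pd b \<eta> x * F b x)" using i2 by auto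
 have "(LINT x|lebesgue_on W. \<eta> x * (\<Sum>b\<in>Basis. pd b (F b) x)) = (\<Sum>b\<in>Basis. LINT x|lebesgue_on W. \<eta> x * pd b (F b) x)"
  unfolding sum_distrib_left by (rule Bochner_Integration.integral_sum[OF i1])
 also have "\<dots> = (\<Sum>b\<in>Basis. - (LINT x|lebesgue_on W. pd b \<eta> x * F b x))"
  by (intro sum.cong refl integral_by_parts[OF W K \<eta>(1) F \<eta>0])
 also have "\<dots> = - (LINT x|lebesgue_on W. (\<Sum>b\<in>Basis. pd b \<eta> x * F b x))"
  unfolding sum_negf by (subst Bochner_Integration.integral_sum[OF i2]) auto
 finally show "(LINT x|lebesgue_on W. \<eta> x * (\<Sum>b\<in>Basis. pd b (F b) x)) = - (LINT x|lebesgue_on W. (\<Sum>b\<in>Basis. pd b \<eta> x * F b x))" .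
qed

section \<open>Mean values of harmonic functions\<close>

lemma integral_scale:
 fixes f :: "'a::euclidean_space \<Rightarrow> real"
 assumes "f \<in> borel_measurable borel" "s > 0"
 shows "integral\<^sup>L lborel f = s ^ DIM('a) * (LBINT x. f (s *\<^sub>R x))"
proof -
 have "integral\<^sup>L lborel f = integral\<^sup>L (density (distr lborel borel (\<lambda>x. 0 + s *\<^sub>R x)) (\<lambda>_. \<bar>s\<bar> ^ DIM('a))) f"
  using lborel_affine[of s "0::'a"] assms by simp
 also have "\<dots> = integral\<^sup>L (distr lborel borel (\<lambda>x. s *\<^sub>R x)) (\<lambda>x. s ^ DIM('a) * f x)"
  using assms by (subst integral_density) auto
 also have "\<dots> = s ^ DIM('a) * (LBINT x. f (s *\<^sub>R x))"
  using assms by (subst integral_distr) auto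
 finally show ?thesis .
qed

text \<open>Truncated powers of quadratic polynomials supply the kernels and bumps below; the
  exponent decides how many derivatives are continuous.\<close>

lemma has_real_derivative_pos_part_power:
 assumes "n \<ge> 2"
 shows "((\<lambda>t::real. (max 0 t) ^ n) has_real_derivative (real n * (max 0 t) ^ (n - 1))) (at t)"
proof -
 consider "t < 0" | "t > 0" | "t = 0" by linarith
 then show ?thesis
 proof cases
  case 1
  have "((\<lambda>t::real. 0) has_real_derivative 0) (at t)" by simp
  then have "((\<lambda>t::real. (max 0 t) ^ n) has_real_derivative 0) (at t)"
   by (rule has_field_derivative_transform_within_open[where S="{..<0}"]) (use 1 assms in auto)
  then show ?thesis using 1 assms by (simp add: power_0_left)
 next
  case 2
  have "((\<lambda>t::real. t ^ n) has_real_derivative (real n * t ^ (n - 1))) (at t)"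
   by (auto intro!: derivative_eq_intros)
  then have "((\<lambda>t::real. (max 0 t) ^ n) has_real_derivative (real n * t ^ (n - 1))) (at t)"
   by (rule has_field_derivative_transform_within_open[where S="{0<..}"]) (use 2 assms in auto)
  then show ?thesis using 2 by simp
 next
  case 3
  have "((\<lambda>h::real. (max 0 h) ^ n / h) \<longlongrightarrow> 0) (at 0)"
  proof (rule Lim_null_comparison)
   show "\<forall>\<^sub>F h in at 0. norm ((max 0 h) ^ n / h) \<le> \<bar>h\<bar> ^ (n - 1)"
   proof (intro always_eventually allI)
    fix h :: real
    obtain m where m: "n = Suc m" using assms by (cases n) auto
    show "norm ((max 0 h) ^ n / h) \<le> \<bar>h\<bar> ^ (n - 1)"
     unfolding m by (auto simp: max_def abs_mult)
   qed
   have "((\<lambda>h::real. \<bar>h\<bar> ^ (n - 1)) \<longlongrightarrow> \<bar>0\<bar> ^ (n - 1)) (at 0)" by (intro tendsto_intros)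
   moreover have "\<bar>0::real\<bar> ^ (n - 1) = 0" using assms by (simp add: power_0_left)
   ultimately show "((\<lambda>h::real. \<bar>h\<bar> ^ (n - 1)) \<longlongrightarrow> 0) (at 0)" by (simp only:)
  qed
  then show ?thesis using 3 assms by (simp add: DERIV_def power_0_left)
 qed
qed

text \<open>Mean value arguments move the centre or the radius of a ball, which takes a slightly
  larger ball inside the open set.\<close>

lemma cball_enlarge:
 fixes x :: "'a::euclidean_space"
 assumes "open W" "cball x s \<subseteq> W"
 obtains r where "r > s" "cball x r \<subseteq> W"
proof (cases "W = UNIV")
 case True then show ?thesis using that[of "s + 1"] by auto
next
 case False
 then obtain c where c: "c \<in> - W" "\<And>z. z \<in> - W ==> dist x c \<le> dist x z"
  using distance_attains_inf[of "- W" x] assms(1) by (auto simp: closed_Compl)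
 have sc: "s < dist x c" using c(1) assms(2) by force
 show ?thesis
 proof (rule that[of "(s + dist x c) / 2"])
  show "cball x ((s + dist x c) / 2) \<subseteq> W"
  proof
   fix z assume z: "z \<in> cball x ((s + dist x c) / 2)"
   show "z \<in> W"
   proof (rule ccontr)
    assume "z \<notin> W"
    then have "dist x c \<le> dist x z" using c(2) by auto
    then show False using z sc by auto
   qed
  qed
 qed (use sc in auto)
qed

text \<open>Averaging against a C^1 kernel instead of over spheres avoids surface integrals.\<close>

definition ker :: "real \<Rightarrow> 'a::euclidean_space \<Rightarrow> real" where
 "ker s v = (max 0 (s\<^sup>2 - v \<bullet> v)) ^ 2"

definition dker :: "real \<Rightarrow> 'a::euclidean_space \<Rightarrow> 'a" where
 "dker s v = (- 4 * max 0 (s\<^sup>2 - v \<bullet> v)) *\<^sub>R v"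

lemma gderiv_pos_part_power:
 assumes "n \<ge> 2"
 shows "GDERIV (\<lambda>v. (max 0 (s - (v - p) \<bullet> (v - p))) ^ n) v :> (- 2 * real n * (max 0 (s - (v - p) \<bullet> (v - p))) ^ (n - 1)) *\<^sub>R (v - p)"
proof -
 have "GDERIV (\<lambda>v. s - (v - p) \<bullet> (v - p)) v :> - (2 *\<^sub>R (v - p))"
  unfolding gderiv_def by (auto intro!: derivative_eq_intros simp: inner_commute inner_diff_right inner_diff_left algebra_simps)
 from GDERIV_DERIV_compose[OF this has_real_derivative_pos_part_power[OF assms]]
 show ?thesis by (simp add: ac_simps scaleR_minus_left)
qed

lemma gderiv_ker: "GDERIV (ker s) v :> dker s v"
 using gderiv_pos_part_power[of 2 "s\<^sup>2" 0 v] unfolding ker_def[abs_def] dker_def by simp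

lemma continuous_ker: "continuous_on UNIV (ker s)"
 unfolding ker_def[abs_def] by (intro continuous_intros)

lemma continuous_dker: "continuous_on UNIV (dker s)"
 unfolding dker_def[abs_def] by (intro continuous_intros)

lemma outside_cball: "0 < s ==> v \<notin> cball 0 s ==> s\<^sup>2 - v \<bullet> v \<le> 0"
 by (simp add: power2_norm_eq_inner[symmetric])

lemma ker_outside: "0 < s ==> v \<notin> cball 0 s ==> ker s v = 0"
 using outside_cball[of s v] by (simp add: ker_def max_def)

lemma dker_outside: "0 < s ==> v \<notin> cball 0 s ==> dker s v = 0"
 using outside_cball[of s v] by (simp add: dker_def max_def)

lemma ker_nonneg: "ker s v \<ge> 0"
 by (simp add: ker_def)

lemma ker_le: "ker s v \<le> s ^ 4"
proof -
 have "max 0 (s\<^sup>2 - v \<bullet> v) \<le> s\<^sup>2" by (simp add: max_def)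
 then have "ker s v \<le> (s\<^sup>2)\<^sup>2" unfolding ker_def by (intro power_mono) auto
 then show ?thesis by simp
qed

lemma norm_dker_le: "0 < s ==> norm (dker s v) \<le> 4 * s ^ 3"
proof (cases "v \<in> cball 0 s")
 case True assume s: "0 < s"
 have "norm (dker s v) = 4 * (max 0 (s\<^sup>2 - v \<bullet> v) * norm v)" by (simp add: dker_def)
 also have "\<dots> \<le> 4 * (s\<^sup>2 * s)" using True s by (intro mult_left_mono mult_mono) (auto simp: max_def)
 finally show ?thesis by (simp add: power3_eq_cube power2_eq_square)
qed (simp add: dker_outside)

lemma ker_scale: "0 < s ==> ker s (s *\<^sub>R v) = s ^ 4 * ker 1 v"
proof -
 assume s: "0 < s"
 have "max 0 (s\<^sup>2 - (s *\<^sub>R v) \<bullet> (s *\<^sub>R v)) = s\<^sup>2 * max 0 (1 - v \<bullet> v)"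
  using s by (simp add: max_mult_distrib_left power2_eq_square algebra_simps)
 then show ?thesis by (simp add: ker_def power_mult_distrib)
qed

definition kerc :: "'a::euclidean_space itself \<Rightarrow> real" where
 "kerc _ = integral\<^sup>L lborel (ker 1 :: 'a \<Rightarrow> real)"

lemma continuous_on_kernel_mult:
 fixes w k :: "'a::euclidean_space \<Rightarrow> real"
 assumes "open W" "continuous_on W w" "cball x s \<subseteq> W" "continuous_on UNIV k" "\<And>v. v \<notin> cball 0 s ==> k v = 0"
 shows "continuous_on UNIV (\<lambda>v. w (x + v) * k v)"
proof -
 let ?U = "(\<lambda>v. x + v) -` W"
 have "continuous_on UNIV (\<lambda>v. if v \<in> ?U then w (x + v) * k v else 0)"
 proof (rule continuous_on_extend_0[of ?U "cball 0 s"])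
  show "open ?U" using assms(1) by (intro open_vimage) (auto intro!: continuous_intros)
  show "cball 0 s \<subseteq> ?U" using assms(3) by (auto simp: subset_iff dist_norm)
  show "continuous_on ?U (\<lambda>v. w (x + v) * k v)"
   using assms(4) by (intro continuous_on_mult continuous_on_compose2[OF assms(2)]) (auto intro!: continuous_intros intro: continuous_on_subset)
 qed (use assms(5) in auto)
 moreover have "(\<lambda>v. if v \<in> ?U then w (x + v) * k v else 0) = (\<lambda>v. w (x + v) * k v)"
 proof
  fix v show "(if v \<in> ?U then w (x + v) * k v else 0) = w (x + v) * k v"
   using assms(3) assms(5)[of v] by (cases "v \<in> cball 0 s") (auto simp: subset_iff dist_norm)
 qed
 ultimately show ?thesis by (simp only:)
qed

lemma integrable_kernel_mult:
 fixes w k :: "'a::euclidean_space \<Rightarrow> real"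
 assumes "open W" "continuous_on W w" "cball x s \<subseteq> W" "continuous_on UNIV k" "\<And>v. v \<notin> cball 0 s ==> k v = 0"
 shows "integrable lborel (\<lambda>v. w (x + v) * k v)"
proof (rule integrable_continuous_compact_support[OF _ compact_cball[of 0 s]])
 show "continuous_on UNIV (\<lambda>v. w (x + v) * k v)" by (rule continuous_on_kernel_mult[OF assms(1-4)]) (rule assms(5))
 show "w (x + v) * k v = 0" if "v \<notin> cball 0 s" for v using assms(5)[OF that] by simp
qed

lemma kerc_pos: "kerc TYPE('a::euclidean_space) > 0"
proof -
 have i: "integrable lborel (ker 1 :: 'a \<Rightarrow> real)"
  by (rule integrable_continuous_compact_support[OF continuous_ker compact_cball[of 0 1]]) (simp add: ker_outside)
 have "kerc TYPE('a) \<ge> integral\<^sup>L lborel (\<lambda>v::'a. indicator (cball 0 (1/2)) v * (1/4))"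
  unfolding kerc_def
 proof (rule integral_mono[OF _ i])
  have "integrable lborel (\<lambda>v::'a. indicator (cball 0 (1/2)) v *\<^sub>R (1/4::real))"
   by (intro borel_integrable_compact) auto
  then show "integrable lborel (\<lambda>v::'a. indicator (cball 0 (1/2)) v * (1/4::real))" by simp
  fix v :: 'a
  show "indicator (cball 0 (1/2)) v * (1/4) \<le> ker 1 v"
  proof (cases "norm v \<le> 1/2")
   case True
   then have "(norm v)\<^sup>2 \<le> (1/2)\<^sup>2" by (intro power_mono) auto
   then have "v \<bullet> v \<le> 1/4" by (simp add: dot_square_norm power2_eq_square)
   then have "1/2 \<le> max 0 (1 - v \<bullet> v)" by linarith
   then have "(1/2)^2 \<le> ker 1 v" unfolding ker_def power_one by (rule power_mono) simp
   then show ?thesis using True by (simp add: power2_eq_square)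
  qed (simp add: ker_nonneg)
 qed
 moreover have "integral\<^sup>L lborel (\<lambda>v::'a. indicator (cball 0 (1/2)) v * (1/4::real)) = measure lborel (cball (0::'a) (1/2)) / 4"
  by simp
 moreover have "measure lborel (cball (0::'a) (1/2)) > 0"
  using content_cball[of "1/2" "0::'a"] by (simp add: measure_completion)
 ultimately show ?thesis by linarith
qed

text \<open>The weight \<open>ker s\<close> has degree 4 in lengths, so its total mass is
  \<open>s ^ (DIM('a) + 4) * kerc TYPE('a)\<close>. The property mentions no second derivatives and
  can therefore be inherited by partial derivatives before these are known to be C^2.\<close>

definition MV :: "'a::euclidean_space set \<Rightarrow> ('a \<Rightarrow> real) \<Rightarrow> bool" where
 "MV W w \<longleftrightarrow> continuous_on W w \<and>
   (\<forall>x s. 0 < s \<longrightarrow> cball x s \<subseteq> W \<longrightarrow>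
    (LBINT v. w (x + v) * ker s v) = s ^ (DIM('a) + 4) * kerc TYPE('a) * w x)"

lemma gderiv_scale_shift:
 assumes "GDERIV f (x + s *\<^sub>R y) :> G"
 shows "GDERIV (\<lambda>y. f (x + s *\<^sub>R y)) y :> s *\<^sub>R G"
proof -
 have g: "(f has_derivative (\<lambda>h. h \<bullet> G)) (at (x + s *\<^sub>R y))" using assms by (simp add: gderiv_def)
 have "((\<lambda>y. x + s *\<^sub>R y) has_derivative (\<lambda>h. s *\<^sub>R h)) (at y)" by (auto intro!: derivative_eq_intros)
 from has_derivative_compose[OF this g] show ?thesis by (simp add: gderiv_def)
qed

text \<open>The weighted mean \<open>f t\<close> at scale t has as derivative the integral of (grad
  w . y) times \<open>ker 1 y\<close>. Since \<open>ker 1 y\<close> times y is a multiple of the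
  gradient of the third truncated power, integration by parts turns this into an integral of the
  Laplacian, which vanishes; so \<open>f s = f 0\<close>.\<close>

lemma harmonic_imp_MV:
 fixes w :: "'a::euclidean_space \<Rightarrow> real"
 assumes W: "open W" and C2: "C2_on W w" and lap: "\<And>x. x \<in> W ==> laplacian w x = 0"
 shows "MV W w"
 unfolding MV_def
proof (intro conjI allI impI)
 have C1: "C1_on W w" and C1p: "\<And>b. b \<in> Basis ==> C1_on W (pd b w)"
  using C2 C2_on_iff[OF W] by auto
 show cw: "continuous_on W w" by (rule C1_on_continuous[OF C1])
 fix x :: 'a and s :: real assume s: "0 < s" and sub: "cball x s \<subseteq> W"
 obtain r where r: "r > s" "cball x r \<subseteq> W" using cball_enlarge[OF W sub] by blast
 define f where "f t = (LBINT y. w (x + t *\<^sub>R y) * ker 1 y)" for t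
 have inb: "x + t *\<^sub>R y \<in> cball x r" if "\<bar>t\<bar> \<le> r" "y \<in> cball 0 1" for t y
  using that mult_mono[of "\<bar>t\<bar>" r "norm y" 1] by (simp add: dist_norm)
 have der: "(f has_real_derivative 0) (at t)" if t: "\<bar>t\<bar> < r" for t
 proof -
  obtain B where B: "\<And>z. z \<in> cball x r ==> norm (grad w z) \<le> B" "B > 0"
   using bounded_on_compact[OF C1_on_continuous_grad[OF C1] compact_cball r(2)] by blast
  have U: "open ((\<lambda>y. x + t' *\<^sub>R y) -` W)" for t' :: real
   using W by (intro open_vimage) (auto intro!: continuous_intros)
  have Usub: "cball 0 1 \<subseteq> (\<lambda>y. x + t' *\<^sub>R y) -` W" if "\<bar>t'\<bar> \<le> r" for t'
   using inb[OF that] r(2) by blast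
  have "((\<lambda>h. (LBINT y. w (x + (t + h) *\<^sub>R y) * ker 1 y)) has_real_derivative
    (LBINT y. (grad w (x + (t + 0) *\<^sub>R y) \<bullet> y) * ker 1 y)) (at 0)"
  proof (rule has_derivative_under_integral[of "r - \<bar>t\<bar>" _ _ "\<lambda>y. indicator (cball 0 1) y *\<^sub>R B"])
   fix h assume h: "\<bar>h\<bar> < r - \<bar>t\<bar>"
   then have th: "\<bar>t + h\<bar> \<le> r" by linarith
   have ce: "continuous_on ((\<lambda>y. x + (t + h) *\<^sub>R y) -` W) (\<lambda>y. w (x + (t + h) *\<^sub>R y))"
    by (intro continuous_on_compose2[OF cw]) (auto intro!: continuous_intros)
   show "integrable lborel (\<lambda>y. w (x + (t + h) *\<^sub>R y) * ker 1 y)"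
   proof -
    have "integrable lborel (\<lambda>y. w (x + (t + h) *\<^sub>R (0 + y)) * ker 1 y)"
     by (rule integrable_kernel_mult[OF U ce Usub[OF th] continuous_ker]) (rule ker_outside[OF zero_less_one])
    then show ?thesis by simp
   qed
   fix v :: 'a
   show "((\<lambda>h. w (x + (t + h) *\<^sub>R v) * ker 1 v) has_real_derivative grad w (x + (t + h) *\<^sub>R v) \<bullet> v * ker 1 v) (at h)"
   proof (cases "v \<in> cball 0 1")
    case True
    have "GDERIV w (x + t *\<^sub>R v + h *\<^sub>R v) :> grad w (x + (t + h) *\<^sub>R v)"
     using C1_onD[OF C1, of "x + (t + h) *\<^sub>R v"] inb[OF th True] r by (auto simp: algebra_simps)
    from gderiv_line[OF this] have "((\<lambda>h. w (x + (t + h) *\<^sub>R v)) has_real_derivative grad w (x + (t + h) *\<^sub>R v) \<bullet> v) (at h)"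
     by (simp add: algebra_simps)
    then show ?thesis by (rule DERIV_cmult_right)
   qed (simp add: ker_outside)
   show "\<bar>grad w (x + (t + h) *\<^sub>R v) \<bullet> v * ker 1 v\<bar> \<le> indicator (cball 0 1) v *\<^sub>R B"
   proof (cases "v \<in> cball 0 1")
    case True
    have "\<bar>grad w (x + (t + h) *\<^sub>R v) \<bullet> v * ker 1 v\<bar> \<le> (norm (grad w (x + (t + h) *\<^sub>R v)) * norm v) * 1"
     unfolding abs_mult using ker_nonneg[of 1 v] ker_le[of 1 v] by (intro mult_mono Cauchy_Schwarz_ineq2) auto
    also have "\<dots> \<le> (B * 1) * 1" using True B inb[OF th True] by (intro mult_mono) auto
    finally show ?thesis using True by simp
   qed (simp add: ker_outside)
  next
   show "integrable lborel (\<lambda>y::'a. indicator (cball 0 1) y *\<^sub>R B)" by (intro borel_integrable_compact) auto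
  qed (use t in auto)
  moreover have "(LBINT y. (grad w (x + t *\<^sub>R y) \<bullet> y) * ker 1 y) = 0"
  proof -
   \<comment> \<open>One power more than in \<open>ker 1\<close>: the gradient of k at y is - 6
     times \<open>ker 1 y\<close> times y, which recovers the weight.\<close>
   define k where "k y = (max 0 (1 - y \<bullet> y)) ^ 3" for y :: 'a
   have gk: "GDERIV k y :> (- 6 * ker 1 y) *\<^sub>R y" for y
    using gderiv_pos_part_power[of 3 1 0 y] unfolding k_def[abs_def] ker_def by simp
   then have grk: "grad k y = (- 6 * ker 1 y) *\<^sub>R y" for y by (rule gderiv_grad)
   have k: "C1_on UNIV k"
    by (rule C1_onI[OF gk]) (intro continuous_intros continuous_ker)
   have k0: "k y = 0" if "y \<notin> cball 0 1" for y
    using outside_cball[of 1 y] that by (simp add: k_def max_def)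
   let ?O = "(\<lambda>y. x + t *\<^sub>R y) -` W"
   have sub: "cball 0 1 \<subseteq> ?O" using Usub[of t] t by simp
   have gd: "GDERIV (\<lambda>y. pd b w (x + t *\<^sub>R y)) y :> t *\<^sub>R grad (pd b w) (x + t *\<^sub>R y)" if "b \<in> Basis" "y \<in> ?O" for b y
    using that C1_onD[OF C1p] by (intro gderiv_scale_shift) auto
   have gC: "C1_on ?O (\<lambda>y. pd b w (x + t *\<^sub>R y))" if b: "b \<in> Basis" for b
   proof (rule C1_onI[OF gd[OF b]])
    show "continuous_on ?O (\<lambda>y. t *\<^sub>R grad (pd b w) (x + t *\<^sub>R y))"
     by (intro continuous_on_scaleR continuous_on_const continuous_on_compose2[OF C1_on_continuous_grad[OF C1p[OF b]]]) (auto intro!: continuous_intros)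
   qed
   have k0': "\<forall>y\<in>?O - cball 0 1. k y = 0" using k0 by blast
   note P = divergence_parts[OF U compact_cball sub C1_on_subset[OF k subset_UNIV] k0', of "\<lambda>b y. pd b w (x + t *\<^sub>R y)", OF ballI[OF gC]]
   have "k y * (\<Sum>b\<in>Basis. pd b (\<lambda>y. pd b w (x + t *\<^sub>R y)) y) = 0" if y: "y \<in> ?O" for y
   proof -
    have "pd b (\<lambda>y. pd b w (x + t *\<^sub>R y)) y = t * pd b (pd b w) (x + t *\<^sub>R y)" if "b \<in> Basis" for b
     using gderiv_pd[OF gd[OF that y]] that by (simp add: pd_eq_grad)
    then show ?thesis using lap[of "x + t *\<^sub>R y"] y by (simp add: laplacian_def sum_distrib_left[symmetric])
   qed
   then have "integral\<^sup>L (lebesgue_on ?O) (\<lambda>y. k y * (\<Sum>b\<in>Basis. pd b (\<lambda>y. pd b w (x + t *\<^sub>R y)) y)) = integral\<^sup>L (lebesgue_on ?O) (\<lambda>_. 0)"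
    by (intro Bochner_Integration.integral_cong) auto
   then have "integral\<^sup>L (lebesgue_on ?O) (\<lambda>y. \<Sum>b\<in>Basis. pd b k y * pd b w (x + t *\<^sub>R y)) = 0" using P(1) by simp
   moreover have e: "(\<Sum>b\<in>Basis. pd b k y * pd b w (x + t *\<^sub>R y)) = - 6 * ((grad w (x + t *\<^sub>R y) \<bullet> y) * ker 1 y)" for y
    by (subst euclidean_inner[of _ y]) (simp add: gderiv_pd[OF gk] pd_eq_grad sum_distrib_left mult_ac)
   ultimately have "integral\<^sup>L (lebesgue_on ?O) (\<lambda>y. (grad w (x + t *\<^sub>R y) \<bullet> y) * ker 1 y) = 0" by simp
   also have "integral\<^sup>L (lebesgue_on ?O) (\<lambda>y. (grad w (x + t *\<^sub>R y) \<bullet> y) * ker 1 y) = (LBINT y. (grad w (x + t *\<^sub>R y) \<bullet> y) * ker 1 y)"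
    by (rule integral_lborel_compact_support[OF U compact_cball sub])
     (auto intro!: continuous_intros continuous_on_compose2[OF C1_on_continuous_grad[OF C1]] continuous_on_subset[OF continuous_ker] simp: ker_outside)
   finally show ?thesis .
  qed
  ultimately have "((\<lambda>h. f (t + h)) has_real_derivative 0) (at 0)" by (simp add: f_def)
  then show ?thesis using DERIV_shift[of f 0 0 t] by (simp add: add.commute)
 qed
 have "f s = f 0"
 proof (rule DERIV_isconst2[of 0 s f])
  show "continuous_on {0..s} f"
   by (intro continuous_at_imp_continuous_on ballI, rule DERIV_isCont[OF der]) (use r s in auto)
 qed (use s r der in auto)
 then have fs: "f s = w x * kerc TYPE('a)" by (simp add: f_def kerc_def)
 have "(\<lambda>v. w (x + s *\<^sub>R v) * ker s (s *\<^sub>R v)) = (\<lambda>v. s ^ 4 * (w (x + s *\<^sub>R v) * ker 1 v))"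
  using s by (simp add: fun_eq_iff ker_scale)
 then have "(LBINT v. w (x + s *\<^sub>R v) * ker s (s *\<^sub>R v)) = s ^ 4 * f s"
  by (simp only: f_def integral_mult_right_zero)
 moreover have "(LBINT v. w (x + v) * ker s v) = s ^ DIM('a) * (LBINT v. w (x + s *\<^sub>R v) * ker s (s *\<^sub>R v))"
  by (rule integral_scale[OF _ s])
    (intro borel_measurable_continuous_onI continuous_on_kernel_mult[OF W cw sub continuous_ker], simp add: ker_outside s)
 ultimately show "(LBINT v. w (x + v) * ker s v) = s ^ (DIM('a) + 4) * kerc TYPE('a) * w x"
  by (simp add: fs power_add)
qed

lemma cball_shift:
 fixes x :: "'a::euclidean_space"
 assumes "cball x r \<subseteq> S" "dist x z + s \<le> r"
 shows "cball z s \<subseteq> S"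
proof -
 have "cball z s \<subseteq> cball x r" using assms(2) by (simp add: cball_subset_cball_iff dist_commute)
 then show ?thesis using assms(1) by blast
qed

lemma integrable_cball_const: "integrable lborel (\<lambda>y::'a::euclidean_space. indicator (cball c r) y * (B::real))"
proof -
 have "integrable lborel (\<lambda>y::'a. indicator (cball c r) y *\<^sub>R B)" by (intro borel_integrable_compact) auto
 then show ?thesis by simp
qed

lemma continuous_on_convolution:
 fixes w :: "'a::euclidean_space \<Rightarrow> real" and k :: "'a \<Rightarrow> real"
 assumes W: "open W" and cw: "continuous_on W w" and sub: "cball x r \<subseteq> W" and sr: "0 < s" "s < r"
  and k: "continuous_on UNIV k" "\<And>v. v \<notin> cball 0 s ==> k v = 0"
 shows "isCont (\<lambda>z. (LBINT v. w (z + v) * k v)) x"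
 unfolding continuous_at_sequentially
proof (intro allI impI)
 fix X :: "nat \<Rightarrow> 'a" assume X: "X \<longlonglongrightarrow> x"
 obtain B where B: "B > 0" "\<And>z. z \<in> cball x r ==> norm (w z) \<le> B"
  using bounded_on_compact[OF cw compact_cball sub] by blast
 obtain C where C: "C > 0" "\<And>z. z \<in> cball 0 s ==> norm (k z) \<le> C"
  using bounded_on_compact[OF k(1) compact_cball subset_UNIV] by blast
 have "\<forall>\<^sub>F i in sequentially. dist (X i) x < r - s" using X sr by (intro tendstoD) auto
 then obtain n where n: "\<And>i. i \<ge> n ==> dist (X i) x < r - s" by (auto simp: eventually_sequentially)
 define Y where "Y i = X (i + n)" for i
 have Y: "Y \<longlonglongrightarrow> x" unfolding Y_def using X by (rule LIMSEQ_ignore_initial_segment)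
 have inb: "z + v \<in> cball x r" if "dist z x < r - s" "v \<in> cball 0 s" for z v
  using dist_triangle[of x "z + v" z] that by (simp add: dist_norm norm_minus_commute)
 have Ys: "cball (Y i) s \<subseteq> W" for i using n[of "i + n"] by (intro cball_shift[OF sub]) (simp add: Y_def dist_commute)
 have xs: "cball x s \<subseteq> W" using sr by (intro cball_shift[OF sub]) simp
 have "(\<lambda>i. (LBINT v. w (Y i + v) * k v)) \<longlonglongrightarrow> (LBINT v. w (x + v) * k v)"
 proof (rule integral_dominated_convergence[where w="\<lambda>v. indicator (cball 0 s) v * (B * C)"])
  show "(\<lambda>v. w (x + v) * k v) \<in> borel_measurable lborel"
   using borel_measurable_integrable[OF integrable_kernel_mult[OF W cw xs k]] by simp
  show "(\<lambda>v. w (Y i + v) * k v) \<in> borel_measurable lborel" for i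
   using borel_measurable_integrable[OF integrable_kernel_mult[OF W cw Ys k]] by simp
  show "AE v in lborel. (\<lambda>i. w (Y i + v) * k v) \<longlonglongrightarrow> w (x + v) * k v"
  proof (rule AE_I2)
   fix v show "(\<lambda>i. w (Y i + v) * k v) \<longlonglongrightarrow> w (x + v) * k v"
   proof (cases "v \<in> cball 0 s")
    case True
    have xv: "x + v \<in> W" using True sub sr by (auto simp: subset_iff dist_norm)
    then have ic: "isCont w (x + v)" using cw W continuous_on_eq_continuous_at by blast
    have "(\<lambda>i. w (Y i + v)) \<longlonglongrightarrow> w (x + v)"
     by (rule isCont_tendsto_compose[OF ic]) (intro tendsto_intros Y)
    then show ?thesis by (intro tendsto_intros)
   qed (simp add: k(2))
  qed
  show "AE v in lborel. norm (w (Y i + v) * k v) \<le> indicator (cball 0 s) v * (B * C)" for i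
  proof (rule AE_I2)
   fix v show "norm (w (Y i + v) * k v) \<le> indicator (cball 0 s) v * (B * C)"
   proof (cases "v \<in> cball 0 s")
    case True
    have "Y i + v \<in> cball x r" using n[of "i + n"] True by (intro inb) (auto simp: Y_def)
    then have "\<bar>w (Y i + v)\<bar> * \<bar>k v\<bar> \<le> B * C" using B C True by (intro mult_mono) auto
    then show ?thesis using True by (simp add: abs_mult)
   qed (simp add: k(2))
  qed
 qed (rule integrable_cball_const)
 then have "(\<lambda>i. (LBINT v. w (X i + v) * k v)) \<longlonglongrightarrow> (LBINT v. w (x + v) * k v)"
  unfolding Y_def by (rule LIMSEQ_offset)
 then show "((\<lambda>z. (LBINT v. w (z + v) * k v)) \<circ> X) \<longlonglongrightarrow> (LBINT v. w (x + v) * k v)"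
  by (simp add: comp_def)
qed

lemma C1_convolution_deriv:
 fixes w :: "'a::euclidean_space \<Rightarrow> real" and k :: "'a \<Rightarrow> real"
 assumes W: "open W" and w: "C1_on W w" and s: "0 < s" and sub: "cball x s \<subseteq> W"
  and k: "continuous_on UNIV k" "\<And>v. v \<notin> cball 0 s ==> k v = 0" and b: "b \<in> Basis"
 shows "((\<lambda>t. (LBINT v. w (x + t *\<^sub>R b + v) * k v)) has_real_derivative
   (LBINT v. pd b w (x + v) * k v)) (at 0)"
proof -
 have cw: "continuous_on W w" by (rule C1_on_continuous[OF w])
 obtain r where r: "r > s" "cball x r \<subseteq> W" using cball_enlarge[OF W sub] by blast
 have inb: "x + t *\<^sub>R b + v \<in> cball x r" if "\<bar>t\<bar> < r - s" "v \<in> cball 0 s" for t v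
 proof -
  have "norm (t *\<^sub>R b + v) \<le> \<bar>t\<bar> * norm b + norm v" using norm_triangle_ineq[of "t *\<^sub>R b" v] by simp
  moreover have "x - (x + t *\<^sub>R b + v) = - (t *\<^sub>R b + v)" by simp
  ultimately show ?thesis using that b by (simp add: dist_norm del: minus_add_distrib)
 qed
 have sb: "cball (x + t *\<^sub>R b) s \<subseteq> W" if "\<bar>t\<bar> < r - s" for t
  using that b by (intro cball_shift[OF r(2)]) (simp add: dist_norm)
 obtain B where B: "B > 0" "\<And>z. z \<in> cball x r ==> norm (pd b w z) \<le> B"
  using bounded_on_compact[OF C1_on_continuous_pd[OF w b] compact_cball r(2)] by blast
 obtain C where C: "C > 0" "\<And>z. z \<in> cball 0 s ==> norm (k z) \<le> C"
  using bounded_on_compact[OF k(1) compact_cball subset_UNIV] by blast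
 have "((\<lambda>t. (LBINT v. w (x + t *\<^sub>R b + v) * k v)) has_real_derivative
   (LBINT v. pd b w (x + 0 *\<^sub>R b + v) * k v)) (at 0)"
 proof (rule has_derivative_under_integral[where e="r - s" and g="\<lambda>v. indicator (cball 0 s) v * (B * C)"])
  fix t v assume t: "\<bar>t\<bar> < r - s"
  show "integrable lborel (\<lambda>v. w (x + t *\<^sub>R b + v) * k v)"
   by (rule integrable_kernel_mult[OF W cw sb[OF t] k])
  show "((\<lambda>t. w (x + t *\<^sub>R b + v) * k v) has_real_derivative pd b w (x + t *\<^sub>R b + v) * k v) (at t)"
  proof (cases "v \<in> cball 0 s")
   case True
   have "GDERIV w (x + v + t *\<^sub>R b) :> grad w (x + v + t *\<^sub>R b)"
    using inb[OF t True] r by (intro C1_onD[OF w]) (auto simp: ac_simps)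
   from gderiv_line[OF this] show ?thesis by (intro DERIV_cmult_right) (simp add: ac_simps pd_eq_grad b)
  qed (simp add: k(2))
  show "\<bar>pd b w (x + t *\<^sub>R b + v) * k v\<bar> \<le> indicator (cball 0 s) v * (B * C)"
  proof (cases "v \<in> cball 0 s")
   case True
   then have "\<bar>pd b w (x + t *\<^sub>R b + v)\<bar> * \<bar>k v\<bar> \<le> B * C" using B(2)[OF inb[OF t True]] C B by (intro mult_mono) auto
   then show ?thesis using True by (simp add: abs_mult)
  qed (simp add: k(2))
 next
  show "integrable lborel (\<lambda>v::'a. indicator (cball 0 s) v * (B * C))" by (rule integrable_cball_const)
 qed (use r in auto)
 then show ?thesis by simp
qed

lemma pd_sum_C1:
 assumes "\<And>i. i \<in> I ==> C1_on U (f i)" "x \<in> U" "b \<in> Basis"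
 shows "pd b (\<lambda>x. \<Sum>i\<in>I. f i x) x = (\<Sum>i\<in>I. pd b (f i) x)"
proof -
 have "GDERIV (\<lambda>x. \<Sum>i\<in>I. f i x) x :> (\<Sum>i\<in>I. grad (f i) x)"
  by (rule gderiv_sum) (use assms C1_onD in blast)
 from gderiv_pd[OF this, of b] show ?thesis using assms(3) by (simp add: pd_eq_grad inner_sum_left)
qed

text \<open>Differentiating the mean value identity in its centre shows that partial derivatives
  inherit it. Integration by parts then puts the derivative on the kernel, which leaves a formula
  for \<open>pd b w\<close> without any derivative of w.\<close>

lemma MV_pd:
 fixes w :: "'a::euclidean_space \<Rightarrow> real"
 assumes W: "open W" and C1: "C1_on W w" and MV: "MV W w" and b: "b \<in> Basis"
 shows "MV W (pd b w)"
  and "0 < s ==> cball x s \<subseteq> W ==> pd b w x = - (LBINT v. w (x + v) * (dker s v \<bullet> b)) / (s ^ (DIM('a) + 4) * kerc TYPE('a))"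
proof -
 have main: "(LBINT v. pd b w (x + v) * ker s v) = s ^ (DIM('a) + 4) * kerc TYPE('a) * pd b w x"
  if s: "0 < s" and sub: "cball x s \<subseteq> W" for x s
 proof -
  define c where "c = s ^ (DIM('a) + 4) * kerc TYPE('a)"
  obtain r where r: "r > s" "cball x r \<subseteq> W" using cball_enlarge[OF W sub] by blast
  have D: "((\<lambda>t. (LBINT v. w (x + t *\<^sub>R b + v) * ker s v)) has_real_derivative
    (LBINT v. pd b w (x + v) * ker s v)) (at 0)"
   by (rule C1_convolution_deriv[OF W C1 s sub continuous_ker ker_outside[OF s] b])
  have "(LBINT v. w (x + t *\<^sub>R b + v) * ker s v) = c * w (x + t *\<^sub>R b)" if "t \<in> {-(r-s)<..<r-s}" for t
  proof -
   have "cball (x + t *\<^sub>R b) s \<subseteq> W" using that b by (intro cball_shift[OF r(2)]) (auto simp: dist_norm)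
   then show ?thesis using MV s unfolding MV_def c_def by simp
  qed
  then have "((\<lambda>t. c * w (x + t *\<^sub>R b)) has_real_derivative (LBINT v. pd b w (x + v) * ker s v)) (at 0)"
   by (intro has_field_derivative_transform_within_open[OF D, of "{-(r-s)<..<r-s}"]) (use r in auto)
  moreover have "((\<lambda>t. c * w (x + t *\<^sub>R b)) has_real_derivative c * pd b w x) (at 0)"
  proof -
   have "GDERIV w (x + 0 *\<^sub>R b) :> grad w x" using C1_onD[OF C1, of x] subsetD[OF sub, of x] s by simp
   from gderiv_line[OF this] show ?thesis using b by (intro DERIV_cmult) (simp add: pd_eq_grad)
  qed
  ultimately show ?thesis using DERIV_unique unfolding c_def by blast
 qed
 then show "MV W (pd b w)" unfolding MV_def using C1_on_continuous_pd[OF C1 b] by simp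
 assume s: "0 < s" and sub: "cball x s \<subseteq> W"
 let ?O = "(\<lambda>v. x + v) -` W"
 have O: "open ?O" using W by (intro open_vimage) (auto intro!: continuous_intros)
 have subO: "cball 0 s \<subseteq> ?O" using sub by (auto simp: subset_iff dist_norm)
 have gd: "GDERIV (\<lambda>v. w (x + v)) v :> grad w (x + v)" if "v \<in> ?O" for v
  using gderiv_scale_shift[of w x 1 v] C1_onD[OF C1] that by simp
 have C1w: "C1_on ?O (\<lambda>v. w (x + v))"
  by (rule C1_onI[OF gd]) (auto intro!: continuous_intros continuous_on_compose2[OF C1_on_continuous_grad[OF C1]])
 have Ck: "C1_on UNIV (ker s :: 'a \<Rightarrow> real)" by (rule C1_onI[OF gderiv_ker continuous_dker])
 have dk: "pd b (ker s) v = dker s v \<bullet> b" for v by (rule gderiv_pd[OF gderiv_ker])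
 have dw: "pd b (\<lambda>v. w (x + v)) v = pd b w (x + v)" if "v \<in> ?O" for v using gderiv_pd[OF gd[OF that]] b by (simp add: pd_eq_grad)
 have cw: "continuous_on ?O (\<lambda>v. w (x + v))" "continuous_on ?O (\<lambda>v. pd b w (x + v))"
  by (intro continuous_on_compose2[OF C1_on_continuous[OF C1]] continuous_on_compose2[OF C1_on_continuous_pd[OF C1 b]]; auto intro!: continuous_intros)+
 have ck: "continuous_on ?O (ker s)" "continuous_on ?O (\<lambda>v. dker s v \<bullet> b)"
  by (intro continuous_intros continuous_on_subset[OF continuous_ker] continuous_on_subset[OF continuous_dker]; simp)+
 have "integral\<^sup>L (lebesgue_on ?O) (\<lambda>v. ker s v * pd b (\<lambda>v. w (x + v)) v) = - integral\<^sup>L (lebesgue_on ?O) (\<lambda>v. pd b (ker s) v * w (x + v))"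
  by (rule integral_by_parts[OF O compact_cball subO C1_on_subset[OF Ck subset_UNIV] C1w _ b]) (simp add: ker_outside[OF s])
 also have "integral\<^sup>L (lebesgue_on ?O) (\<lambda>v. ker s v * pd b (\<lambda>v. w (x + v)) v) = integral\<^sup>L (lebesgue_on ?O) (\<lambda>v. pd b w (x + v) * ker s v)"
  by (intro Bochner_Integration.integral_cong) (auto simp: dw)
 also have "\<dots> = (LBINT v. pd b w (x + v) * ker s v)"
  by (rule integral_lborel_compact_support[OF O compact_cball subO]) (auto intro!: continuous_intros cw ck simp: ker_outside[OF s])
 also have "integral\<^sup>L (lebesgue_on ?O) (\<lambda>v. pd b (ker s) v * w (x + v)) = (LBINT v. pd b (ker s) v * w (x + v))"
  unfolding dk by (rule integral_lborel_compact_support[OF O compact_cball subO]) (auto intro!: continuous_on_mult cw ck simp: dker_outside[OF s])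
 finally show "pd b w x = - (LBINT v. w (x + v) * (dker s v \<bullet> b)) / (s ^ (DIM('a) + 4) * kerc TYPE('a))"
  using main[OF s sub] s kerc_pos[where 'a='a] by (simp add: dk mult.commute)
qed

text \<open>A bootstrap: the kernel formula for \<open>pd b w\<close> involves only w, which is C^1,
  so it can be differentiated once more. The result \<open>E b d\<close> is also the kernel formula
  in direction b for the function \<open>pd d w\<close>, hence the symmetry of the second
  derivatives.\<close>

lemma MV_C2:
 fixes w :: "'a::euclidean_space \<Rightarrow> real"
 assumes W: "open W" and C1: "C1_on W w" and MV: "MV W w"
 shows "b \<in> Basis ==> C1_on W (pd b w)" and "b \<in> Basis ==> d \<in> Basis ==> x \<in> W ==> pd d (pd b w) x = pd b (pd d w) x"
proof -
 define E where "E b d s z = - (LBINT v. pd d w (z + v) * (dker s v \<bullet> b)) / (s ^ (DIM('a) + 4) * kerc TYPE('a))" for b d s z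
 have dk: "continuous_on UNIV (\<lambda>v. dker s v \<bullet> b)" for s b using continuous_dker by (intro continuous_intros) auto
 have D: "((\<lambda>t. pd b w (z + t *\<^sub>R d)) has_real_derivative E b d s z) (at 0)"
  if s: "0 < s" "s < r" and r: "cball z r \<subseteq> W" and b: "b \<in> Basis" and d: "d \<in> Basis" for s r z b d
 proof -
  have zs: "cball z s \<subseteq> W" using s by (intro cball_shift[OF r]) simp
  have "((\<lambda>t. (LBINT v. w (z + t *\<^sub>R d + v) * (dker s v \<bullet> b))) has_real_derivative
    (LBINT v. pd d w (z + v) * (dker s v \<bullet> b))) (at 0)"
   by (rule C1_convolution_deriv[OF W C1 s(1) zs dk _ d]) (simp add: dker_outside[OF s(1)])
  from DERIV_cdivide[OF DERIV_minus[OF this], of "s ^ (DIM('a) + 4) * kerc TYPE('a)"]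
  show ?thesis unfolding E_def
  proof (rule has_field_derivative_transform_within_open[of _ _ _ "{-(r-s)<..<r-s}"])
   fix t assume "t \<in> {-(r-s)<..<r-s}"
   then have "cball (z + t *\<^sub>R d) s \<subseteq> W" using d by (intro cball_shift[OF r]) (auto simp: dist_norm)
   then show "- (LBINT v. w (z + t *\<^sub>R d + v) * (dker s v \<bullet> b)) / (s ^ (DIM('a) + 4) * kerc TYPE('a)) = pd b w (z + t *\<^sub>R d)"
    using MV_pd(2)[OF W C1 MV b s(1)] by simp
  qed (use s in auto)
 qed
 have rad: "\<exists>r>0. cball x r \<subseteq> W" if "x \<in> W" for x using W open_contains_cball that by blast
 show C: "C1_on W (pd b w)" if b: "b \<in> Basis" for b
 proof (rule C1_on_pd[OF W])
  fix d x :: 'a assume d: "d \<in> Basis" and "x \<in> W"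
  then obtain r where "0 < r" "cball x r \<subseteq> W" using rad by blast
  then show "has_pd d (pd b w) x" by (intro has_pdI[OF D[of "r/2" r]]) (use b d in auto)
 next
  fix d :: 'a assume d: "d \<in> Basis"
  have "isCont (pd d (pd b w)) x" if x: "x \<in> W" for x
  proof -
   obtain r where r: "0 < r" "cball x r \<subseteq> W" using rad x by blast
   \<comment> \<open>The radius r/3 serves all z within r/3 of x at once, because a ball of radius
     2r/3 about such a z still lies in W. Continuity of the second derivative thus becomes
     continuity of one fixed convolution.\<close>
   have "isCont (\<lambda>z. (LBINT v. pd d w (z + v) * (dker (r/3) v \<bullet> b))) x"
    by (rule continuous_on_convolution[OF W C1_on_continuous_pd[OF C1 d] r(2), where s="r/3"]) (use r dk in \<open>auto simp: dker_outside[of "r/3"]\<close>)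
   then have ic: "isCont (E b d (r/3)) x"
    unfolding E_def[abs_def] using r kerc_pos[where 'a='a] by (intro continuous_intros) auto
   have "\<forall>\<^sub>F z in nhds x. z \<in> ball x (r/3)" using r by (intro eventually_nhds_in_open) auto
   then have ev: "\<forall>\<^sub>F z in nhds x. E b d (r/3) z = pd d (pd b w) z"
   proof eventually_elim
    case (elim z)
    have "cball z (2*r/3) \<subseteq> W" using elim by (intro cball_shift[OF r(2)]) simp
    from pd_eqI[OF D[OF _ _ this b d, of "r/3"]] show ?case using r by simp
   qed
   show ?thesis using ic isCont_cong[OF ev] by simp
  qed
  then show "continuous_on W (pd d (pd b w))" by (simp add: continuous_at_imp_continuous_on)
 qed
 assume b: "b \<in> Basis" and d: "d \<in> Basis" and x: "x \<in> W"
 obtain r where r: "0 < r" "cball x r \<subseteq> W" using rad x by blast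
 then have "cball x (r/2) \<subseteq> W" by (intro cball_shift[OF r(2)]) simp
 then show "pd d (pd b w) x = pd b (pd d w) x"
  using pd_eqI[OF D[of "r/2" r x b d]] MV_pd(2)[OF W C[OF d] MV_pd(1)[OF W C1 MV d] b, of "r/2" x] r b d by (simp add: E_def)
qed

definition harm :: "'a::euclidean_space set \<Rightarrow> ('a \<Rightarrow> real) \<Rightarrow> bool" where
 "harm W w \<longleftrightarrow> C2_on W w \<and> (\<forall>x\<in>W. laplacian w x = 0)"

lemma harm_C2: "harm W w ==> C2_on W w" by (simp add: harm_def)

lemma harm_C1: "open W ==> harm W w ==> C1_on W w" by (simp add: harm_def C2_on_iff)

lemma harm_MV: "open W ==> harm W w ==> MV W w"
 unfolding harm_def by (intro harmonic_imp_MV) auto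

text \<open>Third derivatives of a function that is only given as C^2 are needed. They exist because
  \<open>MV_C2\<close> applies to each \<open>pd c w\<close> in turn, and its symmetry part moves
  \<open>pd b\<close> out of the Laplacian.\<close>

lemma harm_pd:
 fixes w :: "'a::euclidean_space \<Rightarrow> real"
 assumes W: "open W" and w: "harm W w" and b: "b \<in> Basis"
 shows "harm W (pd b w)"
proof -
 have C: "C1_on W w" "\<And>c. c \<in> Basis ==> C1_on W (pd c w)" using harm_C2[OF w] C2_on_iff[OF W] by auto
 have MV: "MV W w" "\<And>c. c \<in> Basis ==> MV W (pd c w)" using harm_MV[OF W w] MV_pd(1)[OF W C(1)] by auto
 have C2: "C1_on W (pd d (pd c w))" if "c \<in> Basis" "d \<in> Basis" for c d using that by (intro MV_C2(1)[OF W C(2) MV(2)])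
 have "laplacian (pd b w) x = 0" if x: "x \<in> W" for x
 proof -
  have "pd c (pd c (pd b w)) x = pd b (pd c (pd c w)) x" if c: "c \<in> Basis" for c
  proof -
   have "pd c (pd c (pd b w)) x = pd c (pd b (pd c w)) x"
    by (rule pd_cong[OF W x MV_C2(2)[OF W C(1) MV(1) b c]])
   also have "\<dots> = pd b (pd c (pd c w)) x" by (rule MV_C2(2)[OF W C(2)[OF c] MV(2)[OF c] b c x])
   finally show ?thesis .
  qed
  then have "laplacian (pd b w) x = pd b (laplacian w) x"
   unfolding laplacian_def[abs_def] using pd_sum_C1[of Basis W "\<lambda>c. pd c (pd c w)" x b] C2 x b by simp
  also have "\<dots> = pd b (\<lambda>x. 0) x" by (rule pd_cong[OF W x]) (use w in \<open>simp add: harm_def\<close>)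
  also have "\<dots> = 0" using gderiv_pd[OF GDERIV_const[of 0 x], of b] by simp
  finally show ?thesis .
 qed
 then show ?thesis using C(2)[OF b] C2[OF b] by (simp add: harm_def C2_on_iff[OF W])
qed

section \<open>L2 and sup estimates for harmonic functions\<close>

abbreviation sq_integrable :: "'a::euclidean_space set \<Rightarrow> ('a \<Rightarrow> real) \<Rightarrow> bool" where
 "sq_integrable W f \<equiv> integrable (lebesgue_on W) (\<lambda>x. (f x)\<^sup>2)"

abbreviation sq_integral :: "'a::euclidean_space set \<Rightarrow> ('a \<Rightarrow> real) \<Rightarrow> real" where
 "sq_integral W f \<equiv> (LINT x|lebesgue_on W. (f x)\<^sup>2)"

abbreviation finite_energy :: "'a::euclidean_space set \<Rightarrow> ('a \<Rightarrow> real) \<Rightarrow> bool" where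
 "finite_energy W v \<equiv> sq_integrable W (\<lambda>x. norm (grad v x))"

abbreviation energy :: "'a::euclidean_space set \<Rightarrow> ('a \<Rightarrow> real) \<Rightarrow> real" where
 "energy W v \<equiv> sq_integral W (\<lambda>x. norm (grad v x))"

lemma open_borel_if:
 fixes f :: "'a::euclidean_space \<Rightarrow> real"
 assumes "open W" "continuous_on W f"
 shows "(\<lambda>x. if x \<in> W then f x else 0) \<in> borel_measurable borel"
 using assms by (intro borel_measurable_continuous_on_if) auto

lemma integral_translate':
 fixes f g :: "'a::euclidean_space \<Rightarrow> real"
 assumes "\<And>v. f v = g (v + a)" "f \<in> borel_measurable borel"
 shows "integral\<^sup>L lborel f = integral\<^sup>L lborel g"
proof -
 have "g = (\<lambda>v. f (v + - a))" using assms(1) by (auto simp: fun_eq_iff)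
 then show ?thesis using integral_translate[OF assms(2), of "- a"] by simp
qed

lemma integrable_translate:
 fixes f :: "'a::euclidean_space \<Rightarrow> real"
 assumes "integrable lborel f"
 shows "integrable lborel (\<lambda>x. f (a + x))"
proof -
 have "integrable (distr lborel borel ((+) a)) f" using assms by (simp add: lborel_distr_plus)
 then show ?thesis using assms by (subst (asm) integrable_distr_eq) auto
qed

text \<open>Jensen's inequality for the normalized weight \<open>ker s\<close>, in the form that the
  variance about the mean value \<open>w x\<close> is nonnegative. Afterwards the weight is
  estimated by \<open>s ^ 4\<close> and the integral is enlarged to all of W.\<close>

lemma harm_L2_bound:
 fixes w :: "'a::euclidean_space \<Rightarrow> real"
 assumes W: "open W" and w: "harm W w" and s: "0 < s" and sub: "cball x s \<subseteq> W"
  and L2: "sq_integrable W w"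
 shows "(w x)\<^sup>2 \<le> sq_integral W w / (kerc TYPE('a) * s ^ DIM('a))"
proof -
 define c where "c = s ^ (DIM('a) + 4) * kerc TYPE('a)"
 have c: "c > 0" using s kerc_pos[where 'a='a] by (simp add: c_def)
 note MV = harm_MV[OF W w] and cw = C1_on_continuous[OF harm_C1[OF W w]]
 have k0: "\<And>v. v \<notin> cball 0 s ==> ker s v = 0" by (rule ker_outside[OF s])
 have i1: "integrable lborel (\<lambda>v. w (x + v) * ker s v)"
  by (rule integrable_kernel_mult[OF W cw sub continuous_ker k0])
 have cw2: "continuous_on W (\<lambda>x. (w x)\<^sup>2)" by (intro continuous_intros cw)
 have i2: "integrable lborel (\<lambda>v. (w (x + v))\<^sup>2 * ker s v)"
  by (rule integrable_kernel_mult[OF W cw2 sub continuous_ker k0])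
 have ik: "integrable lborel (ker s :: 'a \<Rightarrow> real)"
  by (rule integrable_continuous_compact_support[OF continuous_ker compact_cball k0])
 have one: "integral\<^sup>L lborel (ker s :: 'a \<Rightarrow> real) = c"
 proof -
  have "integral\<^sup>L lborel (ker s :: 'a \<Rightarrow> real) = s ^ DIM('a) * integral\<^sup>L lborel (\<lambda>v::'a. ker s (s *\<^sub>R v))"
   by (rule integral_scale[OF borel_measurable_continuous_onI[OF continuous_ker] s])
  then show ?thesis using s by (simp add: ker_scale kerc_def c_def power_add)
 qed
 have mean: "(LBINT v. w (x + v) * ker s v) = c * w x" using MV s sub by (simp add: MV_def c_def)
 have "0 \<le> (LBINT v. (w (x + v) - w x)\<^sup>2 * ker s v)"
  by (intro Bochner_Integration.integral_nonneg) (simp add: ker_nonneg)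
 also have "(\<lambda>v. (w (x + v) - w x)\<^sup>2 * ker s v) = (\<lambda>v. (w (x + v))\<^sup>2 * ker s v - 2 * w x * (w (x + v) * ker s v) + (w x)\<^sup>2 * ker s v)"
  by (auto simp: fun_eq_iff power2_eq_square algebra_simps)
 also have "(LBINT v. (w (x + v))\<^sup>2 * ker s v - 2 * w x * (w (x + v) * ker s v) + (w x)\<^sup>2 * ker s v)
   = (LBINT v. (w (x + v))\<^sup>2 * ker s v) - 2 * w x * (c * w x) + (w x)\<^sup>2 * c"
  using i1 i2 ik by (simp add: one mean)
 finally have le: "(w x)\<^sup>2 * c \<le> (LBINT v. (w (x + v))\<^sup>2 * ker s v)"
  by (simp add: power2_eq_square algebra_simps)
 have m2: "(\<lambda>x. if x \<in> W then (w x)\<^sup>2 else 0) \<in> borel_measurable borel"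
  by (rule open_borel_if[OF W cw2])
 have i3: "integrable lborel (\<lambda>x. if x \<in> W then (w x)\<^sup>2 else 0)"
  using L2 W m2 by (subst (asm) lebesgue_on_lborel(2)) auto
 have "(LBINT v. (w (x + v))\<^sup>2 * ker s v) = (LBINT y. (w y)\<^sup>2 * ker s (y - x))"
  by (rule integral_translate'[where a=x]) (use borel_measurable_integrable[OF i2] in \<open>auto simp: add.commute\<close>)
 also have "\<dots> \<le> (LBINT y. s ^ 4 * (if y \<in> W then (w y)\<^sup>2 else 0))"
 proof (rule integral_mono)
  have "(\<lambda>y. (w y)\<^sup>2 * ker s (y - x)) = (\<lambda>y. (\<lambda>v. (w (x + v))\<^sup>2 * ker s v) (- x + y))" by (simp add: fun_eq_iff)
  moreover have "integrable lborel (\<lambda>y. (\<lambda>v. (w (x + v))\<^sup>2 * ker s v) (- x + y))"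
   by (rule integrable_translate[OF i2])
  ultimately show "integrable lborel (\<lambda>y. (w y)\<^sup>2 * ker s (y - x))" by (simp only:)
  show "integrable lborel (\<lambda>y. s ^ 4 * (if y \<in> W then (w y)\<^sup>2 else 0))" using i3 by simp
  fix y show "(w y)\<^sup>2 * ker s (y - x) \<le> s ^ 4 * (if y \<in> W then (w y)\<^sup>2 else 0)"
  proof (cases "y - x \<in> cball 0 s")
   case True
   then have "y \<in> W" using sub by (auto simp: subset_iff dist_norm norm_minus_commute)
   then show ?thesis using mult_right_mono[OF ker_le[of s "y - x"], of "(w y)\<^sup>2"] by (simp add: mult.commute)
  qed (simp add: k0)
 qed
 also have "\<dots> = s ^ 4 * sq_integral W w"
  using W m2 by (subst lebesgue_on_lborel(1)) auto
 finally have "(w x)\<^sup>2 * c \<le> s ^ 4 * sq_integral W w" using le by linarith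
 then show ?thesis using s kerc_pos[where 'a='a] by (simp add: c_def field_simps power_add)
qed

text \<open>The 4 comes from the bound \<open>4 * s ^ 3\<close> for the kernel gradient, the volume
  from integrating it over the ball, the denominator from the kernel mass.\<close>

definition gradc :: "'a::euclidean_space itself \<Rightarrow> real" where
 "gradc _ = 4 * measure lborel (cball (0::'a) 1) / kerc TYPE('a)"

lemma gradc_pos: "gradc TYPE('a::euclidean_space) > 0"
 using kerc_pos[where 'a='a] content_cball[of 1 "0::'a"] by (simp add: gradc_def measure_completion)

lemma measure_cball_scale:
 assumes "0 < s" shows "measure lborel (cball (0::'a::euclidean_space) s) = s ^ DIM('a) * measure lborel (cball (0::'a) 1)"
 using content_cball[of s "0::'a"] content_cball[of 1 "0::'a"] assms by (simp add: measure_completion)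

lemma harm_dir_bound:
 fixes w :: "'a::euclidean_space \<Rightarrow> real"
 assumes W: "open W" and w: "harm W w" and s: "0 < s" and sub: "cball x s \<subseteq> W"
  and B: "\<And>y. y \<in> cball x s ==> \<bar>w y\<bar> \<le> B"
 shows "\<bar>grad w x \<bullet> b\<bar> \<le> gradc TYPE('a) / s * B * norm b"
proof -
 define c where "c = s ^ (DIM('a) + 4) * kerc TYPE('a)"
 have c: "c > 0" using s kerc_pos[where 'a='a] by (simp add: c_def)
 note C1 = harm_C1[OF W w] and MV = harm_MV[OF W w]
 note cw = C1_on_continuous[OF C1]
 have B0: "B \<ge> 0" using B[of x] s by simp
 have ii: "integrable lborel (\<lambda>v. w (x + v) * (dker s v \<bullet> i))" for i
  using continuous_dker by (intro integrable_kernel_mult[OF W cw sub]) (auto intro!: continuous_intros simp: dker_outside[OF s])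
 have "grad w x \<bullet> b = (\<Sum>i\<in>Basis. pd i w x * (b \<bullet> i))" by (subst euclidean_inner) (simp add: pd_eq_grad)
 also have "\<dots> = (\<Sum>i\<in>Basis. - (LBINT v. w (x + v) * (dker s v \<bullet> i) * (b \<bullet> i)) / c)"
  using MV_pd(2)[OF W C1 MV _ s sub] by (intro sum.cong) (simp_all add: c_def)
 also have "\<dots> = - (LBINT v. \<Sum>i\<in>Basis. w (x + v) * (dker s v \<bullet> i) * (b \<bullet> i)) / c"
  using ii by (subst Bochner_Integration.integral_sum) (simp_all add: sum_negf sum_divide_distrib)
 also have "(\<lambda>v. \<Sum>i\<in>Basis. w (x + v) * (dker s v \<bullet> i) * (b \<bullet> i)) = (\<lambda>v. w (x + v) * (dker s v \<bullet> b))"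
  by (subst (2) euclidean_inner) (simp add: sum_distrib_left mult.assoc)
 finally have e: "\<bar>grad w x \<bullet> b\<bar> = \<bar>(LBINT v. w (x + v) * (dker s v \<bullet> b))\<bar> / c" using c by simp
 have "\<bar>(LBINT v. w (x + v) * (dker s v \<bullet> b))\<bar> \<le> (LBINT v. \<bar>w (x + v) * (dker s v \<bullet> b)\<bar>)"
  by (rule integral_abs_bound)
 also have "\<dots> \<le> integral\<^sup>L lborel (\<lambda>v::'a. indicator (cball 0 s) v * (B * (4 * s ^ 3 * norm b)))"
 proof (rule integral_mono)
  show "integrable lborel (\<lambda>v. \<bar>w (x + v) * (dker s v \<bullet> b)\<bar>)"
   by (intro integrable_abs ii)
  show "integrable lborel (\<lambda>v::'a. indicator (cball 0 s) v * (B * (4 * s ^ 3 * norm b)))" by (rule integrable_cball_const)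
  fix v show "\<bar>w (x + v) * (dker s v \<bullet> b)\<bar> \<le> indicator (cball 0 s) v * (B * (4 * s ^ 3 * norm b))"
  proof (cases "v \<in> cball 0 s")
   case True
   have "\<bar>dker s v \<bullet> b\<bar> \<le> 4 * s ^ 3 * norm b"
    using norm_dker_le[OF s] by (intro order_trans[OF Cauchy_Schwarz_ineq2] mult_right_mono) auto
   moreover have "\<bar>w (x + v)\<bar> \<le> B" using True by (intro B) (auto simp: dist_norm)
   ultimately have "\<bar>w (x + v)\<bar> * \<bar>dker s v \<bullet> b\<bar> \<le> B * (4 * s ^ 3 * norm b)" using B0 by (intro mult_mono) auto
   then show ?thesis using True by (simp add: abs_mult)
  qed (simp add: dker_outside[OF s])
 qed
 also have "\<dots> = B * (4 * s ^ 3 * norm b) * (s ^ DIM('a) * measure lborel (cball (0::'a) 1))"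
  using measure_cball_scale[OF s, where 'a='a] by simp
 finally have "\<bar>grad w x \<bullet> b\<bar> \<le> B * (4 * s ^ 3 * norm b) * (s ^ DIM('a) * measure lborel (cball (0::'a) 1)) / c"
  unfolding e using c by (intro divide_right_mono) auto
 also have "\<dots> = gradc TYPE('a) / s * B * norm b"
  using s kerc_pos[where 'a='a] unfolding c_def gradc_def by (simp add: field_simps power_add power3_eq_cube power4_eq_xxxx)
 finally show ?thesis .
qed

text \<open>Taking the gradient itself as direction avoids the dimensional factor of a
  coordinatewise estimate; one factor of its norm cancels.\<close>

lemma harm_grad_sup_bound:
 fixes w :: "'a::euclidean_space \<Rightarrow> real"
 assumes W: "open W" and w: "harm W w" and s: "0 < s" and sub: "cball x s \<subseteq> W"
  and B: "\<And>y. y \<in> cball x s ==> \<bar>w y\<bar> \<le> B"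
 shows "norm (grad w x) \<le> gradc TYPE('a) / s * B"
proof (cases "grad w x = 0")
 case True
 have "B \<ge> 0" using B[of x] s by simp
 then show ?thesis using True gradc_pos[where 'a='a] s by simp
next
 case False
 have "\<bar>grad w x \<bullet> grad w x\<bar> \<le> gradc TYPE('a) / s * B * norm (grad w x)" by (rule harm_dir_bound[OF assms])
 then have "norm (grad w x) * norm (grad w x) \<le> (gradc TYPE('a) / s * B) * norm (grad w x)"
  by (simp add: dot_square_norm power2_eq_square)
 then show ?thesis using False by (simp only: mult_le_cancel_right) auto
qed

text \<open>Half of the radius goes into bounding w on a smaller ball by its L2 norm, the other half
  into the gradient estimate there.\<close>

lemma harm_grad_L2_bound:
 fixes w :: "'a::euclidean_space \<Rightarrow> real"
 assumes W: "open W" and w: "harm W w" and s: "0 < s" and sub: "cball x s \<subseteq> W"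
  and L2: "sq_integrable W w"
 shows "(norm (grad w x))\<^sup>2 \<le> (2 * gradc TYPE('a) / s)\<^sup>2 * (sq_integral W w / (kerc TYPE('a) * (s / 2) ^ DIM('a)))"
proof -
 define I where "I = sq_integral W w / (kerc TYPE('a) * (s / 2) ^ DIM('a))"
 have I0: "I \<ge> 0" using kerc_pos[where 'a='a] s unfolding I_def by (intro divide_nonneg_pos) auto
 have "norm (grad w x) \<le> gradc TYPE('a) / (s / 2) * sqrt I"
 proof (rule harm_grad_sup_bound[OF W w])
  show "cball x (s / 2) \<subseteq> W" using sub s by auto
  fix y assume y: "y \<in> cball x (s / 2)"
  have "cball y (s / 2) \<subseteq> W" using y by (intro cball_shift[OF sub]) simp
  then have "(w y)\<^sup>2 \<le> I" unfolding I_def using s by (intro harm_L2_bound[OF W w _ _ L2]) auto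
  then show "\<bar>w y\<bar> \<le> sqrt I" by (simp add: real_le_rsqrt)
 qed (use s in auto)
 then have "(norm (grad w x))\<^sup>2 \<le> (gradc TYPE('a) / (s / 2) * sqrt I)\<^sup>2" by (intro power_mono) auto
 also have "\<dots> = (2 * gradc TYPE('a) / s)\<^sup>2 * I" using I0 by (simp add: power_mult_distrib power_divide)
 finally show ?thesis by (simp add: I_def)
qed

section \<open>Maximum principle\<close>

lemma interior_max_laplacian:
 fixes w :: "'a::euclidean_space \<Rightarrow> real"
 assumes G: "open G" and C2: "C2_on G w" and x: "x \<in> G" and mx: "\<And>y. y \<in> G ==> w y \<le> w x"
 shows "laplacian w x \<le> 0"
 unfolding laplacian_def
proof (rule sum_nonpos)
 fix b :: 'a assume b: "b \<in> Basis"
 have C1: "C1_on G w" "C1_on G (pd b w)" using C2 C2_on_iff[OF G] b by auto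
 obtain e where e: "e > 0" "ball x e \<subseteq> G" using G x open_contains_ball by blast
 have inG: "x + t *\<^sub>R b \<in> G" if "\<bar>t\<bar> < e" for t using that b e by (auto simp: subset_iff dist_norm)
 define f where "f t = w (x + t *\<^sub>R b)" for t
 define f' where "f' t = pd b w (x + t *\<^sub>R b)" for t
 have d1: "(f has_real_derivative f' t) (at t)" if "\<bar>t\<bar> < e" for t
  unfolding f_def f'_def using gderiv_line[OF C1_onD[OF C1(1) inG[OF that]]] b by (simp add: pd_eq_grad)
 have d2: "(f' has_real_derivative pd b (pd b w) x) (at 0)"
  unfolding f'_def using gderiv_line[of "pd b w" x 0 b] C1_onD[OF C1(2) x] b by (simp add: pd_eq_grad)
 have f0: "f' 0 = 0"
  using DERIV_local_max[OF d1, of 0 e] e mx inG by (auto simp: f_def)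
 show "pd b (pd b w) x \<le> 0"
 proof (rule ccontr)
  assume "\<not> ?thesis"
  \<comment> \<open>With a positive second derivative, \<open>f'\<close> would be positive just to
    the right of its zero, and the mean value theorem would lift f above its maximum.\<close>
  then obtain d where d: "d > 0" "\<And>h. 0 < h ==> h < d ==> f' 0 < f' (0 + h)"
   using DERIV_pos_inc_right[OF d2] by auto
  define h where "h = min d e / 2"
  have h: "0 < h" "h < d" "h < e" using d e by (auto simp: h_def)
  obtain z where z: "0 < z" "z < h" "f h - f 0 = (h - 0) * f' z"
   using MVT2[of 0 h f f'] d1 h by auto
  have "f' z > 0" using d(2)[of z] z h f0 by auto
  then have "f h > f 0" using z(3) h by (smt (verit) mult_pos_pos)
  moreover have "f h \<le> f 0" using mx[OF inG[of h]] h by (simp add: f_def)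
  ultimately show False by simp
 qed
qed

text \<open>The barriers below all satisfy strict differential inequalities, so an interior maximum
  is contradicted directly, without connectedness or a strong maximum principle.\<close>

lemma max_principle:
 fixes w :: "'a::euclidean_space \<Rightarrow> real"
 assumes G: "open G" "bounded G" and C2: "C2_on G w" and c: "continuous_on (closure G) w"
  and lap: "\<And>x. x \<in> G ==> laplacian w x > 0" and bd: "\<And>y. y \<in> closure G - G ==> w y \<le> m" and x: "x \<in> closure G"
 shows "w x \<le> m"
proof -
 have "compact (closure G)" by (rule compact_closure[THEN iffD2, OF G(2)])
 moreover have "closure G \<noteq> {}" using x by (metis empty_iff)
 ultimately obtain y where y: "y \<in> closure G" "\<And>z. z \<in> closure G ==> w z \<le> w y"
  using continuous_attains_sup[OF _ _ c] by metis
 have "y \<notin> G"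
 proof
  assume yG: "y \<in> G"
  have "laplacian w y \<le> 0"
   by (rule interior_max_laplacian[OF G(1) C2 yG]) (rule y(2)[OF subsetD[OF closure_subset]])
  then show False using lap[OF yG] by simp
 qed
 then show ?thesis using y(2)[OF x] bd[of y] y(1) by auto
qed

section \<open>Linear combinations and compositions of C^2 functions\<close>

lemma C2_on_subset: "open U ==> open V ==> C2_on U f ==> V \<subseteq> U ==> C2_on V f"
 by (auto simp: C2_on_iff intro: C1_on_subset)

lemma C2_on_cong:
 assumes "open U" "\<And>y. y \<in> U ==> f y = g y" "C2_on U f"
 shows "C2_on U g"
 using assms(3) unfolding C2_on_iff[OF assms(1)]
 by (auto intro: C1_on_cong[OF assms(1,2)] C1_on_cong[OF assms(1) pd_cong[OF assms(1) _ assms(2)]])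

lemma laplacian_cong:
 assumes "open U" "x \<in> U" "\<And>y. y \<in> U ==> f y = g y"
 shows "laplacian f x = laplacian g x"
 unfolding laplacian_def
 by (intro sum.cong refl pd_cong[OF assms(1,2)] pd_cong[OF assms(1) _ assms(3)])

lemma C2_on_lincomb:
 assumes U: "open U" and f: "C2_on U f" and g: "C2_on U g"
 shows "C2_on U (\<lambda>x. a * f x + c * g x)"
  and "x \<in> U ==> laplacian (\<lambda>x. a * f x + c * g x) x = a * laplacian f x + c * laplacian g x"
  and "x \<in> U ==> grad (\<lambda>x. a * f x + c * g x) x = a *\<^sub>R grad f x + c *\<^sub>R grad g x"
proof -
 have C1: "C1_on U f" "C1_on U g" using f g C2_on_iff[OF U] by auto
 have C1p: "C1_on U (pd b f)" "C1_on U (pd b g)" if "b \<in> Basis" for b using f g C2_on_iff[OF U] that by auto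
 have gl: "GDERIV (\<lambda>x. a * f x + c * g x) x :> a *\<^sub>R F + c *\<^sub>R G" if "GDERIV f x :> F" "GDERIV g x :> G" for f g x and F G :: 'a
  using GDERIV_add[OF GDERIV_mult[OF GDERIV_const[of a x] that(1)] GDERIV_mult[OF GDERIV_const[of c x] that(2)]] by simp
 have p1: "pd b (\<lambda>x. a * f x + c * g x) x = a * pd b f x + c * pd b g x" if "x \<in> U" "b \<in> Basis" for x b
  using gderiv_pd[OF gl[OF C1_onD[OF C1(1) that(1)] C1_onD[OF C1(2) that(1)]], of b] that by (simp add: pd_eq_grad inner_add_left)
 have p2: "pd b (pd b (\<lambda>x. a * f x + c * g x)) x = a * pd b (pd b f) x + c * pd b (pd b g) x" if "x \<in> U" "b \<in> Basis" for x b
 proof -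
  have "pd b (pd b (\<lambda>x. a * f x + c * g x)) x = pd b (\<lambda>x. a * pd b f x + c * pd b g x) x"
   by (rule pd_cong[OF U that(1)]) (simp add: p1 that)
  also have "\<dots> = a * pd b (pd b f) x + c * pd b (pd b g) x"
   using gderiv_pd[OF gl[OF C1_onD[OF C1p(1) that(1)] C1_onD[OF C1p(2) that(1)]], of b b b] that by (simp add: pd_eq_grad inner_add_left)
  finally show ?thesis .
 qed
 show "C2_on U (\<lambda>x. a * f x + c * g x)"
  unfolding C2_on_iff[OF U]
 proof (intro conjI ballI)
  show "C1_on U (\<lambda>x. a * f x + c * g x)" using C1 by (intro C1_on_add C1_on_mult C1_on_const)
  fix b :: 'a assume b: "b \<in> Basis"
  have "C1_on U (\<lambda>x. a * pd b f x + c * pd b g x)" using C1p[OF b] by (intro C1_on_add C1_on_mult C1_on_const)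
  then show "C1_on U (pd b (\<lambda>x. a * f x + c * g x))"
   by (rule C1_on_cong[OF U, rotated]) (simp add: p1 b)
 qed
 show "laplacian (\<lambda>x. a * f x + c * g x) x = a * laplacian f x + c * laplacian g x" if "x \<in> U"
  using p2[OF that] by (simp add: laplacian_def sum.distrib sum_distrib_left)
 show "grad (\<lambda>x. a * f x + c * g x) x = a *\<^sub>R grad f x + c *\<^sub>R grad g x" if "x \<in> U"
  by (rule gderiv_grad[OF gl[OF C1_onD[OF C1(1) that] C1_onD[OF C1(2) that]]])
qed

lemma C2_on_compose:
 assumes U: "open U" and f: "C2_on U f"
  and d1: "\<And>x. x \<in> U ==> (\<phi> has_real_derivative \<phi>' (f x)) (at (f x))"
  and d2: "\<And>x. x \<in> U ==> (\<phi>' has_real_derivative \<phi>'' (f x)) (at (f x))"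
  and c: "continuous_on (f ` U) \<phi>''"
 shows "C2_on U (\<lambda>x. \<phi> (f x))"
  and "x \<in> U ==> laplacian (\<lambda>x. \<phi> (f x)) x = \<phi>'' (f x) * (norm (grad f x))\<^sup>2 + \<phi>' (f x) * laplacian f x"
proof -
 have C1: "C1_on U f" using f C2_on_iff[OF U] by auto
 have C1p: "C1_on U (pd b f)" if "b \<in> Basis" for b using f C2_on_iff[OF U] that by auto
 have c': "continuous_on (f ` U) \<phi>'"
  using d2 by (auto intro!: continuous_at_imp_continuous_on DERIV_isCont)
 have C1f': "C1_on U (\<lambda>x. \<phi>' (f x))" by (rule C1_on_compose[OF C1 d2 c])
 have p1: "pd b (\<lambda>x. \<phi> (f x)) x = \<phi>' (f x) * pd b f x" if "x \<in> U" "b \<in> Basis" for x b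
  using gderiv_pd[OF GDERIV_DERIV_compose[OF C1_onD[OF C1 that(1)] d1[OF that(1)]]] that by (simp add: pd_eq_grad)
 have p2: "pd b (pd b (\<lambda>x. \<phi> (f x))) x = \<phi>'' (f x) * (pd b f x)\<^sup>2 + \<phi>' (f x) * pd b (pd b f) x" if "x \<in> U" "b \<in> Basis" for x b
 proof -
  have "pd b (pd b (\<lambda>x. \<phi> (f x))) x = pd b (\<lambda>x. \<phi>' (f x) * pd b f x) x"
   by (rule pd_cong[OF U that(1)]) (simp add: p1 that)
  also have "\<dots> = \<phi>'' (f x) * (pd b f x)\<^sup>2 + \<phi>' (f x) * pd b (pd b f) x"
   using gderiv_pd[OF GDERIV_mult[OF GDERIV_DERIV_compose[OF C1_onD[OF C1 that(1)] d2[OF that(1)]] C1_onD[OF C1p[OF that(2)] that(1)]], of b] that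
   by (simp add: pd_eq_grad inner_add_left power2_eq_square)
  finally show ?thesis .
 qed
 show "C2_on U (\<lambda>x. \<phi> (f x))"
  unfolding C2_on_iff[OF U]
 proof (intro conjI ballI)
  show "C1_on U (\<lambda>x. \<phi> (f x))" by (rule C1_on_compose[OF C1 d1 c'])
  fix b :: 'a assume b: "b \<in> Basis"
  have "C1_on U (\<lambda>x. \<phi>' (f x) * pd b f x)" by (rule C1_on_mult[OF C1f' C1p[OF b]])
  then show "C1_on U (pd b (\<lambda>x. \<phi> (f x)))"
   by (rule C1_on_cong[OF U, rotated]) (simp add: p1 b)
 qed
 show "laplacian (\<lambda>x. \<phi> (f x)) x = \<phi>'' (f x) * (norm (grad f x))\<^sup>2 + \<phi>' (f x) * laplacian f x" if "x \<in> U"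
 proof -
  have "(norm (grad f x))\<^sup>2 = (\<Sum>b\<in>Basis. (pd b f x)\<^sup>2)"
   unfolding power2_norm_eq_inner euclidean_inner[of "grad f x" "grad f x"] by (simp add: pd_eq_grad power2_eq_square)
  then show ?thesis using p2[OF that] by (simp add: laplacian_def sum.distrib sum_distrib_left)
 qed
qed

lemma gderiv_sqdist: "GDERIV (\<lambda>x. (x - p) \<bullet> (x - p)) x :> 2 *\<^sub>R (x - p)"
 unfolding gderiv_def by (auto intro!: derivative_eq_intros simp: inner_commute)

lemma sqdist_C2:
 fixes p :: "'a::euclidean_space"
 shows "C2_on UNIV (\<lambda>x. (x - p) \<bullet> (x - p))" and "laplacian (\<lambda>x. (x - p) \<bullet> (x - p)) x = 2 * real DIM('a)"
  and "grad (\<lambda>x. (x - p) \<bullet> (x - p)) x = 2 *\<^sub>R (x - p)"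
  and "b \<in> Basis ==> pd b (\<lambda>x. (x - p) \<bullet> (x - p)) = (\<lambda>x. 2 * (x \<bullet> b - p \<bullet> b))"
proof -
 show "grad (\<lambda>x. (x - p) \<bullet> (x - p)) x = 2 *\<^sub>R (x - p)" by (rule gderiv_grad[OF gderiv_sqdist])
 have p: "pd b (\<lambda>x. (x - p) \<bullet> (x - p)) = (\<lambda>x. 2 * (x \<bullet> b - p \<bullet> b))" for b
  using gderiv_pd[OF gderiv_sqdist[of p]] by (auto simp: fun_eq_iff inner_diff_left)
 then show "pd b (\<lambda>x. (x - p) \<bullet> (x - p)) = (\<lambda>x. 2 * (x \<bullet> b - p \<bullet> b))" by blast
 have g2: "GDERIV (\<lambda>x. 2 * (x \<bullet> b - p \<bullet> b)) x :> 2 *\<^sub>R b" for b x :: 'a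
  unfolding gderiv_def by (auto intro!: derivative_eq_intros)
 show "C2_on UNIV (\<lambda>x. (x - p) \<bullet> (x - p))"
  unfolding C2_on_iff[OF open_UNIV] p
 proof (intro conjI ballI)
  show "C1_on UNIV (\<lambda>x. (x - p) \<bullet> (x - p))" by (rule C1_onI[OF gderiv_sqdist]) (intro continuous_intros)
  show "C1_on UNIV (\<lambda>x. 2 * (x \<bullet> b - p \<bullet> b))" for b by (rule C1_onI[OF g2]) (intro continuous_intros)
 qed
 show "laplacian (\<lambda>x. (x - p) \<bullet> (x - p)) x = 2 * real DIM('a)"
  unfolding laplacian_def p using gderiv_pd[OF g2] by simp
qed

section \<open>Steiner symmetrization and the isodiametric inequality\<close>

lemma nn_integral_basis_split:
 fixes f :: "'a::euclidean_space \<Rightarrow> ennreal"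
 assumes b: "b \<in> Basis" and f: "f \<in> borel_measurable borel"
 shows "(\<integral>\<^sup>+x. f x \<partial>lborel) =
  (\<integral>\<^sup>+g. (\<integral>\<^sup>+t. f ((\<Sum>i\<in>Basis - {b}. g i *\<^sub>R i) + t *\<^sub>R b) \<partial>lborel) \<partial>(\<Pi>\<^sub>M i\<in>Basis - {b}. (lborel :: real measure)))"
proof -
 interpret P: product_sigma_finite "\<lambda>_::'a. lborel :: real measure" by standard
 have B: "insert b (Basis - {b}) = (Basis :: 'a set)" by (rule insert_Diff[OF b])
 have e: "(\<Sum>i\<in>Basis. (g(b := t)) i *\<^sub>R i) = (\<Sum>i\<in>Basis - {b}. g i *\<^sub>R i) + t *\<^sub>R b" for g :: "'a \<Rightarrow> real" and t
 proof -
  have "(\<Sum>i\<in>Basis. (g(b := t)) i *\<^sub>R i) = (g(b := t)) b *\<^sub>R b + (\<Sum>i\<in>Basis - {b}. (g(b := t)) i *\<^sub>R i)"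
   by (rule sum.remove[OF finite_Basis b])
  also have "(\<Sum>i\<in>Basis - {b}. (g(b := t)) i *\<^sub>R i) = (\<Sum>i\<in>Basis - {b}. g i *\<^sub>R i)"
   by (intro sum.cong) auto
  finally show ?thesis by (simp add: add.commute)
 qed
 have "(\<integral>\<^sup>+x. f x \<partial>lborel) = (\<integral>\<^sup>+g. f (\<Sum>i\<in>Basis. g i *\<^sub>R i) \<partial>(\<Pi>\<^sub>M i\<in>Basis. (lborel :: real measure)))"
  by (subst lborel_eq) (use f in \<open>simp add: nn_integral_distr\<close>)
 also have "\<dots> = (\<integral>\<^sup>+g. f (\<Sum>i\<in>Basis. g i *\<^sub>R i) \<partial>(\<Pi>\<^sub>M i\<in>insert b (Basis - {b}). (lborel :: real measure)))"
  by (simp only: B)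
 also have "\<dots> = (\<integral>\<^sup>+g. (\<integral>\<^sup>+t. f (\<Sum>i\<in>Basis. (g(b := t)) i *\<^sub>R i) \<partial>lborel) \<partial>(\<Pi>\<^sub>M i\<in>Basis - {b}. (lborel :: real measure)))"
  by (rule P.product_nn_integral_insert) (use f B in auto)
 finally show ?thesis unfolding e .
qed

lemma emeasure_basis_split:
 fixes A :: "'a::euclidean_space set"
 assumes b: "b \<in> Basis" and A: "A \<in> sets borel"
 shows "emeasure lborel A =
  (\<integral>\<^sup>+g. emeasure lborel {t. (\<Sum>i\<in>Basis - {b}. g i *\<^sub>R i) + t *\<^sub>R b \<in> A} \<partial>(\<Pi>\<^sub>M i\<in>Basis - {b}. (lborel :: real measure)))"
proof -
 have e: "(\<integral>\<^sup>+t. indicator A (y + t *\<^sub>R b) \<partial>lborel) = emeasure lborel {t. y + t *\<^sub>R b \<in> A}" for y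
 proof -
  have m: "{t. y + t *\<^sub>R b \<in> A} \<in> sets lborel"
  proof -
   have "(\<lambda>t. y + t *\<^sub>R b) \<in> borel_measurable borel" by (intro borel_measurable_continuous_onI continuous_intros)
   then have "(\<lambda>t. y + t *\<^sub>R b) -` A \<inter> space borel \<in> sets borel" using A by (rule measurable_sets)
   then show ?thesis by (simp add: vimage_def)
  qed
  have "(\<integral>\<^sup>+t. indicator A (y + t *\<^sub>R b) \<partial>lborel) = (\<integral>\<^sup>+t. indicator {t. y + t *\<^sub>R b \<in> A} t \<partial>lborel)"
   by (intro nn_integral_cong) (auto simp: indicator_def)
  then show ?thesis using m by simp
 qed
 have "emeasure lborel A = (\<integral>\<^sup>+x. indicator A x \<partial>lborel)" using A by simp
 also have "\<dots> = (\<integral>\<^sup>+g. (\<integral>\<^sup>+t. indicator A ((\<Sum>i\<in>Basis - {b}. g i *\<^sub>R i) + t *\<^sub>R b) \<partial>lborel) \<partial>(\<Pi>\<^sub>M i\<in>Basis - {b}. (lborel :: real measure)))"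
  by (rule nn_integral_basis_split[OF b]) (use A in simp)
 finally show ?thesis unfolding e .
qed

text \<open>Squeezing: with p and q the infimum and supremum of \<open>I'\<close>, every point of I
  lies in [q - D, p + D], and the lengths p + D - (q - D) and q - p add up to 2 D. Applied to two
  parallel sections, this controls their symmetrized heights.\<close>

lemma emeasure_two_sets_within:
 fixes I I' :: "real set"
 assumes "I \<noteq> {}" "I' \<noteq> {}" "\<And>s s'. s \<in> I ==> s' \<in> I' ==> \<bar>s - s'\<bar> \<le> D"
 shows "emeasure lborel I + emeasure lborel I' \<le> ennreal (2 * D)"
proof -
 obtain s0 s0' where s0: "s0 \<in> I" "s0' \<in> I'" using assms by blast
 have bd: "bdd_above I'" "bdd_below I'"
  using assms(3)[OF s0(1)] by (auto intro!: bdd_aboveI[of _ "s0 + D"] bdd_belowI[of _ "s0 - D"] simp: abs_le_iff algebra_simps)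
 define p q where "p = Inf I'" and "q = Sup I'"
 have pq: "p \<le> q" unfolding p_def q_def using bd assms(2) cInf_le_cSup by blast
 have I': "I' \<subseteq> {p..q}" using bd by (auto simp: p_def q_def intro: cInf_lower cSup_upper)
 have I: "I \<subseteq> {q - D..p + D}"
 proof
  fix s assume s: "s \<in> I"
  have "q \<le> s + D" unfolding q_def by (rule cSup_least[OF assms(2)]) (use assms(3)[OF s] in \<open>auto simp: abs_le_iff algebra_simps\<close>)
  moreover have "s - D \<le> p" unfolding p_def by (rule cInf_greatest[OF assms(2)]) (use assms(3)[OF s] in \<open>auto simp: abs_le_iff algebra_simps\<close>)
  ultimately show "s \<in> {q - D..p + D}" by auto
 qed
 then have le: "q - D \<le> p + D" using assms(1) by fastforce
 have "emeasure lborel I \<le> emeasure lborel {q - D..p + D}" using I by (intro emeasure_mono) auto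
 moreover have "emeasure lborel I' \<le> emeasure lborel {p..q}" using I' by (intro emeasure_mono) auto
 ultimately have "emeasure lborel I + emeasure lborel I' \<le> ennreal (p + D - (q - D)) + ennreal (q - p)"
  using le pq by (intro add_mono) auto
 also have "\<dots> = ennreal (2 * D)" using le pq by (subst ennreal_plus[symmetric]) auto
 finally show ?thesis .
qed

definition section_len :: "'a::euclidean_space \<Rightarrow> 'a set \<Rightarrow> 'a \<Rightarrow> ennreal" where
 "section_len b A x = emeasure lborel {t. x - (x \<bullet> b) *\<^sub>R b + t *\<^sub>R b \<in> A}"

text \<open>Each line in direction b keeps the length of its section but has it centred at height 0.
  The condition \<open>section_len b A x > 0\<close> drops lines with a null section, which would
  otherwise keep their midpoint although A may not meet them at all.\<close>

definition steiner :: "'a::euclidean_space \<Rightarrow> 'a set \<Rightarrow> 'a set" where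
 "steiner b A = {x. section_len b A x > 0 \<and> ennreal (2 * \<bar>x \<bullet> b\<bar>) \<le> section_len b A x}"

lemma measurable_section_len:
 assumes A: "A \<in> sets borel"
 shows "section_len b A \<in> borel_measurable borel"
proof -
 have m: "(\<lambda>z. fst z - (fst z \<bullet> b) *\<^sub>R b + snd z *\<^sub>R b) \<in> borel_measurable (borel \<Otimes>\<^sub>M lborel)"
  by (simp add: measurable_cong_sets[OF sets_pair_measure_cong[OF refl sets_lborel] refl])
 have "{z. fst z - (fst z \<bullet> b) *\<^sub>R b + snd z *\<^sub>R b \<in> A} \<in> sets (borel \<Otimes>\<^sub>M lborel)"
  using measurable_sets[OF m A] by (simp add: vimage_def space_pair_measure)
 from lborel.measurable_emeasure_Pair[OF this] show ?thesis
  by (simp add: section_len_def[abs_def] vimage_def)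
qed

lemma borel_steiner:
 assumes A: "A \<in> sets borel"
 shows "steiner b A \<in> sets borel"
proof -
 have "section_len b A \<in> borel_measurable borel" by (rule measurable_section_len[OF A])
 then show ?thesis unfolding steiner_def by measurable
qed

lemma section_len_shift:
 assumes b: "b \<in> Basis"
 shows "section_len b A ((\<Sum>i\<in>Basis - {b}. g i *\<^sub>R i) + t *\<^sub>R b) = emeasure lborel {t. (\<Sum>i\<in>Basis - {b}. g i *\<^sub>R i) + t *\<^sub>R b \<in> A}"
  and "((\<Sum>i\<in>Basis - {b}. g i *\<^sub>R i) + t *\<^sub>R b) \<bullet> b = t"
proof -
 have "(\<Sum>i\<in>Basis - {b}. g i *\<^sub>R i) \<bullet> b = 0"
  using b by (auto simp: inner_sum_left inner_Basis intro!: sum.neutral)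
 then show "((\<Sum>i\<in>Basis - {b}. g i *\<^sub>R i) + t *\<^sub>R b) \<bullet> b = t" using b by (simp add: inner_add_left)
 then show "section_len b A ((\<Sum>i\<in>Basis - {b}. g i *\<^sub>R i) + t *\<^sub>R b) = emeasure lborel {t. (\<Sum>i\<in>Basis - {b}. g i *\<^sub>R i) + t *\<^sub>R b \<in> A}"
  unfolding section_len_def by simp
qed

lemma emeasure_centered_interval:
 assumes "l < top"
 shows "emeasure lborel {t::real. l > 0 \<and> ennreal (2 * \<bar>t\<bar>) \<le> l} = l"
proof (cases "l > 0")
 case True
 obtain r where r: "l = ennreal r" "r > 0" using True assms by (cases l) (auto simp: top_unique)
 have "{t::real. l > 0 \<and> ennreal (2 * \<bar>t\<bar>) \<le> l} = {- r / 2..r / 2}"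
  using r by (auto simp: ennreal_le_iff abs_le_iff)
 then show ?thesis using r by simp
qed auto

text \<open>For a unit vector n, the orthogonal projection to the hyperplane normal to n. Diameters
  are measured after this projection, so that the isodiametric inequality in dimension N - 1 can be
  proved for slabs of cylinders inside the N-dimensional space.\<close>

definition perp :: "'a::euclidean_space \<Rightarrow> 'a \<Rightarrow> 'a" where
 "perp n x = x - (x \<bullet> n) *\<^sub>R n"

lemma norm_perp_split:
 assumes b: "b \<in> Basis" "n \<in> Basis" "b \<noteq> n"
 shows "(norm (perp n x))\<^sup>2 = (x \<bullet> b)\<^sup>2 + (norm (perp n (perp b x)))\<^sup>2"
proof -
 have o: "b \<bullet> n = 0" "n \<bullet> b = 0" "b \<bullet> b = 1" "n \<bullet> n = 1" using b by (auto simp: inner_Basis)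
 show ?thesis
  unfolding power2_norm_eq_inner perp_def
  by (simp add: inner_diff_left inner_diff_right o inner_commute power2_eq_square algebra_simps)
qed

lemma perp_diff: "perp n (x - y) = perp n x - perp n y"
 by (simp add: perp_def inner_diff_left algebra_simps)

text \<open>By Pythagoras, the squared projected distance of points on two lines is the squared
  height difference plus a part R fixed by the lines. All height differences in A are thus at most
  sqrt(d^2 - R), so the two section lengths add up to at most twice that, and centred points have
  heights at most half their section lengths.\<close>

lemma steiner_perp:
 assumes b: "b \<in> Basis" "n \<in> Basis" "b \<noteq> n" and d: "d \<ge> 0"
  and Q: "\<And>x y. x \<in> A ==> y \<in> A ==> norm (perp n (x - y)) \<le> d"
  and x: "x \<in> steiner b A" and y: "y \<in> steiner b A"
 shows "norm (perp n (x - y)) \<le> d" "section_len b A x \<le> ennreal (2 * d)"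
proof -
 define I where "I z = {t. z - (z \<bullet> b) *\<^sub>R b + t *\<^sub>R b \<in> A}" for z
 have sl: "section_len b A z = emeasure lborel (I z)" for z by (simp add: section_len_def I_def)
 have ne: "I z \<noteq> {}" if "z \<in> steiner b A" for z using that by (auto simp: steiner_def sl)
 define R where "R z z' = (norm (perp n (perp b (z - z'))))\<^sup>2" for z z'
 have bb: "b \<bullet> b = 1" using b by simp
 have sq: "(s - s')\<^sup>2 + R z z' \<le> d\<^sup>2" if s: "s \<in> I z" "s' \<in> I z'" for s s' z z'
 proof -
  define u where "u = (z - (z \<bullet> b) *\<^sub>R b + s *\<^sub>R b) - (z' - (z' \<bullet> b) *\<^sub>R b + s' *\<^sub>R b)"
  have "norm (perp n u) \<le> d" unfolding u_def using s by (intro Q) (auto simp: I_def)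
  then have "(norm (perp n u))\<^sup>2 \<le> d\<^sup>2" by (intro power_mono) auto
  moreover have "u \<bullet> b = s - s'" unfolding u_def by (simp add: inner_diff_left inner_add_left bb)
  moreover have "perp b u = perp b (z - z')" unfolding u_def perp_def by (simp add: inner_diff_left inner_add_left bb algebra_simps)
  ultimately show ?thesis using norm_perp_split[OF b, of u] by (simp add: R_def)
 qed
 have R: "R z z' \<le> d\<^sup>2" if "z \<in> steiner b A" "z' \<in> steiner b A" for z z'
  using sq ne[OF that(1)] ne[OF that(2)] by (smt (verit) ex_in_conv zero_le_power2)
 have D: "section_len b A z + section_len b A z' \<le> ennreal (2 * sqrt (d\<^sup>2 - R z z'))" if z: "z \<in> steiner b A" "z' \<in> steiner b A" for z z'
  unfolding sl
 proof (rule emeasure_two_sets_within[OF ne[OF z(1)] ne[OF z(2)]])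
  fix s s' assume "s \<in> I z" "s' \<in> I z'"
  then have "(s - s')\<^sup>2 \<le> d\<^sup>2 - R z z'" using sq by (simp add: algebra_simps)
  then show "\<bar>s - s'\<bar> \<le> sqrt (d\<^sup>2 - R z z')" using real_le_rsqrt[of "\<bar>s - s'\<bar>"] by simp
 qed
 have "section_len b A x + section_len b A x \<le> ennreal (2 * sqrt (d\<^sup>2 - R x x))" by (rule D[OF x x])
 also have "\<dots> \<le> ennreal (2 * d)"
  using d by (intro ennreal_leI) (auto simp: R_def intro!: real_le_lsqrt)
 finally show "section_len b A x \<le> ennreal (2 * d)" by (metis add.right_neutral add_left_mono order_trans zero_le)
 have "ennreal (2 * \<bar>x \<bullet> b\<bar>) + ennreal (2 * \<bar>y \<bullet> b\<bar>) \<le> section_len b A x + section_len b A y"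
  using x y by (intro add_mono) (auto simp: steiner_def)
 also have "\<dots> \<le> ennreal (2 * sqrt (d\<^sup>2 - R x y))" by (rule D[OF x y])
 finally have "ennreal (2 * \<bar>x \<bullet> b\<bar> + 2 * \<bar>y \<bullet> b\<bar>) \<le> ennreal (2 * sqrt (d\<^sup>2 - R x y))" by (simp add: ennreal_plus)
 then have "2 * \<bar>x \<bullet> b\<bar> + 2 * \<bar>y \<bullet> b\<bar> \<le> 2 * sqrt (d\<^sup>2 - R x y)"
  using R[OF x y] by (subst (asm) ennreal_le_iff) auto
 then have "\<bar>(x - y) \<bullet> b\<bar> \<le> sqrt (d\<^sup>2 - R x y)" by (simp add: inner_diff_left)
 then have "((x - y) \<bullet> b)\<^sup>2 \<le> d\<^sup>2 - R x y" using R[OF x y] by (metis abs_ge_zero diff_ge_0_iff_ge power2_abs power_mono real_sqrt_pow2)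
 then have "(norm (perp n (x - y)))\<^sup>2 \<le> d\<^sup>2" using norm_perp_split[OF b, of "x - y"] by (simp add: R_def)
 then show "norm (perp n (x - y)) \<le> d" using d by (rule power2_le_imp_le)
qed

definition refl_sym :: "'a::euclidean_space \<Rightarrow> 'a set \<Rightarrow> bool" where
 "refl_sym c A \<longleftrightarrow> (\<forall>x\<in>A. x - (2 * (x \<bullet> c)) *\<^sub>R c \<in> A)"

lemma steiner_refl_sym_same:
 assumes b: "b \<in> Basis"
 shows "refl_sym b (steiner b A)"
proof -
 have "section_len b A (x - (2 * (x \<bullet> b)) *\<^sub>R b) = section_len b A x" for x
 proof -
  have "(2 * (x \<bullet> b)) *\<^sub>R b = (x \<bullet> b) *\<^sub>R b + (x \<bullet> b) *\<^sub>R b" by (metis mult_2 scaleR_add_left)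
  moreover have "(x - (2 * (x \<bullet> b)) *\<^sub>R b) \<bullet> b = - (x \<bullet> b)" using b by (simp add: inner_diff_left)
  ultimately have "x - (2 * (x \<bullet> b)) *\<^sub>R b - ((x - (2 * (x \<bullet> b)) *\<^sub>R b) \<bullet> b) *\<^sub>R b = x - (x \<bullet> b) *\<^sub>R b" by simp
  then show ?thesis unfolding section_len_def by (simp only:)
 qed
 then show ?thesis using b by (simp add: refl_sym_def steiner_def inner_diff_left)
qed

text \<open>Reflection in a coordinate orthogonal to b permutes the lines in direction b and
  preserves section lengths, so symmetrizing in b does not destroy the symmetries gained
  before.\<close>

lemma steiner_refl_sym:
 assumes b: "b \<in> Basis" and c: "c \<in> Basis" "c \<noteq> b" and A: "refl_sym c A"
 shows "refl_sym c (steiner b A)"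
proof -
 have o: "b \<bullet> c = 0" "c \<bullet> b = 0" "c \<bullet> c = 1" using b c by (auto simp: inner_Basis)
 define R where "R x = x - (2 * (x \<bullet> c)) *\<^sub>R c" for x
 have RR: "R (R x) = x" for x by (simp add: R_def inner_diff_left o algebra_simps)
 have RA: "R x \<in> A \<longleftrightarrow> x \<in> A" for x using A RR unfolding refl_sym_def R_def[symmetric] by metis
 have "section_len b A (R x) = section_len b A x" for x
 proof -
  have "R x - (R x \<bullet> b) *\<^sub>R b + t *\<^sub>R b = R (x - (x \<bullet> b) *\<^sub>R b + t *\<^sub>R b)" for t
   by (simp add: R_def inner_diff_left inner_add_left o algebra_simps)
  then show ?thesis unfolding section_len_def by (simp add: RA)
 qed
 moreover have "R x \<bullet> b = x \<bullet> b" for x by (simp add: R_def inner_diff_left o)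
 ultimately show ?thesis by (simp add: refl_sym_def steiner_def R_def[symmetric])
qed

lemma emeasure_steiner:
 assumes b: "b \<in> Basis" "n \<in> Basis" "b \<noteq> n" and d: "d \<ge> 0" and A: "A \<in> sets borel"
  and Q: "\<And>x y. x \<in> A ==> y \<in> A ==> norm (perp n (x - y)) \<le> d"
 shows "emeasure lborel (steiner b A) = emeasure lborel A"
 unfolding emeasure_basis_split[OF b(1) A] emeasure_basis_split[OF b(1) borel_steiner[OF A]]
proof (rule nn_integral_cong)
 fix g :: "'a \<Rightarrow> real"
 let ?y = "\<Sum>i\<in>Basis - {b}. g i *\<^sub>R i"
 define l where "l = emeasure lborel {t. ?y + t *\<^sub>R b \<in> A}"
 have e: "{t. ?y + t *\<^sub>R b \<in> steiner b A} = {t. l > 0 \<and> ennreal (2 * \<bar>t\<bar>) \<le> l}"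
  unfolding steiner_def l_def by (simp add: section_len_shift[OF b(1)])
 have "l < top"
 proof (cases "l > 0")
  case True
  then have "0 \<in> {t. ?y + t *\<^sub>R b \<in> steiner b A}" unfolding e by simp
  then have "?y + 0 *\<^sub>R b \<in> steiner b A" by blast
  from steiner_perp(2)[OF b d Q this this] have "l \<le> ennreal (2 * d)"
   using section_len_shift(1)[OF b(1), of A g 0] by (simp add: l_def)
  then show ?thesis using le_less_trans ennreal_less_top by blast
 qed (simp add: not_gr_zero)
 then show "emeasure lborel {t. ?y + t *\<^sub>R b \<in> steiner b A} = emeasure lborel {t. ?y + t *\<^sub>R b \<in> A}"
  unfolding e by (simp add: emeasure_centered_interval l_def)
qed

lemma steiner_slab:
 assumes b: "b \<in> Basis" "n \<in> Basis" "b \<noteq> n" and A: "\<And>x. x \<in> A ==> p \<le> x \<bullet> n \<and> x \<bullet> n < q" and x: "x \<in> steiner b A"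
 shows "p \<le> x \<bullet> n \<and> x \<bullet> n < q"
proof -
 have "section_len b A x \<noteq> emeasure lborel {}" using x by (auto simp: steiner_def)
 then have "{t. x - (x \<bullet> b) *\<^sub>R b + t *\<^sub>R b \<in> A} \<noteq> {}" unfolding section_len_def by metis
 then obtain t where "x - (x \<bullet> b) *\<^sub>R b + t *\<^sub>R b \<in> A" by auto
 moreover have "(x - (x \<bullet> b) *\<^sub>R b + t *\<^sub>R b) \<bullet> n = x \<bullet> n" using b by (simp add: inner_diff_left inner_add_left inner_Basis)
 ultimately show ?thesis using A by metis
qed

lemma steiner_iterate:
 assumes n: "n \<in> Basis" and d: "d \<ge> 0" and A: "A \<in> sets borel"
  and Q: "\<And>x y. x \<in> A ==> y \<in> A ==> norm (perp n (x - y)) \<le> d"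
  and sl: "\<And>x. x \<in> A ==> p \<le> x \<bullet> n \<and> x \<bullet> n < q"
  and S: "finite S" "S \<subseteq> Basis - {n}"
 shows "\<exists>A'. A' \<in> sets borel \<and> emeasure lborel A' = emeasure lborel A \<and> (\<forall>x\<in>A'. \<forall>y\<in>A'. norm (perp n (x - y)) \<le> d)
  \<and> (\<forall>x\<in>A'. p \<le> x \<bullet> n \<and> x \<bullet> n < q) \<and> (\<forall>c\<in>S. refl_sym c A')"
 using S
proof (induction S)
 case empty
 then show ?case using A Q sl by (intro exI[of _ A]) auto
next
 case (insert b S)
 then obtain A' where A': "A' \<in> sets borel" "emeasure lborel A' = emeasure lborel A" "\<And>x y. x\<in>A' ==> y\<in>A' ==> norm (perp n (x - y)) \<le> d"
  "\<And>x. x\<in>A' ==> p \<le> x \<bullet> n \<and> x \<bullet> n < q" "\<And>c. c\<in>S ==> refl_sym c A'" by auto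
 have b: "b \<in> Basis" "b \<noteq> n" using insert by auto
 show ?case
 proof (intro exI[of _ "steiner b A'"] conjI ballI)
  show "steiner b A' \<in> sets borel" by (rule borel_steiner[OF A'(1)])
  show "emeasure lborel (steiner b A') = emeasure lborel A" using emeasure_steiner[OF b(1) n b(2) d A'(1,3)] A'(2) by simp
  show "norm (perp n (x - y)) \<le> d" if "x \<in> steiner b A'" "y \<in> steiner b A'" for x y
   by (rule steiner_perp(1)[OF b(1) n b(2) d A'(3) that])
  show "p \<le> x \<bullet> n" "x \<bullet> n < q" if "x \<in> steiner b A'" for x
   using steiner_slab[OF b(1) n b(2) A'(4) that] by auto
  show "refl_sym c (steiner b A')" if c: "c \<in> insert b S" for c
  proof (cases "c = b")
   case True then show ?thesis using steiner_refl_sym_same[OF b(1)] by simp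
  next
   case False
   then show ?thesis using c insert by (intro steiner_refl_sym[OF b(1)] A'(5)) auto
  qed
 qed
qed

text \<open>After symmetrization in all basis directions but n, each x comes with its mirror image
  \<open>x - 2 *\<^sub>R perp n x\<close> in the axis. Their projected distance is twice the norm of
  \<open>perp n x\<close>, so the set sits in a cylinder of radius d / 2, whose volume is
  explicit.\<close>

lemma isodiametric_cylinder_basis:
 fixes A :: "'a::euclidean_space set"
 assumes n: "n \<in> Basis" and d: "d > 0" and A: "A \<in> sets borel"
  and Q: "\<And>x y. x \<in> A ==> y \<in> A ==> norm (perp n (x - y)) \<le> d"
  and sl: "\<And>x. x \<in> A ==> p \<le> x \<bullet> n \<and> x \<bullet> n < q" and pq: "p \<le> q"
 shows "emeasure lborel A \<le> ennreal (unit_ball_vol (real (DIM('a) - 1)) * (d / 2) ^ (DIM('a) - 1) * (q - p))"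
proof -
 define B where "B = (Basis - {n} :: 'a set)"
 have "d \<ge> 0" "finite B" "B \<subseteq> Basis - {n}" using d by (auto simp: B_def)
 from steiner_iterate[OF n this(1) A Q sl this(2,3)]
 obtain A' where A': "A' \<in> sets borel" "emeasure lborel A' = emeasure lborel A" "\<And>x y. x\<in>A' ==> y\<in>A' ==> norm (perp n (x - y)) \<le> d"
  "\<And>x. x\<in>A' ==> p \<le> x \<bullet> n \<and> x \<bullet> n < q" "\<And>c. c\<in>B ==> refl_sym c A'"
  by (metis (no_types, lifting))
 have refl_in: "S \<subseteq> B ==> x \<in> A' ==> x - 2 *\<^sub>R (\<Sum>c\<in>S. (x \<bullet> c) *\<^sub>R c) \<in> A'" if "finite S" for S x
  using that
 proof (induction S)
  case (insert c S)
  let ?z = "x - 2 *\<^sub>R (\<Sum>c\<in>S. (x \<bullet> c) *\<^sub>R c)"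
  have "?z \<in> A'" using insert by auto
  then have "?z - (2 * (?z \<bullet> c)) *\<^sub>R c \<in> A'" using A'(5)[of c] insert by (simp add: refl_sym_def)
  moreover have "?z \<bullet> c = x \<bullet> c"
  proof -
   have "(\<Sum>c'\<in>S. (x \<bullet> c') *\<^sub>R c') \<bullet> c = 0"
    unfolding inner_sum_left
   proof (rule sum.neutral, rule ballI)
    fix c' assume "c' \<in> S"
    then have "c' \<bullet> c = 0" using insert by (intro inner_not_same_Basis) (auto simp: B_def)
    then show "(x \<bullet> c') *\<^sub>R c' \<bullet> c = 0" by simp
   qed
   then show ?thesis by (simp add: inner_diff_left)
  qed
  ultimately show ?case using insert by (simp add: algebra_simps)
 qed simp
 define Z where "Z = {x::'a. norm (perp n x) \<le> d / 2 \<and> p \<le> x \<bullet> n \<and> x \<bullet> n < q}"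
 have sub: "A' \<subseteq> Z"
 proof
  fix x assume x: "x \<in> A'"
  have s: "(\<Sum>c\<in>B. (x \<bullet> c) *\<^sub>R c) = perp n x"
  proof -
   have "x = (x \<bullet> n) *\<^sub>R n + (\<Sum>c\<in>B. (x \<bullet> c) *\<^sub>R c)"
    unfolding B_def using sum.remove[OF finite_Basis n, of "\<lambda>c. (x \<bullet> c) *\<^sub>R c"] by (simp add: euclidean_representation)
   then show ?thesis by (simp add: perp_def algebra_simps)
  qed
  have "x - 2 *\<^sub>R perp n x \<in> A'" using refl_in[of B x] x s by (simp add: B_def)
  from A'(3)[OF x this] have "norm (perp n (2 *\<^sub>R perp n x)) \<le> d" by simp
  moreover have "perp n (2 *\<^sub>R perp n x) = 2 *\<^sub>R perp n x" using n by (simp add: perp_def inner_diff_left algebra_simps)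
  ultimately show "x \<in> Z" using A'(4)[OF x] by (simp add: Z_def)
 qed
 have Zb: "Z \<in> sets borel" unfolding Z_def perp_def by measurable
 have "emeasure lborel A \<le> emeasure lborel Z" using A'(2) emeasure_mono[OF sub, of lborel] Zb by simp
 also have "\<dots> = (\<integral>\<^sup>+g. emeasure lborel {t. (\<Sum>i\<in>B. g i *\<^sub>R i) + t *\<^sub>R n \<in> Z} \<partial>(\<Pi>\<^sub>M i\<in>B. (lborel :: real measure)))"
  unfolding B_def by (rule emeasure_basis_split[OF n Zb])
 also have "\<dots> = (\<integral>\<^sup>+g. ennreal (q - p) * indicator ({f. sqrt (\<Sum>i\<in>B. (f i)\<^sup>2) \<le> d / 2} \<inter> space (\<Pi>\<^sub>M i\<in>B. (lborel :: real measure))) g \<partial>(\<Pi>\<^sub>M i\<in>B. (lborel :: real measure)))"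
 proof (rule nn_integral_cong)
  fix g :: "'a \<Rightarrow> real" assume g: "g \<in> space (\<Pi>\<^sub>M i\<in>B. (lborel :: real measure))"
  let ?y = "\<Sum>i\<in>B. g i *\<^sub>R i"
  have i: "(?y + t *\<^sub>R n) \<bullet> n = t" for t unfolding B_def by (rule section_len_shift(2)[OF n])
  then have pp: "perp n (?y + t *\<^sub>R n) = ?y" for t by (simp add: perp_def)
  have "norm ?y = sqrt (\<Sum>i\<in>B. (g i)\<^sup>2)"
  proof -
   have yi: "?y \<bullet> i = g i" if "i \<in> B" for i
   proof -
    have "?y \<bullet> i = (\<Sum>j\<in>B. if j = i then g i else 0)"
     unfolding inner_sum_left by (intro sum.cong refl) (use that in \<open>auto simp: B_def inner_Basis\<close>)
    then show ?thesis using that by (simp add: B_def)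
   qed
   have "?y \<bullet> ?y = (\<Sum>i\<in>B. g i * (?y \<bullet> i))" by (subst inner_sum_right) simp
   also have "\<dots> = (\<Sum>i\<in>B. (g i)\<^sup>2)" by (intro sum.cong refl) (simp add: yi power2_eq_square)
   finally have "?y \<bullet> ?y = (\<Sum>i\<in>B. (g i)\<^sup>2)" .
   then show ?thesis by (simp add: norm_eq_sqrt_inner)
  qed
  then have "{t. ?y + t *\<^sub>R n \<in> Z} = (if sqrt (\<Sum>i\<in>B. (g i)\<^sup>2) \<le> d / 2 then {p..<q} else {})"
   by (auto simp: Z_def i pp)
  then show "emeasure lborel {t. ?y + t *\<^sub>R n \<in> Z} = ennreal (q - p) * indicator ({f. sqrt (\<Sum>i\<in>B. (f i)\<^sup>2) \<le> d / 2} \<inter> space (\<Pi>\<^sub>M i\<in>B. (lborel :: real measure))) g"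
   using g pq by (simp add: indicator_def)
 qed
 also have "\<dots> = ennreal (q - p) * emeasure (\<Pi>\<^sub>M i\<in>B. (lborel :: real measure)) ({f. sqrt (\<Sum>i\<in>B. (f i)\<^sup>2) \<le> d / 2} \<inter> space (\<Pi>\<^sub>M i\<in>B. (lborel :: real measure)))"
 proof (rule nn_integral_cmult_indicator)
  have c: "(\<lambda>f. f i) \<in> borel_measurable (\<Pi>\<^sub>M i\<in>B. (lborel :: real measure))" if "i \<in> B" for i
   using measurable_component_singleton[OF that, of "\<lambda>_. lborel :: real measure"] by simp
  have "(\<lambda>f. \<Sum>i\<in>B. (f i)\<^sup>2) \<in> borel_measurable (\<Pi>\<^sub>M i\<in>B. (lborel :: real measure))"
   by (intro borel_measurable_sum borel_measurable_power c)
  then have "(\<lambda>f. sqrt (\<Sum>i\<in>B. (f i)\<^sup>2)) \<in> borel_measurable (\<Pi>\<^sub>M i\<in>B. (lborel :: real measure))"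
   by measurable
  then have "(\<lambda>f. sqrt (\<Sum>i\<in>B. (f i)\<^sup>2)) -` {..d/2} \<inter> space (\<Pi>\<^sub>M i\<in>B. (lborel :: real measure)) \<in> sets (\<Pi>\<^sub>M i\<in>B. (lborel :: real measure))"
   by (rule measurable_sets) simp
  then show "{f. sqrt (\<Sum>i\<in>B. (f i)\<^sup>2) \<le> d / 2} \<inter> space (\<Pi>\<^sub>M i\<in>B. (lborel :: real measure)) \<in> sets (\<Pi>\<^sub>M i\<in>B. (lborel :: real measure))"
   by (simp add: vimage_def)
 qed
 also have "\<dots> = ennreal (q - p) * ennreal (unit_ball_vol (real (card B)) * (d / 2) ^ card B)"
  using d by (subst emeasure_cball_aux) (auto simp: B_def)
 also have "card B = DIM('a) - 1" using n by (simp add: B_def)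
 finally show ?thesis using pq d by (simp add: ennreal_mult[symmetric] mult.commute)
qed

text \<open>Both measures are compared through the unit ball B: multiplied by the measure of B they
  equal the same double integral, because T maps B to itself and Lebesgue measure is translation
  invariant.\<close>

lemma emeasure_vimage_isometric_involution:
 fixes T :: "'a::euclidean_space \<Rightarrow> 'a"
 assumes T: "linear T" and iso: "\<And>x. norm (T x) = norm x" and inv: "\<And>x. T (T x) = x" and A[measurable]: "A \<in> sets borel"
 shows "emeasure lborel (T -` A) = emeasure lborel A"
proof -
 have Tm[measurable]: "T \<in> borel_measurable borel"
  using T by (intro borel_measurable_continuous_onI) (simp add: linear_continuous_on linear_conv_bounded_linear)
 have TA: "T -` A \<in> sets borel" using measurable_sets[OF Tm A] by simp
 have tr: "(\<integral>\<^sup>+x. f (c + x) \<partial>lborel) = (\<integral>\<^sup>+x. f x \<partial>lborel)" if "f \<in> borel_measurable borel" for f :: "'a \<Rightarrow> ennreal" and c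
  using that by (subst (2) lborel_distr_plus[of c, symmetric]) (simp add: nn_integral_distr)
 define B where "B = ball (0::'a) 1"
 have B[measurable]: "B \<in> sets borel" by (simp add: B_def)
 have "emeasure lborel (T -` A) * emeasure lborel B = (\<integral>\<^sup>+y. \<integral>\<^sup>+x. indicator A (T x + y) * indicator B y \<partial>lborel \<partial>lborel)"
 proof -
  have "(\<integral>\<^sup>+x. indicator A (T x + y) \<partial>lborel) = emeasure lborel (T -` A)" for y
  proof -
   have "(\<integral>\<^sup>+x. indicator A (T x + y) \<partial>lborel) = (\<integral>\<^sup>+x. indicator (T -` A) (T y + x) \<partial>lborel)"
    by (intro nn_integral_cong) (simp add: indicator_def linear_add[OF T] inv add.commute)
   also have "\<dots> = (\<integral>\<^sup>+x. indicator (T -` A) x \<partial>lborel)" by (rule tr) (use TA in simp)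
   finally show ?thesis using TA by simp
  qed
  then show ?thesis by (simp add: nn_integral_multc nn_integral_cmult)
 qed
 also have "\<dots> = (\<integral>\<^sup>+x. \<integral>\<^sup>+y. indicator A (T x + y) * indicator B y \<partial>lborel \<partial>lborel)"
  by (rule lborel_pair.Fubini') measurable
 also have "\<dots> = (\<integral>\<^sup>+x. \<integral>\<^sup>+y. indicator A y * indicator B (T y - x) \<partial>lborel \<partial>lborel)"
 proof (rule nn_integral_cong)
  fix x
  have "(\<integral>\<^sup>+y. indicator A (T x + y) * indicator B y \<partial>lborel) = (\<integral>\<^sup>+y. indicator A (T x + y) * indicator B (T (T x + y) - x) \<partial>lborel)"
   by (intro nn_integral_cong) (simp add: indicator_def B_def iso linear_add[OF T] inv)
  also have "\<dots> = (\<integral>\<^sup>+y. indicator A y * indicator B (T y - x) \<partial>lborel)" by (rule tr) measurable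
  finally show "(\<integral>\<^sup>+y. indicator A (T x + y) * indicator B y \<partial>lborel) = (\<integral>\<^sup>+y. indicator A y * indicator B (T y - x) \<partial>lborel)" .
 qed
 also have "\<dots> = (\<integral>\<^sup>+y. \<integral>\<^sup>+x. indicator A y * indicator B (T y - x) \<partial>lborel \<partial>lborel)"
  by (rule lborel_pair.Fubini'[symmetric]) measurable
 also have "\<dots> = (\<integral>\<^sup>+y. indicator A y * emeasure lborel B \<partial>lborel)"
 proof (rule nn_integral_cong)
  fix y
  have "(\<integral>\<^sup>+x. indicator B (T y - x) \<partial>lborel) = (\<integral>\<^sup>+x. indicator (ball (T y) 1) x \<partial>lborel)"
   by (intro nn_integral_cong) (simp add: indicator_def B_def dist_norm norm_minus_commute[of "T y"])
  then have "(\<integral>\<^sup>+x. indicator B (T y - x) \<partial>lborel) = emeasure lborel B" by (simp add: emeasure_ball B_def)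
  then show "(\<integral>\<^sup>+x. indicator A y * indicator B (T y - x) \<partial>lborel) = indicator A y * emeasure lborel B"
   by (simp add: nn_integral_cmult)
 qed
 also have "\<dots> = emeasure lborel A * emeasure lborel B" by (simp add: nn_integral_multc)
 finally have "emeasure lborel B * emeasure lborel (T -` A) = emeasure lborel B * emeasure lborel A" by (simp only: mult.commute)
 moreover have "emeasure lborel B \<noteq> 0" "emeasure lborel B \<noteq> top"
  using unit_ball_vol_pos[of "real DIM('a)"] by (auto simp: B_def emeasure_ball simp del: unit_ball_vol_pos)
 ultimately show ?thesis by (auto simp: ennreal_mult_cancel_left)
qed

lemma isodiametric_cylinder:
 fixes A :: "'a::euclidean_space set"
 assumes n: "norm n = 1" and d: "d > 0" and A: "A \<in> sets borel"
  and Q: "\<And>x y. x \<in> A ==> y \<in> A ==> norm (perp n (x - y)) \<le> d"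
  and sl: "\<And>x. x \<in> A ==> p \<le> x \<bullet> n \<and> x \<bullet> n < q" and pq: "p \<le> q"
 shows "emeasure lborel A \<le> ennreal (unit_ball_vol (real (DIM('a) - 1)) * (d / 2) ^ (DIM('a) - 1) * (q - p))"
proof -
 obtain b :: 'a where b: "b \<in> Basis" using nonempty_Basis by blast
 show ?thesis
 proof (cases "n = b")
  case True then show ?thesis using isodiametric_cylinder_basis[OF _ d A] Q sl pq b by auto
 next
  case False
  define v where "v = n - b"
  have v: "v \<bullet> v \<noteq> 0" using False by (simp add: v_def)
  have nn: "n \<bullet> n = 1" "b \<bullet> b = 1" using n b by (auto simp: dot_square_norm)
  \<comment> \<open>The Householder reflection exchanging the unit vectors n and b, which reduces to
    the case of a coordinate axis.\<close>
  define T where "T x = x - (2 * (x \<bullet> v) / (v \<bullet> v)) *\<^sub>R v" for x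
  have T: "linear T" unfolding T_def by (intro linearI) (auto simp: inner_add_left algebra_simps add_divide_distrib)
  have Tv: "T x \<bullet> v = - (x \<bullet> v)" for x using v by (simp add: T_def inner_diff_left)
  have inv: "T (T x) = x" for x unfolding T_def[of "T x"] Tv by (simp add: T_def)
  have TT: "T x \<bullet> T y = x \<bullet> y" for x y
   using v by (simp add: T_def inner_diff_left inner_diff_right inner_commute field_simps)
  have iso: "norm (T x) = norm x" for x using TT[of x x] by (simp add: norm_eq_sqrt_inner)
  have vv: "v \<bullet> v = 2 * (n \<bullet> v)" using nn by (simp add: v_def inner_diff_left inner_diff_right inner_commute)
  have Tn: "T n = b" using v vv by (simp add: T_def v_def[symmetric]) (simp add: v_def)
  then have Tb: "T b = n" using inv by metis
  have Tc: "continuous_on UNIV T" using T by (simp add: linear_continuous_on linear_conv_bounded_linear)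
  define A' where "A' = T -` A"
  have A': "A' \<in> sets borel" unfolding A'_def using measurable_sets[OF borel_measurable_continuous_onI[OF Tc] A] by simp
  have inn: "x \<bullet> b = T x \<bullet> n" for x using TT[of x b] Tb by simp
  have "T -` A' = A" by (auto simp: A'_def inv)
  then have "emeasure lborel A = emeasure lborel A'"
   using emeasure_vimage_isometric_involution[OF T iso inv A'] by simp
  also have "\<dots> \<le> ennreal (unit_ball_vol (real (DIM('a) - 1)) * (d / 2) ^ (DIM('a) - 1) * (q - p))"
  proof (rule isodiametric_cylinder_basis[OF b d A' _ _ pq])
   fix x y assume xy: "x \<in> A'" "y \<in> A'"
   have "T (perp b (x - y)) = perp n (T x - T y)"
    by (simp add: perp_def linear_diff[OF T] linear_scale[OF T] Tb inner_diff_left inn)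
   then have "norm (perp b (x - y)) = norm (perp n (T x - T y))" by (metis iso)
   then show "norm (perp b (x - y)) \<le> d" using Q xy by (simp add: A'_def)
  next
   fix x assume "x \<in> A'" then show "p \<le> x \<bullet> b \<and> x \<bullet> b < q" using sl unfolding inn by (simp add: A'_def)
  qed
  finally show ?thesis .
 qed
qed

section \<open>Defining functions\<close>

text \<open>Boundedness is included because Holder estimates multiply only for bounded
  factors.\<close>

definition holder :: "real \<Rightarrow> 'a::euclidean_space set \<Rightarrow> ('a \<Rightarrow> real) \<Rightarrow> bool" where
 "holder \<alpha> S g \<longleftrightarrow> (\<exists>L\<ge>0. \<forall>x\<in>S. \<forall>y\<in>S. \<bar>g x - g y\<bar> \<le> L * dist x y powr \<alpha>) \<and> (\<exists>M. \<forall>x\<in>S. \<bar>g x\<bar> \<le> M)"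

lemma holderE:
 assumes "holder \<alpha> S g"
 obtains L M where "L \<ge> 0" "\<And>x y. x \<in> S ==> y \<in> S ==> \<bar>g x - g y\<bar> \<le> L * dist x y powr \<alpha>" "\<And>x. x \<in> S ==> \<bar>g x\<bar> \<le> M"
 using assms unfolding holder_def by blast

lemma holder_add:
 assumes "holder \<alpha> S f" "holder \<alpha> S g"
 shows "holder \<alpha> S (\<lambda>x. f x + g x)"
proof -
 obtain L M where f: "L \<ge> 0" "\<And>x y. x \<in> S ==> y \<in> S ==> \<bar>f x - f y\<bar> \<le> L * dist x y powr \<alpha>" "\<And>x. x \<in> S ==> \<bar>f x\<bar> \<le> M"
  using holderE[OF assms(1)] by metis
 obtain L' M' where g: "L' \<ge> 0" "\<And>x y. x \<in> S ==> y \<in> S ==> \<bar>g x - g y\<bar> \<le> L' * dist x y powr \<alpha>" "\<And>x. x \<in> S ==> \<bar>g x\<bar> \<le> M'"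
  using holderE[OF assms(2)] by metis
 have "\<bar>f x + g x - (f y + g y)\<bar> \<le> (L + L') * dist x y powr \<alpha>" if "x \<in> S" "y \<in> S" for x y
  using f(2)[OF that] g(2)[OF that] by (simp add: distrib_right)
 moreover have "\<bar>f x + g x\<bar> \<le> M + M'" if "x \<in> S" for x using f(3)[OF that] g(3)[OF that] by simp
 ultimately show ?thesis unfolding holder_def using f(1) g(1) by (meson add_nonneg_nonneg)
qed

lemma holder_mult:
 assumes "holder \<alpha> S f" "holder \<alpha> S g"
 shows "holder \<alpha> S (\<lambda>x. f x * g x)"
proof -
 obtain L M where f: "L \<ge> 0" "\<And>x y. x \<in> S ==> y \<in> S ==> \<bar>f x - f y\<bar> \<le> L * dist x y powr \<alpha>" "\<And>x. x \<in> S ==> \<bar>f x\<bar> \<le> M"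
  using holderE[OF assms(1)] by metis
 obtain L' M' where g: "L' \<ge> 0" "\<And>x y. x \<in> S ==> y \<in> S ==> \<bar>g x - g y\<bar> \<le> L' * dist x y powr \<alpha>" "\<And>x. x \<in> S ==> \<bar>g x\<bar> \<le> M'"
  using holderE[OF assms(2)] by metis
 have "\<bar>f x * g x - f y * g y\<bar> \<le> (\<bar>M\<bar> * L' + \<bar>M'\<bar> * L) * dist x y powr \<alpha>" if "x \<in> S" "y \<in> S" for x y
 proof -
  have "f x * g x - f y * g y = f x * (g x - g y) + g y * (f x - f y)" by (simp add: algebra_simps)
  also have "\<bar>\<dots>\<bar> \<le> \<bar>f x\<bar> * \<bar>g x - g y\<bar> + \<bar>g y\<bar> * \<bar>f x - f y\<bar>" by (simp add: abs_mult[symmetric])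
  also have "\<dots> \<le> \<bar>M\<bar> * (L' * dist x y powr \<alpha>) + \<bar>M'\<bar> * (L * dist x y powr \<alpha>)"
   using f(2)[OF that] g(2)[OF that] f(3)[OF that(1)] g(3)[OF that(2)] f(1) g(1)
   by (intro add_mono mult_mono) auto
  finally show ?thesis by (simp add: algebra_simps)
 qed
 moreover have "\<bar>f x * g x\<bar> \<le> \<bar>M\<bar> * \<bar>M'\<bar>" if "x \<in> S" for x
  unfolding abs_mult using f(3)[OF that] g(3)[OF that] by (intro mult_mono) auto
 moreover have "0 \<le> \<bar>M\<bar> * L' + \<bar>M'\<bar> * L" using f(1) g(1) by simp
 ultimately show ?thesis unfolding holder_def by blast
qed

lemma C1_imp_holder:
 assumes W: "open W" and g: "C1_on W g" and sub: "cball p R \<subseteq> W" and a: "0 < \<alpha>" "\<alpha> < 1"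
 shows "holder \<alpha> (ball p R) g"
proof -
 obtain B where B: "B > 0" "\<And>z. z \<in> cball p R ==> norm (grad g z) \<le> B"
  using bounded_on_compact[OF C1_on_continuous_grad[OF g] compact_cball sub] by blast
 obtain M where M: "\<And>z. z \<in> cball p R ==> norm (g z) \<le> M"
  using bounded_on_compact[OF C1_on_continuous[OF g] compact_cball sub] by blast
 have "\<bar>g x - g y\<bar> \<le> (B * (2 * \<bar>R\<bar>) powr (1 - \<alpha>)) * dist x y powr \<alpha>" if "x \<in> ball p R" "y \<in> ball p R" for x y
 proof -
  have "\<bar>g x - g y\<bar> \<le> B * norm (x - y)"
   by (rule differentiable_bound_gderiv[OF convex_ball, of p R g "grad g"]) (use that B C1_onD[OF g] subsetD[OF sub] in auto)
  also have "norm (x - y) = dist x y powr (1 - \<alpha>) * dist x y powr \<alpha>"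
   by (cases "x = y") (auto simp: powr_add[symmetric] dist_norm)
  also have "B * (dist x y powr (1 - \<alpha>) * dist x y powr \<alpha>) \<le> B * ((2 * \<bar>R\<bar>) powr (1 - \<alpha>) * dist x y powr \<alpha>)"
  proof -
   have "dist x y \<le> 2 * \<bar>R\<bar>" using that dist_triangle2[of x y p] by (auto simp: dist_commute)
   then show ?thesis using B a by (intro mult_left_mono mult_right_mono powr_mono2) auto
  qed
  finally show ?thesis by (simp add: mult.assoc)
 qed
 moreover have "\<bar>g x\<bar> \<le> M" if "x \<in> ball p R" for x using M[of x] that by auto
 moreover have "0 \<le> B * (2 * \<bar>R\<bar>) powr (1 - \<alpha>)" using B by simp
 ultimately show ?thesis unfolding holder_def by blast
qed

section \<open>Cutoffs and local regularity\<close>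

lemma C1_on_Un:
 assumes "open U" "open V" "C1_on U f" "C1_on V f"
 shows "C1_on (U \<union> V) f"
 using assms unfolding C1_on_def by (auto intro: continuous_on_open_Un)

lemma C1_on_local:
 assumes "\<And>x. x \<in> U ==> \<exists>e>0. C1_on (ball x e) f"
 shows "C1_on U f"
proof (rule C1_onI)
 show "GDERIV f x :> grad f x" if "x \<in> U" for x using assms[OF that] by (auto intro: C1_onD)
 have "isCont (grad f) x" if x: "x \<in> U" for x
 proof -
  obtain e where "e > 0" "C1_on (ball x e) f" using assms[OF x] by blast
  then show ?thesis using C1_on_continuous_grad[of "ball x e" f] by (simp add: continuous_on_eq_continuous_at)
 qed
 then show "continuous_on U (grad f)" by (simp add: continuous_at_imp_continuous_on)
qed

lemma pd_zero_outside:
 fixes f :: "'a::euclidean_space \<Rightarrow> real"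
 assumes "compact K" "\<And>x. x \<notin> K ==> f x = 0" "x \<notin> K"
 shows "pd b f x = 0"
proof -
 have "open (- K)" using assms(1) compact_imp_closed by blast
 then have "pd b f x = pd b (\<lambda>_. 0) x" by (rule pd_cong) (use assms in auto)
 then show ?thesis using gderiv_pd[OF GDERIV_const[of 0 x]] by simp
qed

lemma pd_mult:
 assumes "C1_on U f" "C1_on U g" "x \<in> U" "b \<in> Basis"
 shows "pd b (\<lambda>x. f x * g x) x = f x * pd b g x + g x * pd b f x"
 using gderiv_pd[OF GDERIV_mult[OF C1_onD[OF assms(1,3)] C1_onD[OF assms(2,3)]], of b] assms(4)
 by (simp add: pd_eq_grad inner_add_left)

lemma pd_add:
 assumes "C1_on U f" "C1_on U g" "x \<in> U" "b \<in> Basis"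
 shows "pd b (\<lambda>x. f x + g x) x = pd b f x + pd b g x"
 using gderiv_pd[OF GDERIV_add[OF C1_onD[OF assms(1,3)] C1_onD[OF assms(2,3)]], of b] assms(4)
 by (simp add: pd_eq_grad inner_add_left)

lemma pd_pd_mult:
 assumes U: "open U" and f: "C2_on U f" and g: "C2_on U g" and x: "x \<in> U" and b: "b \<in> Basis" "c \<in> Basis"
 shows "pd c (pd b (\<lambda>x. f x * g x)) x =
   (f x * pd c (pd b g) x + pd b g x * pd c f x) + (g x * pd c (pd b f) x + pd b f x * pd c g x)"
proof -
 have C: "C1_on U f" "C1_on U g" "C1_on U (pd b f)" "C1_on U (pd b g)" using f g b C2_on_iff[OF U] by auto
 have "pd c (pd b (\<lambda>x. f x * g x)) x = pd c (\<lambda>x. f x * pd b g x + g x * pd b f x) x"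
  by (rule pd_cong[OF U x]) (rule pd_mult[OF C(1,2) _ b(1)])
 also have "\<dots> = pd c (\<lambda>x. f x * pd b g x) x + pd c (\<lambda>x. g x * pd b f x) x"
  by (rule pd_add[OF C1_on_mult[OF C(1,4)] C1_on_mult[OF C(2,3)] x b(2)])
 also have "\<dots> = (f x * pd c (pd b g) x + pd b g x * pd c f x) + (g x * pd c (pd b f) x + pd b f x * pd c g x)"
  by (simp add: pd_mult[OF C(1,4) x b(2)] pd_mult[OF C(2,3) x b(2)])
 finally show ?thesis .
qed

lemma C2_on_mult:
 assumes U: "open U" and f: "C2_on U f" and g: "C2_on U g"
 shows "C2_on U (\<lambda>x. f x * g x)"
 unfolding C2_on_iff[OF U]
proof (intro conjI ballI)
 have C: "C1_on U f" "C1_on U g" using f g C2_on_iff[OF U] by auto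
 show "C1_on U (\<lambda>x. f x * g x)" by (rule C1_on_mult[OF C])
 fix b :: 'a assume b: "b \<in> Basis"
 have C': "C1_on U (pd b f)" "C1_on U (pd b g)" using f g b C2_on_iff[OF U] by auto
 have "C1_on U (\<lambda>x. f x * pd b g x + g x * pd b f x)" by (intro C1_on_add C1_on_mult C C')
 then show "C1_on U (pd b (\<lambda>x. f x * g x))"
  by (rule C1_on_cong[OF U, rotated]) (simp add: pd_mult[OF C _ b])
qed

text \<open>The exponent 4 gives three continuous derivatives. In the second derivatives of the
  product with \<phi>, those of \<phi> are then multiplied by C^1 factors, and the Holder exponent
  is kept.\<close>

definition bump :: "'a::euclidean_space \<Rightarrow> real \<Rightarrow> 'a \<Rightarrow> real" where
 "bump p s x = (max 0 (s\<^sup>2 - (x - p) \<bullet> (x - p))) ^ 4"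

lemma bump_C3:
 fixes p :: "'a::euclidean_space"
 shows "C2_on UNIV (bump p s)" "\<And>b c. b \<in> Basis ==> c \<in> Basis ==> C1_on UNIV (pd c (pd b (bump p s)))"
proof -
 define m where "m n x = (max 0 (s\<^sup>2 - (x - p) \<bullet> (x - p))) ^ n" for n and x :: 'a
 have gm: "GDERIV (m n) x :> (- 2 * real n * m (n - 1) x) *\<^sub>R (x - p)" if "n \<ge> 2" for n x
  using gderiv_pos_part_power[OF that, of "s\<^sup>2" p x] unfolding m_def[abs_def] .
 have cm: "continuous_on UNIV (m n)" for n unfolding m_def[abs_def] by (intro continuous_intros)
 have Cm: "C1_on UNIV (m n)" if "n \<ge> 2" for n
  by (rule C1_onI[OF gm[OF that]]) (intro continuous_intros cm)
 have pm: "pd b (m n) = (\<lambda>x. (- 2 * real n) * (m (n - 1) x * (x \<bullet> b + - (p \<bullet> b))))" if "n \<ge> 2" for n b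
  using gderiv_pd[OF gm[OF that], of b] by (auto simp: fun_eq_iff inner_diff_left)
 have Cl: "C1_on UNIV (\<lambda>x. x \<bullet> b + - (p \<bullet> b))" for b by (intro C1_on_add C1_on_const C1_on_inner_left)
 have C1p: "C1_on UNIV (pd b (m n))" if "n \<ge> 3" for n b
 proof -
  have n: "n \<ge> 2" "n - 1 \<ge> 2" using that by auto
  show ?thesis unfolding pm[OF n(1)] by (intro C1_on_mult C1_on_const Cl Cm n)
 qed
 have bm: "bump p s = m 4" by (simp add: bump_def[abs_def] m_def[abs_def])
 show "C2_on UNIV (bump p s)"
  unfolding C2_on_iff[OF open_UNIV] bm using Cm[of 4] C1p[of 4] by auto
 fix b c :: 'a assume b: "b \<in> Basis" and c: "c \<in> Basis"
 have pl: "pd c (\<lambda>x. x \<bullet> b + - (p \<bullet> b)) x = b \<bullet> c" for x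
 proof -
  have "GDERIV (\<lambda>x. x \<bullet> b + - (p \<bullet> b)) x :> b + 0" by (rule GDERIV_add[OF gderiv_inner_left GDERIV_const])
  from gderiv_pd[OF this, of c] show ?thesis by simp
 qed
 have "pd c (pd b (m 4)) x = (- 8) * (m 3 x * (b \<bullet> c) + (x \<bullet> b + - (p \<bullet> b)) * ((-6) * (m 2 x * (x \<bullet> c + - (p \<bullet> c)))))" for x
 proof -
  have "pd c (pd b (m 4)) x = pd c (\<lambda>x. (-8) * (m 3 x * (x \<bullet> b + - (p \<bullet> b)))) x" using pm[of 4 b] by simp
  also have "\<dots> = (-8) * pd c (\<lambda>x. m 3 x * (x \<bullet> b + - (p \<bullet> b))) x"
   using pd_mult[OF C1_on_const[of UNIV "-8"] C1_on_mult[OF Cm[of 3] Cl], of x c b] c gderiv_pd[OF GDERIV_const[of "-8::real" x]] by simp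
  also have "pd c (\<lambda>x. m 3 x * (x \<bullet> b + - (p \<bullet> b))) x = m 3 x * (b \<bullet> c) + (x \<bullet> b + - (p \<bullet> b)) * ((-6) * (m 2 x * (x \<bullet> c + - (p \<bullet> c))))"
   using pd_mult[OF Cm[of 3] Cl, of x c b] c pl pm[of 3 c] by simp
  finally show ?thesis .
 qed
 then have "pd c (pd b (bump p s)) = (\<lambda>x. (- 8) * (m 3 x * (b \<bullet> c) + (x \<bullet> b + - (p \<bullet> b)) * ((-6) * (m 2 x * (x \<bullet> c + - (p \<bullet> c))))))"
  unfolding bm by blast
 moreover have "C1_on UNIV (\<lambda>x. (- 8) * (m 3 x * (b \<bullet> c) + (x \<bullet> b + - (p \<bullet> b)) * ((-6) * (m 2 x * (x \<bullet> c + - (p \<bullet> c))))))"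
  by (rule C1_on_mult[OF C1_on_const C1_on_add[OF C1_on_mult[OF Cm C1_on_const] C1_on_mult[OF Cl C1_on_mult[OF C1_on_const C1_on_mult[OF Cm Cl]]]]]) simp_all
 ultimately show "C1_on UNIV (pd c (pd b (bump p s)))" by (simp only:)
qed

lemma bump_pos: "x \<in> ball p s ==> bump p s x > 0"
proof -
 assume x: "x \<in> ball p s"
 then have "(norm (x - p))\<^sup>2 < s\<^sup>2" by (intro power_strict_mono) (auto simp: dist_norm norm_minus_commute)
 then have "0 < max 0 (s\<^sup>2 - (x - p) \<bullet> (x - p))" by (simp add: power2_norm_eq_inner)
 then show ?thesis unfolding bump_def by (rule zero_less_power)
qed

lemma bump_zero: "s > 0 ==> x \<notin> ball p s ==> bump p s x = 0"
proof -
 assume x: "s > 0" "x \<notin> ball p s"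
 then have "s\<^sup>2 \<le> (norm (x - p))\<^sup>2" by (intro power_mono) (auto simp: dist_norm norm_minus_commute)
 then show ?thesis unfolding bump_def by (simp add: power2_norm_eq_inner max_def)
qed

lemma bump_nonneg: "bump p s x \<ge> 0" by (simp add: bump_def)

text \<open>The bump lives on half the radius, away from the rim of the ball on which \<phi> is
  controlled, so extension by zero loses no regularity.\<close>

definition bumped :: "'a::euclidean_space \<Rightarrow> real \<Rightarrow> ('a \<Rightarrow> real) \<Rightarrow> 'a \<Rightarrow> real" where
 "bumped p r \<phi> x = (if x \<in> ball p r then bump p (r / 2) x * \<phi> x else 0)"

text \<open>Demanded for all small radii rather than for one, so that the summands of a finite sum
  can be treated on a common ball.\<close>

definition C2holder_at :: "real \<Rightarrow> ('a::euclidean_space \<Rightarrow> real) \<Rightarrow> 'a \<Rightarrow> bool" where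
 "C2holder_at \<alpha> f x \<longleftrightarrow> (\<exists>e>0. \<forall>d. 0 < d \<longrightarrow> d \<le> e \<longrightarrow> C2_on (ball x d) f \<and> (\<forall>b\<in>Basis. \<forall>c\<in>Basis. holder \<alpha> (ball x d) (pd c (pd b f))))"

lemma holder_subset: "holder \<alpha> S g ==> T \<subseteq> S ==> holder \<alpha> T g"
 unfolding holder_def by (meson subsetD)

lemma holder_cong: "holder \<alpha> S g ==> (\<And>x. x \<in> S ==> f x = g x) ==> holder \<alpha> S f"
 unfolding holder_def by simp

lemma C2holder_atI:
 assumes "e > 0" "C2_on (ball x e) f" "\<And>b c. b \<in> Basis ==> c \<in> Basis ==> holder \<alpha> (ball x e) (pd c (pd b f))"
 shows "C2holder_at \<alpha> f x"
 unfolding C2holder_at_def using assms(1)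
 by (intro exI[of _ e] conjI allI impI ballI C2_on_subset[OF open_ball open_ball assms(2)] holder_subset[OF assms(3)]) auto

lemma C2holder_at_const: "C2holder_at \<alpha> (\<lambda>_. k) x"
proof -
 have c: "pd b (\<lambda>x::'a. c::real) = (\<lambda>_. 0)" for b c using gderiv_pd[OF GDERIV_const] by (auto simp: fun_eq_iff)
 show ?thesis by (rule C2holder_atI[OF zero_less_one]) (auto simp: C2_on_iff c holder_def intro: exI[of _ 0])
qed

lemma C2holder_at_cong:
 assumes "C2holder_at \<alpha> f x" "open W" "x \<in> W" "\<And>y. y \<in> W ==> g y = f y"
 shows "C2holder_at \<alpha> g x"
proof -
 obtain e where e: "e > 0" "\<And>d. 0 < d ==> d \<le> e ==> C2_on (ball x d) f \<and> (\<forall>b\<in>Basis. \<forall>c\<in>Basis. holder \<alpha> (ball x d) (pd c (pd b f)))"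
  using assms(1) unfolding C2holder_at_def by blast
 obtain d where d: "d > 0" "ball x d \<subseteq> W" using openE[OF assms(2,3)] .
 define m where "m = min d e"
 have m: "m > 0" "ball x m \<subseteq> W" using e d by (auto simp: m_def)
 have eq: "y \<in> ball x m ==> g y = f y" for y using m assms(4) by blast
 have "pd c (pd b g) y = pd c (pd b f) y" if "y \<in> ball x m" for b c y
  by (rule pd_cong[OF open_ball that pd_cong[OF open_ball _ eq]])
 moreover have f: "C2_on (ball x m) f" "\<And>b c. b \<in> Basis ==> c \<in> Basis ==> holder \<alpha> (ball x m) (pd c (pd b f))"
  using e(2)[of m] m(1) by (auto simp: m_def)
 moreover have "C2_on (ball x m) g" by (rule C2_on_cong[OF open_ball _ f(1)]) (simp only: eq)
 ultimately show ?thesis by (intro C2holder_atI[OF m(1)] holder_cong[OF f(2)])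
qed

lemma C2holder_at_add:
 assumes "C2holder_at \<alpha> f x" "C2holder_at \<alpha> g x"
 shows "C2holder_at \<alpha> (\<lambda>x. f x + g x) x"
proof -
 obtain e e' where e: "e > 0" "e' > 0" "\<And>d. 0 < d ==> d \<le> e ==> C2_on (ball x d) f \<and> (\<forall>b\<in>Basis. \<forall>c\<in>Basis. holder \<alpha> (ball x d) (pd c (pd b f)))"
  "\<And>d. 0 < d ==> d \<le> e' ==> C2_on (ball x d) g \<and> (\<forall>b\<in>Basis. \<forall>c\<in>Basis. holder \<alpha> (ball x d) (pd c (pd b g)))"
  using assms unfolding C2holder_at_def by blast
 define m where "m = min e e'"
 have m: "m > 0" "m \<le> e" "m \<le> e'" using e by (auto simp: m_def)
 have f: "C2_on (ball x m) f" "C2_on (ball x m) g" using e m by auto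
 have h: "holder \<alpha> (ball x m) (pd c (pd b f))" "holder \<alpha> (ball x m) (pd c (pd b g))" if "b \<in> Basis" "c \<in> Basis" for b c
  using e(3,4)[of m] m that by auto
 show ?thesis
 proof (rule C2holder_atI[OF m(1)])
  show "C2_on (ball x m) (\<lambda>x. f x + g x)" using C2_on_lincomb(1)[OF open_ball f, of 1 1] by simp
  fix b c :: 'a assume b: "b \<in> Basis" and c: "c \<in> Basis"
  have C: "C1_on (ball x m) f" "C1_on (ball x m) g" "C1_on (ball x m) (pd b f)" "C1_on (ball x m) (pd b g)"
   using f b C2_on_iff[OF open_ball] by auto
  have e: "pd c (pd b (\<lambda>x. f x + g x)) y = pd c (pd b f) y + pd c (pd b g) y" if "y \<in> ball x m" for y
   using pd_cong[OF open_ball that pd_add[OF C(1,2) _ b]] pd_add[OF C(3,4) that c] by simp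
  show "holder \<alpha> (ball x m) (pd c (pd b (\<lambda>x. f x + g x)))"
   by (rule holder_cong[OF holder_add[OF h[OF b c]]]) (rule e)
 qed
qed

lemma C2holder_at_sum:
 assumes "finite I" "\<And>i. i \<in> I ==> C2holder_at \<alpha> (f i) x"
 shows "C2holder_at \<alpha> (\<lambda>x. \<Sum>i\<in>I. f i x) x"
 using assms by (induction I) (simp_all add: C2holder_at_const C2holder_at_add)

lemma C2holder_at_imp_C2_on:
 assumes "\<And>x. C2holder_at \<alpha> f x"
 shows "C2_on UNIV f"
proof -
 have "\<exists>e>0. C2_on (ball x e) f" for x using assms[of x] unfolding C2holder_at_def by blast
 then show ?thesis unfolding C2_on_iff[OF open_UNIV] C2_on_iff[OF open_ball]
  by (intro conjI ballI C1_on_local) blast+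
qed

lemma C2holder_at_imp_C2alpha_on:
 fixes f :: "'a::euclidean_space \<Rightarrow> real"
 assumes "C2holder_at \<alpha> f x" "d > 0"
 shows "\<exists>e>0. e \<le> d \<and> C2alpha_on \<alpha> (ball x e) f"
proof -
 obtain e where e: "e > 0" "\<And>d. 0 < d ==> d \<le> e ==> C2_on (ball x d) f \<and> (\<forall>b\<in>Basis. \<forall>c\<in>Basis. holder \<alpha> (ball x d) (pd c (pd b f)))"
  using assms(1) unfolding C2holder_at_def by blast
 define m where "m = min d e"
 have m: "m > 0" "m \<le> e" "m \<le> d" using e assms(2) by (auto simp: m_def)
 have "\<exists>L. \<forall>y\<in>ball x m. \<forall>z\<in>ball x m. \<bar>pd c (pd b f) y - pd c (pd b f) z\<bar> \<le> L * dist y z powr \<alpha>" if "b \<in> Basis" "c \<in> Basis" for b c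
  using e(2)[OF m(1,2)] that unfolding holder_def by blast
 then obtain L where L: "\<And>b c y z. b \<in> Basis ==> c \<in> Basis ==> y \<in> ball x m ==> z \<in> ball x m ==> \<bar>pd c (pd b f) y - pd c (pd b f) z\<bar> \<le> L b c * dist y z powr \<alpha>"
  by metis
 define K where "K = Max ((\<lambda>(b, c). L b c) ` (Basis \<times> Basis))"
 have "L b c \<le> K" if "b \<in> Basis" "c \<in> Basis" for b c
  unfolding K_def by (rule Max_ge) (use that in auto)
 then have "L b c * dist y z powr \<alpha> \<le> K * dist y z powr \<alpha>" if "b \<in> Basis" "c \<in> Basis" for b c y z
  using that by (intro mult_right_mono) auto
 then show ?thesis unfolding C2alpha_on_def using L e(2)[OF m(1,2)] m by (meson order_trans)
qed

lemma C2holder_at_bumped: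
 fixes p :: "'a::euclidean_space"
 assumes r: "r > 0" and \<phi>: "C2alpha_on \<alpha> (ball p r) \<phi>" and a: "0 < \<alpha>" "\<alpha> < 1"
 shows "C2holder_at \<alpha> (bumped p r \<phi>) x"
proof (cases "x \<in> ball p r")
 case False
 show ?thesis
 proof (rule C2holder_at_cong[OF C2holder_at_const[of \<alpha> 0], of "- cball p (r/2)"])
  show "bumped p r \<phi> y = 0" if "y \<in> - cball p (r/2)" for y using that r by (auto simp: bumped_def bump_zero)
 qed (use False r in auto)
next
 case True
 let ?W = "ball p r" and ?\<beta> = "bump p (r / 2)"
 have W: "open ?W" by simp
 obtain e where e: "e > 0" "cball x e \<subseteq> ?W" using True W open_contains_cball by blast
 have sub: "ball x e \<subseteq> ?W" using e(2) ball_subset_cball by blast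
 have p2: "C2_on ?W \<phi>" using \<phi> by (simp add: C2alpha_on_def)
 have b2: "C2_on ?W ?\<beta>" using C2_on_subset[OF open_UNIV W bump_C3(1)] by simp
 have "C2holder_at \<alpha> (\<lambda>x. ?\<beta> x * \<phi> x) x"
 proof (rule C2holder_atI[OF e(1)])
  show "C2_on (ball x e) (\<lambda>x. ?\<beta> x * \<phi> x)" by (rule C2_on_subset[OF W open_ball C2_on_mult[OF W b2 p2] sub])
  fix b c :: 'a assume b: "b \<in> Basis" and c: "c \<in> Basis"
  have hC: "holder \<alpha> (ball x e) g" if "C1_on ?W g" for g by (rule C1_imp_holder[OF W that e(2) a])
  have C1: "C1_on ?W \<phi>" "C1_on ?W (pd b \<phi>)" "C1_on ?W (pd c \<phi>)" using p2 b c C2_on_iff[OF W] by auto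
  have C1b: "C1_on ?W ?\<beta>" "C1_on ?W (pd b ?\<beta>)" "C1_on ?W (pd c ?\<beta>)" using b2 b c C2_on_iff[OF W] by auto
  have C1bb: "C1_on ?W (pd c (pd b ?\<beta>))" using bump_C3(2)[OF b c] C1_on_subset by blast
  have h2: "holder \<alpha> (ball x e) (pd c (pd b \<phi>))"
  proof -
   obtain L where L: "\<And>x y. x \<in> ?W ==> y \<in> ?W ==> \<bar>pd c (pd b \<phi>) x - pd c (pd b \<phi>) y\<bar> \<le> L * dist x y powr \<alpha>"
    using \<phi> b c unfolding C2alpha_on_def by metis
   obtain M where M: "\<And>z. z \<in> cball x e ==> norm (pd c (pd b \<phi>) z) \<le> M"
    using bounded_on_compact[OF C1_on_continuous_pd[OF C1(2) c] compact_cball e(2)] by blast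
   have "\<bar>pd c (pd b \<phi>) y - pd c (pd b \<phi>) z\<bar> \<le> \<bar>L\<bar> * dist y z powr \<alpha>" if "y \<in> ball x e" "z \<in> ball x e" for y z
    by (rule order_trans[OF L[OF subsetD[OF sub that(1)] subsetD[OF sub that(2)]]]) (intro mult_right_mono; simp)
   moreover have "\<bar>pd c (pd b \<phi>) y\<bar> \<le> M" if "y \<in> ball x e" for y using M[of y] that by simp
   ultimately show ?thesis unfolding holder_def by (meson abs_ge_zero)
  qed
  have "holder \<alpha> (ball x e) (\<lambda>x. (?\<beta> x * pd c (pd b \<phi>) x + pd b \<phi> x * pd c ?\<beta> x) + (\<phi> x * pd c (pd b ?\<beta>) x + pd b ?\<beta> x * pd c \<phi> x))"
   by (intro holder_add holder_mult hC C1 C1b C1bb h2)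
  then show "holder \<alpha> (ball x e) (pd c (pd b (\<lambda>x. ?\<beta> x * \<phi> x)))"
   by (rule holder_cong) (rule pd_pd_mult[OF W b2 p2 subsetD[OF sub] b c])
 qed
 then show ?thesis by (rule C2holder_at_cong[OF _ W True]) (simp add: bumped_def)
qed

text \<open>A sum of cut-off local defining functions keeps the sign pattern, since near each point
  all active pieces have the same sign. That \<rho> is itself a local defining function at every
  boundary point matters later: the curvature hypothesis speaks of such functions only, and all
  computations are done with \<rho>.\<close>

theorem global_defining_function:
 fixes \<Omega> :: "'a::euclidean_space set"
 assumes \<Omega>: "open \<Omega>" "bounded \<Omega>" and a: "0 < \<alpha>" "\<alpha> < 1" and bd: "C2alpha_boundary \<alpha> \<Omega>"
 shows "\<exists>\<rho> K. C2_on UNIV \<rho> \<and> compact K \<and> (\<forall>x. x \<notin> K \<longrightarrow> \<rho> x = 0) \<and>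
   (\<forall>x\<in>\<Omega>. \<rho> x < 0) \<and> (\<forall>x\<in>frontier \<Omega>. \<rho> x = 0) \<and>
   (\<forall>x\<in>frontier \<Omega>. grad \<rho> x \<noteq> 0) \<and> (\<forall>p\<in>frontier \<Omega>. \<exists>r. local_defining_fun \<alpha> \<Omega> p r \<rho>)"
proof -
 \<comment> \<open>Unlike in \<open>local_defining_fun\<close>, the gradient has to be nonzero only
   on the boundary. The constant - 1 then qualifies on balls inside \<Omega>, and the finite cover
   treats interior and boundary points alike.\<close>
 define good where "good p r \<phi> \<longleftrightarrow> 0 < r \<and> C2alpha_on \<alpha> (ball p r) \<phi> \<and> (\<forall>x\<in>ball p r \<inter> frontier \<Omega>. grad \<phi> x \<noteq> 0)
   \<and> \<Omega> \<inter> ball p r = {x\<in>ball p r. \<phi> x < 0} \<and> frontier \<Omega> \<inter> ball p r = {x\<in>ball p r. \<phi> x = 0}" for p r \<phi>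
 have disj: "\<Omega> \<inter> frontier \<Omega> = {}" using \<Omega>(1) by (auto simp: frontier_def interior_open)
 have clo: "closure \<Omega> = \<Omega> \<union> frontier \<Omega>" using closure_subset[of \<Omega>] \<Omega>(1) by (auto simp: frontier_def interior_open)
 have "\<exists>r \<phi>. good p r \<phi>" if "p \<in> closure \<Omega>" for p
 proof (cases "p \<in> \<Omega>")
  case True
  obtain r where r: "r > 0" "ball p r \<subseteq> \<Omega>" by (rule openE[OF \<Omega>(1) True])
  have c: "pd b (\<lambda>x::'a. c::real) = (\<lambda>_. 0)" for b c using gderiv_pd[OF GDERIV_const] by (auto simp: fun_eq_iff)
  have "C2alpha_on \<alpha> (ball p r) (\<lambda>_. -1)"
   unfolding C2alpha_on_def C2_on_iff[OF open_ball] c by (auto intro!: exI[of _ 0])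
  then have "good p r (\<lambda>_. -1)" unfolding good_def using r disj by auto
  then show ?thesis by blast
 next
  case False
  then have "p \<in> frontier \<Omega>" using that clo by auto
  then have "\<exists>r \<phi>. local_defining_fun \<alpha> \<Omega> p r \<phi>" using bd by (simp add: C2alpha_boundary_def)
  then show ?thesis unfolding local_defining_fun_def good_def by (elim exE) (intro exI, auto)
 qed
 then obtain r \<phi> where good: "\<And>p. p \<in> closure \<Omega> ==> good p (r p) (\<phi> p)" by metis
 have rp: "\<And>p. p \<in> closure \<Omega> ==> r p > 0" using good by (simp add: good_def)
 define s where "s p = r p / 2" for p
 have cpt: "compact (closure \<Omega>)" by (rule compact_closure[THEN iffD2, OF \<Omega>(2)])
 have cov: "closure \<Omega> \<subseteq> (\<Union>p\<in>closure \<Omega>. ball p (s p))"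
 proof
  fix x assume "x \<in> closure \<Omega>"
  then show "x \<in> (\<Union>p\<in>closure \<Omega>. ball p (s p))" using rp[of x] by (intro UN_I[of x]) (auto simp: s_def)
 qed
 obtain P where P: "P \<subseteq> closure \<Omega>" "finite P" "closure \<Omega> \<subseteq> (\<Union>p\<in>P. ball p (s p))"
  by (rule compactE_image[OF cpt _ cov]) auto
 have gd0: "GDERIV (\<phi> p) x :> grad (\<phi> p) x" if p: "p \<in> P" and x: "x \<in> ball p (r p)" for p x
 proof -
  have "good p (r p) (\<phi> p)" using good P p by auto
  then have "C2_on (ball p (r p)) (\<phi> p)" by (simp add: good_def C2alpha_on_def)
  then have "C1_on (ball p (r p)) (\<phi> p)" by (simp only: C2_on_iff[OF open_ball])
  then show ?thesis using x by (rule C1_onD)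
 qed
 define \<rho> where "\<rho> x = (\<Sum>p\<in>P. bumped p (r p) (\<phi> p) x)" for x
 define U where "U = (\<Union>p\<in>P. ball p (s p))"
 have inU: "x \<in> U" if "x \<in> closure \<Omega>" for x using subsetD[OF P(3) that] by (simp add: U_def)
 have gP: "good p (r p) (\<phi> p)" "r p > 0" if "p \<in> P" for p using good rp P that by auto
 have near: "C2holder_at \<alpha> (bumped p (r p) (\<phi> p)) x" if "p \<in> P" for p x
  using gP[OF that] unfolding good_def by (intro C2holder_at_bumped[OF _ _ a]) auto
 have near': "C2holder_at \<alpha> \<rho> x" for x unfolding \<rho>_def[abs_def] by (rule C2holder_at_sum[OF P(2) near])
 have C2: "C2_on UNIV \<rho>" by (rule C2holder_at_imp_C2_on[OF near'])
 have C1: "C1_on UNIV \<rho>" using C2 C2_on_iff[OF open_UNIV] by auto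
 have val: "bumped p (r p) (\<phi> p) x = (if x \<in> ball p (s p) then bump p (s p) x * \<phi> p x else 0)" if "p \<in> P" for p x
  using gP(2)[OF that] by (auto simp: bumped_def s_def bump_zero)
 have inb: "x \<in> ball p (r p)" if "p \<in> P" "x \<in> ball p (s p)" for p x using that gP(2)[OF that(1)] by (auto simp: s_def)
 have phi: "x \<in> \<Omega> \<longleftrightarrow> \<phi> p x < 0" "x \<in> frontier \<Omega> \<longleftrightarrow> \<phi> p x = 0" if "p \<in> P" "x \<in> ball p (s p)" for p x
 proof -
  have e1: "\<Omega> \<inter> ball p (r p) = {x\<in>ball p (r p). \<phi> p x < 0}" and e2: "frontier \<Omega> \<inter> ball p (r p) = {x\<in>ball p (r p). \<phi> p x = 0}"
   using gP(1)[OF that(1)] by (simp_all add: good_def)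
  show "x \<in> \<Omega> \<longleftrightarrow> \<phi> p x < 0" using eqset_imp_iff[OF e1, of x] inb[OF that] by auto
  show "x \<in> frontier \<Omega> \<longleftrightarrow> \<phi> p x = 0" using eqset_imp_iff[OF e2, of x] inb[OF that] by auto
 qed
 have sgn: "0 < \<sigma> * \<rho> x" if x: "x \<in> U" and ph: "\<And>p. p \<in> P ==> x \<in> ball p (s p) ==> 0 < \<sigma> * \<phi> p x" for \<sigma> x
 proof -
  obtain q where q: "q \<in> P" "x \<in> ball q (s q)" using x by (auto simp: U_def)
  have bn: "0 < \<sigma> * (bump p (s p) x * \<phi> p x)" if "p \<in> P" "x \<in> ball p (s p)" for p
   using mult_pos_pos[OF bump_pos[OF that(2)] ph[OF that]] by (simp add: mult_ac)
  have "(\<Sum>p\<in>P. 0) < (\<Sum>p\<in>P. \<sigma> * bumped p (r p) (\<phi> p) x)"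
  proof (rule sum_strict_mono_ex1[OF P(2)])
   show "\<forall>p\<in>P. 0 \<le> \<sigma> * bumped p (r p) (\<phi> p) x" using val bn by (auto intro: less_imp_le)
   show "\<exists>p\<in>P. 0 < \<sigma> * bumped p (r p) (\<phi> p) x" using q val[OF q(1)] bn[OF q] by (intro bexI[of _ q]) auto
  qed
  then show ?thesis by (simp add: \<rho>_def sum_distrib_left)
 qed
 have neg: "\<rho> x < 0" if "x \<in> \<Omega>" for x
  using sgn[of x "-1"] that clo inU[of x] phi(1) by auto
 have zero: "\<rho> x = 0" if "x \<in> frontier \<Omega>" for x
  unfolding \<rho>_def using val phi(2) that by (intro sum.neutral) auto
 have pos: "\<rho> x > 0" if "x \<in> U - closure \<Omega>" for x
 proof -
  have "\<phi> p x > 0" if "p \<in> P" "x \<in> ball p (s p)" for p using phi[OF that] \<open>x \<in> U - closure \<Omega>\<close> clo by force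
  then show ?thesis using sgn[of x 1] \<open>x \<in> U - closure \<Omega>\<close> by simp
 qed
 have gnz: "grad \<rho> x \<noteq> 0" if x: "x \<in> frontier \<Omega>" for x
 proof -
  have "x \<in> closure \<Omega>" using x clo by simp
  from subsetD[OF P(3) this] obtain q where q: "q \<in> P" "x \<in> ball q (s q)" by blast
  define v where "v = grad (\<phi> q) x"
  have v: "v \<noteq> 0" using gP(1)[OF q(1)] inb[OF q] x unfolding v_def good_def by (metis IntI)
  let ?q = "bumped q (r q) (\<phi> q)"
  have xq: "x \<in> ball q (r q)" by (rule inb[OF q])
  note line = gderiv_line[of _ x 0 v, simplified]
  have lq: "((\<lambda>t. \<phi> q (x + t *\<^sub>R v)) has_real_derivative v \<bullet> v) (at 0)"
   using line[OF gd0[OF q(1) xq]] by (simp add: v_def)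
  have "GDERIV (bump q (s q)) x :> grad (bump q (s q)) x"
   using bump_C3(1)[of q "s q"] C1_onD[of UNIV "bump q (s q)" x] by (simp add: C2_on_iff)
  from GDERIV_mult[OF this gd0[OF q(1) xq]] have "GDERIV (\<lambda>x. bump q (s q) x * \<phi> q x) x :> bump q (s q) x *\<^sub>R v"
   using phi(2)[OF q] x by (simp add: v_def)
  from gderiv_cong[OF open_ball xq _ this, of ?q] have "GDERIV ?q x :> bump q (s q) x *\<^sub>R v"
   by (simp add: bumped_def s_def)
  from DERIV_diff[OF line[OF C1_onD[OF C1 UNIV_I]] line[OF this]]
  have D: "((\<lambda>t. \<rho> (x + t *\<^sub>R v) - ?q (x + t *\<^sub>R v)) has_real_derivative grad \<rho> x \<bullet> v - bump q (s q) x *\<^sub>R v \<bullet> v) (at 0)" .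
  \<comment> \<open>Replaces a proof that the gradients of the pieces are parallel. If the claim
    failed, the sum of the other pieces would be positive at a point slightly behind x along v; but
    that point lies in \<Omega>, where all pieces are nonpositive.\<close>
  have "grad \<rho> x \<bullet> v \<ge> bump q (s q) x *\<^sub>R v \<bullet> v"
  proof (rule ccontr)
   assume "\<not> ?thesis"
   then obtain d where d: "d > 0" "\<And>h. 0 < h ==> h < d ==> \<rho> (x + (0 - h) *\<^sub>R v) - ?q (x + (0 - h) *\<^sub>R v) > \<rho> (x + 0 *\<^sub>R v) - ?q (x + 0 *\<^sub>R v)"
    using DERIV_neg_dec_left[OF D] by auto
   obtain d' where d': "d' > 0" "\<And>h. 0 < h ==> h < d' ==> \<phi> q (x + (0 - h) *\<^sub>R v) < \<phi> q (x + 0 *\<^sub>R v)"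
    using DERIV_pos_inc_left[OF lq] v by auto
   have "((\<lambda>t. x + t *\<^sub>R v) \<longlongrightarrow> x + 0 *\<^sub>R v) (at 0)" by (intro tendsto_intros)
   then have "\<forall>\<^sub>F t in at 0. x + t *\<^sub>R v \<in> ball q (s q)" using q(2) by (intro topological_tendstoD[OF _ open_ball]) auto
   then obtain d'' where d'': "d'' > 0" "\<And>t. t \<noteq> 0 ==> dist t 0 < d'' ==> x + t *\<^sub>R v \<in> ball q (s q)"
    unfolding eventually_at by blast
   define h where "h = min d (min d' d'') / 2"
   have h: "0 < h" "h < d" "h < d'" "h < d''" using d(1) d'(1) d''(1) by (auto simp: h_def)
   let ?y = "x + (0 - h) *\<^sub>R v"
   have yq: "?y \<in> ball q (s q)" using d''(2)[of "0 - h"] h by simp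
   have "\<phi> q ?y < 0" using d'(2)[OF h(1,3)] phi(2)[OF q] x by simp
   then have yO: "?y \<in> \<Omega>" using phi(1)[OF q(1) yq] by simp
   have "\<rho> ?y = ?q ?y + (\<Sum>p\<in>P - {q}. bumped p (r p) (\<phi> p) ?y)" unfolding \<rho>_def by (rule sum.remove[OF P(2) q(1)])
   also have "(\<Sum>p\<in>P - {q}. bumped p (r p) (\<phi> p) ?y) \<le> 0"
    using phi(1)[of _ ?y] yO val by (intro sum_nonpos) (auto intro!: mult_nonneg_nonpos bump_nonneg intro: less_imp_le)
   finally have "\<rho> ?y - ?q ?y \<le> 0" by simp
   moreover have "?q x = 0" using val[OF q(1)] phi(2)[OF q] x by simp
   ultimately show False using d(2)[OF h(1,2)] zero[OF x] by simp
  qed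
  moreover have "bump q (s q) x *\<^sub>R v \<bullet> v > 0" using bump_pos[OF q(2)] v by simp
  ultimately show ?thesis by auto
 qed
 have ldf: "\<exists>r. local_defining_fun \<alpha> \<Omega> p r \<rho>" if p: "p \<in> frontier \<Omega>" for p
 proof -
  have "isCont (grad \<rho>) p" using C1_on_continuous_grad[OF C1] by (simp add: continuous_on_eq_continuous_at)
  then have "\<forall>\<^sub>F x in at p. grad \<rho> x \<noteq> 0" using gnz[OF p] unfolding isCont_def by (rule tendsto_imp_eventually_ne)
  then obtain d where d: "d > 0" "\<And>x. x \<noteq> p ==> dist x p < d ==> grad \<rho> x \<noteq> 0" by (auto simp: eventually_at)
  have oU: "open U" unfolding U_def by auto
  have "p \<in> U" using p clo by (intro inU) simp
  obtain e where e: "e > 0" "ball p e \<subseteq> U" by (rule openE[OF oU \<open>p \<in> U\<close>])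
  obtain t where t: "t > 0" "t \<le> min d e" and C2t: "C2alpha_on \<alpha> (ball p t) \<rho>"
   using C2holder_at_imp_C2alpha_on[OF near'[of p], of "min d e"] d(1) e(1) by auto
  have tU: "ball p t \<subseteq> U" using t e by auto
  have "local_defining_fun \<alpha> \<Omega> p t \<rho>"
   unfolding local_defining_fun_def
  proof (intro conjI)
   show "\<forall>x\<in>ball p t. grad \<rho> x \<noteq> 0"
   proof
    fix x assume "x \<in> ball p t"
    then show "grad \<rho> x \<noteq> 0" using d(2)[of x] gnz[OF p] by (cases "x = p") (use t in \<open>simp_all add: dist_commute\<close>)
   qed
   have tri: "(x \<in> \<Omega> \<longleftrightarrow> \<rho> x < 0) \<and> (x \<in> frontier \<Omega> \<longleftrightarrow> \<rho> x = 0)" if "x \<in> ball p t" for x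
   proof -
    have "x \<in> U" by (rule subsetD[OF tU that])
    moreover have "x \<in> \<Omega> ==> x \<notin> frontier \<Omega>" using disj by blast
    ultimately show ?thesis using neg[of x] zero[of x] pos[of x] unfolding clo by fastforce
   qed
   show "\<Omega> \<inter> ball p t = {x \<in> ball p t. \<rho> x < 0}"
   proof (rule set_eqI)
    fix x show "x \<in> \<Omega> \<inter> ball p t \<longleftrightarrow> x \<in> {x \<in> ball p t. \<rho> x < 0}"
     using tri[of x] by (cases "x \<in> ball p t") (simp_all del: mem_ball)
   qed
   show "frontier \<Omega> \<inter> ball p t = {x \<in> ball p t. \<rho> x = 0}"
   proof (rule set_eqI)
    fix x show "x \<in> frontier \<Omega> \<inter> ball p t \<longleftrightarrow> x \<in> {x \<in> ball p t. \<rho> x = 0}"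
     using tri[of x] by (cases "x \<in> ball p t") (simp_all del: mem_ball)
   qed
  qed (rule t C2t)+
  then show ?thesis by blast
 qed
 define K where "K = (\<Union>p\<in>P. cball p (s p))"
 have K: "\<rho> x = 0" if "x \<notin> K" for x
  unfolding \<rho>_def using val that by (intro sum.neutral) (auto simp: K_def)
 have cK: "compact K" unfolding K_def using P by (intro compact_UN) auto
 have "C2_on UNIV \<rho> \<and> compact K \<and> (\<forall>x. x \<notin> K \<longrightarrow> \<rho> x = 0) \<and>
   (\<forall>x\<in>\<Omega>. \<rho> x < 0) \<and> (\<forall>x\<in>frontier \<Omega>. \<rho> x = 0) \<and>
   (\<forall>x\<in>frontier \<Omega>. grad \<rho> x \<noteq> 0) \<and> (\<forall>p\<in>frontier \<Omega>. \<exists>r. local_defining_fun \<alpha> \<Omega> p r \<rho>)"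
  by (intro conjI ballI allI impI; (rule C2 cK | (rule K neg zero gnz ldf, assumption)))
 then show ?thesis by (intro exI)
qed

section \<open>Flux through a boundary strip\<close>

text \<open>\<rho> plays the role of a signed distance to the boundary; its compact support makes
  the bounds on its derivatives global constants.\<close>

locale domain =
 fixes \<Omega> K :: "'a::euclidean_space set" and \<rho> :: "'a \<Rightarrow> real"
 assumes open_Omega: "open \<Omega>" and bounded_Omega: "bounded \<Omega>" and Omega_ne: "\<Omega> \<noteq> {}"
  and C2_rho: "C2_on UNIV \<rho>"
  and compact_K: "compact K" and rho_K: "\<And>x. x \<notin> K ==> \<rho> x = 0"
  and rho_neg: "\<And>x. x \<in> \<Omega> ==> \<rho> x < 0" and rho_zero: "\<And>x. x \<in> frontier \<Omega> ==> \<rho> x = 0"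
  and grad_rho_nz: "\<And>x. x \<in> frontier \<Omega> ==> grad \<rho> x \<noteq> 0"
begin

abbreviation vol :: "'a measure" where "vol \<equiv> lebesgue_on \<Omega>"

abbreviation \<Gamma> :: "'a set" where "\<Gamma> \<equiv> frontier \<Omega>"

lemma closure_Omega: "closure \<Omega> = \<Omega> \<union> \<Gamma>"
 using closure_subset[of \<Omega>] open_Omega by (auto simp: frontier_def interior_open)

lemma frontier_disjoint: "\<Omega> \<inter> \<Gamma> = {}"
 using open_Omega by (auto simp: frontier_def interior_open)

lemma compact_closure_Omega: "compact (closure \<Omega>)"
 by (rule compact_closure[THEN iffD2, OF bounded_Omega])

lemma compact_frontier_Omega: "compact \<Gamma>"
 by (rule compact_frontier_bounded[OF bounded_Omega])

lemma frontier_ne: "\<Gamma> \<noteq> {}"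
proof
 assume "\<Gamma> = {}"
 then have "\<Omega> = UNIV" using frontier_eq_empty Omega_ne by blast
 then show False using bounded_Omega not_bounded_UNIV by blast
qed

lemma C1_rho: "C1_on UNIV \<rho>" and C1_pd_rho: "b \<in> Basis ==> C1_on UNIV (pd b \<rho>)"
 using C2_rho C2_on_iff[OF open_UNIV] by auto

lemma gderiv_rho: "GDERIV \<rho> x :> grad \<rho> x"
 using C1_onD[OF C1_rho] by blast

lemma grad_rho_outside: "x \<notin> K ==> grad \<rho> x = 0"
 unfolding grad_def
proof (rule sum.neutral, rule ballI)
 fix b :: 'a assume "x \<notin> K"
 then have "pd b \<rho> x = 0" using pd_zero_outside[OF compact_K, of \<rho> x b] rho_K by simp
 then show "pd b \<rho> x *\<^sub>R b = 0" by simp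
qed

lemma pd_pd_rho_outside: "x \<notin> K ==> b \<in> Basis ==> grad (pd b \<rho>) x = 0"
proof -
 assume x: "x \<notin> K" and b: "b \<in> Basis"
 have "pd c (pd b \<rho>) x = 0" for c
  using pd_zero_outside[OF compact_K, of "pd b \<rho>" x c] grad_rho_outside x b by (simp add: pd_eq_grad)
 then show ?thesis by (simp add: grad_def)
qed

lemma ex_lip_rho: "\<exists>L>0. \<forall>x. norm (grad \<rho> x) \<le> L"
proof -
 obtain B where B: "B > 0" "\<And>z. z \<in> K ==> norm (grad \<rho> z) \<le> B"
  using bounded_on_compact[OF C1_on_continuous_grad[OF C1_rho] compact_K] by auto
 then have "norm (grad \<rho> x) \<le> B" for x using grad_rho_outside[of x] by (cases "x \<in> K") auto
 then show ?thesis using B(1) by blast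
qed

text \<open>A global bound for \<open>grad \<rho>\<close>, as \<open>L2\<close> below is one for the
  rows of the Hessian of \<rho>; the names have nothing to do with Lebesgue spaces.\<close>

definition L1 where "L1 = (SOME L. L > 0 \<and> (\<forall>x. norm (grad \<rho> x) \<le> L))"

lemma L1: "L1 > 0" "norm (grad \<rho> x) \<le> L1"
 using someI_ex[OF ex_lip_rho[unfolded Bex_def]] unfolding L1_def by auto

lemma rho_lip: "\<bar>\<rho> x - \<rho> y\<bar> \<le> L1 * norm (x - y)"
 by (rule differentiable_bound_gderiv[OF convex_UNIV]) (use gderiv_rho L1 in auto)

lemma ex_lip_grad: "\<exists>L>0. \<forall>x b. b \<in> Basis \<longrightarrow> norm (grad (pd b \<rho>) x) \<le> L"
proof -
 have "\<exists>B>0. \<forall>x. norm (grad (pd b \<rho>) x) \<le> B" if b: "b \<in> Basis" for b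
 proof -
  obtain B where B: "B > 0" "\<And>z. z \<in> K ==> norm (grad (pd b \<rho>) z) \<le> B"
   using bounded_on_compact[OF C1_on_continuous_grad[OF C1_pd_rho[OF b]] compact_K] by auto
  then have "norm (grad (pd b \<rho>) x) \<le> B" for x using pd_pd_rho_outside[of x b] b by (cases "x \<in> K") auto
  then show ?thesis using B(1) by blast
 qed
 then obtain B where B: "\<And>b x. b \<in> Basis ==> B b > 0 \<and> norm (grad (pd b \<rho>) x) \<le> B b" by metis
 define BB where "BB = (\<Sum>b\<in>Basis. B b)"
 have le: "B b \<le> BB" if "b \<in> Basis" for b unfolding BB_def by (rule member_le_sum[OF that]) (use B in \<open>auto intro: less_imp_le\<close>)
 have "BB > 0" unfolding BB_def using B by (intro sum_pos) auto
 then show ?thesis using B le by (meson order_trans)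
qed

definition L2 where "L2 = (SOME L. L > 0 \<and> (\<forall>x b. b \<in> Basis \<longrightarrow> norm (grad (pd b \<rho>) x) \<le> L))"

lemma L2: "L2 > 0" "b \<in> Basis ==> norm (grad (pd b \<rho>) x) \<le> L2"
 using someI_ex[OF ex_lip_grad[unfolded Bex_def]] unfolding L2_def by auto

lemma grad_rho_lip: "norm (grad \<rho> x - grad \<rho> y) \<le> real DIM('a) * L2 * norm (x - y)"
proof -
 have "norm (grad \<rho> x - grad \<rho> y) \<le> (\<Sum>b\<in>Basis. \<bar>(grad \<rho> x - grad \<rho> y) \<bullet> b\<bar>)" by (rule norm_le_l1)
 also have "\<dots> \<le> (\<Sum>b\<in>(Basis::'a set). L2 * norm (x - y))"
 proof (rule sum_mono)
  fix b :: 'a assume b: "b \<in> Basis"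
  have "\<bar>pd b \<rho> x - pd b \<rho> y\<bar> \<le> L2 * norm (x - y)"
   by (rule differentiable_bound_gderiv[OF convex_UNIV, of "pd b \<rho>" "grad (pd b \<rho>)"]) (use C1_onD[OF C1_pd_rho[OF b]] L2(2)[OF b] in auto)
  then show "\<bar>(grad \<rho> x - grad \<rho> y) \<bullet> b\<bar> \<le> L2 * norm (x - y)" using b by (simp add: inner_diff_left pd_eq_grad)
 qed
 finally show ?thesis by simp
qed

lemma laplacian_rho_bound: "\<bar>laplacian \<rho> x\<bar> \<le> real DIM('a) * L2"
proof -
 have "\<bar>laplacian \<rho> x\<bar> \<le> (\<Sum>b\<in>(Basis::'a set). \<bar>pd b (pd b \<rho>) x\<bar>)" unfolding laplacian_def by (rule sum_abs)
 also have "\<dots> \<le> (\<Sum>b\<in>(Basis::'a set). L2)"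
 proof (rule sum_mono)
  fix b :: 'a assume b: "b \<in> Basis"
  have "\<bar>grad (pd b \<rho>) x \<bullet> b\<bar> \<le> norm (grad (pd b \<rho>) x) * norm b" by (rule Cauchy_Schwarz_ineq2)
  then show "\<bar>pd b (pd b \<rho>) x\<bar> \<le> L2" using b L2(2)[OF b, of x] by (simp add: pd_eq_grad)
 qed
 finally show ?thesis by simp
qed

text \<open>Compactness: away from the boundary the continuous \<rho> has a negative maximum. This
  translates between level strips, on which cutoffs live, and metric neighbourhoods, in which
  estimates hold.\<close>

lemma strip_near_frontier:
 assumes "e > 0"
 obtains t where "t > 0" "\<And>x. x \<in> closure \<Omega> ==> - t < \<rho> x ==> \<exists>p\<in>\<Gamma>. dist x p < e"
proof -
 define S where "S = closure \<Omega> - (\<Union>p\<in>\<Gamma>. ball p e)"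
 have S: "compact S" unfolding S_def by (intro compact_diff compact_closure_Omega) auto
 have sub: "S \<subseteq> \<Omega>" using closure_Omega assms by (auto simp: S_def)
 show thesis
 proof (cases "S = {}")
  case True
  show thesis
  proof (rule that[of 1])
   fix x assume "x \<in> closure \<Omega>"
   moreover have "closure \<Omega> \<subseteq> (\<Union>p\<in>\<Gamma>. ball p e)" using True unfolding S_def by (simp only: Diff_eq_empty_iff)
   ultimately have "x \<in> (\<Union>p\<in>\<Gamma>. ball p e)" by (rule subsetD[rotated])
   then obtain p where "p \<in> \<Gamma>" "dist p x < e" by auto
   then show "\<exists>p\<in>\<Gamma>. dist x p < e" by (auto simp: dist_commute)
  qed auto
 next
  case False
  obtain y where y: "y \<in> S" "\<And>x. x \<in> S ==> \<rho> x \<le> \<rho> y"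
   using continuous_attains_sup[OF S False] continuous_on_subset[OF C1_on_continuous[OF C1_rho]] by blast
  show thesis
  proof (rule that[of "- \<rho> y"])
   show "- \<rho> y > 0" using rho_neg sub y by auto
   fix x assume "x \<in> closure \<Omega>" "- (- \<rho> y) < \<rho> x"
   then show "\<exists>p\<in>\<Gamma>. dist x p < e" using y(2)[of x] by (fastforce simp: S_def dist_commute)
  qed
 qed
qed

lemma ex_grad_lower: "\<exists>c>0. \<forall>p\<in>\<Gamma>. c \<le> norm (grad \<rho> p)"
proof -
 have "continuous_on \<Gamma> (\<lambda>x. norm (grad \<rho> x))"
  using C1_on_continuous_grad[OF C1_rho] by (auto intro!: continuous_intros intro: continuous_on_subset)
 then obtain y where "y \<in> \<Gamma>" "\<And>x. x \<in> \<Gamma> ==> norm (grad \<rho> y) \<le> norm (grad \<rho> x)"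
  using continuous_attains_inf[OF compact_frontier_Omega frontier_ne] by blast
 then show ?thesis using grad_rho_nz by (intro exI[of _ "norm (grad \<rho> y)"]) auto
qed

definition c0 where "c0 = (SOME c. c > 0 \<and> (\<forall>p\<in>\<Gamma>. c \<le> norm (grad \<rho> p)))"

lemma c0: "c0 > 0" "p \<in> \<Gamma> ==> c0 \<le> norm (grad \<rho> p)"
 using someI_ex[OF ex_grad_lower[unfolded Bex_def]] unfolding c0_def by auto

text \<open>Within this radius the gradient changes by at most \<kappa> c0 / 4, a small fraction of
  its own size, so a single direction represents all normals of a cell up to the factor 1 -
  \<kappa>.\<close>

lemma grad_rho_near:
 assumes p: "p \<in> \<Gamma>" and k: "0 < \<kappa>" and x: "norm (x - p) \<le> \<kappa> * c0 / (4 * (real DIM('a) * L2))" and k1: "\<kappa> \<le> 1"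
 shows "(1 - \<kappa>) * norm (grad \<rho> x) \<le> grad \<rho> x \<bullet> sgn (grad \<rho> p)" "norm (grad \<rho> x) \<ge> c0 / 2"
proof -
 define \<Lambda> where "\<Lambda> = real DIM('a) * L2"
 have L: "\<Lambda> > 0" unfolding \<Lambda>_def using L2(1) by simp
 have d: "norm (grad \<rho> x - grad \<rho> p) \<le> \<kappa> * c0 / 4"
 proof -
  have "norm (grad \<rho> x - grad \<rho> p) \<le> \<Lambda> * norm (x - p)" unfolding \<Lambda>_def by (rule grad_rho_lip)
  also have "\<dots> \<le> \<Lambda> * (\<kappa> * c0 / (4 * \<Lambda>))" using x L by (intro mult_left_mono) (auto simp: \<Lambda>_def)
  finally show ?thesis using L by simp
 qed
 define n where "n = sgn (grad \<rho> p)"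
 have n: "norm n = 1" "grad \<rho> p \<bullet> n = norm (grad \<rho> p)"
  using grad_rho_nz[OF p] by (auto simp: n_def norm_sgn sgn_div_norm dot_square_norm power2_eq_square)
 have "\<kappa> * c0 \<le> c0" using k1 c0(1) by simp
 have g: "norm (grad \<rho> x) \<ge> norm (grad \<rho> p) - \<kappa> * c0 / 4" "norm (grad \<rho> x) \<le> norm (grad \<rho> p) + \<kappa> * c0 / 4"
  using d norm_triangle_ineq2[of "grad \<rho> p" "grad \<rho> x"] norm_triangle_ineq2[of "grad \<rho> x" "grad \<rho> p"] by (auto simp: norm_minus_commute)
 then show g2: "norm (grad \<rho> x) \<ge> c0 / 2" using c0(2)[OF p] \<open>\<kappa> * c0 \<le> c0\<close> c0(1) by linarith
 have "\<bar>(grad \<rho> x - grad \<rho> p) \<bullet> n\<bar> \<le> \<kappa> * c0 / 4"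
  using Cauchy_Schwarz_ineq2[of "grad \<rho> x - grad \<rho> p" n] d n by simp
 moreover have "(grad \<rho> x - grad \<rho> p) \<bullet> n = grad \<rho> x \<bullet> n - norm (grad \<rho> p)" using n by (simp add: inner_diff_left)
 ultimately have "grad \<rho> x \<bullet> n \<ge> norm (grad \<rho> p) - \<kappa> * c0 / 4" by linarith
 then have "grad \<rho> x \<bullet> n \<ge> norm (grad \<rho> x) - \<kappa> * c0 / 2" using g by linarith
 moreover have "\<kappa> * (c0 / 2) \<le> \<kappa> * norm (grad \<rho> x)" using g2 k by (intro mult_left_mono) auto
 ultimately show "(1 - \<kappa>) * norm (grad \<rho> x) \<le> grad \<rho> x \<bullet> sgn (grad \<rho> p)"
  by (simp add: n_def algebra_simps)
qed

text \<open>Translating the cylinder over the shadow of C by a small multiple of n, the difference of the two integrals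
  of the composition lives on a thin slab, whose volume the isodiametric inequality bounds.\<close>

lemma flux_cell:
 assumes \<theta>: "\<And>r. (\<theta> has_real_derivative \<theta>' r) (at r)" "continuous_on UNIV \<theta>'" "\<And>r. \<theta>' r \<ge> 0" "\<And>r. -1 \<le> \<theta> r" "\<And>r. \<theta> r \<le> 0"
  and n: "norm n = 1" and k: "0 \<le> \<kappa>" "\<kappa> < 1" and C: "compact C" and c: "c \<in> C" and d: "d > 0"
  and diam: "\<And>x y. x \<in> C ==> y \<in> C ==> norm (x - y) \<le> d"
  and dir: "\<And>x. x \<in> cball c (3 * d) ==> (1 - \<kappa>) * norm (grad \<rho> x) \<le> grad \<rho> x \<bullet> n"
 shows "(LBINT x. indicator C x * (\<theta>' (\<rho> x) * norm (grad \<rho> x)))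
   \<le> unit_ball_vol (real (DIM('a) - 1)) * (d / 2) ^ (DIM('a) - 1) / (1 - \<kappa>)"
proof -
 have nn: "n \<bullet> n = 1" using n by (simp add: dot_square_norm)
 define \<omega> where "\<omega> = unit_ball_vol (real (DIM('a) - 1)) * (d / 2) ^ (DIM('a) - 1)"
 have w0: "\<omega> \<ge> 0" using d by (simp add: \<omega>_def)
 have pc: "continuous_on UNIV (perp n)" unfolding perp_def[abs_def] by (intro continuous_intros)
 define PC where "PC = perp n ` C"
 have PCc: "closed PC" unfolding PC_def using C pc by (intro compact_imp_closed compact_continuous_image) (auto intro: continuous_on_subset)
 have pp: "perp n (x + s *\<^sub>R n) = perp n x" for x s by (simp add: perp_def inner_add_left nn algebra_simps)
 have np: "(norm x)\<^sup>2 = (norm (perp n x))\<^sup>2 + (x \<bullet> n)\<^sup>2" for x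
  unfolding power2_norm_eq_inner perp_def by (simp add: inner_diff_left inner_diff_right nn inner_commute power2_eq_square algebra_simps)
 have npl: "norm (perp n x) \<le> norm x" for x
  by (rule power2_le_imp_le) (use np[of x] in auto)
 define a where "a = c \<bullet> n - d"
 define Z where "Z = {x. perp n x \<in> PC \<and> a \<le> x \<bullet> n \<and> x \<bullet> n < a + 3 * d}"
 have pvb: "{x. perp n x \<in> PC} \<in> sets borel"
 proof -
  have "closed (perp n -` PC)" by (rule continuous_closed_vimage[OF PCc]) (use pc in \<open>simp add: continuous_on_eq_continuous_at\<close>)
  then show ?thesis by (simp add: vimage_def)
 qed
 have slabb: "{x::'a. r \<le> x \<bullet> n \<and> x \<bullet> n < s} \<in> sets borel" for r s by measurable
 have Zb: "Z \<in> sets borel"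
 proof -
  have "Z = {x. perp n x \<in> PC} \<inter> {x. a \<le> x \<bullet> n \<and> x \<bullet> n < a + 3 * d}" by (auto simp: Z_def)
  then show ?thesis using pvb slabb by auto
 qed
 have PCd: "norm (y - z) \<le> d" if yz: "y \<in> PC" "z \<in> PC" for y z
 proof -
  obtain y' z' where "y = perp n y'" "z = perp n z'" "y' \<in> C" "z' \<in> C" using yz by (auto simp: PC_def)
  then show ?thesis using npl[of "y' - z'"] diam[of y' z'] by (simp add: perp_diff)
 qed
 have CZ: "C \<subseteq> Z"
 proof
  fix x assume x: "x \<in> C"
  show "x \<in> Z"
  proof -
   have "\<bar>(x - c) \<bullet> n\<bar> \<le> d" using Cauchy_Schwarz_ineq2[of "x - c" n] n diam[OF x c] by simp
   moreover have "perp n x \<in> PC" using x by (simp add: PC_def)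
   ultimately show ?thesis using d unfolding Z_def a_def abs_le_iff by (simp add: inner_diff_left)
  qed
 qed
 have Zball: "Z \<subseteq> cball c (3 * d)"
 proof
  fix x assume x: "x \<in> Z"
  have "norm (perp n (x - c)) \<le> d" unfolding perp_diff using x c by (intro PCd) (auto simp: Z_def PC_def)
  then have "(norm (perp n (x - c)))\<^sup>2 \<le> d\<^sup>2" by (intro power_mono) auto
  moreover have "\<bar>(x - c) \<bullet> n\<bar> \<le> 2 * d" using x by (auto simp: Z_def a_def inner_diff_left)
  then have "((x - c) \<bullet> n)\<^sup>2 \<le> (2 * d)\<^sup>2" by (rule abs_le_square_iff[THEN iffD1, OF order_trans]) (use d in simp)
  moreover have "(2 * d)\<^sup>2 = 4 * d\<^sup>2" "(3 * d)\<^sup>2 = 9 * d\<^sup>2" by (simp_all add: power_mult_distrib)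
  ultimately have "(norm (perp n (x - c)))\<^sup>2 + ((x - c) \<bullet> n)\<^sup>2 \<le> (3 * d)\<^sup>2" using zero_le_power2[of d] by linarith
  then have "(norm (x - c))\<^sup>2 \<le> (3 * d)\<^sup>2" unfolding np[of "x - c"] .
  then have "norm (x - c) \<le> 3 * d" by (rule power2_le_imp_le) (use d in simp)
  then show "x \<in> cball c (3 * d)" by (simp add: dist_norm norm_minus_commute)
 qed
 have rc: "continuous_on UNIV \<rho>" and gc: "continuous_on UNIV (grad \<rho>)"
  using C1_on_continuous[OF C1_rho] C1_on_continuous_grad[OF C1_rho] by auto
 have tc: "continuous_on UNIV (\<lambda>x. \<theta>' (\<rho> x))" by (rule continuous_on_compose2[OF \<theta>(2) rc]) auto
 define G where "G x = \<theta> (\<rho> x)" for x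
 define g where "g x = \<theta>' (\<rho> x) *\<^sub>R grad \<rho> x" for x
 have Gg: "GDERIV G x :> g x" for x unfolding G_def g_def by (rule GDERIV_DERIV_compose[OF gderiv_rho \<theta>(1)])
 have gcont: "continuous_on UNIV g" unfolding g_def[abs_def] by (intro continuous_intros tc gc)
 have Gcont: "continuous_on UNIV G" using Gg by (auto intro: continuous_at_imp_continuous_on gderiv_isCont)
 obtain B where B: "B > 0" "\<And>x. norm (g x) \<le> B"
 proof -
  obtain B where B: "B > 0" "\<And>z. z \<in> K ==> norm (g z) \<le> B" using bounded_on_compact[OF gcont compact_K] by auto
  then have "norm (g x) \<le> B" for x using grad_rho_outside[of x] by (cases "x \<in> K") (auto simp: g_def)
  then show thesis using that B(1) by blast
 qed
 have iZ: "integrable lborel (\<lambda>x. indicator Z x * f x)" if "f \<in> borel_measurable borel" "\<And>x. \<bar>f x\<bar> \<le> M" for f :: "'a \<Rightarrow> real" and M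
 proof (rule Bochner_Integration.integrable_bound[OF integrable_cball_const[of c "3 * d" M]])
  show "(\<lambda>x. indicator Z x * f x) \<in> borel_measurable lborel" using that(1) Zb by measurable
  have "M \<ge> 0" using that(2)[of c] by linarith
  then show "AE x in lborel. norm (indicator Z x * f x) \<le> norm (indicator (cball c (3 * d)) x * M)"
   using that(2) Zball by (intro AE_I2) (auto simp: indicator_def)
 qed
 have gm: "(\<lambda>x. g x \<bullet> n) \<in> borel_measurable borel" using gcont by (intro borel_measurable_continuous_onI continuous_intros)
 have gb: "\<bar>g x \<bullet> n\<bar> \<le> B" for x using Cauchy_Schwarz_ineq2[of "g x" n] B(2)[of x] n by simp
 have Gm: "G \<in> borel_measurable borel" using Gcont by (rule borel_measurable_continuous_onI)
 have Gt: "(\<lambda>x. G (x + s *\<^sub>R n)) \<in> borel_measurable borel" for s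
  by (intro borel_measurable_continuous_onI continuous_on_compose2[OF Gcont]) (auto intro!: continuous_intros)
 have Gb: "\<bar>G x\<bar> \<le> 1" "-1 \<le> G x" "G x \<le> 0" for x using \<theta>(4,5)[of "\<rho> x"] by (auto simp: G_def abs_le_iff)
 define F where "F s = (LBINT x. indicator Z x * G (x + s *\<^sub>R n))" for s
 have i1: "integrable lborel (\<lambda>x. indicator Z x * G (x + s *\<^sub>R n))" for s by (rule iZ[OF Gt]) (rule Gb)
 have dF: "(F has_real_derivative (LBINT x. indicator Z x * (g x \<bullet> n))) (at 0)"
 proof -
  have "(F has_real_derivative (LBINT x. indicator Z x * (g (x + 0 *\<^sub>R n) \<bullet> n))) (at 0)"
   unfolding F_def[abs_def]
  proof (rule has_derivative_under_integral[where e=1 and g="\<lambda>x. indicator (cball c (3 * d)) x * B"])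
   fix h and x :: 'a
   show "((\<lambda>h. indicator Z x * G (x + h *\<^sub>R n)) has_real_derivative indicator Z x * (g (x + h *\<^sub>R n) \<bullet> n)) (at h)"
    by (intro DERIV_cmult gderiv_line Gg)
   show "\<bar>indicator Z x * (g (x + h *\<^sub>R n) \<bullet> n)\<bar> \<le> indicator (cball c (3 * d)) x * B"
    using gb B(1) Zball by (auto simp: indicator_def)
  qed (rule i1 integrable_cball_const zero_less_one)+
  then show ?thesis by simp
 qed
 \<comment> \<open>After a shift of variables the integrand is G times a difference of indicators.
   As G lies between - 1 and 0, only points of Z whose backward translate is outside Z count
   positively, and these lie in a slab of height s at the bottom.\<close>
 have Fle: "F s - F 0 \<le> \<omega> * s" if s: "s > 0" for s
 proof -
  define bot where "bot = {x. perp n x \<in> PC \<and> a \<le> x \<bullet> n \<and> x \<bullet> n < a + s}"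
  have botb: "bot \<in> sets borel"
  proof -
   have "bot = {x. perp n x \<in> PC} \<inter> {x. a \<le> x \<bullet> n \<and> x \<bullet> n < a + s}" by (auto simp: bot_def)
   then show ?thesis using pvb slabb by auto
  qed
  have em: "emeasure lborel bot \<le> ennreal (\<omega> * s)"
  proof -
   have "emeasure lborel bot \<le> ennreal (unit_ball_vol (real (DIM('a) - 1)) * (d / 2) ^ (DIM('a) - 1) * (a + s - a))"
   proof (rule isodiametric_cylinder[OF n d botb])
    show "norm (perp n (x - y)) \<le> d" if "x \<in> bot" "y \<in> bot" for x y
     unfolding perp_diff using that by (intro PCd) (auto simp: bot_def)
   qed (use s in \<open>auto simp: bot_def\<close>)
   then show ?thesis by (simp add: \<omega>_def)
  qed
  have i2: "integrable lborel (\<lambda>x. indicator Z x * G x)" using i1[of 0] by simp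
  have i3: "integrable lborel (\<lambda>y. indicator Z (y - s *\<^sub>R n) * G y)"
   using integrable_translate[OF i1[of s], of "- s *\<^sub>R n"] by (simp add: algebra_simps)
  have "emeasure lborel bot < top" using em ennreal_less_top le_less_trans by blast
  then have ib: "integrable lborel (indicator bot :: 'a \<Rightarrow> real)" using botb by (intro integrable_real_indicator) auto
  have "F s = (LBINT y. indicator Z (y - s *\<^sub>R n) * G y)"
   unfolding F_def by (rule integral_translate'[where a="s *\<^sub>R n"]) (use i1 in auto)
  then have "F s - F 0 = (LBINT y. indicator Z (y - s *\<^sub>R n) * G y - indicator Z y * G y)"
   using i2 i3 by (simp add: F_def)
  also have "\<dots> \<le> integral\<^sup>L lborel (indicator bot :: 'a \<Rightarrow> real)"
  proof (rule integral_mono)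
   fix y
   have sh: "perp n (y - s *\<^sub>R n) = perp n y" using pp[of y "- s"] by simp
   have sn: "(y - s *\<^sub>R n) \<bullet> n = y \<bullet> n - s" by (simp add: inner_diff_left nn)
   have "y \<in> Z ==> y - s *\<^sub>R n \<notin> Z ==> y \<in> bot" using s by (auto simp: Z_def bot_def sh sn)
   then show "indicator Z (y - s *\<^sub>R n) * G y - indicator Z y * G y \<le> indicator bot y"
    using Gb(2,3)[of y] by (auto simp: indicator_def)
  qed (use i2 i3 ib in auto)
  also have "\<dots> = measure lborel bot" by simp
  also have "\<dots> \<le> \<omega> * s" using em w0 s by (simp add: measure_def enn2real_leI)
  finally show ?thesis .
 qed
 have main: "(LBINT x. indicator Z x * (g x \<bullet> n)) \<le> \<omega>"
 proof (rule ccontr)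
  assume "\<not> ?thesis"
  then obtain e where "e > 0" "\<And>h. 0 < h ==> h < e ==> F 0 - \<omega> * 0 < F (0 + h) - \<omega> * (0 + h)"
   using DERIV_pos_inc_right[OF DERIV_diff[OF dF DERIV_cmult[OF DERIV_ident, of \<omega>]]] by auto
  from this(2)[of "e / 2"] this(1) show False using Fle[of "e / 2"] by simp
 qed
 have tm: "(\<lambda>x. \<theta>' (\<rho> x) * norm (grad \<rho> x)) \<in> borel_measurable borel"
  by (intro borel_measurable_continuous_onI continuous_intros tc gc)
 have "(LBINT x. indicator C x * (\<theta>' (\<rho> x) * norm (grad \<rho> x))) \<le> (LBINT x. (indicator Z x * (g x \<bullet> n)) / (1 - \<kappa>))"
 proof (rule integral_mono)
  have "integrable lborel (\<lambda>x. indicator C x *\<^sub>R (\<theta>' (\<rho> x) * norm (grad \<rho> x)))"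
   by (intro borel_integrable_compact C continuous_intros continuous_on_subset[OF tc] continuous_on_subset[OF gc]) auto
  then show "integrable lborel (\<lambda>x. indicator C x * (\<theta>' (\<rho> x) * norm (grad \<rho> x)))" by simp
  show "integrable lborel (\<lambda>x. (indicator Z x * (g x \<bullet> n)) / (1 - \<kappa>))"
   by (intro integrable_divide iZ[OF gm]) (use gb in auto)
  fix x
  show "indicator C x * (\<theta>' (\<rho> x) * norm (grad \<rho> x)) \<le> (indicator Z x * (g x \<bullet> n)) / (1 - \<kappa>)"
  proof (cases "x \<in> Z")
   case True
   have "(1 - \<kappa>) * norm (grad \<rho> x) \<le> grad \<rho> x \<bullet> n" using True Zball dir by blast
   then have "\<theta>' (\<rho> x) * ((1 - \<kappa>) * norm (grad \<rho> x)) \<le> \<theta>' (\<rho> x) * (grad \<rho> x \<bullet> n)" using \<theta>(3) by (intro mult_left_mono) auto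
   then have 1: "\<theta>' (\<rho> x) * norm (grad \<rho> x) \<le> (g x \<bullet> n) / (1 - \<kappa>)" using k by (simp add: g_def field_simps)
   moreover have "0 \<le> \<theta>' (\<rho> x) * norm (grad \<rho> x)" using \<theta>(3) by simp
   ultimately show ?thesis using True by (auto simp: indicator_def)
  next
   case False
   then have "x \<notin> C" using CZ by auto
   then show ?thesis using False by simp
  qed
 qed
 also have "\<dots> \<le> \<omega> / (1 - \<kappa>)" using main k by (simp add: divide_right_mono)
 finally show ?thesis by (simp add: \<omega>_def)
qed

end

text \<open>A C^1 hump on [0, 3], whose normalized integral \<open>spline\<close> is a C^2 step from
  0 to 1. Two derivatives are needed because the derivative of the cutoff is itself differentiated
  in the tangential flux.\<close>

definition hump :: "real \<Rightarrow> real" where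
 "hump t = (max 0 (t * (3 - t)))\<^sup>2"

definition hump_integral :: "real \<Rightarrow> real" where
 "hump_integral t = (LBINT s=0..t. hump s)"

definition spline :: "real \<Rightarrow> real" where
 "spline t = hump_integral t / hump_integral 3"

definition dspline :: "real \<Rightarrow> real" where
 "dspline t = hump t / hump_integral 3"

definition ddspline :: "real \<Rightarrow> real" where
 "ddspline t = 2 * max 0 (t * (3 - t)) * (3 - 2 * t) / hump_integral 3"

lemma continuous_hump: "continuous_on S hump"
 unfolding hump_def[abs_def] by (intro continuous_intros)

lemma hump_integral_deriv: "(hump_integral has_real_derivative hump t) (at t)"
proof -
 have "(hump_integral has_vector_derivative hump t) (at t within {-\<bar>t\<bar>-1..\<bar>t\<bar>+1})"
  unfolding hump_integral_def[abs_def] zero_ereal_def by (rule interval_integral_FTC2) (auto intro: continuous_hump)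
 moreover have "at t within {-\<bar>t\<bar>-1..\<bar>t\<bar>+1} = at t" by (rule at_within_Icc_at) auto
 ultimately show ?thesis by (simp add: has_real_derivative_iff_has_vector_derivative)
qed

lemma hump_integral_mono: "s \<le> t ==> hump_integral s \<le> hump_integral t"
 by (rule DERIV_nonneg_imp_nondecreasing) (auto simp: hump_def intro!: exI hump_integral_deriv)

lemma hump_zero: "t \<le> 0 \<or> 3 \<le> t ==> hump t = 0"
 by (auto simp: hump_def mult_le_0_iff)

lemma hump_integral_const: "s \<le> t ==> t \<le> 0 \<or> 3 \<le> s ==> hump_integral s = hump_integral t"
 by (intro antisym[OF hump_integral_mono] DERIV_nonpos_imp_nonincreasing[of s t hump_integral])
  (auto simp: hump_zero intro!: exI[of _ 0] intro: DERIV_cong[OF hump_integral_deriv])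

lemma hump_integral_pos: "hump_integral 0 = 0" "hump_integral 3 > 0"
proof -
 show z: "hump_integral 0 = 0" by (simp add: hump_integral_def zero_ereal_def[symmetric])
 obtain z where "0 < z" "z < 3" "hump_integral 3 - hump_integral 0 = (3 - 0) * hump z"
  using MVT2[of 0 3 hump_integral hump] hump_integral_deriv by auto
 then show "hump_integral 3 > 0" using z by (simp add: hump_def)
qed

lemma spline_deriv: "(spline has_real_derivative dspline t) (at t)"
 unfolding spline_def[abs_def] dspline_def by (rule DERIV_cdivide[OF hump_integral_deriv])

lemma dspline_deriv: "(dspline has_real_derivative ddspline t) (at t)"
proof -
 have "((\<lambda>t. t * (3 - t)) has_real_derivative 3 - 2 * t) (at t)" by (auto intro!: derivative_eq_intros)
 from DERIV_cdivide[OF DERIV_chain2[OF has_real_derivative_pos_part_power[of 2] this], of "hump_integral 3"]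
 show ?thesis unfolding dspline_def[abs_def] hump_def ddspline_def by simp
qed

lemma continuous_ddspline: "continuous_on UNIV ddspline"
 unfolding ddspline_def[abs_def] using hump_integral_pos(2) by (intro continuous_intros) auto

lemma continuous_dspline: "continuous_on UNIV dspline"
 unfolding dspline_def[abs_def] using hump_integral_pos(2) by (intro continuous_intros continuous_hump) auto

lemma dspline_nonneg: "dspline t \<ge> 0"
 unfolding dspline_def hump_def using hump_integral_pos(2) by simp

lemma dspline_zero: "t \<le> 0 \<or> 3 \<le> t ==> dspline t = 0"
 by (simp add: dspline_def hump_zero)

lemma spline_zero: "t \<le> 0 ==> spline t = 0"
 using hump_integral_const[of t 0] hump_integral_pos by (simp add: spline_def)

lemma spline_one: "3 \<le> t ==> spline t = 1"
 using hump_integral_const[of 3 t] hump_integral_pos by (simp add: spline_def)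

lemma spline_bounds: "0 \<le> spline t" "spline t \<le> 1"
proof -
 have m: "spline s \<le> spline t" if "s \<le> t" for s t
  unfolding spline_def using hump_integral_mono[OF that] hump_integral_pos(2) by (simp add: divide_right_mono)
 show "0 \<le> spline t" using m[of "min t 0" t] spline_zero[of "min t 0"] by simp
 show "spline t \<le> 1" using m[of t "max t 3"] spline_one[of "max t 3"] by simp
qed

context domain
begin

section \<open>Hausdorff measure of the boundary and flux through strips\<close>

definition rad :: "real \<Rightarrow> real" where "rad \<kappa> = \<kappa> * c0 / (4 * (real DIM('a) * L2))"

lemma rad_pos: "\<kappa> > 0 ==> rad \<kappa> > 0"
 unfolding rad_def using c0(1) L2(1) by simp

lemma grad_rho_near_rad:
 assumes "p \<in> \<Gamma>" "0 < \<kappa>" "\<kappa> \<le> 1" "norm (x - p) \<le> rad \<kappa>"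
 shows "(1 - \<kappa>) * norm (grad \<rho> x) \<le> grad \<rho> x \<bullet> sgn (grad \<rho> p)" "norm (grad \<rho> x) \<ge> c0 / 2"
 using grad_rho_near[OF assms(1,2) assms(4)[unfolded rad_def] assms(3)] by auto

lemma neighborhood_in_cover:
 assumes "open V" "\<Gamma> \<subseteq> V"
 obtains e where "e > 0" "\<And>x p. p \<in> \<Gamma> ==> dist x p < e ==> x \<in> V"
proof -
 obtain e where e: "e > 0" "(\<Union>p\<in>\<Gamma>. ball p e) \<subseteq> V"
  using compact_subset_open_imp_ball_epsilon_subset[OF compact_frontier_Omega assms] by metis
 show thesis
 proof (rule that[OF e(1)])
  fix x p assume "p \<in> \<Gamma>" "dist x p < e"
  then have "x \<in> (\<Union>p\<in>\<Gamma>. ball p e)" by (auto simp: dist_commute)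
  then show "x \<in> V" using e(2) by (rule subsetD[rotated])
 qed
qed

text \<open>The normalization of the Hausdorff measure assigns to a set the volume of a ball of the
  same diameter, so the share of a cell is exactly the isodiametric bound in
  \<open>flux_cell\<close>.\<close>

lemma hausdorff_const_ball:
 assumes "DIM('a) \<ge> 2" "d \<ge> 0"
 shows "hausdorff_const (real DIM('a) - 1) * d powr (real DIM('a) - 1) = unit_ball_vol (real (DIM('a) - 1)) * (d / 2) ^ (DIM('a) - 1)"
proof -
 define s where "s = DIM('a) - 1"
 have s: "real DIM('a) - 1 = real s" "s \<ge> 1" using assms by (auto simp: s_def)
 have p: "d powr real s = d ^ s" using assms(2) s(2) by (cases "d = 0") (auto simp: powr_realpow)
 show ?thesis unfolding s s_def[symmetric] p hausdorff_const_def unit_ball_vol_def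
  by (simp add: powr_realpow power_divide field_simps)
qed

lemma hausdorff_const_pos: "DIM('a) \<ge> 2 ==> hausdorff_const (real DIM('a) - 1) > 0"
 unfolding hausdorff_const_def by (intro divide_pos_pos mult_pos_pos Gamma_real_pos add_nonneg_pos) auto

text \<open>Some component of the gradient is at least c0 / N at p, hence at least half of that
  nearby. Two boundary points have equal \<rho>, so by the mean value theorem their difference is
  orthogonal to the gradient at an intermediate point, and the coordinate with the large gradient
  component can be solved for.\<close>

lemma frontier_lipschitz_graph:
 obtains r c where "r > 0" "c \<ge> 0" "\<And>p. p \<in> \<Gamma> ==> \<exists>b\<in>Basis. \<forall>x\<in>\<Gamma> \<inter> ball p r. \<forall>y\<in>\<Gamma> \<inter> ball p r.
  \<bar>(x - y) \<bullet> b\<bar> \<le> c * (\<Sum>i\<in>Basis - {b}. \<bar>(x - y) \<bullet> i\<bar>)"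
proof
 define n where "n = real DIM('a)"
 define \<eta> where "\<eta> = c0 / (2 * n)"
 have n: "n > 0" by (simp add: n_def)
 have \<eta>: "\<eta> > 0" using c0(1) n by (simp add: \<eta>_def)
 show "\<eta> / (n * L2) > 0" using \<eta> n L2(1) by simp
 show "L1 / \<eta> \<ge> 0" using \<eta> L1(1) by simp
 fix p assume p: "p \<in> \<Gamma>"
 have "\<exists>b\<in>Basis. 2 * \<eta> \<le> \<bar>grad \<rho> p \<bullet> b\<bar>"
 proof (rule ccontr)
  assume "\<not> ?thesis"
  then have "(\<Sum>b\<in>Basis. \<bar>grad \<rho> p \<bullet> b\<bar>) < (\<Sum>b\<in>(Basis::'a set). 2 * \<eta>)" by (intro sum_strict_mono) (auto simp: not_le)
  also have "\<dots> = c0" using n by (simp add: \<eta>_def n_def)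
  finally show False using norm_le_l1[of "grad \<rho> p"] c0(2)[OF p] by linarith
 qed
 then obtain b where b: "b \<in> Basis" "2 * \<eta> \<le> \<bar>grad \<rho> p \<bullet> b\<bar>" by blast
 show "\<exists>b\<in>Basis. \<forall>x\<in>\<Gamma> \<inter> ball p (\<eta> / (n * L2)). \<forall>y\<in>\<Gamma> \<inter> ball p (\<eta> / (n * L2)).
  \<bar>(x - y) \<bullet> b\<bar> \<le> L1 / \<eta> * (\<Sum>i\<in>Basis - {b}. \<bar>(x - y) \<bullet> i\<bar>)"
 proof (intro bexI[OF _ b(1)] ballI)
  fix x y assume x: "x \<in> \<Gamma> \<inter> ball p (\<eta> / (n * L2))" and y: "y \<in> \<Gamma> \<inter> ball p (\<eta> / (n * L2))"
  have "((\<lambda>t. \<rho> (y + t *\<^sub>R (x - y))) has_real_derivative grad \<rho> (y + t *\<^sub>R (x - y)) \<bullet> (x - y)) (at t)" for t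
   by (rule gderiv_line[OF gderiv_rho])
  from MVT2[OF zero_less_one this] obtain t where t: "0 < t" "t < 1" "grad \<rho> (y + t *\<^sub>R (x - y)) \<bullet> (x - y) = 0"
   using rho_zero x y by auto
  define z where "z = y + t *\<^sub>R (x - y)"
  have "z = (1 - t) *\<^sub>R y + t *\<^sub>R x" by (simp add: z_def algebra_simps)
  then have "z \<in> ball p (\<eta> / (n * L2))" using convexD_alt[OF convex_ball, of y p _ x t] x y t by simp
  then have "n * L2 * norm (z - p) \<le> \<eta>" using n L2(1) by (simp add: dist_norm norm_minus_commute field_simps)
  then have "norm (grad \<rho> z - grad \<rho> p) \<le> \<eta>" using grad_rho_lip[of z p] by (simp add: n_def)
  then have "\<bar>(grad \<rho> z - grad \<rho> p) \<bullet> b\<bar> \<le> \<eta>" using Basis_le_norm[OF b(1), of "grad \<rho> z - grad \<rho> p"] by linarith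
  then have zb: "\<eta> \<le> \<bar>grad \<rho> z \<bullet> b\<bar>" using b(2) by (simp add: inner_diff_left)
  have "(grad \<rho> z \<bullet> b) * ((x - y) \<bullet> b) + (\<Sum>i\<in>Basis - {b}. (grad \<rho> z \<bullet> i) * ((x - y) \<bullet> i)) = 0"
   using t(3) b(1) unfolding z_def[symmetric] by (subst (asm) euclidean_inner) (simp add: sum.remove)
  then have "\<bar>grad \<rho> z \<bullet> b\<bar> * \<bar>(x - y) \<bullet> b\<bar> = \<bar>\<Sum>i\<in>Basis - {b}. (grad \<rho> z \<bullet> i) * ((x - y) \<bullet> i)\<bar>"
   unfolding abs_mult[symmetric] by linarith
  also have "\<dots> \<le> (\<Sum>i\<in>Basis - {b}. L1 * \<bar>(x - y) \<bullet> i\<bar>)"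
   by (intro order_trans[OF sum_abs] sum_mono) (auto simp: abs_mult intro!: mult_right_mono order_trans[OF Basis_le_norm L1(2)])
  finally have "\<eta> * \<bar>(x - y) \<bullet> b\<bar> \<le> L1 * (\<Sum>i\<in>Basis - {b}. \<bar>(x - y) \<bullet> i\<bar>)"
   using mult_right_mono[OF zb, of "\<bar>(x - y) \<bullet> b\<bar>"] by (simp add: sum_distrib_left)
  then show "\<bar>(x - y) \<bullet> b\<bar> \<le> L1 / \<eta> * (\<Sum>i\<in>Basis - {b}. \<bar>(x - y) \<bullet> i\<bar>)" using \<eta> by (simp add: field_simps)
 qed
qed

text \<open>\<open>surface_area\<close> passes through \<open>enn2real\<close>, which sends infinity
  to 0, so finiteness has to come first. The boundary is a finite union of Lipschitz graphs, and a
  grid of mesh h in the remaining N - 1 coordinates needs of the order of h^(1 - N) cells of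
  diameter at most \<open>K * h\<close>.\<close>

lemma hausdorff_finite:
 assumes N: "DIM('a) \<ge> 2"
 shows "hausdorff_measure (real DIM('a) - 1) \<Gamma> < top"
proof -
 obtain r c where r: "r > 0" and c: "c \<ge> 0" and graph: "\<And>p. p \<in> \<Gamma> ==> \<exists>b\<in>Basis. \<forall>x\<in>\<Gamma> \<inter> ball p r. \<forall>y\<in>\<Gamma> \<inter> ball p r.
  \<bar>(x - y) \<bullet> b\<bar> \<le> c * (\<Sum>i\<in>Basis - {b}. \<bar>(x - y) \<bullet> i\<bar>)"
  by (rule frontier_lipschitz_graph) blast
 obtain b where b: "\<And>p. p \<in> \<Gamma> ==> b p \<in> Basis" "\<And>p x y. p \<in> \<Gamma> ==> x \<in> \<Gamma> \<inter> ball p r ==> y \<in> \<Gamma> \<inter> ball p r ==>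
  \<bar>(x - y) \<bullet> b p\<bar> \<le> c * (\<Sum>i\<in>Basis - {b p}. \<bar>(x - y) \<bullet> i\<bar>)" using graph by metis
 have "\<Gamma> \<subseteq> (\<Union>p\<in>\<Gamma>. ball p r)" using r by auto
 from compactE_image[OF compact_frontier_Omega _ this] obtain P where P: "P \<subseteq> \<Gamma>" "finite P" "\<Gamma> \<subseteq> (\<Union>p\<in>P. ball p r)" by auto
 define m where "m = DIM('a) - 1"
 have m: "m \<ge> 1" "real DIM('a) - 1 = real m" using N by (auto simp: m_def)
 define hc where "hc = hausdorff_const (real m)"
 have hc: "hc > 0" using hausdorff_const_pos[OF N] by (simp add: hc_def m)
 define K where "K = (c + 1) * real m"
 have K: "K > 0" using c m by (simp add: K_def)
 have "hausdorff_measure (real m) \<Gamma> \<le> ennreal (real (card P) * (hc * ((2 * r + 3) * K) ^ m))"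
  unfolding hausdorff_measure_def hc_def[symmetric]
 proof (rule SUP_least)
  fix \<delta> :: real assume \<delta>: "\<delta> \<in> {0<..}"
  \<comment> \<open>The mesh is fine enough for diameters at most \<delta>; h \<le> 1 makes the
    final bound independent of \<delta>.\<close>
  define h where "h = min 1 (\<delta> / K)"
  have h: "0 < h" "h \<le> 1" "K * h \<le> \<delta>" using \<delta> K by (auto simp: h_def min_def field_simps)
  define M where "M = \<lceil>r / h\<rceil>"
  have M: "M \<ge> 0" "r / h \<le> of_int M" "of_int M \<le> r / h + 1" using divide_pos_pos[OF r h(1)] unfolding M_def by linarith+
  define J where "J = Sigma P (\<lambda>p. Basis - {b p} \<rightarrow>\<^sub>E {-M..M})"
  define S where "S j = {x \<in> \<Gamma> \<inter> ball (fst j) r. \<forall>i\<in>Basis - {b (fst j)}. \<lfloor>(x - fst j) \<bullet> i / h\<rfloor> = snd j i}" for j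
  have J: "finite J" unfolding J_def by (intro finite_SigmaI finite_PiE P(2)) auto
  have "card J = (\<Sum>p\<in>P. nat (2 * M + 1) ^ m)"
   unfolding J_def using P b(1) by (subst card_SigmaI) (auto simp: card_PiE finite_PiE m_def card_Diff_singleton subset_iff)
  then have cJ: "real (card J) = real (card P) * (2 * of_int M + 1) ^ m" using M(1) by simp
  have d: "norm (x - y) \<le> K * h" if j: "j \<in> J" and x: "x \<in> S j" and y: "y \<in> S j" for j x y
  proof -
   define p where "p = fst j"
   have p: "p \<in> \<Gamma>" using j P(1) by (auto simp: p_def J_def)
   have "(\<Sum>i\<in>Basis - {b p}. \<bar>(x - y) \<bullet> i\<bar>) \<le> (\<Sum>i\<in>Basis - {b p}. h)"
   proof (rule sum_mono)
    fix i assume "i \<in> Basis - {b p}"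
    then have "\<lfloor>(x - p) \<bullet> i / h\<rfloor> = \<lfloor>(y - p) \<bullet> i / h\<rfloor>" using x y by (simp add: S_def p_def)
    then have "\<bar>(x - p) \<bullet> i / h - (y - p) \<bullet> i / h\<bar> \<le> 1" by linarith
    then show "\<bar>(x - y) \<bullet> i\<bar> \<le> h" using h(1) by (simp add: diff_divide_distrib[symmetric] inner_diff_left)
   qed
   then have s: "(\<Sum>i\<in>Basis - {b p}. \<bar>(x - y) \<bullet> i\<bar>) \<le> real m * h" using b(1)[OF p] by (simp add: m_def)
   have "norm (x - y) \<le> \<bar>(x - y) \<bullet> b p\<bar> + (\<Sum>i\<in>Basis - {b p}. \<bar>(x - y) \<bullet> i\<bar>)"
    using norm_le_l1[of "x - y"] b(1)[OF p] by (simp add: sum.remove)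
   also have "\<dots> \<le> c * (\<Sum>i\<in>Basis - {b p}. \<bar>(x - y) \<bullet> i\<bar>) + (\<Sum>i\<in>Basis - {b p}. \<bar>(x - y) \<bullet> i\<bar>)"
    using x y by (intro add_right_mono b(2)[OF p]) (auto simp: S_def p_def)
   also have "\<dots> \<le> c * (real m * h) + real m * h" using s c by (intro add_mono mult_left_mono)
   finally show ?thesis by (simp add: K_def algebra_simps)
  qed
  have cov: "\<exists>j\<in>J. x \<in> S j" if x: "x \<in> \<Gamma>" for x
  proof -
   obtain p where p: "p \<in> P" "x \<in> ball p r" using x P(3) by blast
   have "\<lfloor>(x - p) \<bullet> i / h\<rfloor> \<in> {-M..M}" if "i \<in> Basis" for i
   proof -
    have "\<bar>(x - p) \<bullet> i / h\<bar> \<le> r / h"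
     using Basis_le_norm[OF that, of "x - p"] p(2) h(1) by (simp add: dist_norm norm_minus_commute divide_right_mono)
    then show ?thesis using M(2) by (simp only: atLeastAtMost_iff le_floor_iff floor_le_iff) linarith
   qed
   then show ?thesis using x p unfolding J_def S_def
    by (intro bexI[of _ "(p, restrict (\<lambda>i. \<lfloor>(x - p) \<bullet> i / h\<rfloor>) (Basis - {b p}))"]) auto
  qed
  obtain f where f: "bij_betw f {0..<card J} J" using ex_bij_betw_nat_finite[OF J] by blast
  define C where "C i = (if i < card J then S (f i) else {})" for i
  have fJ: "f i \<in> J" if "i < card J" for i using f that by (auto simp: bij_betw_def)
  have dC: "diameter (C i) \<le> K * h" for i
   using d[OF fJ] K h(1) by (intro diameter_le) (auto simp: C_def split: if_splits)
  have bC: "bounded (C i)" for i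
   by (rule bounded_subset[OF compact_imp_bounded[OF compact_frontier_Omega]]) (auto simp: C_def S_def)
  show "(INF C\<in>{C :: nat \<Rightarrow> 'a set. \<Gamma> \<subseteq> (\<Union>i. C i) \<and> (\<forall>i. bounded (C i) \<and> diameter (C i) \<le> \<delta>)}.
    (\<Sum>i. ennreal (hc * diameter (C i) powr real m))) \<le> ennreal (real (card P) * (hc * ((2 * r + 3) * K) ^ m))"
  proof (rule INF_lower2[of C])
   have "x \<in> (\<Union>i. C i)" if x: "x \<in> \<Gamma>" for x
   proof -
    obtain j where "j \<in> J" "x \<in> S j" using cov[OF x] by blast
    moreover have "J = f ` {0..<card J}" using f by (simp add: bij_betw_def)
    ultimately obtain i where "i < card J" "x \<in> S (f i)" by force
    then show ?thesis by (auto simp: C_def)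
   qed
   moreover have "diameter (C i) \<le> \<delta>" for i using dC[of i] h by linarith
   ultimately show "C \<in> {C. \<Gamma> \<subseteq> (\<Union>i. C i) \<and> (\<forall>i. bounded (C i) \<and> diameter (C i) \<le> \<delta>)}"
    using bC by blast
   have "(\<Sum>i. ennreal (hc * diameter (C i) powr real m)) = (\<Sum>i<card J. ennreal (hc * diameter (C i) powr real m))"
    by (rule suminf_finite) (use m in \<open>auto simp: C_def\<close>)
   also have "\<dots> \<le> (\<Sum>i<card J. ennreal (hc * (K * h) ^ m))"
   proof (intro sum_mono ennreal_leI mult_left_mono)
    fix i
    have "diameter (C i) powr real m \<le> (K * h) powr real m" by (intro powr_mono2 dC diameter_ge_0 bC) simp
    then show "diameter (C i) powr real m \<le> (K * h) ^ m" using K h(1) by (simp add: powr_realpow)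
   qed (use hc in simp)
   also have "\<dots> = ennreal (real (card J) * (hc * (K * h) ^ m))"
    using hc K h by (simp add: ennreal_mult ennreal_of_nat_eq_real_of_nat)
   also have "real (card J) * (hc * (K * h) ^ m) = real (card P) * (hc * ((2 * of_int M + 1) * h * K) ^ m)"
    by (simp add: cJ power_mult_distrib mult_ac)
   also have "ennreal \<dots> \<le> ennreal (real (card P) * (hc * ((2 * r + 3) * K) ^ m))"
   proof (intro ennreal_leI mult_left_mono power_mono mult_right_mono)
    have "(2 * of_int M + 1) * h \<le> (2 * (r / h + 1) + 1) * h" using M h by (intro mult_right_mono) auto
    also have "\<dots> = 2 * r + 3 * h" using h by (simp add: field_simps)
    finally show "(2 * of_int M + 1) * h \<le> 2 * r + 3" using h by linarith
   qed (use hc K h M in auto)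
   finally show "(\<Sum>i. ennreal (hc * diameter (C i) powr real m)) \<le> ennreal (real (card P) * (hc * ((2 * r + 3) * K) ^ m))" .
  qed
 qed
 then show ?thesis unfolding m(2) using le_less_trans ennreal_less_top by blast
qed

text \<open>A cover nearly attaining the Hausdorff sum at scale \<delta> is opened up and made
  finite by compactness; each piece is then handled by \<open>flux_cell\<close> with the normal at
  one of its boundary points. Only an upper bound of the flux is wanted, so overlaps do no
  harm.\<close>

lemma strip_area:
 assumes N: "DIM('a) \<ge> 2" and k: "0 < \<kappa>" "\<kappa> < 1"
 obtains t where "t > 0"
  "\<And>\<theta> \<theta>'. (\<And>r. (\<theta> has_real_derivative \<theta>' r) (at r)) ==> continuous_on UNIV \<theta>' ==> (\<And>r. \<theta>' r \<ge> 0) ==> (\<And>r. -1 \<le> \<theta> r) ==> (\<And>r. \<theta> r \<le> 0) ==>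
   (\<And>r. r \<le> - t ==> \<theta>' r = 0) ==>
   (LBINT x. indicator \<Omega> x * (\<theta>' (\<rho> x) * norm (grad \<rho> x))) \<le> (surface_area \<Gamma> + 2 * \<kappa>) / (1 - \<kappa>)"
proof -
 define s where "s = real DIM('a) - 1"
 define hc where "hc = hausdorff_const s"
 have hc: "hc > 0" unfolding hc_def s_def by (rule hausdorff_const_pos[OF N])
 have s: "s > 0" using N by (simp add: s_def)
 define h where "h = surface_area \<Gamma>"
 have h: "hausdorff_measure s \<Gamma> = ennreal h"
  unfolding h_def surface_area_def s_def by (rule ennreal_enn2real[symmetric]) (rule hausdorff_finite[OF N])
 have h0: "h \<ge> 0" by (simp add: h_def surface_area_def)
 \<comment> \<open>After enlargement the pieces have diameter below 2 \<delta>, and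
   \<open>flux_cell\<close> looks at three times the diameter; 6 \<delta> is the radius in
   \<open>grad_rho_near\<close>.\<close>
 define \<delta> where "\<delta> = rad \<kappa> / 6"
 have \<delta>: "\<delta> > 0" using rad_pos[OF k(1)] by (simp add: \<delta>_def)
 let ?F = "\<lambda>C :: nat \<Rightarrow> 'a set. (\<Sum>i. ennreal (hc * diameter (C i) powr s))"
 let ?CC = "{C :: nat \<Rightarrow> 'a set. \<Gamma> \<subseteq> (\<Union>i. C i) \<and> (\<forall>i. bounded (C i) \<and> diameter (C i) \<le> \<delta>)}"
 have "(INF C\<in>?CC. ?F C) \<le> hausdorff_measure s \<Gamma>"
  unfolding hausdorff_measure_def hc_def by (rule SUP_upper2[of \<delta>]) (use \<delta> in auto)
 also have "\<dots> < ennreal (h + \<kappa>)" unfolding h using k h0 by (simp add: ennreal_lessI)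
 finally obtain C where C: "\<Gamma> \<subseteq> (\<Union>i. C i)" "\<And>i. bounded (C i)" "\<And>i. diameter (C i) \<le> \<delta>" "?F C < ennreal (h + \<kappa>)"
  unfolding INF_less_iff by auto
 define D where "D i = diameter (C i)" for i
 have D0: "D i \<ge> 0" for i unfolding D_def by (rule diameter_ge_0[OF C(2)])
 \<comment> \<open>Each diameter is enlarged strictly, which leaves room for open neighbourhoods and
   gives single points a positive diameter. The costs form a geometric series with sum
   \<kappa>.\<close>
 have "\<exists>d. D i < d \<and> d < D i + \<delta> \<and> hc * d powr s < hc * D i powr s + \<kappa> * (1/2) ^ Suc i" for i
 proof -
  have "continuous_on {0..} (\<lambda>d. hc * d powr s)" using s by (intro continuous_intros continuous_on_powr') auto
  then have "((\<lambda>d. hc * d powr s) \<longlongrightarrow> hc * D i powr s) (at (D i) within {0..})" using D0[of i] by (simp add: continuous_on_def)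
  then have "((\<lambda>d. hc * d powr s) \<longlongrightarrow> hc * D i powr s) (at_right (D i))"
   by (rule tendsto_within_subset) (use D0[of i] in auto)
  then have "\<forall>\<^sub>F d in at_right (D i). hc * d powr s < hc * D i powr s + \<kappa> * (1/2) ^ Suc i"
   using k by (intro order_tendstoD) auto
  moreover have "\<forall>\<^sub>F d in at_right (D i). d \<in> {D i<..<D i + \<delta>}" using \<delta> by (intro eventually_at_rightI[of _ "D i + \<delta>"]) auto
  ultimately have "\<forall>\<^sub>F d in at_right (D i). D i < d \<and> d < D i + \<delta> \<and> hc * d powr s < hc * D i powr s + \<kappa> * (1/2) ^ Suc i"
   by eventually_elim auto
  then show ?thesis using eventually_happens'[OF trivial_limit_at_right_real] by blast
 qed
 then obtain d where d: "\<And>i. D i < d i" "\<And>i. d i < D i + \<delta>" "\<And>i. hc * d i powr s < hc * D i powr s + \<kappa> * (1/2) ^ Suc i" by metis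
 define V where "V i = (\<Union>y\<in>C i. ball y ((d i - D i) / 2))" for i
 have Vo: "open (V i)" for i unfolding V_def by auto
 have CV: "C i \<subseteq> V i" for i unfolding V_def using d(1)[of i] by auto
 have Vd: "norm (x - y) \<le> d i" if xyV: "x \<in> V i" "y \<in> V i" for i x y
 proof -
  obtain x' y' where xy: "x' \<in> C i" "dist x' x < (d i - D i) / 2" "y' \<in> C i" "dist y' y < (d i - D i) / 2" using xyV by (auto simp: V_def)
  have "dist x' y' \<le> D i" unfolding D_def by (rule diameter_bounded_bound[OF C(2) xy(1,3)])
  then show ?thesis using xy dist_triangle[of x y x'] dist_triangle[of x' y y'] by (simp add: dist_norm norm_minus_commute)
 qed
 have Vb: "bounded (V i)" for i
 proof (cases "V i = {}")
  case False
  then obtain y where "y \<in> V i" by blast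
  then show ?thesis using Vd[of _ i y] by (intro boundedI[of _ "norm y + d i"]) (smt (verit) norm_triangle_sub)
 qed simp
 have cl: "norm (x - y) \<le> d i" if xy: "x \<in> closure (V i)" "y \<in> closure (V i)" for x y i
 proof -
  have "closure (V i) \<times> closure (V i) \<subseteq> {z. norm (fst z - snd z) \<le> d i}"
   unfolding closure_Times[symmetric]
   by (rule closure_minimal) (use Vd in \<open>auto intro!: closed_Collect_le continuous_intros\<close>)
  then show ?thesis using xy by auto
 qed
 have cov: "\<Gamma> \<subseteq> (\<Union>i\<in>UNIV. V i)" using C(1) CV by (meson SUP_mono' order_trans)
 obtain I0 where I0: "finite I0" "\<Gamma> \<subseteq> (\<Union>i\<in>I0. V i)"
  by (rule compactE_image[OF compact_frontier_Omega _ cov]) (use Vo in auto)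
 \<comment> \<open>Pieces missing the boundary offer no normal direction and are dropped; the others
   still cover the boundary.\<close>
 define I where "I = {i\<in>I0. V i \<inter> \<Gamma> \<noteq> {}}"
 have I: "finite I" "\<Gamma> \<subseteq> (\<Union>i\<in>I. V i)" using I0 unfolding I_def by (simp, blast)
 have "open (\<Union>i\<in>I. V i)" using Vo by auto
 then obtain e where e: "e > 0" "\<And>x p. p \<in> \<Gamma> ==> dist x p < e ==> x \<in> (\<Union>i\<in>I. V i)"
  using neighborhood_in_cover[OF _ I(2)] by metis
 obtain t where t: "t > 0" "\<And>x. x \<in> closure \<Omega> ==> - t < \<rho> x ==> \<exists>p\<in>\<Gamma>. dist x p < e"
  using strip_near_frontier[OF e(1)] by metis
 have rc: "continuous_on UNIV \<rho>" and gc: "continuous_on UNIV (grad \<rho>)"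
  using C1_on_continuous[OF C1_rho] C1_on_continuous_grad[OF C1_rho] by auto
 show thesis
 proof (rule that[OF t(1)])
  fix \<theta> \<theta>' :: "real \<Rightarrow> real"
  assume \<theta>: "\<And>r. (\<theta> has_real_derivative \<theta>' r) (at r)" "continuous_on UNIV \<theta>'" "\<And>r. \<theta>' r \<ge> 0" "\<And>r. -1 \<le> \<theta> r" "\<And>r. \<theta> r \<le> 0"
   and z: "\<And>r. r \<le> - t ==> \<theta>' r = 0"
  define g where "g x = \<theta>' (\<rho> x) * norm (grad \<rho> x)" for x
  have gcont: "continuous_on UNIV g" unfolding g_def by (intro continuous_intros gc continuous_on_compose2[OF \<theta>(2) rc]) auto
  have g0: "g x \<ge> 0" for x using \<theta>(3) by (simp add: g_def)
  have cell: "(LBINT x. indicator (closure (V i)) x * g x) \<le> (hc * d i powr s) / (1 - \<kappa>)" if i: "i \<in> I" for i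
  proof -
   obtain p where p: "p \<in> V i" "p \<in> \<Gamma>" using i by (auto simp: I_def)
   have dp: "d i > 0" using D0[of i] d(1)[of i] by linarith
   have "(LBINT x. indicator (closure (V i)) x * g x) \<le> unit_ball_vol (real (DIM('a) - 1)) * (d i / 2) ^ (DIM('a) - 1) / (1 - \<kappa>)"
    unfolding g_def
   proof (rule flux_cell[OF \<theta>])
    show "norm (sgn (grad \<rho> p)) = 1" using grad_rho_nz[OF p(2)] by (simp add: norm_sgn)
    show "compact (closure (V i))" by (rule compact_closure[THEN iffD2, OF Vb])
    show "p \<in> closure (V i)" using p(1) closure_subset by (rule subsetD[rotated])
    show "d i > 0" by (rule dp)
    show "norm (x - y) \<le> d i" if "x \<in> closure (V i)" "y \<in> closure (V i)" for x y by (rule cl[OF that])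
    show "(1 - \<kappa>) * norm (grad \<rho> x) \<le> grad \<rho> x \<bullet> sgn (grad \<rho> p)" if x: "x \<in> cball p (3 * d i)" for x
    proof (rule grad_rho_near(1)[OF p(2) k(1)])
     have "norm (x - p) \<le> 3 * d i" using x by (simp add: dist_norm norm_minus_commute)
     also have "\<dots> \<le> 3 * (2 * \<delta>)" using d(2)[of i] C(3)[of i] by (simp add: D_def)
     also have "\<dots> = rad \<kappa>" by (simp add: \<delta>_def)
     finally show "norm (x - p) \<le> \<kappa> * c0 / (4 * (real DIM('a) * L2))" by (simp add: rad_def)
    qed (use k in auto)
   qed (use k in auto)
   also have "unit_ball_vol (real (DIM('a) - 1)) * (d i / 2) ^ (DIM('a) - 1) = hc * d i powr s"
    unfolding hc_def s_def by (rule hausdorff_const_ball[OF N, symmetric]) (use dp in simp)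
   finally show ?thesis .
  qed
  have ic: "integrable lborel (\<lambda>x. indicator (closure (V i)) x * g x)" for i
  proof -
   have "integrable lborel (\<lambda>x. indicator (closure (V i)) x *\<^sub>R g x)"
    by (rule borel_integrable_compact) (use compact_closure[THEN iffD2, OF Vb] gcont in \<open>auto intro: continuous_on_subset\<close>)
   then show ?thesis by simp
  qed
  have "(LBINT x. indicator \<Omega> x * g x) \<le> (LBINT x. \<Sum>i\<in>I. indicator (closure (V i)) x * g x)"
  proof (rule integral_mono)
   show "integrable lborel (\<lambda>x. indicator \<Omega> x * g x)"
   proof (rule Bochner_Integration.integrable_bound)
    have "integrable lborel (\<lambda>x. indicator (closure \<Omega>) x *\<^sub>R g x)"
     by (rule borel_integrable_compact[OF compact_closure_Omega continuous_on_subset[OF gcont]]) simp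
    then show "integrable lborel (\<lambda>x. indicator (closure \<Omega>) x * g x)" by simp
    show "(\<lambda>x. indicator \<Omega> x * g x) \<in> borel_measurable lborel"
     using borel_measurable_continuous_onI[OF gcont] borel_open[OF open_Omega] by (intro borel_measurable_times borel_measurable_indicator) auto
    show "AE x in lborel. norm (indicator \<Omega> x * g x) \<le> norm (indicator (closure \<Omega>) x * g x)"
     using closure_Omega by (intro AE_I2) (auto simp: indicator_def)
   qed
   show "integrable lborel (\<lambda>x. \<Sum>i\<in>I. indicator (closure (V i)) x * g x)" using ic by auto
   fix x
   show "indicator \<Omega> x * g x \<le> (\<Sum>i\<in>I. indicator (closure (V i)) x * g x)"
   proof (cases "x \<in> \<Omega> \<and> g x \<noteq> 0")
    case True
    then have "- t < \<rho> x" using z[of "\<rho> x"] by (force simp: g_def)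
    moreover have "x \<in> closure \<Omega>" using True closure_Omega by auto
    ultimately obtain p where "p \<in> \<Gamma>" "dist x p < e" using t(2) by blast
    then have "x \<in> (\<Union>i\<in>I. V i)" by (rule e(2))
    then obtain i where i: "i \<in> I" "x \<in> V i" by blast
    then have "x \<in> closure (V i)" by (metis closure_subset subsetD)
    then have "g x = indicator (closure (V i)) x * g x" by simp
    also have "\<dots> \<le> (\<Sum>i\<in>I. indicator (closure (V i)) x * g x)"
     using i(1) I(1) g0 by (intro member_le_sum) auto
    finally show ?thesis using True by simp
   next
    case False
    then have "indicator \<Omega> x * g x = 0" by (auto simp: indicator_def)
    moreover have "0 \<le> (\<Sum>i\<in>I. indicator (closure (V i)) x * g x)" using g0 by (intro sum_nonneg) auto
    ultimately show ?thesis by linarith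
   qed
  qed
  also have "\<dots> = (\<Sum>i\<in>I. (LBINT x. indicator (closure (V i)) x * g x))"
   by (rule Bochner_Integration.integral_sum) (rule ic)
  also have "\<dots> \<le> (\<Sum>i\<in>I. (hc * d i powr s) / (1 - \<kappa>))" by (rule sum_mono[OF cell])
  also have "\<dots> = (\<Sum>i\<in>I. hc * d i powr s) / (1 - \<kappa>)" by (simp add: sum_divide_distrib)
  also have "\<dots> \<le> (h + 2 * \<kappa>) / (1 - \<kappa>)"
  proof (rule divide_right_mono)
   have "(\<Sum>i\<in>I. hc * d i powr s) \<le> (\<Sum>i\<in>I. hc * D i powr s + \<kappa> * (1/2) ^ Suc i)" by (rule sum_mono) (use d(3) in \<open>auto intro: less_imp_le\<close>)
   also have "\<dots> = (\<Sum>i\<in>I. hc * D i powr s) + \<kappa> * (\<Sum>i\<in>I. (1/2) ^ Suc i)" by (simp add: sum.distrib sum_distrib_left)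
   also have "\<dots> \<le> (h + \<kappa>) + \<kappa> * 1"
   proof (intro add_mono mult_left_mono)
    have "ennreal (\<Sum>i\<in>I. hc * D i powr s) = (\<Sum>i\<in>I. ennreal (hc * D i powr s))" using hc by (subst sum_ennreal) auto
    also have "\<dots> \<le> ?F C" unfolding D_def by (intro sum_le_suminf I(1)) auto
    also have "\<dots> \<le> ennreal (h + \<kappa>)" using C(4) by (rule less_imp_le)
    finally show "(\<Sum>i\<in>I. hc * D i powr s) \<le> h + \<kappa>" using h0 k by (subst (asm) ennreal_le_iff) auto
    have "(\<Sum>i\<in>I. (1/2::real) ^ Suc i) \<le> (\<Sum>i. (1/2) ^ Suc i)" by (intro sum_le_suminf I(1) sums_summable[OF power_half_series]) auto
    also have "\<dots> = 1" using power_half_series by (rule sums_unique[symmetric])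
    finally show "(\<Sum>i\<in>I. (1/2::real) ^ Suc i) \<le> 1" .
   qed (use k in auto)
   finally show "(\<Sum>i\<in>I. hc * d i powr s) \<le> h + 2 * \<kappa>" by simp
  qed (use k in auto)
  finally show "(LBINT x. indicator \<Omega> x * (\<theta>' (\<rho> x) * norm (grad \<rho> x))) \<le> (surface_area \<Gamma> + 2 * \<kappa>) / (1 - \<kappa>)"
   by (simp add: g_def h_def)
 qed
qed

end

section \<open>Boundary behaviour of the torsion function\<close>

lemma harm_lincomb: "open \<Omega> ==> harm \<Omega> f ==> harm \<Omega> g ==> harm \<Omega> (\<lambda>x. a * f x + c * g x)"
 unfolding harm_def by (intro conjI ballI C2_on_lincomb(1)) (auto simp: C2_on_lincomb(2)[where U = \<Omega>])

lemma harm_cong: "open \<Omega> ==> (\<And>x. x \<in> \<Omega> ==> f x = g x) ==> harm \<Omega> f ==> harm \<Omega> g"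
 unfolding harm_def using C2_on_cong laplacian_cong by metis

lemma harm_sum:
 fixes f :: "'i \<Rightarrow> 'a::euclidean_space \<Rightarrow> real"
 assumes "finite I" and \<Omega>: "open \<Omega>" and "\<And>i. i \<in> I ==> harm \<Omega> (f i)"
 shows "harm \<Omega> (\<lambda>x. \<Sum>i\<in>I. a i * f i x)"
 using assms(1,3)
proof (induction I rule: finite_induct)
 case empty
 have z: "pd b (\<lambda>x::'a. 0::real) = (\<lambda>_. 0)" for b using gderiv_pd[OF GDERIV_const] by (auto simp: fun_eq_iff)
 show ?case using \<Omega> by (simp add: harm_def C2_on_iff laplacian_def z)
next
 case (insert i I)
 then have "harm \<Omega> (\<lambda>x. a i * f i x + 1 * (\<Sum>i\<in>I. a i * f i x))" by (intro harm_lincomb \<Omega>) auto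
 then show ?case using insert by simp
qed

lemma affine_C2: "C2_on UNIV (\<lambda>x. x \<bullet> b + c)" "laplacian (\<lambda>x::'a::euclidean_space. x \<bullet> b + c) x = 0"
proof -
 have g: "GDERIV (\<lambda>x. x \<bullet> b + c) x :> b" for x :: 'a
  using GDERIV_add[OF gderiv_inner_left GDERIV_const[of c x]] by simp
 have p: "pd d (\<lambda>x. x \<bullet> b + c) = (\<lambda>_. b \<bullet> d)" for d using gderiv_pd[OF g] by (auto simp: fun_eq_iff)
 have z: "pd d (\<lambda>x::'a. k::real) = (\<lambda>_. 0)" for d k using gderiv_pd[OF GDERIV_const] by (auto simp: fun_eq_iff)
 show "C2_on UNIV (\<lambda>x. x \<bullet> b + c)" unfolding C2_on_iff[OF open_UNIV] p by (auto intro: C1_on_add)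
 show "laplacian (\<lambda>x. x \<bullet> b + c) x = 0" unfolding laplacian_def p z by simp
qed

lemma harm_affine: "open \<Omega> ==> harm \<Omega> (\<lambda>x. x \<bullet> b + c)"
 unfolding harm_def using C2_on_subset[OF open_UNIV _ affine_C2(1)] affine_C2(2) by auto

lemma pd_shift: "pd b (\<lambda>x. f (x + v)) x = pd b f (x + v)"
 unfolding pd_def by (simp add: algebra_simps)

lemma C2_on_shift:
 assumes U: "open U" and f: "C2_on U f" and V: "open V" "\<And>x. x \<in> V ==> x + v \<in> U"
 shows "C2_on V (\<lambda>x. f (x + v))" "laplacian (\<lambda>x. f (x + v)) x = laplacian f (x + v)"
proof -
 have p: "pd b (\<lambda>x. f (x + v)) = (\<lambda>x. pd b f (x + v))" for b f by (rule ext) (rule pd_shift)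
 show "laplacian (\<lambda>x. f (x + v)) x = laplacian f (x + v)" unfolding laplacian_def p by simp
 have c: "C1_on V (\<lambda>x. g (x + v))" if g: "C1_on U g" for g
 proof (rule C1_onI)
  show "GDERIV (\<lambda>x. g (x + v)) x :> grad g (x + v)" if "x \<in> V" for x
  proof -
   have "GDERIV g (v + 1 *\<^sub>R x) :> grad g (x + v)" using C1_onD[OF g V(2)[OF that]] by (simp add: add.commute)
   from gderiv_scale_shift[OF this] show ?thesis by (simp add: add.commute)
  qed
  show "continuous_on V (\<lambda>x. grad g (x + v))"
   by (intro continuous_on_compose2[OF C1_on_continuous_grad[OF g]]) (auto intro!: continuous_intros V)
 qed
 show "C2_on V (\<lambda>x. f (x + v))" unfolding C2_on_iff[OF V(1)] p using f c unfolding C2_on_iff[OF U] by auto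
qed

text \<open>Apart from the continuity of u, nothing is assumed up to the boundary; gradient bounds
  there have to come from comparison with functions of \<rho>.\<close>

locale torsion = domain +
 fixes u :: "'a \<Rightarrow> real"
 assumes C2_u: "C2_on \<Omega> u" and cont_u: "continuous_on (closure \<Omega>) u"
  and lap_u: "\<And>x. x \<in> \<Omega> ==> laplacian u x = real DIM('a)" and u_zero: "\<And>x. x \<in> frontier \<Omega> ==> u x = 0"
begin

text \<open>Spelled with the coefficients \<open>1 / 2\<close> and \<open>- 1\<close> to be
  literally an instance of \<open>C2_on_lincomb\<close>.\<close>

definition hh :: "'a \<Rightarrow> 'a \<Rightarrow> real" where "hh p x = 1 / 2 * ((x - p) \<bullet> (x - p)) + - 1 * u x"

lemma C1_u: "C1_on \<Omega> u" and C1_pd_u: "b \<in> Basis ==> C1_on \<Omega> (pd b u)"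
 using C2_u C2_on_iff[OF open_Omega] by auto

lemma sqdist_C2_Omega: "C2_on \<Omega> (\<lambda>x. (x - p) \<bullet> (x - p))"
 by (rule C2_on_subset[OF open_UNIV open_Omega sqdist_C2(1)]) simp

lemma harm_hh: "harm \<Omega> (hh p)"
 unfolding harm_def hh_def[abs_def]
proof (intro conjI ballI C2_on_lincomb(1) open_Omega sqdist_C2_Omega C2_u)
 show "laplacian (\<lambda>x. 1 / 2 * ((x - p) \<bullet> (x - p)) + - 1 * u x) x = 0" if "x \<in> \<Omega>" for x
  unfolding C2_on_lincomb(2)[OF open_Omega sqdist_C2_Omega C2_u that] by (simp add: sqdist_C2 lap_u that)
qed

lemma grad_hh: "x \<in> \<Omega> ==> grad (hh p) x = (x - p) - grad u x"
 unfolding hh_def[abs_def] C2_on_lincomb(3)[OF open_Omega sqdist_C2_Omega C2_u] by (simp add: sqdist_C2)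

lemma pd_hh: "x \<in> \<Omega> ==> b \<in> Basis ==> pd b (hh p) x = (x - p) \<bullet> b - pd b u x"
 using grad_hh by (simp add: pd_eq_grad inner_diff_left)

text \<open>u is only given as C^2, so its Laplacian cannot simply be differentiated. But
  \<open>pd b u\<close> is a coordinate function minus \<open>pd b (hh 0)\<close>, and derivatives
  of harmonic functions are already known to be harmonic.\<close>

lemma harm_pd_u: "b \<in> Basis ==> harm \<Omega> (pd b u)"
proof -
 assume b: "b \<in> Basis"
 have "harm \<Omega> (\<lambda>x. 1 * (x \<bullet> b + 0) + - 1 * pd b (hh 0) x)"
  by (intro harm_lincomb harm_affine harm_pd open_Omega harm_hh b)
 then show ?thesis by (rule harm_cong[OF open_Omega, rotated]) (simp add: pd_hh b)
qed

lemma harm_dir_u: "harm \<Omega> (\<lambda>x. grad u x \<bullet> e)"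
proof -
 have "harm \<Omega> (\<lambda>x. \<Sum>b\<in>Basis. (e \<bullet> b) * pd b u x)" by (rule harm_sum[OF finite_Basis open_Omega harm_pd_u])
 moreover have "(\<lambda>x. \<Sum>b\<in>Basis. (e \<bullet> b) * pd b u x) = (\<lambda>x. grad u x \<bullet> e)"
  by (simp add: fun_eq_iff pd_eq_grad inner_commute[of _ e] euclidean_inner[of e "grad u _"])
 ultimately show ?thesis by simp
qed

lemma u_neg: "x \<in> \<Omega> ==> u x < 0" and u_nonpos: "y \<in> closure \<Omega> ==> u y \<le> 0"
proof -
 have np: "u y \<le> 0" if "y \<in> closure \<Omega>" for y
 proof (rule max_principle[OF open_Omega bounded_Omega C2_u cont_u _ _ that])
  show "laplacian u x > 0" if "x \<in> \<Omega>" for x using lap_u[OF that] by simp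
  show "u y \<le> 0" if "y \<in> closure \<Omega> - \<Omega>" for y using that closure_Omega u_zero by auto
 qed
 then show "y \<in> closure \<Omega> ==> u y \<le> 0" .
 assume x: "x \<in> \<Omega>"
 show "u x < 0"
 proof (rule ccontr)
  assume "\<not> ?thesis"
  then have "u y \<le> u x" if "y \<in> \<Omega>" for y using np[of y] that closure_Omega by auto
  from interior_max_laplacian[OF open_Omega C2_u x this] show False using lap_u[OF x] by simp
 qed
qed

lemma strip_grad_lower:
 "\<exists>t>0. \<forall>x\<in>closure \<Omega>. - t < \<rho> x \<longrightarrow> c0 / 2 \<le> norm (grad \<rho> x)"
proof -
 obtain t where t: "t > 0" "\<And>x. x \<in> closure \<Omega> ==> - t < \<rho> x ==> \<exists>p\<in>\<Gamma>. dist x p < rad 1"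
  using strip_near_frontier[OF rad_pos[of 1]] by auto
 show ?thesis
 proof (intro exI[of _ t] conjI t(1) ballI impI)
  fix x assume "x \<in> closure \<Omega>" "- t < \<rho> x"
  then obtain p where "p \<in> \<Gamma>" "dist x p < rad 1" using t(2) by blast
  then show "c0 / 2 \<le> norm (grad \<rho> x)" by (intro grad_rho_near_rad(2)[of p 1]) (auto simp: dist_norm)
 qed
qed

text \<open>In f(\<rho>) with f r = - r - k r^2, the quadratic term contributes - 2 k |grad
  \<rho>|^2 to the Laplacian and beats the Laplacian of \<rho>, whose sign is unknown, in a thin
  strip. Comparison there gives at most linear growth of - u; away from the strip a large factor
  suffices.\<close>

lemma ex_u_barrier: "\<exists>A>0. \<forall>x\<in>closure \<Omega>. - u x \<le> A * (- \<rho> x)"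
proof -
 obtain t0 where t0: "t0 > 0" "\<And>x. x \<in> closure \<Omega> ==> - t0 < \<rho> x ==> c0 / 2 \<le> norm (grad \<rho> x)"
  using strip_grad_lower by blast
 define \<Lambda> where "\<Lambda> = real DIM('a) * L2"
 have L: "\<Lambda> > 0" "\<And>x. \<bar>laplacian \<rho> x\<bar> \<le> \<Lambda>" using L2(1) laplacian_rho_bound by (auto simp: \<Lambda>_def)
 \<comment> \<open>Chosen so that 2 k (c0 / 2)^2 = \<Lambda> + 1: one unit is left after absorbing
   the Laplacian of \<rho>.\<close>
 define k where "k = 2 * (\<Lambda> + 1) / c0\<^sup>2"
 have k: "k > 0" using L c0(1) by (simp add: k_def)
 define t where "t = min t0 (1 / (2 * k))"
 have t: "t > 0" "t \<le> t0" "2 * k * t \<le> 1" using t0 k by (auto simp: t_def min_def field_simps)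
 obtain B where B: "B > 0" "\<And>z. z \<in> closure \<Omega> ==> norm (u z) \<le> B"
  using bounded_on_compact[OF cont_u compact_closure_Omega order_refl] by blast
 \<comment> \<open>\<open>real DIM('a) + 1\<close> beats the Laplacian of u; the last summand makes
   A t / 2 dominate |u| on the inner edge of the strip.\<close>
 define A where "A = real DIM('a) + 1 + 2 * B / t"
 have A: "A > real DIM('a)" "A > 0" "A * (t / 2) \<ge> B" using B t by (auto simp: A_def field_simps add_pos_pos)
 define f where "f r = - r - k * r\<^sup>2" for r :: real
 define f' where "f' r = - 1 - 2 * k * r" for r :: real
 define f'' where "f'' r = - 2 * k" for r :: real
 have d1: "(f has_real_derivative f' r) (at r)" for r unfolding f_def f'_def by (auto intro!: derivative_eq_intros)
 have d2: "(f' has_real_derivative f'' r) (at r)" for r unfolding f'_def f''_def by (auto intro!: derivative_eq_intros)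
 have fC: "C2_on UNIV (\<lambda>x. f (\<rho> x))"
  and fL: "laplacian (\<lambda>x. f (\<rho> x)) x = f'' (\<rho> x) * (norm (grad \<rho> x))\<^sup>2 + f' (\<rho> x) * laplacian \<rho> x" for x
  using C2_on_compose[OF open_UNIV C2_rho d1 d2] unfolding f''_def by auto
 define G where "G = \<Omega> \<inter> {x. - t < \<rho> x}"
 have rc: "continuous_on UNIV \<rho>" by (rule C1_on_continuous[OF C1_rho])
 have G: "open G" "bounded G" "G \<subseteq> \<Omega>" unfolding G_def using open_Omega bounded_Omega rc
  by (auto intro!: open_Int open_Collect_less continuous_intros intro: bounded_subset)
 have fl: "laplacian (\<lambda>x. f (\<rho> x)) x \<le> - 1" if x: "x \<in> G" for x
 proof -
  have "x \<in> closure \<Omega>" "- t0 < \<rho> x" "\<rho> x < 0" "- t < \<rho> x" using x t rho_neg closure_Omega by (auto simp: G_def)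
  then have "c0 / 2 \<le> norm (grad \<rho> x)" using t0 by blast
  then have "(c0 / 2)\<^sup>2 \<le> (norm (grad \<rho> x))\<^sup>2" using c0(1) by (intro power_mono) auto
  then have "2 * k * (c0 / 2)\<^sup>2 \<le> 2 * k * (norm (grad \<rho> x))\<^sup>2" using k by (intro mult_left_mono) auto
  moreover have "2 * k * (c0 / 2)\<^sup>2 = \<Lambda> + 1" using c0(1) by (simp add: k_def power2_eq_square)
  moreover have "\<bar>f' (\<rho> x)\<bar> \<le> 1"
  proof -
   have "k * (- \<rho> x) \<le> k * t" using k \<open>- t < \<rho> x\<close> by (intro mult_left_mono) auto
   moreover have "0 \<le> k * (- \<rho> x)" using k \<open>\<rho> x < 0\<close> by (intro mult_nonneg_nonneg) auto
   ultimately show ?thesis using t(3) by (simp add: f'_def abs_le_iff)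
  qed
  then have "\<bar>f' (\<rho> x)\<bar> * \<bar>laplacian \<rho> x\<bar> \<le> 1 * \<Lambda>" using L by (intro mult_mono) auto
  then have "f' (\<rho> x) * laplacian \<rho> x \<le> \<Lambda>" by (simp add: abs_mult[symmetric] abs_le_iff)
  ultimately show ?thesis unfolding fL f''_def by simp
 qed
 have half: "(- r) / 2 \<le> f r" "f r \<le> - r" if "- t \<le> r" "r \<le> 0" for r
 proof -
  have "k * (- r) \<le> k * t" using k that by (intro mult_left_mono) auto
  then have "k * (- r) * (- r) \<le> 1 / 2 * (- r)" using t(3) that by (intro mult_right_mono) auto
  then show "(- r) / 2 \<le> f r" by (simp add: f_def power2_eq_square)
  show "f r \<le> - r" using k by (simp add: f_def)
 qed
 define w where "w x = - 1 * u x + (- A) * f (\<rho> x)" for x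
 have fG: "C2_on G (\<lambda>x. f (\<rho> x))" by (rule C2_on_subset[OF open_UNIV G(1) fC]) simp
 have uG: "C2_on G u" by (rule C2_on_subset[OF open_Omega G(1) C2_u G(3)])
 have wle: "w x \<le> 0" if x: "x \<in> closure G" for x
 proof (rule max_principle[OF G(1,2) _ _ _ _ x])
  show "C2_on G w" unfolding w_def[abs_def] by (rule C2_on_lincomb(1)[OF G(1) uG fG])
  have "continuous_on (closure G) u" by (rule continuous_on_subset[OF cont_u closure_mono[OF G(3)]])
  moreover have "continuous_on (closure G) (\<lambda>x. f (\<rho> x))" using C1_on_continuous[of UNIV "\<lambda>x. f (\<rho> x)"] fC C2_on_iff[OF open_UNIV]
   by (auto intro: continuous_on_subset)
  ultimately show "continuous_on (closure G) w" unfolding w_def[abs_def] by (intro continuous_intros)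
  show "laplacian w x > 0" if x: "x \<in> G" for x
  proof -
   have "laplacian w x = - laplacian u x - A * laplacian (\<lambda>x. f (\<rho> x)) x"
    unfolding w_def[abs_def] using C2_on_lincomb(2)[OF G(1) uG fG x, of "-1" "-A"] by simp
   moreover have "A * laplacian (\<lambda>x. f (\<rho> x)) x \<le> A * (- 1)" using fl[OF x] A(2) by (intro mult_left_mono) auto
   ultimately show ?thesis using A(1) lap_u[of x] x G(3) by auto
  qed
  show "w y \<le> 0" if y: "y \<in> closure G - G" for y
  proof -
   have yc: "y \<in> closure \<Omega>" using y closure_mono[OF G(3)] by blast
   have "closure G \<subseteq> {x. - t \<le> \<rho> x}" unfolding G_def by (rule closure_minimal) (auto intro!: closed_Collect_le continuous_intros rc)
   then have ty: "- t \<le> \<rho> y" using y by auto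
   show ?thesis
   proof (cases "y \<in> \<Omega>")
    case True
    then have "\<rho> y = - t" using y ty by (auto simp: G_def)
    then have "t / 2 \<le> f (\<rho> y)" using half(1)[of "- t"] t by simp
    then have "A * (t / 2) \<le> A * f (\<rho> y)" using A by (intro mult_left_mono) auto
    then show ?thesis using A(3) B(2)[OF yc] by (simp add: w_def)
   next
    case False
    then have "y \<in> \<Gamma>" using yc closure_Omega by auto
    then show ?thesis using u_zero rho_zero by (simp add: w_def f_def)
   qed
  qed
 qed
 have "- u x \<le> A * (- \<rho> x)" if x: "x \<in> closure \<Omega>" for x
 proof (cases "x \<in> \<Omega>")
  case True
  show ?thesis
  proof (cases "x \<in> G")
   case xG: True
   then have "x \<in> closure G" by (metis closure_subset subsetD)
   then have "- u x \<le> A * f (\<rho> x)" using wle by (fastforce simp: w_def)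
   also have "\<dots> \<le> A * (- \<rho> x)" using half(2)[of "\<rho> x"] xG rho_neg[of x] A(2) by (intro mult_left_mono) (auto simp: G_def)
   finally show ?thesis .
  next
   case False
   then have "t / 2 \<le> - \<rho> x" using True t by (auto simp: G_def)
   then have "A * (t / 2) \<le> A * (- \<rho> x)" using A(2) by (intro mult_left_mono) auto
   then show ?thesis using A(3) B(2)[OF x] by simp
  qed
 next
  case False
  then have "x \<in> \<Gamma>" using x closure_Omega by auto
  then show ?thesis using u_zero rho_zero by simp
 qed
 then show ?thesis using A(2) by blast
qed

definition A0 where "A0 = (SOME A. A > 0 \<and> (\<forall>x\<in>closure \<Omega>. - u x \<le> A * (- \<rho> x)))"

lemma A0: "A0 > 0" "x \<in> closure \<Omega> ==> - u x \<le> A0 * (- \<rho> x)"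
 using someI_ex[OF ex_u_barrier[unfolded Bex_def]] unfolding A0_def by auto

lemma u_dist: "x \<in> closure \<Omega> ==> p \<in> \<Gamma> ==> \<bar>u x\<bar> \<le> A0 * L1 * norm (x - p)"
proof -
 assume x: "x \<in> closure \<Omega>" and p: "p \<in> \<Gamma>"
 have "- u x \<le> A0 * (- \<rho> x)" by (rule A0(2)[OF x])
 also have "\<dots> \<le> A0 * (L1 * norm (x - p))" using rho_lip[of x p] rho_zero[OF p] A0(1) by (intro mult_left_mono) auto
 finally show ?thesis using u_nonpos[OF x] by simp
qed

lemma nearest_point:
 assumes x: "x \<in> \<Omega>"
 obtains p where "p \<in> \<Gamma>" "dist x p > 0" "ball x (dist x p) \<subseteq> \<Omega>" "\<And>q. q \<in> \<Gamma> ==> dist x p \<le> dist x q"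
proof -
 obtain p where p: "p \<in> \<Gamma>" "\<And>q. q \<in> \<Gamma> ==> dist x p \<le> dist x q"
  using distance_attains_inf[OF compact_imp_closed[OF compact_frontier_Omega] frontier_ne, of x] by metis
 have "x \<noteq> p" using x p(1) frontier_disjoint by auto
 moreover have "ball x (dist x p) \<subseteq> \<Omega>"
 proof
  fix y assume y: "y \<in> ball x (dist x p)"
  show "y \<in> \<Omega>"
  proof (rule ccontr)
   assume "y \<notin> \<Omega>"
   have xb: "x \<in> ball x (dist x p)" using \<open>x \<noteq> p\<close> by simp
   have "ball x (dist x p) \<inter> \<Gamma> \<noteq> {}"
   proof (rule connected_Int_frontier)
    show "ball x (dist x p) \<inter> \<Omega> \<noteq> {}" using x xb by blast
    show "ball x (dist x p) - \<Omega> \<noteq> {}" using y \<open>y \<notin> \<Omega>\<close> by blast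
   qed (simp add: convex_connected)
   then obtain q where "q \<in> ball x (dist x p)" "q \<in> \<Gamma>" by blast
   then show False using p(2)[of q] by auto
  qed
 qed
 ultimately show thesis using that p by simp
qed

text \<open>The interior gradient estimate on half the distance s to the boundary has a factor 1 /
  s, but by the barrier u is of order s on that ball. Centring \<open>hh\<close> at x makes the
  quadratic part of order s^2.\<close>

lemma ex_grad_bound: "\<exists>M>0. \<forall>x\<in>\<Omega>. norm (grad u x) \<le> M"
proof -
 obtain D where D: "D > 0" "\<And>x. x \<in> closure \<Omega> ==> norm x \<le> D"
  using compact_imp_bounded[OF compact_closure_Omega] unfolding bounded_pos by blast
 define g where "g = gradc TYPE('a)"
 have g: "g > 0" using gradc_pos by (simp add: g_def)
 have AL: "A0 * L1 > 0" using A0(1) L1(1) by simp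
 have "norm (grad u x) \<le> g * (D / 2 + 3 * (A0 * L1))" if x: "x \<in> \<Omega>" for x
 proof -
  obtain p where p: "p \<in> \<Gamma>" "dist x p > 0" "ball x (dist x p) \<subseteq> \<Omega>" by (rule nearest_point[OF x])
  define s where "s = dist x p"
  have s: "s > 0" "s \<le> 2 * D" using p D(2)[of x] D(2)[of p] x closure_Omega dist_triangle[of x p 0] by (auto simp: s_def)
  have sub: "cball x (s / 2) \<subseteq> \<Omega>" using p(3) s(1) unfolding s_def[symmetric] by (auto simp: subset_eq)
  have "norm (grad (hh x) x) \<le> g / (s / 2) * ((s / 2)\<^sup>2 / 2 + A0 * L1 * (3 * s / 2))"
   unfolding g_def
  proof (rule harm_grad_sup_bound[OF open_Omega harm_hh _ sub])
   fix y assume y: "y \<in> cball x (s / 2)"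
   have yO: "y \<in> closure \<Omega>" using y sub closure_Omega by blast
   have n: "norm (y - x) \<le> s / 2" using y by (simp add: dist_norm norm_minus_commute)
   have "norm (y - p) \<le> 3 * s / 2" using n norm_triangle_ineq[of "y - x" "x - p"] by (simp add: s_def dist_norm)
   then have "A0 * L1 * norm (y - p) \<le> A0 * L1 * (3 * s / 2)" using AL by (intro mult_left_mono) auto
   then have "\<bar>u y\<bar> \<le> A0 * L1 * (3 * s / 2)" using u_dist[OF yO p(1)] by linarith
   moreover have "(y - x) \<bullet> (y - x) \<le> (s / 2)\<^sup>2" unfolding power2_norm_eq_inner[symmetric] using n by (intro power_mono) auto
   moreover have "0 \<le> (y - x) \<bullet> (y - x)" by simp
   ultimately show "\<bar>hh x y\<bar> \<le> (s / 2)\<^sup>2 / 2 + A0 * L1 * (3 * s / 2)" unfolding hh_def by linarith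
  qed (use s in auto)
  also have "\<dots> = g * (s / 4 + 3 * (A0 * L1))" using s by (simp add: power2_eq_square field_simps)
  also have "\<dots> \<le> g * (D / 2 + 3 * (A0 * L1))" using s g by (intro mult_left_mono) auto
  finally show ?thesis using grad_hh[OF x, of x] by simp
 qed
 moreover have "g * (D / 2 + 3 * (A0 * L1)) > 0" using g D(1) A0(1) L1(1) by (simp add: add_pos_pos)
 ultimately show ?thesis by blast
qed

definition M0 where "M0 = (SOME M. M > 0 \<and> (\<forall>x\<in>\<Omega>. norm (grad u x) \<le> M))"

lemma M0: "M0 > 0" "x \<in> \<Omega> ==> norm (grad u x) \<le> M0"
 using someI_ex[OF ex_grad_bound[unfolded Bex_def]] unfolding M0_def by auto

lemma u_lip_aux:
 assumes M: "M \<ge> 0" "\<And>x. x \<in> \<Omega> ==> norm (grad u x) \<le> M" and x: "x \<in> \<Omega>" and y: "y \<in> ball x s" and s: "ball x s \<subseteq> \<Omega>"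
 shows "\<bar>u x - u y\<bar> \<le> M * norm (x - y)"
proof (rule differentiable_bound_gderiv[OF convex_ball[of x s], of u "grad u"])
 have "0 < s" using y by (metis dist_not_less_zero mem_ball order.strict_trans2 linorder_not_le)
 then show "x \<in> ball x s" by simp
qed (use assms C1_onD[OF C1_u] in \<open>auto dest: subsetD[OF s]\<close>)

text \<open>\<Omega> need not be convex, so the gradient bound cannot be integrated along segments.
  If y is farther from x than the nearest boundary point of x, both points are within 2 |x - y| of
  that boundary point, and the linear decay of u takes over.\<close>

lemma ex_u_lip: "\<exists>M>0. \<forall>x\<in>closure \<Omega>. \<forall>y\<in>closure \<Omega>. \<bar>u x - u y\<bar> \<le> M * norm (x - y)"
proof -
 define M where "M = M0 + 3 * (A0 * L1)"
 have AL: "A0 * L1 > 0" using A0(1) L1(1) by simp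
 have M: "M > 0" "M0 \<le> M" "3 * (A0 * L1) \<le> M" using M0(1) AL by (auto simp: M_def)
 have "\<bar>u x - u y\<bar> \<le> M * norm (x - y)" if x: "x \<in> closure \<Omega>" and y: "y \<in> closure \<Omega>" for x y
 proof (cases "x \<in> \<Omega>")
  case True
  obtain p where p: "p \<in> \<Gamma>" "dist x p > 0" "ball x (dist x p) \<subseteq> \<Omega>" by (rule nearest_point[OF True])
  show ?thesis
  proof (cases "y \<in> ball x (dist x p)")
   case yb: True
   have "\<bar>u x - u y\<bar> \<le> M0 * norm (x - y)" by (rule u_lip_aux[OF _ M0(2) True yb p(3)]) (use M0(1) in auto)
   also have "\<dots> \<le> M * norm (x - y)" using M by (intro mult_right_mono) auto
   finally show ?thesis .
  next
   case False
   then have xp: "norm (x - p) \<le> norm (x - y)" by (simp add: dist_norm)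
   have yp: "norm (y - p) \<le> 2 * norm (x - y)" using xp norm_triangle_ineq[of "y - x" "x - p"] by (simp add: norm_minus_commute)
   have "A0 * L1 * norm (x - p) \<le> A0 * L1 * norm (x - y)" "A0 * L1 * norm (y - p) \<le> A0 * L1 * (2 * norm (x - y))"
    using xp yp AL by (intro mult_left_mono; simp)+
   then have "\<bar>u x - u y\<bar> \<le> 3 * (A0 * L1) * norm (x - y)" using u_dist[OF x p(1)] u_dist[OF y p(1)] by (simp add: algebra_simps)
   also have "\<dots> \<le> M * norm (x - y)" using M by (intro mult_right_mono) auto
   finally show ?thesis .
  qed
 next
  case False
  then have xf: "x \<in> \<Gamma>" using x closure_Omega by auto
  have "\<bar>u x - u y\<bar> \<le> A0 * L1 * norm (x - y)" using u_dist[OF y xf] u_zero[OF xf] by (simp add: norm_minus_commute)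
  also have "\<dots> \<le> M * norm (x - y)" using M AL by (intro mult_right_mono) auto
  finally show ?thesis .
 qed
 then show ?thesis using M(1) by blast
qed

text \<open>The barrier |y - p|^(3/4) + K (-rho)^(3/4) is strictly superharmonic near p because
  the concave power of -rho has Laplacian of order -(-rho)^(-5/4).\<close>

lemma tangential_one_sided:
 obtains C R where "C > 0" "0 < R" "R \<le> 1"
  "\<And>p e x :: 'a. p \<in> \<Gamma> ==> norm e = 1 ==> x \<in> \<Omega> ==> norm (x - p) < R ==>
    grad u x \<bullet> e \<le> C * norm (x - p) powr (3 / 4) + A0 * \<bar>grad \<rho> p \<bullet> e\<bar>"
proof -
 obtain t0 where t0: "t0 > 0" "\<And>x. x \<in> closure \<Omega> ==> - t0 < \<rho> x ==> c0 / 2 \<le> norm (grad \<rho> x)"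
  using strip_grad_lower by blast
 obtain Ml where Ml: "Ml > 0" "\<And>x y. x \<in> closure \<Omega> ==> y \<in> closure \<Omega> ==> \<bar>u x - u y\<bar> \<le> Ml * norm (x - y)"
  using ex_u_lip by blast
 define N where "N = real DIM('a)"
 define \<Lambda> where "\<Lambda> = N * L2"
 have N: "N > 0" by (simp add: N_def)
 have L: "\<Lambda> > 0" "\<And>x. \<bar>laplacian \<rho> x\<bar> \<le> \<Lambda>" using L2(1) laplacian_rho_bound by (auto simp: \<Lambda>_def N_def)
 \<comment> \<open>With the main part of K, the negative Laplacian of (- \<rho>)^(3/4) cancels the
   positive contribution of |y - p|^(3/4); the + 1 makes the sum strictly negative.\<close>
 define K where "K = 32 * N * L1 powr (5 / 4) / c0\<^sup>2 + 1"
 have K: "K > 0" using N c0(1) by (auto simp: K_def intro!: add_nonneg_pos)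
 \<comment> \<open>The second entry keeps points of \<Omega> near p inside the strip where |grad
   \<rho>| is at least c0 / 2; the third makes |\<rho>| times the Laplacian of \<rho> at most c0^2 /
   32.\<close>
 define R where "R = Min {1, t0 / (2 * L1), c0\<^sup>2 / (32 * \<Lambda> * L1)}"
 have R: "R > 0" "R \<le> 1" "R \<le> t0 / (2 * L1)" "R \<le> c0\<^sup>2 / (32 * \<Lambda> * L1)"
  using t0(1) L1(1) L(1) c0(1) by (auto simp: R_def)
 have R': "L1 * R < t0" "L1 * R * (32 * \<Lambda>) \<le> c0\<^sup>2" using R(3,4) t0(1) L1(1) L(1) by (auto simp: field_simps)
 \<comment> \<open>The two summands serve two parts of the boundary of the comparison domain:
   \<open>A0 * \<Lambda>\<close> where the shifted point is on the boundary of \<Omega>, the other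
   on the sphere of radius R about p.\<close>
 define C1 where "C1 = A0 * \<Lambda> + Ml / R powr (3 / 4)"
 have C1: "C1 > 0" "A0 * \<Lambda> \<le> C1" "Ml \<le> C1 * R powr (3 / 4)"
  using A0(1) L(1) Ml(1) R(1) by (auto simp: C1_def add_pos_pos field_simps)
 define C where "C = C1 * (1 + K * L1 powr (3 / 4))"
 have C: "C > 0" using C1 K by (auto simp: C_def intro!: mult_pos_pos add_pos_nonneg)
 show thesis
 proof (rule that[OF C R(1,2)])
  fix p e x :: 'a assume p: "p \<in> \<Gamma>" and e: "norm e = 1" and x: "x \<in> \<Omega>" and xp: "norm (x - p) < R"
  define B where "B y = ((y - p) \<bullet> (y - p)) powr (3 / 8) + K * (- \<rho> y) powr (3 / 4)" for y
  define G where "G = \<Omega> \<inter> ball p R"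
  have G: "open G" "bounded G" "G \<subseteq> \<Omega>" unfolding G_def using open_Omega bounded_Omega by (auto intro: bounded_subset)
  have psi: "- \<rho> y \<le> L1 * norm (y - p)" for y using rho_lip[of y p] rho_zero[OF p] by simp
  have pc: "p \<in> closure \<Omega>" using p closure_Omega by blast
  have yp: "y \<noteq> p" "(y - p) \<bullet> (y - p) > 0" "\<rho> y < 0" if "y \<in> \<Omega>" for y
   using that p frontier_disjoint rho_neg[OF that] by auto
  have sqC: "C2_on G (\<lambda>y. (y - p) \<bullet> (y - p))" by (rule C2_on_subset[OF open_UNIV G(1) sqdist_C2(1)]) simp
  have rC: "C2_on G \<rho>" by (rule C2_on_subset[OF open_UNIV G(1) C2_rho]) simp
  define f1 where "f1 s = (s::real) powr (3 / 8)" for s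
  define f2 where "f2 s = (- s) powr (3 / 4)" for s :: real
  have d1: "(f1 has_real_derivative 3 / 8 * s powr (- 5 / 8)) (at s)"
       "((\<lambda>s. 3 / 8 * s powr (- 5 / 8)) has_real_derivative - 15 / 64 * s powr (- 13 / 8)) (at s)" if "s > 0" for s
   unfolding f1_def using that by (auto intro!: derivative_eq_intros)
  have d2: "(f2 has_real_derivative - 3 / 4 * (- s) powr (- 1 / 4)) (at s)"
       "((\<lambda>s. - 3 / 4 * (- s) powr (- 1 / 4)) has_real_derivative - 3 / 16 * (- s) powr (- 5 / 4)) (at s)" if "s < 0" for s
   unfolding f2_def using that by (auto intro!: derivative_eq_intros)
  have GO: "y \<in> \<Omega>" if "y \<in> G" for y using that G(3) by blast
  have F1: "C2_on G (\<lambda>y. f1 ((y - p) \<bullet> (y - p)))"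
   "y \<in> G ==> laplacian (\<lambda>y. f1 ((y - p) \<bullet> (y - p))) y = - 15 / 64 * ((y - p) \<bullet> (y - p)) powr (- 13 / 8) * (norm (grad (\<lambda>y. (y - p) \<bullet> (y - p)) y))\<^sup>2
    + 3 / 8 * ((y - p) \<bullet> (y - p)) powr (- 5 / 8) * laplacian (\<lambda>y. (y - p) \<bullet> (y - p)) y" for y
   by (rule C2_on_compose[OF G(1) sqC d1, OF yp(2)[OF GO] yp(2)[OF GO]];
     force intro!: continuous_intros dest!: GO yp(2))+
  have F2: "C2_on G (\<lambda>y. f2 (\<rho> y))"
   "y \<in> G ==> laplacian (\<lambda>y. f2 (\<rho> y)) y = - 3 / 16 * (- \<rho> y) powr (- 5 / 4) * (norm (grad \<rho> y))\<^sup>2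
    + - 3 / 4 * (- \<rho> y) powr (- 1 / 4) * laplacian \<rho> y" for y
   by (rule C2_on_compose[OF G(1) rC d2, OF yp(3)[OF GO] yp(3)[OF GO]];
     force intro!: continuous_intros dest!: GO yp(3))+
  have Beq: "B = (\<lambda>y. 1 * f1 ((y - p) \<bullet> (y - p)) + K * f2 (\<rho> y))" by (simp add: B_def f1_def f2_def fun_eq_iff)
  have BC: "C2_on G B" unfolding Beq by (rule C2_on_lincomb(1)[OF G(1) F1(1) F2(1)])
  have Bc: "continuous_on (closure \<Omega>) B" unfolding B_def[abs_def]
  proof (intro continuous_on_add continuous_on_mult continuous_on_const continuous_on_powr')
   show "\<forall>x\<in>closure \<Omega>. 0 \<le> - \<rho> x \<and> (- \<rho> x = 0 \<longrightarrow> 0 < (3 / 4 :: real))"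
    using rho_neg rho_zero closure_Omega by force
   show "continuous_on (closure \<Omega>) (\<lambda>x. - \<rho> x)"
    by (intro continuous_intros continuous_on_subset[OF C1_on_continuous[OF C1_rho]]) simp
  qed (auto intro!: continuous_intros)
  have Blap: "laplacian B y < 0" if y: "y \<in> G" for y
  proof -
   define s where "s = (y - p) \<bullet> (y - p)"
   define q where "q = - \<rho> y"
   have s: "s > 0" "q > 0" using yp GO[OF y] by (auto simp: s_def q_def)
   have ns: "norm (y - p) = s powr (1 / 2)" using s by (simp add: s_def powr_half_sqrt[OF less_imp_le] norm_eq_sqrt_inner)
   have nR: "norm (y - p) < R" using y by (simp add: G_def dist_norm norm_minus_commute)
   have qs: "q \<le> L1 * s powr (1 / 2)" using psi[of y] by (simp add: q_def ns)
   have qR: "q < L1 * R" using psi[of y] nR L1(1) mult_strict_left_mono[OF nR L1(1)] unfolding q_def by linarith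
   have yc: "y \<in> closure \<Omega>" using GO[OF y] closure_Omega by auto
   have gr: "c0 / 2 \<le> norm (grad \<rho> y)" using t0(2)[OF yc] qR R'(1) by (simp add: q_def)
   have a: "laplacian (\<lambda>y. f1 ((y - p) \<bullet> (y - p))) y \<le> 3 * N / 4 * s powr (- 5 / 8)"
    unfolding F1(2)[OF y] sqdist_C2(2) s_def[symmetric] N_def by simp
   have "- 3 / 16 * q powr (- 5 / 4) * (norm (grad \<rho> y))\<^sup>2 \<le> - 3 / 16 * q powr (- 5 / 4) * (c0 / 2)\<^sup>2"
    using gr c0(1) by (intro mult_left_mono_neg power_mono) auto
   moreover have "- 3 / 4 * q powr (- 1 / 4) * laplacian \<rho> y \<le> 3 / 4 * q powr (- 5 / 4) * (c0\<^sup>2 / 32)"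
   proof -
    have "\<bar>q * laplacian \<rho> y\<bar> \<le> L1 * R * \<Lambda>" unfolding abs_mult using L qR s by (intro mult_mono) auto
    then have "- (q * laplacian \<rho> y) \<le> c0\<^sup>2 / 32" using R'(2) by linarith
    then have "q powr (- 5 / 4) * (- (q * laplacian \<rho> y)) \<le> q powr (- 5 / 4) * (c0\<^sup>2 / 32)" by (intro mult_left_mono) auto
    moreover have q4: "q powr (- 1 / 4) = q powr (- 5 / 4) * q" using s powr_mult_base[of q "- 5 / 4"] by (simp add: mult.commute)
    have "- 3 / 4 * q powr (- 1 / 4) * laplacian \<rho> y = 3 / 4 * (q powr (- 5 / 4) * (- (q * laplacian \<rho> y)))" unfolding q4 by simp
    ultimately show ?thesis by linarith
   qed
   ultimately have b: "laplacian (\<lambda>y. f2 (\<rho> y)) y \<le> - (3 / 128) * c0\<^sup>2 * q powr (- 5 / 4)"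
   proof -
    have c4: "(c0 / 2)\<^sup>2 = c0\<^sup>2 / 4" by (simp add: power_divide)
    assume "- 3 / 16 * q powr (- 5 / 4) * (norm (grad \<rho> y))\<^sup>2 \<le> - 3 / 16 * q powr (- 5 / 4) * (c0 / 2)\<^sup>2"
     "- 3 / 4 * q powr (- 1 / 4) * laplacian \<rho> y \<le> 3 / 4 * q powr (- 5 / 4) * (c0\<^sup>2 / 32)"
    then show ?thesis unfolding F2(2)[OF y] q_def[symmetric] c4 by (simp only: mult.commute[of _ "q powr (- 5 / 4)"])
   qed
   have "(L1 * s powr (1 / 2)) powr (- 5 / 4) \<le> q powr (- 5 / 4)" by (rule powr_mono2') (use s qs in auto)
   then have "L1 powr (- 5 / 4) * s powr (- 5 / 8) \<le> q powr (- 5 / 4)" using L1(1) by (simp add: powr_mult powr_powr)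
   then have "3 / 128 * c0\<^sup>2 * (L1 powr (- 5 / 4) * s powr (- 5 / 8)) \<le> 3 / 128 * c0\<^sup>2 * q powr (- 5 / 4)" by (intro mult_left_mono) auto
   with b have "laplacian (\<lambda>y. f2 (\<rho> y)) y \<le> - (3 / 128 * c0\<^sup>2 * (L1 powr (- 5 / 4) * s powr (- 5 / 8)))" by linarith
   then have "K * laplacian (\<lambda>y. f2 (\<rho> y)) y \<le> K * - (3 / 128 * c0\<^sup>2 * (L1 powr (- 5 / 4) * s powr (- 5 / 8)))"
    using K by (intro mult_left_mono) auto
   moreover have "K * (3 / 128 * c0\<^sup>2 * (L1 powr (- 5 / 4) * s powr (- 5 / 8)))
     = 3 * N / 4 * s powr (- 5 / 8) + 3 / 128 * c0\<^sup>2 * (L1 powr (- 5 / 4) * s powr (- 5 / 8))"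
   proof -
    have "L1 powr (5 / 4) * L1 powr (- 5 / 4) = 1" using L1(1) by (simp add: powr_add[symmetric])
    then have "32 * N * L1 powr (5 / 4) / c0\<^sup>2 * (3 / 128 * c0\<^sup>2 * (L1 powr (- 5 / 4) * s powr (- 5 / 8))) = 3 * N / 4 * s powr (- 5 / 8)"
     using c0(1) by (simp add: field_simps)
    then show ?thesis by (simp add: K_def distrib_right)
   qed
   moreover have "0 < 3 / 128 * c0\<^sup>2 * (L1 powr (- 5 / 4) * s powr (- 5 / 8))" using c0(1) L1(1) s by simp
   ultimately have "laplacian (\<lambda>y. f1 ((y - p) \<bullet> (y - p))) y + K * laplacian (\<lambda>y. f2 (\<rho> y)) y < 0" using a by linarith
   then show ?thesis unfolding Beq C2_on_lincomb(2)[OF G(1) F1(1) F2(1) y] by simp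
  qed
  have Bnn: "0 \<le> B y" for y using K by (simp add: B_def)
  have Blow: "norm (y - p) powr (3 / 4) \<le> B y" for y
  proof -
   have "norm (y - p) = ((y - p) \<bullet> (y - p)) powr (1 / 2)" by (simp add: powr_half_sqrt norm_eq_sqrt_inner)
   then have "norm (y - p) powr (3 / 4) = ((y - p) \<bullet> (y - p)) powr (3 / 8)" by (simp add: powr_powr)
   then show ?thesis using K by (simp add: B_def)
  qed
  \<comment> \<open>Increments of u are compared instead of derivatives, since only u itself extends
    continuously to the boundary. The increment is harmonic where both points lie in \<Omega>, so
    subtracting a multiple of the superharmonic B makes it strictly subharmonic.\<close>
  have main: "u (x + t *\<^sub>R e) - u x \<le> t * (C1 * B x + A0 * (\<bar>grad \<rho> p \<bullet> e\<bar> + \<Lambda> * t))" if t: "t > 0" and xt: "x + t *\<^sub>R e \<in> \<Omega>" for t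
  proof -
   define \<kappa> where "\<kappa> = A0 * (\<bar>grad \<rho> p \<bullet> e\<bar> + \<Lambda> * t)"
   have \<kappa>: "\<kappa> \<ge> 0" using A0(1) L(1) t by (simp add: \<kappa>_def)
   define D where "D = G \<inter> {y. y + t *\<^sub>R e \<in> \<Omega>}"
   have oD: "open {y. y + t *\<^sub>R e \<in> \<Omega>}" using open_vimage[OF open_Omega, of "\<lambda>y. y + t *\<^sub>R e"]
    by (simp add: vimage_def continuous_intros)
   have D: "open D" "bounded D" "D \<subseteq> G" using G oD by (auto simp: D_def intro: bounded_subset)
   have uD: "C2_on D u" by (rule C2_on_subset[OF open_Omega D(1) C2_u]) (use D(3) G(3) in blast)
   have sh: "C2_on D (\<lambda>y. u (y + t *\<^sub>R e))" "laplacian (\<lambda>y. u (y + t *\<^sub>R e)) y = laplacian u (y + t *\<^sub>R e)" for y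
    by (rule C2_on_shift[OF open_Omega C2_u D(1)]; simp add: D_def)+
   define w1 where "w1 y = 1 * u (y + t *\<^sub>R e) + - 1 * u y" for y
   have w1: "C2_on D w1" unfolding w1_def[abs_def] by (rule C2_on_lincomb(1)[OF D(1) sh(1) uD])
   have w1l: "laplacian w1 y = 0" if "y \<in> D" for y
    unfolding w1_def[abs_def] C2_on_lincomb(2)[OF D(1) sh(1) uD that] sh(2) using that D(3) lap_u GO by (auto simp: D_def)
   define w2 where "w2 y = 1 * w1 y + (- (t * C1)) * B y" for y
   have BD: "C2_on D B" by (rule C2_on_subset[OF G(1) D(1) BC D(3)])
   have w2: "C2_on D w2" unfolding w2_def[abs_def] by (rule C2_on_lincomb(1)[OF D(1) w1 BD])
   have w2l: "laplacian w2 y > 0" if "y \<in> D" for y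
    unfolding w2_def[abs_def] C2_on_lincomb(2)[OF D(1) w1 BD that] w1l[OF that]
    using Blap[of y] that D(3) t C1(1) by (auto simp: mult_less_0_iff)
   have cD: "closure D \<subseteq> closure \<Omega>" "closure D \<subseteq> cball p R" "\<And>y. y \<in> closure D ==> y + t *\<^sub>R e \<in> closure \<Omega>"
   proof -
    show "closure D \<subseteq> closure \<Omega>" using D(3) G(3) by (intro closure_mono) auto
    show "closure D \<subseteq> cball p R" by (rule closure_minimal) (auto simp: D_def G_def)
    have "closure D \<subseteq> (\<lambda>y. y + t *\<^sub>R e) -` closure \<Omega>"
     by (rule closure_minimal) (auto simp: D_def intro!: closed_vimage continuous_intros subsetD[OF closure_subset])
    then show "y + t *\<^sub>R e \<in> closure \<Omega>" if "y \<in> closure D" for y using that by auto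
   qed
   have "w2 x \<le> t * \<kappa>"
   proof (rule max_principle[OF D(1,2) w2 _ w2l])
    show "continuous_on (closure D) w2" unfolding w2_def[abs_def] w1_def[abs_def]
     by (intro continuous_intros continuous_on_subset[OF Bc] continuous_on_subset[OF cont_u] continuous_on_compose2[OF cont_u])
      (use cD in auto)
    have "x \<in> D" using x xp xt by (simp add: D_def G_def dist_norm norm_minus_commute)
    then show "x \<in> closure D" by (rule subsetD[OF closure_subset])
    fix y assume y: "y \<in> closure D - D"
    have yc: "y \<in> closure \<Omega>" "y + t *\<^sub>R e \<in> closure \<Omega>" "norm (y - p) \<le> R"
     using y cD by (auto simp: dist_norm norm_minus_commute)
    have tn: "norm (t *\<^sub>R e) = t" using e t by simp
    have tC: "0 \<le> t * C1 * B y" using t C1(1) Bnn by simp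
    have tk: "0 \<le> t * \<kappa>" using t \<kappa> by simp
    consider "y \<notin> \<Omega>" | "y + t *\<^sub>R e \<notin> \<Omega>" | "norm (y - p) = R"
     using y yc(3) by (fastforce simp: D_def G_def dist_norm norm_minus_commute)
    then show "w2 y \<le> t * \<kappa>"
    proof cases
     case 1
     then have "u y = 0" using yc(1) closure_Omega u_zero by auto
     then show ?thesis using u_nonpos[OF yc(2)] tC tk by (simp add: w2_def w1_def)
    next
     \<comment> \<open>With the shifted point on the boundary the increment equals - u y, which is
       at most \<open>A0 * (- \<rho> y)\<close>. The mean value theorem writes - \<rho> y as t times
       a derivative of \<rho> in direction e near p.\<close>
     case 2
     then have f: "y + t *\<^sub>R e \<in> \<Gamma>" using yc(2) closure_Omega by auto
     obtain z where z: "0 < z" "z < t" "\<rho> (y + t *\<^sub>R e) - \<rho> (y + 0 *\<^sub>R e) = (t - 0) * (grad \<rho> (y + z *\<^sub>R e) \<bullet> e)"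
      using MVT2[OF t, of "\<lambda>s. \<rho> (y + s *\<^sub>R e)" "\<lambda>s. grad \<rho> (y + s *\<^sub>R e) \<bullet> e"] gderiv_line[OF gderiv_rho] by blast
     have "norm (y + z *\<^sub>R e - p) \<le> norm (y - p) + t" using norm_triangle_ineq[of "y - p" "z *\<^sub>R e"] z e
      by (simp add: algebra_simps)
     then have "\<Lambda> * norm (y + z *\<^sub>R e - p) \<le> \<Lambda> * (norm (y - p) + t)" using L(1) by (intro mult_left_mono) auto
     then have "norm (grad \<rho> (y + z *\<^sub>R e) - grad \<rho> p) \<le> \<Lambda> * (norm (y - p) + t)"
      using grad_rho_lip[of "y + z *\<^sub>R e" p] unfolding \<Lambda>_def N_def by linarith
     moreover have "(grad \<rho> (y + z *\<^sub>R e) - grad \<rho> p) \<bullet> e \<le> norm (grad \<rho> (y + z *\<^sub>R e) - grad \<rho> p)"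
      using norm_cauchy_schwarz[of "grad \<rho> (y + z *\<^sub>R e) - grad \<rho> p" e] e by simp
     ultimately have ge: "grad \<rho> (y + z *\<^sub>R e) \<bullet> e \<le> \<bar>grad \<rho> p \<bullet> e\<bar> + \<Lambda> * (norm (y - p) + t)"
      by (simp add: inner_diff_left)
     have "norm (y - p) \<le> norm (y - p) powr (3 / 4)"
      using powr_mono'[of "3 / 4" 1 "norm (y - p)"] yc(3) R(2) by simp
     then have "A0 * \<Lambda> * norm (y - p) \<le> C1 * B y" using C1(1,2) Blow[of y] A0(1) L(1) by (intro mult_mono) auto
     moreover have "A0 * (grad \<rho> (y + z *\<^sub>R e) \<bullet> e) \<le> A0 * (\<bar>grad \<rho> p \<bullet> e\<bar> + \<Lambda> * (norm (y - p) + t))"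
      using ge A0(1) by (intro mult_left_mono) auto
     ultimately have "A0 * (grad \<rho> (y + z *\<^sub>R e) \<bullet> e) \<le> \<kappa> + C1 * B y" by (simp add: \<kappa>_def algebra_simps)
     then have "t * (A0 * (grad \<rho> (y + z *\<^sub>R e) \<bullet> e)) \<le> t * (\<kappa> + C1 * B y)" using t by (intro mult_left_mono) auto
     moreover have "- \<rho> y = t * (grad \<rho> (y + z *\<^sub>R e) \<bullet> e)" using z(3) rho_zero[OF f] by simp
     then have "- u y \<le> t * (A0 * (grad \<rho> (y + z *\<^sub>R e) \<bullet> e))" using A0(2)[OF yc(1)] by (simp add: mult.left_commute)
     ultimately show ?thesis using u_zero[OF f] by (simp add: w2_def w1_def algebra_simps)
    next
     case 3
     have "Ml \<le> C1 * B y" using mult_left_mono[OF Blow[of y] less_imp_le[OF C1(1)]] C1(3) unfolding 3 by linarith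
     then have "t * Ml \<le> t * (C1 * B y)" using t by (intro mult_left_mono) auto
     moreover have "u (y + t *\<^sub>R e) - u y \<le> Ml * t" using Ml(2)[OF yc(2,1)] tn by (simp add: abs_le_iff)
     ultimately show ?thesis using tk by (simp add: w2_def w1_def algebra_simps)
    qed
   qed
   then show ?thesis by (simp add: w2_def w1_def \<kappa>_def algebra_simps)
  qed
  have "((\<lambda>t. (u (x + t *\<^sub>R e) - u x) / t) \<longlongrightarrow> grad u x \<bullet> e) (at_right 0)"
  proof -
   have "((\<lambda>t. u (x + t *\<^sub>R e)) has_real_derivative grad u x \<bullet> e) (at 0)"
    using gderiv_line[of u x 0 e "grad u x"] C1_onD[OF C1_u x] by simp
   then show ?thesis unfolding has_field_derivative_iff by (simp add: filterlim_at_split)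
  qed
  moreover have "((\<lambda>t. C1 * B x + A0 * (\<bar>grad \<rho> p \<bullet> e\<bar> + \<Lambda> * t)) \<longlongrightarrow> C1 * B x + A0 * (\<bar>grad \<rho> p \<bullet> e\<bar> + \<Lambda> * 0)) (at_right 0)"
   by (intro tendsto_intros)
  moreover have "eventually (\<lambda>t. (u (x + t *\<^sub>R e) - u x) / t \<le> C1 * B x + A0 * (\<bar>grad \<rho> p \<bullet> e\<bar> + \<Lambda> * t)) (at_right 0)"
  proof -
   have "((\<lambda>t. x + t *\<^sub>R e) \<longlongrightarrow> x + 0 *\<^sub>R e) (at_right 0)" by (intro tendsto_intros)
   then have "eventually (\<lambda>t. x + t *\<^sub>R e \<in> \<Omega>) (at_right 0)" by (rule topological_tendstoD) (use open_Omega x in auto)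
   then show ?thesis using eventually_at_right_less[of 0]
   proof eventually_elim
    case (elim t) then show ?case using main[of t] by (simp add: field_simps)
   qed
  qed
  ultimately have "grad u x \<bullet> e \<le> C1 * B x + A0 * (\<bar>grad \<rho> p \<bullet> e\<bar> + \<Lambda> * 0)"
   by (intro tendsto_le[OF trivial_limit_at_right_real])
  moreover have "B x \<le> (1 + K * L1 powr (3 / 4)) * norm (x - p) powr (3 / 4)"
  proof -
   have "norm (x - p) = ((x - p) \<bullet> (x - p)) powr (1 / 2)" by (simp add: powr_half_sqrt norm_eq_sqrt_inner)
   then have "norm (x - p) powr (3 / 4) = ((x - p) \<bullet> (x - p)) powr (3 / 8)" by (simp add: powr_powr)
   moreover have "(- \<rho> x) powr (3 / 4) \<le> (L1 * norm (x - p)) powr (3 / 4)" using psi[of x] yp(3)[OF x] by (intro powr_mono2) auto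
   then have "K * (- \<rho> x) powr (3 / 4) \<le> K * (L1 powr (3 / 4) * norm (x - p) powr (3 / 4))"
    using K L1(1) by (intro mult_left_mono) (auto simp: powr_mult)
   ultimately show ?thesis by (simp add: B_def algebra_simps)
  qed
  then have "C1 * B x \<le> C * norm (x - p) powr (3 / 4)" using C1(1) mult_left_mono[of "B x" _ C1] by (fastforce simp: C_def mult.assoc)
  ultimately show "grad u x \<bullet> e \<le> C * norm (x - p) powr (3 / 4) + A0 * \<bar>grad \<rho> p \<bullet> e\<bar>" by simp
 qed
qed

text \<open>For e orthogonal to \<open>grad \<rho> x\<close>, the gradient at the nearest boundary
  point has a component of at most \<Lambda> s along e, and s is below s^(3/4). Using e and - e
  makes the bound two-sided, and the interior estimate for the harmonic function
  \<open>grad u y \<bullet> e\<close> costs one power of s.\<close>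

lemma tangential_interior:
 obtains C R where "C > 0" "0 < R" "R \<le> 1"
  "\<And>x e. x \<in> \<Omega> ==> setdist {x} \<Gamma> < R ==> norm e = 1 ==> grad \<rho> x \<bullet> e = 0 ==>
    \<bar>grad u x \<bullet> e\<bar> \<le> C * setdist {x} \<Gamma> powr (3 / 4) \<and>
    norm (grad (\<lambda>y. grad u y \<bullet> e) x) \<le> C * setdist {x} \<Gamma> powr (- 1 / 4)"
proof -
 obtain C R where C: "C > 0" "0 < R" "R \<le> 1" and
  one: "\<And>p e x. p \<in> \<Gamma> ==> norm e = 1 ==> x \<in> \<Omega> ==> norm (x - p) < R ==>
    grad u x \<bullet> e \<le> C * norm (x - p) powr (3 / 4) + A0 * \<bar>grad \<rho> p \<bullet> e\<bar>" by (rule tangential_one_sided) (rule that)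
 have two: "\<bar>grad u x \<bullet> e\<bar> \<le> C * norm (x - p) powr (3 / 4) + A0 * \<bar>grad \<rho> p \<bullet> e\<bar>"
  if "p \<in> \<Gamma>" "norm e = 1" "x \<in> \<Omega>" "norm (x - p) < R" for p e x
  using one[OF that] one[OF that(1) _ that(3,4), of "- e"] that(2) by simp
 define \<Lambda> where "\<Lambda> = real DIM('a) * L2"
 have L: "\<Lambda> > 0" using L2(1) by (simp add: \<Lambda>_def)
 define C1 where "C1 = 2 * C + A0 * \<Lambda>"
 have C1: "C1 > 0" "C + A0 * \<Lambda> \<le> C1" using C(1) A0(1) L by (auto simp: C1_def add_pos_pos)
 define g where "g = gradc TYPE('a)"
 have g: "g > 0" using gradc_pos by (simp add: g_def)
 show thesis
 proof (rule that[of "C1 + 2 * g * C1" "R / 2"])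
  fix x e assume x: "x \<in> \<Omega>" and xR: "setdist {x} \<Gamma> < R / 2" and e: "norm e = 1" and ort: "grad \<rho> x \<bullet> e = 0"
  obtain p where p: "p \<in> \<Gamma>" "dist x p > 0" "ball x (dist x p) \<subseteq> \<Omega>" "\<And>q. q \<in> \<Gamma> ==> dist x p \<le> dist x q"
   by (rule nearest_point[OF x]) (rule that)
  define s where "s = dist x p"
  have sd: "setdist {x} \<Gamma> = s"
   by (rule antisym) (auto simp: s_def p le_setdist_iff intro!: setdist_le_dist frontier_ne p)
  have s: "0 < s" "s < R / 2" "s \<le> 1" using p(2) xR C by (auto simp: sd s_def[symmetric])
  have "norm (grad \<rho> p - grad \<rho> x) \<le> \<Lambda> * s" using grad_rho_lip[of p x] by (simp add: \<Lambda>_def s_def dist_norm norm_minus_commute)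
  then have pe: "\<bar>grad \<rho> p \<bullet> e\<bar> \<le> \<Lambda> * s"
   using Cauchy_Schwarz_ineq2[of "grad \<rho> p - grad \<rho> x" e] e ort by (simp add: inner_diff_left)
  have s34: "s \<le> s powr (3 / 4)" using powr_mono'[of "3 / 4" 1 s] s by simp
  have Ap: "A0 * \<bar>grad \<rho> p \<bullet> e\<bar> \<le> A0 * \<Lambda> * s powr (3 / 4)"
   using mult_left_mono[OF order_trans[OF pe mult_left_mono[OF s34]], of A0] A0(1) L by (simp add: mult.assoc)
  have b: "\<bar>grad u y \<bullet> e\<bar> \<le> C1 * s powr (3 / 4)" if y: "y \<in> cball x (s / 2)" for y
  proof -
   have "dist x y < dist x p" using y s(1) unfolding mem_cball s_def by linarith
   then have yO: "y \<in> \<Omega>" using p(3) by (auto simp: subset_eq)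
   have n: "norm (y - p) \<le> 3 / 2 * s" using y norm_triangle_ineq[of "y - x" "x - p"] by (simp add: s_def dist_norm norm_minus_commute)
   have "norm (y - p) powr (3 / 4) \<le> (3 / 2 * s) powr (3 / 4)" using n by (intro powr_mono2) auto
   also have "\<dots> \<le> 2 * s powr (3 / 4)"
   proof -
    have "(3 / 2 :: real) powr (3 / 4) \<le> 2" using powr_mono[of "3 / 4" 1 "3 / 2 :: real"] by simp
    then show ?thesis unfolding powr_mult by (intro mult_right_mono) auto
   qed
   finally have "C * norm (y - p) powr (3 / 4) \<le> C * (2 * s powr (3 / 4))" using C(1) by (intro mult_left_mono) auto
   then show ?thesis using two[OF p(1) e yO] n s Ap by (simp add: C1_def algebra_simps)
  qed
  have "norm (grad (\<lambda>y. grad u y \<bullet> e) x) \<le> g / (s / 2) * (C1 * s powr (3 / 4))"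
   unfolding g_def
  proof (rule harm_grad_sup_bound[OF open_Omega harm_dir_u _ _ b])
   show "cball x (s / 2) \<subseteq> \<Omega>" using p(3) s(1) unfolding s_def[symmetric] by (auto simp: subset_eq)
  qed (use s in auto)
  also have "\<dots> = 2 * g * C1 * (s powr (3 / 4) / s powr 1)" using s by simp
  also have "\<dots> = 2 * g * C1 * s powr (- 1 / 4)" by (simp only: powr_diff[symmetric]) simp
  finally have "norm (grad (\<lambda>y. grad u y \<bullet> e) x) \<le> 2 * g * C1 * s powr (- 1 / 4)" .
  then show "\<bar>grad u x \<bullet> e\<bar> \<le> (C1 + 2 * g * C1) * setdist {x} \<Gamma> powr (3 / 4) \<and>
    norm (grad (\<lambda>y. grad u y \<bullet> e) x) \<le> (C1 + 2 * g * C1) * setdist {x} \<Gamma> powr (- 1 / 4)"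
   unfolding sd using b[of x] s g C1(1) by (simp add: distrib_right add_increasing add_increasing2)
 qed (use C C1 g in \<open>auto intro!: add_pos_pos\<close>)
qed

end

section \<open>The integral identity\<close>

text \<open>The Hessian as a linear map, assembled from the gradients of the partial derivatives;
  symmetry is not built in.\<close>

definition hess :: "('a::euclidean_space \<Rightarrow> real) \<Rightarrow> 'a \<Rightarrow> 'a \<Rightarrow> 'a" where
 "hess f x v = (\<Sum>b\<in>Basis. (v \<bullet> b) *\<^sub>R grad (pd b f) x)"

lemma hess_add: "hess f x (v + w) = hess f x v + hess f x w"
 by (simp add: hess_def inner_add_left scaleR_left_distrib sum.distrib)

lemma hess_scaleR: "hess f x (c *\<^sub>R v) = c *\<^sub>R hess f x v"
 by (simp add: hess_def scaleR_sum_right)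

lemma inner_grad_sum: "v \<bullet> grad f y = (\<Sum>b\<in>Basis. (v \<bullet> b) * pd b f y)" for v :: "'a::euclidean_space"
 by (subst euclidean_inner) (simp add: pd_eq_grad)

lemma norm_hess_le:
 fixes v :: "'a::euclidean_space"
 assumes "\<And>b. b \<in> Basis ==> norm (grad (pd b f) x) \<le> L"
 shows "norm (hess f x v) \<le> real DIM('a) * L * norm v"
proof -
 have "norm (hess f x v) \<le> (\<Sum>b\<in>(Basis::'a set). norm v * L)" unfolding hess_def
 proof (rule order_trans[OF norm_sum], rule sum_mono)
  fix b :: 'a assume b: "b \<in> Basis"
  show "norm ((v \<bullet> b) *\<^sub>R grad (pd b f) x) \<le> norm v * L"
   unfolding norm_scaleR real_norm_def by (intro mult_mono assms b Basis_le_norm) auto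
 qed
 then show ?thesis by (simp add: mult_ac)
qed

lemma gderiv_grad_inner:
 fixes f g :: "'a::euclidean_space \<Rightarrow> real"
 assumes f: "\<And>b. b \<in> Basis ==> C1_on U (pd b f)" and g: "\<And>b. b \<in> Basis ==> C1_on U (pd b g)" and x: "x \<in> U"
 shows "GDERIV (\<lambda>y. grad f y \<bullet> grad g y) x :> hess f x (grad g x) + hess g x (grad f x)"
proof -
 have e: "(\<lambda>y. grad f y \<bullet> grad g y) = (\<lambda>y. \<Sum>b\<in>Basis. pd b f y * pd b g y)"
  by (rule ext) (simp add: inner_grad_sum pd_eq_grad)
 have "GDERIV (\<lambda>y. \<Sum>b\<in>Basis. pd b f y * pd b g y) x :>
   (\<Sum>b\<in>Basis. pd b f x *\<^sub>R grad (pd b g) x + pd b g x *\<^sub>R grad (pd b f) x)"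
  by (intro gderiv_sum GDERIV_mult C1_onD[OF f x] C1_onD[OF g x])
 moreover have "(\<Sum>b\<in>Basis. pd b f x *\<^sub>R grad (pd b g) x + pd b g x *\<^sub>R grad (pd b f) x)
   = hess f x (grad g x) + hess g x (grad f x)"
  by (simp add: hess_def sum.distrib pd_eq_grad add.commute)
 ultimately show ?thesis by (simp add: e)
qed

lemma continuous_on_hess:
 assumes f: "\<And>b. b \<in> Basis ==> C1_on U (pd b f)" and v: "continuous_on U v"
 shows "continuous_on U (\<lambda>x. hess f x (v x))"
 unfolding hess_def by (intro continuous_intros v C1_on_continuous_grad f)

lemma C1_on_grad_inner:
 assumes f: "C1_on U f" "\<And>b. b \<in> Basis ==> C1_on U (pd b f)" and g: "C1_on U g" "\<And>b. b \<in> Basis ==> C1_on U (pd b g)"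
 shows "C1_on U (\<lambda>y. grad f y \<bullet> grad g y)"
 by (rule C1_onI[OF gderiv_grad_inner[OF f(2) g(2)]])
  (auto intro!: continuous_intros continuous_on_hess C1_on_continuous_grad f g)

lemma grad_dir_hess:
 assumes f: "\<And>b. b \<in> Basis ==> C1_on U (pd b f)" and x: "x \<in> U"
 shows "grad (\<lambda>y. grad f y \<bullet> e) x = hess f x e"
proof -
 have e: "(\<lambda>y. grad f y \<bullet> e) = (\<lambda>y. \<Sum>b\<in>Basis. (e \<bullet> b) * pd b f y)"
  by (rule ext) (subst inner_commute, rule inner_grad_sum)
 have "GDERIV (\<lambda>y. \<Sum>b\<in>Basis. (e \<bullet> b) * pd b f y) x :> (\<Sum>b\<in>Basis. (e \<bullet> b) *\<^sub>R grad (pd b f) x + pd b f x *\<^sub>R 0)"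
  by (intro gderiv_sum GDERIV_mult C1_onD[OF f x] GDERIV_const)
 then show ?thesis unfolding e by (simp add: hess_def gderiv_grad)
qed

lemma LINT_on_cong: "\<forall>x\<in>S. f x = g x ==> integral\<^sup>L (lebesgue_on S) f = integral\<^sup>L (lebesgue_on S) g"
 by (rule Bochner_Integration.integral_cong) auto

lemma integrable_on_cong: "\<forall>x\<in>S. f x = g x ==> integrable (lebesgue_on S) f ==> integrable (lebesgue_on S) g"
 using Bochner_Integration.integrable_cong[of "lebesgue_on S" "lebesgue_on S" f g] by auto

context torsion begin

text \<open>The shift by 1 makes \<open>eta \<epsilon>\<close> vanish on the whole layer -
  \<epsilon> \<le> \<rho>, so its support inside \<Omega> is compact and no boundary value of
  \<open>grad u\<close> is met. \<open>beta \<epsilon>\<close> is minus its derivative with respect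
  to \<rho>, a nonnegative density that vanishes outside - 4 \<epsilon> < \<rho> < -
  \<epsilon>.\<close>

definition eta :: "real \<Rightarrow> 'a \<Rightarrow> real" where "eta \<epsilon> x = spline (- \<rho> x / \<epsilon> - 1)"
definition beta :: "real \<Rightarrow> 'a \<Rightarrow> real" where "beta \<epsilon> x = dspline (- \<rho> x / \<epsilon> - 1) / \<epsilon>"
text \<open>The centre of \<open>hh\<close> changes only an affine part, so the Hessian taken with
  centre 0 serves all centres.\<close>

definition Hsq :: "'a \<Rightarrow> real" where "Hsq x = (\<Sum>b\<in>Basis. (norm (grad (pd b (hh 0)) x))\<^sup>2)"

lemma C1_pd_hh: "b \<in> Basis ==> C1_on \<Omega> (pd b (hh p))"
 using harm_C1[OF open_Omega harm_pd[OF open_Omega harm_hh]] .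

lemma C1_pd_rho': "b \<in> Basis ==> C1_on V (pd b \<rho>)" and C1_rho': "C1_on V \<rho>"
 using C1_on_subset[OF C1_pd_rho] C1_on_subset[OF C1_rho] by auto

lemma gderiv_eta: "\<epsilon> > 0 ==> GDERIV (eta \<epsilon>) x :> (- beta \<epsilon> x) *\<^sub>R grad \<rho> x"
proof -
 assume e: "\<epsilon> > 0"
 have "((\<lambda>r. spline (- r / \<epsilon> - 1)) has_real_derivative dspline (- r / \<epsilon> - 1) * (- 1 / \<epsilon>)) (at r)" for r
  by (rule DERIV_chain2[OF spline_deriv]) (use e in \<open>auto intro!: derivative_eq_intros\<close>)
 from GDERIV_DERIV_compose[OF gderiv_rho this] show ?thesis by (simp add: eta_def[abs_def] beta_def)
qed

lemma gderiv_beta: "\<epsilon> > 0 ==> GDERIV (beta \<epsilon>) x :> (- ddspline (- \<rho> x / \<epsilon> - 1) / \<epsilon>\<^sup>2) *\<^sub>R grad \<rho> x"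
proof -
 assume e: "\<epsilon> > 0"
 have "((\<lambda>r. dspline (- r / \<epsilon> - 1)) has_real_derivative ddspline (- r / \<epsilon> - 1) * (- 1 / \<epsilon>)) (at r)" for r
  by (rule DERIV_chain2[OF dspline_deriv]) (use e in \<open>auto intro!: derivative_eq_intros\<close>)
 then have "((\<lambda>r. dspline (- r / \<epsilon> - 1) / \<epsilon>) has_real_derivative ddspline (- r / \<epsilon> - 1) * (- 1 / \<epsilon>) / \<epsilon>) (at r)" for r
  by (rule DERIV_cdivide)
 from GDERIV_DERIV_compose[OF gderiv_rho this] show ?thesis by (simp add: beta_def[abs_def] power2_eq_square)
qed

lemma continuous_rho: "continuous_on V \<rho>" and continuous_grad_rho: "continuous_on V (grad \<rho>)"
 using C1_on_continuous[OF C1_rho'] C1_on_continuous_grad[OF C1_rho'] by auto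

lemma C1_beta: "\<epsilon> > 0 ==> C1_on V (beta \<epsilon>)"
 by (rule C1_onI[OF gderiv_beta])
  (auto intro!: continuous_intros continuous_rho continuous_grad_rho continuous_on_compose2[OF continuous_ddspline])

lemma C1_eta: "\<epsilon> > 0 ==> C1_on V (eta \<epsilon>)"
 by (rule C1_onI[OF gderiv_eta]) (auto intro!: continuous_intros continuous_grad_rho C1_on_continuous[OF C1_beta])

lemma eta_beta_values:
 assumes "\<epsilon> > 0"
 shows "- \<epsilon> \<le> \<rho> x ==> eta \<epsilon> x = 0" "- \<epsilon> \<le> \<rho> x ==> beta \<epsilon> x = 0" "\<rho> x \<le> - 4 * \<epsilon> ==> beta \<epsilon> x = 0" "\<rho> x \<le> - 4 * \<epsilon> ==> eta \<epsilon> x = 1"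
  "0 \<le> eta \<epsilon> x" "eta \<epsilon> x \<le> 1" "0 \<le> beta \<epsilon> x"
 unfolding eta_def beta_def using assms spline_bounds dspline_nonneg
 by (auto intro!: spline_zero dspline_zero spline_one simp: field_simps)

lemma eta_sequence:
 assumes "t > 0"
 obtains e :: "nat \<Rightarrow> real" where "\<And>n. e n > 0" "\<And>n. e n < t" "\<And>x. x \<in> \<Omega> ==> eventually (\<lambda>n. eta (e n) x = 1) sequentially"
proof (rule that)
 define e where "e n = t / 2 * inverse (real (Suc n))" for n
 show e: "e n > 0" for n using assms by (simp add: e_def)
 show "e n < t" for n using assms by (simp add: e_def field_simps add_pos_nonneg)
 have l: "e \<longlonglongrightarrow> t / 2 * 0" unfolding e_def[abs_def] by (intro tendsto_intros LIMSEQ_inverse_real_of_nat)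
 fix x assume x: "x \<in> \<Omega>"
 have "eventually (\<lambda>n. e n < - \<rho> x / 4) sequentially" using order_tendstoD(2)[OF l, of "- \<rho> x / 4"] rho_neg[OF x] by simp
 then show "eventually (\<lambda>n. eta (e n) x = 1) sequentially" by eventually_elim (rule eta_beta_values(4)[OF e], simp)
qed

lemma level_compact: "compact (closure \<Omega> \<inter> {x. \<rho> x \<le> - \<epsilon>})"
 by (intro compact_Int_closed compact_closure_Omega closed_Collect_le continuous_intros continuous_rho)

lemma level_subset: "\<epsilon> > 0 ==> closure \<Omega> \<inter> {x. \<rho> x \<le> - \<epsilon>} \<subseteq> \<Omega>"
 using closure_Omega rho_zero by force

lemma support_eta: "\<epsilon> > 0 ==> \<forall>x\<in>\<Omega> - closure \<Omega> \<inter> {x. \<rho> x \<le> - \<epsilon>}. eta \<epsilon> x = 0"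
 and support_beta: "\<epsilon> > 0 ==> x \<in> \<Omega> - closure \<Omega> \<inter> {x. \<rho> x \<le> - \<epsilon>} ==> beta \<epsilon> x = 0"
proof -
 assume e: "\<epsilon> > 0"
 have c: "- \<epsilon> \<le> \<rho> x" if "x \<in> \<Omega> - closure \<Omega> \<inter> {x. \<rho> x \<le> - \<epsilon>}" for x using that closure_Omega by auto
 show "\<forall>x\<in>\<Omega> - closure \<Omega> \<inter> {x. \<rho> x \<le> - \<epsilon>}. eta \<epsilon> x = 0" using eta_beta_values(1)[OF e c] by blast
 show "x \<in> \<Omega> - closure \<Omega> \<inter> {x. \<rho> x \<le> - \<epsilon>} ==> beta \<epsilon> x = 0" using eta_beta_values(2)[OF e c] by blast
qed

lemmas parts = divergence_parts[OF open_Omega level_compact level_subset]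

text \<open>The test field is \<open>grad u\<close>; formally, for \<epsilon> tending to 0, the
  total normal derivative of u on the boundary is N |\<Omega>|.\<close>

lemma flux_laplacian:
 assumes e: "\<epsilon> > 0"
 shows "(LINT x|vol. eta \<epsilon> x * real DIM('a)) = (LINT x|vol. beta \<epsilon> x * (grad \<rho> x \<bullet> grad u x))"
  and "integrable vol (\<lambda>x. eta \<epsilon> x * real DIM('a))"
  and "integrable vol (\<lambda>x. beta \<epsilon> x * (grad \<rho> x \<bullet> grad u x))"
proof -
 note P = parts[OF e C1_eta[OF e] support_eta[OF e], of "\<lambda>b. pd b u", OF ballI[OF C1_pd_u]]
 have l: "\<forall>x\<in>\<Omega>. eta \<epsilon> x * (\<Sum>b\<in>Basis. pd b (pd b u) x) = eta \<epsilon> x * real DIM('a)"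
  using lap_u by (simp add: laplacian_def)
 have r: "(\<Sum>b\<in>Basis. pd b (eta \<epsilon>) x * pd b u x) = - (beta \<epsilon> x * (grad \<rho> x \<bullet> grad u x))" for x
  by (simp add: gderiv_pd[OF gderiv_eta[OF e]] inner_grad_sum sum_negf sum_distrib_left mult.assoc)
 show "(LINT x|vol. eta \<epsilon> x * real DIM('a)) = (LINT x|vol. beta \<epsilon> x * (grad \<rho> x \<bullet> grad u x))"
  using P(1) unfolding r LINT_on_cong[OF l] by simp
 show "integrable vol (\<lambda>x. eta \<epsilon> x * real DIM('a))"
  by (rule integrable_on_cong[OF l P(2)])
 show "integrable vol (\<lambda>x. beta \<epsilon> x * (grad \<rho> x \<bullet> grad u x))"
  using P(3) unfolding r by simp
qed

lemma grad_pd_hh: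
 assumes x: "x \<in> \<Omega>" and b: "b \<in> Basis"
 shows "grad (pd b (hh p)) x = b - grad (pd b u) x"
proof -
 have g: "GDERIV (\<lambda>x. x \<bullet> b - p \<bullet> b - pd b u x) x :> b - 0 - grad (pd b u) x"
  by (intro GDERIV_diff gderiv_inner_left GDERIV_const C1_onD[OF C1_pd_u[OF b] x])
 have "GDERIV (pd b (hh p)) x :> b - 0 - grad (pd b u) x"
  by (rule gderiv_cong[OF open_Omega x _ g]) (simp add: pd_hh b inner_diff_left)
 from gderiv_grad[OF this] show ?thesis by simp
qed

lemma hess_hh: "x \<in> \<Omega> ==> hess (hh p) x v = v - hess u x v"
 by (simp add: hess_def grad_pd_hh scaleR_diff_right sum_subtractf euclidean_representation)

lemma hess_u_sym:
 assumes x: "x \<in> \<Omega>"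
 shows "hess u x v \<bullet> w = v \<bullet> hess u x w"
proof -
 have c: "grad (pd b u) x \<bullet> d = grad (pd d u) x \<bullet> b" if "b \<in> Basis" "d \<in> Basis" for b d
 proof -
  have "grad (pd b (hh 0)) x \<bullet> d = grad (pd d (hh 0)) x \<bullet> b"
   using MV_C2(2)[OF open_Omega harm_C1[OF open_Omega harm_hh] harm_MV[OF open_Omega harm_hh] that x] that by (simp add: pd_eq_grad)
  then show ?thesis using that by (simp add: grad_pd_hh x inner_diff_left inner_diff_right inner_commute)
 qed
 have "hess u x v \<bullet> w = (\<Sum>b\<in>Basis. \<Sum>d\<in>Basis. (v \<bullet> b) * (grad (pd b u) x \<bullet> d) * (w \<bullet> d))"
  unfolding hess_def inner_sum_left by (rule sum.cong[OF refl], subst euclidean_inner) (simp add: sum_distrib_left mult.assoc)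
 also have "\<dots> = (\<Sum>d\<in>Basis. \<Sum>b\<in>Basis. (w \<bullet> d) * (grad (pd d u) x \<bullet> b) * (v \<bullet> b))"
  by (subst sum.swap) (intro sum.cong refl, simp add: c mult_ac)
 also have "\<dots> = hess u x w \<bullet> v"
  unfolding hess_def inner_sum_left by (rule sum.cong[OF refl], subst (2) euclidean_inner) (simp add: sum_distrib_left mult.assoc)
 finally show ?thesis by (simp add: inner_commute)
qed

text \<open>The test field is the Hessian of h applied to \<open>grad u\<close>. The Hessian of u is
  the identity minus that of h, while h is harmonic together with its partial derivatives; so the
  divergence of the field is exactly - |D^2 h|^2.\<close>

lemma flux_hessian:
 assumes e: "\<epsilon> > 0"
 shows "(LINT x|vol. eta \<epsilon> x * Hsq x) = (LINT x|vol. beta \<epsilon> x * (grad \<rho> x \<bullet> hess u x (grad u x) - grad \<rho> x \<bullet> grad u x))"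
  and "integrable vol (\<lambda>x. eta \<epsilon> x * Hsq x)"
  and "integrable vol (\<lambda>x. beta \<epsilon> x * (grad \<rho> x \<bullet> hess u x (grad u x) - grad \<rho> x \<bullet> grad u x))"
proof -
 define h where "h = hh 0"
 have C1d: "C1_on \<Omega> (pd b (pd c h))" if "b \<in> Basis" "c \<in> Basis" for b c
  using harm_C1[OF open_Omega harm_pd[OF open_Omega harm_pd[OF open_Omega harm_hh[of 0] that(2)] that(1)]] by (simp add: h_def)
 define F where "F b x = (\<Sum>c\<in>Basis. pd b (pd c h) x * pd c u x)" for b x
 have F: "C1_on \<Omega> (F b)" if "b \<in> Basis" for b unfolding F_def[abs_def] by (intro C1_on_sum C1_on_mult C1d that C1_pd_u)
 note P = parts[OF e C1_eta[OF e] support_eta[OF e], of F, OF ballI[OF F]]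
 have dF: "(\<Sum>b\<in>Basis. pd b (F b) x) = - Hsq x" if x: "x \<in> \<Omega>" for x
 proof -
  have pu: "pd b (pd c u) x = c \<bullet> b - pd b (pd c h) x" if "b \<in> Basis" "c \<in> Basis" for b c
   using that grad_pd_hh[OF x that(2), of 0] by (simp add: pd_eq_grad h_def inner_diff_left)
  have "(\<Sum>b\<in>Basis. pd b (F b) x) = (\<Sum>b\<in>Basis. \<Sum>c\<in>Basis. pd b (\<lambda>x. pd b (pd c h) x * pd c u x) x)"
   unfolding F_def[abs_def] by (intro sum.cong refl pd_sum_C1[where U=\<Omega>] C1_on_mult C1d C1_pd_u x)
  also have "\<dots> = (\<Sum>b\<in>Basis. \<Sum>c\<in>Basis. pd b (pd c h) x * pd b (pd c u) x + pd c u x * pd b (pd b (pd c h)) x)"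
   by (intro sum.cong refl pd_mult[where U=\<Omega>] C1d C1_pd_u x)
  also have "\<dots> = (\<Sum>b\<in>Basis. \<Sum>c\<in>Basis. pd b (pd c h) x * (c \<bullet> b)) - (\<Sum>b\<in>Basis. \<Sum>c\<in>Basis. (pd b (pd c h) x)\<^sup>2)
    + (\<Sum>b\<in>Basis. \<Sum>c\<in>Basis. pd c u x * pd b (pd b (pd c h)) x)"
   by (simp add: pu sum.distrib sum_subtractf right_diff_distrib power2_eq_square)
  also have "(\<Sum>b\<in>Basis. \<Sum>c\<in>Basis. pd b (pd c h) x * (c \<bullet> b)) = laplacian h x"
   unfolding laplacian_def by (intro sum.cong refl) (simp add: inner_Basis if_distrib cong: if_cong)
  also have "laplacian h x = 0" using harm_hh[of 0] x by (simp add: harm_def h_def)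
  also have "(\<Sum>b\<in>Basis. \<Sum>c\<in>Basis. pd c u x * pd b (pd b (pd c h)) x) = (\<Sum>c\<in>Basis. pd c u x * laplacian (pd c h) x)"
   by (subst sum.swap) (simp add: laplacian_def sum_distrib_left)
  also have "\<dots> = 0" using harm_pd[OF open_Omega harm_hh[of 0]] x by (simp add: harm_def h_def)
  also have "(\<Sum>b\<in>Basis. \<Sum>c\<in>Basis. (pd b (pd c h) x)\<^sup>2) = Hsq x"
   unfolding Hsq_def h_def[symmetric] power2_norm_eq_inner
   by (subst sum.swap) (intro sum.cong refl, subst euclidean_inner, simp add: pd_eq_grad power2_eq_square)
  finally show ?thesis by simp
 qed
 have dF': "\<forall>x\<in>\<Omega>. eta \<epsilon> x * (\<Sum>b\<in>Basis. pd b (F b) x) = - (eta \<epsilon> x * Hsq x)" using dF by simp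
 have r: "(\<Sum>b\<in>Basis. pd b (eta \<epsilon>) x * F b x) = beta \<epsilon> x * (grad \<rho> x \<bullet> hess u x (grad u x) - grad \<rho> x \<bullet> grad u x)" if x: "x \<in> \<Omega>" for x
 proof -
  have "F b x = hess h x (grad u x) \<bullet> b" if "b \<in> Basis" for b
   using that by (simp add: F_def hess_def inner_sum_left pd_eq_grad mult.commute)
  then have "(\<Sum>b\<in>Basis. pd b (eta \<epsilon>) x * F b x) = (\<Sum>b\<in>Basis. - (beta \<epsilon> x * ((grad \<rho> x \<bullet> b) * (hess h x (grad u x) \<bullet> b))))"
   by (intro sum.cong refl) (simp add: gderiv_pd[OF gderiv_eta[OF e]])
  also have "\<dots> = - (beta \<epsilon> x * (grad \<rho> x \<bullet> hess h x (grad u x)))"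
   by (subst (3) euclidean_inner) (simp add: sum_negf sum_distrib_left)
  finally show ?thesis by (simp add: h_def hess_hh[OF x] inner_diff_right algebra_simps)
 qed
 have r': "\<forall>x\<in>\<Omega>. (\<Sum>b\<in>Basis. pd b (eta \<epsilon>) x * F b x) = beta \<epsilon> x * (grad \<rho> x \<bullet> hess u x (grad u x) - grad \<rho> x \<bullet> grad u x)"
  using r by blast
 show "(LINT x|vol. eta \<epsilon> x * Hsq x) = (LINT x|vol. beta \<epsilon> x * (grad \<rho> x \<bullet> hess u x (grad u x) - grad \<rho> x \<bullet> grad u x))"
  using P(1) unfolding LINT_on_cong[OF r'] LINT_on_cong[OF dF'] by simp
 show "integrable vol (\<lambda>x. eta \<epsilon> x * Hsq x)"
  using integrable_on_cong[OF dF' P(2)] by simp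
 show "integrable vol (\<lambda>x. beta \<epsilon> x * (grad \<rho> x \<bullet> hess u x (grad u x) - grad \<rho> x \<bullet> grad u x))"
  by (rule integrable_on_cong[OF r' P(3)])
qed

text \<open>The coefficient of \<open>grad \<rho>\<close> in the orthogonal decomposition of
  \<open>grad u\<close>, whose tangential remainder is \<open>tau\<close>.\<close>

definition pq :: "'a \<Rightarrow> real" where "pq x = (grad \<rho> x \<bullet> grad u x) / (norm (grad \<rho> x))\<^sup>2"
definition tau :: "'a \<Rightarrow> 'a" where "tau x = grad u x - pq x *\<^sub>R grad \<rho> x"
text \<open>On the boundary this is (N - 1) H |grad \<rho>|^3, see \<open>curvature_formula\<close>.
  Clearing denominators keeps it continuous even where the gradient vanishes.\<close>

definition curv :: "'a \<Rightarrow> real" where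
 "curv x = (norm (grad \<rho> x))\<^sup>2 * laplacian \<rho> x - grad \<rho> x \<bullet> hess \<rho> x (grad \<rho> x)"
text \<open>Every term contains \<open>tau\<close>, hence the smallness near the boundary. The last
  two terms are the difference between the Hessian of \<rho> and its transpose, so no symmetry of
  that Hessian enters.\<close>

definition err :: "'a \<Rightarrow> real" where
 "err x = 2 * (grad \<rho> x \<bullet> hess u x (tau x)) + tau x \<bullet> hess \<rho> x (tau x)
   + pq x * (tau x \<bullet> hess \<rho> x (grad \<rho> x)) - pq x * (grad \<rho> x \<bullet> hess \<rho> x (tau x))"

lemma tau_orthogonal: "grad \<rho> x \<noteq> 0 ==> grad \<rho> x \<bullet> tau x = 0"
 by (simp add: tau_def pq_def inner_diff_right power2_norm_eq_inner)

text \<open>The field beta (grad rho . grad u) tau has compact support, so its divergence integrates to zero. This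
  trades the second normal derivative of u, which is not controlled, for the curvature.\<close>

lemma flux_tangential:
 assumes e: "\<epsilon> > 0" and nz: "\<And>x. x \<in> \<Omega> ==> - t < \<rho> x ==> grad \<rho> x \<noteq> 0" and et: "4 * \<epsilon> < t"
 obtains E where "integrable vol E" "integral\<^sup>L vol E = 0"
  "\<And>x. x \<in> \<Omega> ==> E x = beta \<epsilon> x *
    (err x + real DIM('a) * (grad \<rho> x \<bullet> grad u x) - (pq x)\<^sup>2 * curv x - grad \<rho> x \<bullet> hess u x (grad u x))"
proof -
 \<comment> \<open>\<open>pq\<close> is differentiable only where \<open>grad \<rho>\<close> is
   nonzero, which holds on S; on T the density \<open>beta \<epsilon>\<close> vanishes, so the
   product is C^1 on the union of the two.\<close>
 define S where "S = \<Omega> \<inter> {x. - t < \<rho> x}"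
 define T where "T = \<Omega> \<inter> {x. \<rho> x < - 4 * \<epsilon>}"
 have o: "open S" "open T" "S \<union> T = \<Omega>" "S \<subseteq> \<Omega>"
  unfolding S_def T_def using et
  by (auto intro!: open_Int open_Omega open_Collect_less continuous_intros continuous_rho)
 have m0: "grad \<rho> x \<noteq> 0" if "x \<in> S" for x using that nz by (auto simp: S_def)
 define P where "P x = grad \<rho> x \<bullet> grad u x" for x
 define W where "W x = grad \<rho> x \<bullet> grad \<rho> x" for x
 define q where "q x = P x * inverse (W x)" for x
 have W0: "W x \<noteq> 0" if "x \<in> S" for x using m0[OF that] by (simp add: W_def)
 have qpq: "q x = pq x" for x by (simp add: q_def pq_def P_def W_def power2_norm_eq_inner divide_inverse)
 define dP where "dP x = hess \<rho> x (grad u x) + hess u x (grad \<rho> x)" for x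
 define dW where "dW x = hess \<rho> x (grad \<rho> x) + hess \<rho> x (grad \<rho> x)" for x
 define dq where "dq x = P x *\<^sub>R (- (inverse (W x))\<^sup>2 *\<^sub>R dW x) + inverse (W x) *\<^sub>R dP x" for x
 have gP: "GDERIV P x :> dP x" if "x \<in> \<Omega>" for x unfolding P_def[abs_def] dP_def by (rule gderiv_grad_inner[OF C1_pd_rho' C1_pd_u that])
 have gW: "GDERIV W x :> dW x" for x unfolding W_def[abs_def] dW_def by (rule gderiv_grad_inner[OF C1_pd_rho C1_pd_rho UNIV_I])
 have gq: "GDERIV q x :> dq x" if x: "x \<in> S" for x
  unfolding q_def[abs_def] dq_def
  by (intro GDERIV_mult GDERIV_inverse gP gW W0[OF x]) (use x o in auto)
 have cP: "C1_on S P" unfolding P_def[abs_def] by (intro C1_on_grad_inner C1_rho' C1_pd_rho' C1_on_subset[OF C1_u o(4)] C1_on_subset[OF C1_pd_u o(4)])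
 have cW: "C1_on S W" unfolding W_def[abs_def] by (intro C1_on_grad_inner C1_rho' C1_pd_rho')
 have cdq: "continuous_on S dq" unfolding dq_def
  by (intro continuous_intros C1_on_continuous[OF cP] C1_on_continuous[OF cW] W0)
   (use W0 in \<open>auto intro!: continuous_intros continuous_on_hess C1_pd_rho' continuous_grad_rho C1_on_subset[OF C1_pd_u o(4)]
    C1_on_continuous_grad[OF C1_on_subset[OF C1_u o(4)]] simp: dP_def[abs_def] dW_def[abs_def]\<close>)
 have cq: "C1_on S q" by (rule C1_onI[OF _ cdq]) (rule gq)
 define Q where "Q b x = P x * (pd b u x - q x * pd b \<rho> x)" for b x
 define f where "f b x = beta \<epsilon> x * Q b x" for b x
 have cQ: "C1_on S (Q b)" if "b \<in> Basis" for b unfolding Q_def[abs_def]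
  by (intro C1_on_mult C1_on_diff cP cq C1_on_subset[OF C1_pd_u o(4)] C1_pd_rho' that)
 have fT: "f b x = 0" if "x \<in> T" for b x using that eta_beta_values(3)[OF e, of x] by (auto simp: f_def T_def)
 have cf: "C1_on \<Omega> (f b)" if "b \<in> Basis" for b
 proof -
  have "C1_on S (f b)" unfolding f_def[abs_def] by (intro C1_on_mult C1_beta e cQ that)
  moreover have "C1_on T (f b)" by (rule C1_on_cong[OF o(2) _ C1_on_const[of T 0]]) (simp add: fT)
  ultimately show ?thesis using C1_on_Un[OF o(1,2)] o(3) by metis
 qed
 have f0: "f b x = 0" if "x \<in> \<Omega> - closure \<Omega> \<inter> {x. \<rho> x \<le> - \<epsilon>}" for b x using support_beta[OF e that] by (simp add: f_def)
 note I = integral_pd_compact_support[OF open_Omega level_compact level_subset[OF e] cf f0]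
 define E where "E x = (\<Sum>b\<in>Basis. pd b (f b) x)" for x
 show thesis
 proof (rule that[of E])
  show "integrable vol E" unfolding E_def using I(2) by auto
  show "integral\<^sup>L vol E = 0" unfolding E_def
   by (subst Bochner_Integration.integral_sum) (use I(1,2) in auto)
  fix x assume x: "x \<in> \<Omega>"
  show "E x = beta \<epsilon> x *
    (err x + real DIM('a) * (grad \<rho> x \<bullet> grad u x) - (pq x)\<^sup>2 * curv x - grad \<rho> x \<bullet> hess u x (grad u x))"
  proof (cases "x \<in> T")
   case True
   have "pd b (f b) x = 0" if "b \<in> Basis" for b
   proof -
    have "GDERIV (f b) x :> 0" by (rule gderiv_cong[OF o(2) True _ GDERIV_const[of 0]]) (simp add: fT)
    from gderiv_pd[OF this] show ?thesis by simp
   qed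
   moreover have "beta \<epsilon> x = 0" using True eta_beta_values(3)[OF e, of x] by (auto simp: T_def)
   ultimately show ?thesis by (simp add: E_def)
  next
   case False
   then have xS: "x \<in> S" using x o(3) by blast
   define m g A M where "m = grad \<rho> x" and "g = grad u x" and "A = hess u x" and "M = hess \<rho> x"
   define \<tau> where "\<tau> = tau x"
   define N where "N = real DIM('a)"
   have lap: "(\<Sum>b\<in>Basis. pd b (pd b u) x) = N" using lap_u[OF x] by (simp add: laplacian_def N_def)
   have pQ: "pd b (Q b) x = P x * (pd b (pd b u) x - (q x * pd b (pd b \<rho>) x + pd b \<rho> x * (dq x \<bullet> b))) + (pd b u x - q x * pd b \<rho> x) * (dP x \<bullet> b)" if b: "b \<in> Basis" for b
   proof -
    have "GDERIV (Q b) x :> P x *\<^sub>R (grad (pd b u) x - (q x *\<^sub>R grad (pd b \<rho>) x + pd b \<rho> x *\<^sub>R dq x)) + (pd b u x - q x * pd b \<rho> x) *\<^sub>R dP x"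
     unfolding Q_def[abs_def]
     by (intro GDERIV_mult GDERIV_diff gP[OF x] gq[OF xS] C1_onD[OF C1_pd_u[OF b] x] C1_onD[OF C1_pd_rho[OF b] UNIV_I])
    from gderiv_pd[OF this] show ?thesis using b by (simp add: inner_simps pd_eq_grad)
   qed
   have pf: "pd b (f b) x = beta \<epsilon> x * pd b (Q b) x + Q b x * pd b (beta \<epsilon>) x" if b: "b \<in> Basis" for b
    unfolding f_def[abs_def] by (rule pd_mult[OF C1_beta[OF e] cQ[OF b] xS b])
   define k where "k = - ddspline (- \<rho> x / \<epsilon> - 1) / \<epsilon>\<^sup>2"
   have gb: "pd b (beta \<epsilon>) x = k * (grad \<rho> x \<bullet> b)" for b unfolding gderiv_pd[OF gderiv_beta[OF e]] k_def inner_scaleR_left ..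
   \<comment> \<open>\<open>beta \<epsilon>\<close> is a function of \<rho>, so its gradient is
     normal and annihilated by the tangential field; the factor 1 / \<epsilon>^2 disappears.\<close>
   have "(\<Sum>b\<in>Basis. Q b x * pd b (beta \<epsilon>) x) = k * P x * (grad \<rho> x \<bullet> tau x)"
   proof -
    have "(\<Sum>b\<in>Basis. Q b x * pd b (beta \<epsilon>) x) = (\<Sum>b\<in>Basis. k * P x * ((grad \<rho> x \<bullet> b) * (tau x \<bullet> b)))"
     by (intro sum.cong refl) (simp add: Q_def gb pd_eq_grad tau_def qpq inner_simps)
    also have "\<dots> = k * P x * (grad \<rho> x \<bullet> tau x)"
     by (subst euclidean_inner[of "grad \<rho> x" "tau x"]) (simp add: sum_distrib_left)
    finally show ?thesis .
   qed
   also have "\<dots> = 0" using tau_orthogonal[OF m0[OF xS]] by simp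
   finally have E1: "E x = beta \<epsilon> x * (\<Sum>b\<in>Basis. pd b (Q b) x)"
    by (simp add: E_def pf sum.distrib sum_distrib_left)
   have "(\<Sum>b\<in>Basis. pd b (Q b) x) = P x * (N - (q x * laplacian \<rho> x + m \<bullet> dq x)) + \<tau> \<bullet> dP x"
   proof -
    have md: "(\<Sum>b\<in>Basis. pd b \<rho> x * (dq x \<bullet> b)) = m \<bullet> dq x" by (subst euclidean_inner[of m "dq x"]) (simp add: m_def pd_eq_grad)
    have td: "(\<Sum>b\<in>Basis. (pd b u x - q x * pd b \<rho> x) * (dP x \<bullet> b)) = \<tau> \<bullet> dP x"
     by (subst euclidean_inner[of \<tau> "dP x"]) (simp add: \<tau>_def tau_def pd_eq_grad qpq inner_simps)
    have "(\<Sum>b\<in>Basis. pd b (Q b) x) = P x * ((\<Sum>b\<in>Basis. pd b (pd b u) x) - (q x * (\<Sum>b\<in>Basis. pd b (pd b \<rho>) x) + (\<Sum>b\<in>Basis. pd b \<rho> x * (dq x \<bullet> b))))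
     + (\<Sum>b\<in>Basis. (pd b u x - q x * pd b \<rho> x) * (dP x \<bullet> b))"
     by (simp add: pQ sum.distrib sum_subtractf sum_distrib_left[symmetric])
    then show ?thesis unfolding lap md td by (simp add: laplacian_def)
   qed
   moreover have "P x * (m \<bullet> dq x) = q x * (m \<bullet> M g + m \<bullet> A m - 2 * q x * (m \<bullet> M m))"
    using W0[OF xS] by (simp add: q_def dq_def dP_def dW_def m_def g_def A_def M_def inner_simps field_simps power2_eq_square)
   moreover have gg: "g = q x *\<^sub>R m + \<tau>" by (simp add: g_def m_def \<tau>_def tau_def qpq)
   have Ml: "M g = q x *\<^sub>R M m + M \<tau>" and Al: "A g = q x *\<^sub>R A m + A \<tau>" by (simp_all add: gg A_def M_def hess_add hess_scaleR)
   have sym: "\<tau> \<bullet> A m = m \<bullet> A \<tau>" unfolding A_def using hess_u_sym[OF x, of m \<tau>] by (simp add: inner_commute)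
   have PW: "P x = q x * W x" using W0[OF xS] by (simp add: q_def)
   have Wn: "(norm m)\<^sup>2 = W x" by (simp add: W_def m_def power2_norm_eq_inner)
   have curv': "curv x = W x * laplacian \<rho> x - m \<bullet> M m" unfolding curv_def m_def[symmetric] M_def[symmetric] Wn ..
   have err': "err x = 2 * (m \<bullet> A \<tau>) + \<tau> \<bullet> M \<tau> + q x * (\<tau> \<bullet> M m) - q x * (m \<bullet> M \<tau>)"
    unfolding err_def m_def A_def M_def \<tau>_def qpq ..
   have dP': "\<tau> \<bullet> dP x = \<tau> \<bullet> M g + m \<bullet> A \<tau>" unfolding sym[symmetric] by (simp add: dP_def A_def M_def m_def g_def inner_add_right)
   have Pq: "P x * (q x * laplacian \<rho> x) = (q x)\<^sup>2 * (W x * laplacian \<rho> x)" unfolding PW by (simp add: power2_eq_square)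
   ultimately have "(\<Sum>b\<in>Basis. pd b (Q b) x) = err x + N * P x - (q x)\<^sup>2 * curv x - m \<bullet> A g"
    unfolding curv' err' dP' right_diff_distrib distrib_left Pq
    by (simp add: Ml Al inner_simps algebra_simps power2_eq_square)
   then show ?thesis unfolding E1 by (simp add: N_def P_def m_def A_def g_def qpq)
  qed
 qed
qed

section \<open>Smallness of the error, and the limit of thin strips\<close>

lemma hess_rho_bound: "norm (hess \<rho> x v) \<le> real DIM('a) * L2 * norm v"
 by (rule norm_hess_le) (rule L2(2))

text \<open>No bound on the Hessian of u up to the boundary is available, but it occurs only applied
  to \<open>tau x\<close>. The length of \<open>tau x\<close> is of order s^(3/4), the Hessian on
  its direction of order s^(-1/4), which leaves s^(1/2).\<close>

lemma err_small:
 assumes k: "\<kappa> > 0"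
 shows "\<exists>t>0. \<forall>x\<in>\<Omega>. - t < \<rho> x \<longrightarrow> \<bar>err x\<bar> \<le> \<kappa> \<and> c0 / 2 \<le> norm (grad \<rho> x)"
proof -
 obtain C R where C: "C > 0" "0 < R" "R \<le> 1" and tan: "\<And>x e. x \<in> \<Omega> ==> setdist {x} \<Gamma> < R ==> norm e = 1 ==> grad \<rho> x \<bullet> e = 0 ==>
    \<bar>grad u x \<bullet> e\<bar> \<le> C * setdist {x} \<Gamma> powr (3 / 4) \<and>
    norm (grad (\<lambda>y. grad u y \<bullet> e) x) \<le> C * setdist {x} \<Gamma> powr (- 1 / 4)"
  by (rule tangential_interior) (rule that)
 obtain t0 where t0: "t0 > 0" "\<And>x. x \<in> closure \<Omega> ==> - t0 < \<rho> x ==> c0 / 2 \<le> norm (grad \<rho> x)"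
  using strip_grad_lower by blast
 define \<Lambda> where "\<Lambda> = real DIM('a) * L2"
 have L: "\<Lambda> > 0" "\<And>x v. norm (hess \<rho> x v) \<le> \<Lambda> * norm v" using L2(1) hess_rho_bound by (auto simp: \<Lambda>_def)
 define Q where "Q = 2 * M0 / c0"
 have Q: "Q > 0" using M0(1) c0(1) by (simp add: Q_def)
 define B where "B = 2 * (L1 * C\<^sup>2) + \<Lambda> * C\<^sup>2 + 2 * (Q * (\<Lambda> * L1 * C))"
 have B: "B > 0" using L1(1) C(1) L(1) Q by (simp add: B_def add_pos_pos)
 define e where "e = min R ((\<kappa> / B)\<^sup>2)"
 have e: "e > 0" "e \<le> R" "e \<le> (\<kappa> / B)\<^sup>2" using C k B by (auto simp: e_def)
 obtain t1 where t1: "t1 > 0" "\<And>x. x \<in> closure \<Omega> ==> - t1 < \<rho> x ==> \<exists>p\<in>\<Gamma>. dist x p < e"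
  using strip_near_frontier[OF e(1)] by auto
 show ?thesis
 proof (intro exI[of _ "min t0 t1"] conjI ballI impI)
  show "min t0 t1 > 0" using t0 t1 by simp
  fix x assume x: "x \<in> \<Omega>" and r: "- min t0 t1 < \<rho> x"
  have xc: "x \<in> closure \<Omega>" using x closure_Omega by blast
  show W: "c0 / 2 \<le> norm (grad \<rho> x)" using t0(2)[OF xc] r by simp
  then have m0: "grad \<rho> x \<noteq> 0" using c0(1) by auto
  have "- t1 < \<rho> x" using r by linarith
  then obtain p where "p \<in> \<Gamma>" "dist x p < e" using t1(2)[OF xc] by blast
  define s where "s = setdist {x} \<Gamma>"
  have s: "0 \<le> s" "s < e" using setdist_le_dist[of x "{x}" p "\<Gamma>"] \<open>p \<in> \<Gamma>\<close> \<open>dist x p < e\<close>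
   by (auto simp: s_def setdist_pos_le)
  have s1: "s \<le> 1" "s < R" using s e C by auto
  have tb: "norm (tau x) \<le> C * s powr (3 / 4) \<and> norm (hess u x (tau x)) \<le> C\<^sup>2 * s powr (1 / 2)"
  proof (cases "tau x = 0")
   case True
   then show ?thesis using C by (simp add: hess_def)
  next
   case False
   define v where "v = tau x /\<^sub>R norm (tau x)"
   have v: "norm v = 1" "grad \<rho> x \<bullet> v = 0" "tau x = norm (tau x) *\<^sub>R v" using False tau_orthogonal[OF m0] by (auto simp: v_def)
   have "grad u x \<bullet> tau x = tau x \<bullet> tau x"
    using tau_orthogonal[OF m0] by (simp add: tau_def[of x] inner_diff_left inner_commute)
   then have "norm (tau x) = grad u x \<bullet> v" using False by (simp add: v_def power2_norm_eq_inner[symmetric] power2_eq_square)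
   then have n1: "norm (tau x) \<le> C * s powr (3 / 4)" using conjunct1[OF tan[OF x s1(2)[unfolded s_def] v(1,2)]] unfolding s_def by linarith
   have "hess u x v = grad (\<lambda>y. grad u y \<bullet> v) x" by (rule grad_dir_hess[OF C1_pd_u x, symmetric])
   then have "norm (hess u x v) \<le> C * s powr (- 1 / 4)" using tan[OF x s1(2)[unfolded s_def] v(1,2)] by (simp add: s_def)
   then have "norm (tau x) * norm (hess u x v) \<le> (C * s powr (3 / 4)) * (C * s powr (- 1 / 4))"
    using n1 C(1) by (intro mult_mono) auto
   also have "\<dots> = C\<^sup>2 * (s powr (3 / 4) * s powr (- 1 / 4))" by (simp add: power2_eq_square)
   also have "\<dots> = C\<^sup>2 * s powr (1 / 2)" by (simp only: powr_add[symmetric]) simp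
   finally have "norm (hess u x (tau x)) \<le> C\<^sup>2 * s powr (1 / 2)"
    by (subst v(3)) (simp add: hess_scaleR)
   then show ?thesis using n1 by simp
  qed
  define \<sigma> where "\<sigma> = s powr (1 / 2)"
  have \<sigma>: "\<sigma> \<ge> 0" "\<sigma> \<le> 1" "s powr (3 / 4) \<le> \<sigma>"
   using s s1 powr_mono'[of "1 / 2" "3 / 4" s] powr_mono2[of "1 / 2" s 1] by (auto simp: \<sigma>_def)
  have n1: "norm (tau x) \<le> C * \<sigma>" using conjunct1[OF tb] mult_left_mono[OF \<sigma>(3) less_imp_le[OF C(1)]] by linarith
  have n2: "norm (hess u x (tau x)) \<le> C\<^sup>2 * \<sigma>" using tb by (simp add: \<sigma>_def)
  have CS: "\<bar>a \<bullet> b\<bar> \<le> A * B" if "norm a \<le> A" "norm b \<le> B" for a b :: 'a and A B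
   by (rule order_trans[OF Cauchy_Schwarz_ineq2 mult_mono[OF that]]) (use order_trans[OF norm_ge_zero that(1)] in auto)
  have hM: "norm (hess \<rho> x v) \<le> \<Lambda> * V" if "norm v \<le> V" for v V
   using order_trans[OF L(2) mult_left_mono[OF that]] L(1) by simp
  have q: "\<bar>pq x\<bar> \<le> Q"
  proof -
   have n: "norm (grad \<rho> x) > 0" using m0 by simp
   have "\<bar>pq x\<bar> * norm (grad \<rho> x) = \<bar>grad \<rho> x \<bullet> grad u x\<bar> / norm (grad \<rho> x)" by (simp add: pq_def power2_eq_square)
   also have "\<dots> \<le> norm (grad u x)" using Cauchy_Schwarz_ineq2[of "grad \<rho> x" "grad u x"] n by (simp add: field_simps)
   also have "\<dots> \<le> M0" by (rule M0(2)[OF x])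
   finally have "\<bar>pq x\<bar> * (c0 / 2) \<le> M0" using mult_left_mono[OF W, of "\<bar>pq x\<bar>"] by linarith
   then show ?thesis using c0(1) by (simp add: Q_def field_simps)
  qed
  have e1: "\<bar>grad \<rho> x \<bullet> hess u x (tau x)\<bar> \<le> L1 * (C\<^sup>2 * \<sigma>)" by (rule CS[OF L1(2) n2])
  have e2: "\<bar>tau x \<bullet> hess \<rho> x (tau x)\<bar> \<le> \<Lambda> * C\<^sup>2 * \<sigma>"
  proof -
   have "\<bar>tau x \<bullet> hess \<rho> x (tau x)\<bar> \<le> (C * \<sigma>) * (\<Lambda> * (C * \<sigma>))" by (rule CS[OF n1 hM[OF n1]])
   also have "\<dots> = \<Lambda> * C\<^sup>2 * \<sigma> * \<sigma>" by (simp add: power2_eq_square)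
   also have "\<dots> \<le> \<Lambda> * C\<^sup>2 * \<sigma> * 1" using L(1) \<sigma> by (intro mult_left_mono) auto
   finally show ?thesis by simp
  qed
  have e3: "\<bar>tau x \<bullet> hess \<rho> x (grad \<rho> x)\<bar> \<le> (C * \<sigma>) * (\<Lambda> * L1)" by (rule CS[OF n1 hM[OF L1(2)]])
  have e4: "\<bar>grad \<rho> x \<bullet> hess \<rho> x (tau x)\<bar> \<le> L1 * (\<Lambda> * (C * \<sigma>))" by (rule CS[OF L1(2) hM[OF n1]])
  have e3': "\<bar>pq x * (tau x \<bullet> hess \<rho> x (grad \<rho> x))\<bar> \<le> Q * ((C * \<sigma>) * (\<Lambda> * L1))" unfolding abs_mult using q e3 by (intro mult_mono) auto
  have e4': "\<bar>pq x * (grad \<rho> x \<bullet> hess \<rho> x (tau x))\<bar> \<le> Q * (L1 * (\<Lambda> * (C * \<sigma>)))" unfolding abs_mult using q e4 by (intro mult_mono) auto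
  have "\<bar>err x\<bar> \<le> 2 * (L1 * (C\<^sup>2 * \<sigma>)) + \<Lambda> * C\<^sup>2 * \<sigma> + Q * ((C * \<sigma>) * (\<Lambda> * L1)) + Q * (L1 * (\<Lambda> * (C * \<sigma>)))"
   using e1 e2 e3' e4' unfolding err_def by linarith
  also have "\<dots> = B * \<sigma>" by (simp add: B_def algebra_simps)
  also have "\<dots> \<le> B * (\<kappa> / B)"
  proof (rule mult_left_mono)
   have "\<sigma> = sqrt s" using s by (simp add: \<sigma>_def powr_half_sqrt)
   also have "\<dots> \<le> sqrt ((\<kappa> / B)\<^sup>2)" using s(2) e(3) by (intro real_sqrt_le_mono) linarith
   also have "sqrt ((\<kappa> / B)\<^sup>2) = \<kappa> / B" using k B by simp
   finally show "\<sigma> \<le> \<kappa> / B" .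
  qed (use B in simp)
  finally show "\<bar>err x\<bar> \<le> \<kappa>" using B by simp
 qed
qed

lemma continuous_curv: "continuous_on V curv"
 unfolding curv_def[abs_def] laplacian_def
 by (intro continuous_intros continuous_on_hess C1_pd_rho' continuous_grad_rho C1_on_continuous_pd)

text \<open>The Hessian identity, N - 1 times the Laplacian identity, and the tangential identity
  are added. The terms with the Hessian of u cancel and leave \<open>beta \<epsilon>\<close> times
  err + 2 c P - q^2 curv, which is then bounded pointwise by a multiple of |grad \<rho>|, whose flux
  is known.\<close>

lemma flux_bound:
 assumes N: "DIM('a) \<ge> 2" and k: "k > 0" and curv: "\<And>p. p \<in> \<Gamma> ==> k * norm (grad \<rho> p) ^ 3 \<le> curv p"
  and \<kappa>: "0 < \<kappa>" "\<kappa> < k" "\<kappa> < 1"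
 defines "c \<equiv> real DIM('a) - 1"
 defines "B \<equiv> (c\<^sup>2 / (k - \<kappa>) + 2 * \<kappa> / c0) * ((surface_area \<Gamma> + 2 * \<kappa>) / (1 - \<kappa>))"
 shows "\<exists>t>0. \<forall>\<epsilon>. 0 < \<epsilon> \<and> \<epsilon> < t \<longrightarrow> integrable vol (\<lambda>x. eta \<epsilon> x * (Hsq x + c * real DIM('a))) \<and>
   (LINT x|vol. eta \<epsilon> x * (Hsq x + c * real DIM('a))) \<le> B"
proof (rule strip_area[OF N \<kappa>(1,3)])
 fix t2 :: real
 assume t2: "t2 > 0"
  "\<And>\<theta> \<theta>'. (\<And>r. (\<theta> has_real_derivative \<theta>' r) (at r)) ==> continuous_on UNIV \<theta>' ==> (\<And>r. \<theta>' r \<ge> 0) ==> (\<And>r. -1 \<le> \<theta> r) ==> (\<And>r. \<theta> r \<le> 0) ==>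
   (\<And>r. r \<le> - t2 ==> \<theta>' r = 0) ==>
   (LBINT x. indicator \<Omega> x * (\<theta>' (\<rho> x) * norm (grad \<rho> x))) \<le> (surface_area \<Gamma> + 2 * \<kappa>) / (1 - \<kappa>)"
 obtain t1 where t1: "t1 > 0" "\<And>x. x \<in> \<Omega> ==> - t1 < \<rho> x ==> \<bar>err x\<bar> \<le> \<kappa> \<and> c0 / 2 \<le> norm (grad \<rho> x)"
  using err_small[OF \<kappa>(1)] by blast
 \<comment> \<open>The curvature bound is assumed on the boundary only; a slightly smaller constant
   survives in a neighbourhood by continuity.\<close>
 define k' where "k' = k - \<kappa>"
 have k': "k' > 0" "k' < k" using \<kappa> by (auto simp: k'_def)
 define V where "V = {x. k' * norm (grad \<rho> x) ^ 3 < curv x}"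
 have "open V" unfolding V_def by (intro open_Collect_less continuous_intros continuous_curv continuous_grad_rho)
 moreover have "\<Gamma> \<subseteq> V"
 proof
  fix p assume p: "p \<in> \<Gamma>"
  have "norm (grad \<rho> p) > 0" using c0(1) c0(2)[OF p] by linarith
  then have "k' * norm (grad \<rho> p) ^ 3 < k * norm (grad \<rho> p) ^ 3" using k' by simp
  then show "p \<in> V" using curv[OF p] by (simp add: V_def)
 qed
 ultimately obtain e3 where e3: "e3 > 0" "\<And>x p. p \<in> \<Gamma> ==> dist x p < e3 ==> x \<in> V" by (rule neighborhood_in_cover) (rule that)
 obtain t3 where t3: "t3 > 0" "\<And>x. x \<in> closure \<Omega> ==> - t3 < \<rho> x ==> \<exists>p\<in>\<Gamma>. dist x p < e3"
  using strip_near_frontier[OF e3(1)] by auto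
 define t where "t = Min {t1, t2, t3}"
 have t: "t > 0" "t \<le> t1" "t \<le> t2" "t \<le> t3" using t1 t2 t3 by (auto simp: t_def)
 define G where "G = c\<^sup>2 / k' + 2 * \<kappa> / c0"
 have G: "G \<ge> 0" using k' \<kappa> c0(1) by (auto simp: G_def intro!: add_nonneg_nonneg)
 show ?thesis
 proof (intro exI[of _ "t / 8"] conjI allI impI)
  show "t / 8 > 0" using t by simp
  fix \<epsilon> assume "0 < \<epsilon> \<and> \<epsilon> < t / 8"
  then have e: "\<epsilon> > 0" "4 * \<epsilon> < t" by auto
  have nz: "grad \<rho> x \<noteq> 0" if "x \<in> \<Omega>" "- t < \<rho> x" for x using t1(2)[OF that(1)] that(2) t(2) c0(1) by auto
  obtain E where E: "integrable vol E" "integral\<^sup>L vol E = 0"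
   "\<And>x. x \<in> \<Omega> ==> E x = beta \<epsilon> x *
     (err x + real DIM('a) * (grad \<rho> x \<bullet> grad u x) - (pq x)\<^sup>2 * curv x - grad \<rho> x \<bullet> hess u x (grad u x))"
   by (rule flux_tangential[OF e(1) nz e(2)]) (auto intro: that)
  note FH = flux_hessian[OF e(1)] and FL = flux_laplacian[OF e(1)]
  define r where "r x = beta \<epsilon> x * (grad \<rho> x \<bullet> hess u x (grad u x) - grad \<rho> x \<bullet> grad u x) + c * (beta \<epsilon> x * (grad \<rho> x \<bullet> grad u x)) + E x" for x
  have ri: "integrable vol r" unfolding r_def[abs_def] by (intro Bochner_Integration.integrable_add integrable_mult_right FH FL E)
  have fe: "(\<lambda>x. eta \<epsilon> x * (Hsq x + c * real DIM('a))) = (\<lambda>x. eta \<epsilon> x * Hsq x + c * (eta \<epsilon> x * real DIM('a)))"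
   by (simp add: fun_eq_iff algebra_simps)
  show "integrable vol (\<lambda>x. eta \<epsilon> x * (Hsq x + c * real DIM('a)))"
   unfolding fe by (intro Bochner_Integration.integrable_add integrable_mult_right FH FL)
  have bW: "integrable vol (\<lambda>x. beta \<epsilon> x * norm (grad \<rho> x))"
   by (rule integrable_on_compact_support[OF open_Omega level_compact level_subset[OF e(1)]])
    (auto intro!: continuous_intros continuous_grad_rho C1_on_continuous[OF C1_beta[OF e(1)]] simp: support_beta[OF e(1)])
  have area: "(LINT x|vol. beta \<epsilon> x * norm (grad \<rho> x)) \<le> (surface_area \<Gamma> + 2 * \<kappa>) / (1 - \<kappa>)"
  proof -
   define \<theta> where "\<theta> r = - spline (- r / \<epsilon> - 1)" for r
   define \<theta>' where "\<theta>' r = dspline (- r / \<epsilon> - 1) / \<epsilon>" for r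
   have "(\<theta> has_real_derivative - (dspline (- r / \<epsilon> - 1) * (- 1 / \<epsilon>))) (at r)" for r unfolding \<theta>_def
    by (rule DERIV_minus, rule DERIV_chain2[OF spline_deriv]) (use e in \<open>auto intro!: derivative_eq_intros\<close>)
   then have d: "(\<theta> has_real_derivative \<theta>' r) (at r)" for r by (simp add: \<theta>'_def)
   have c: "continuous_on UNIV \<theta>'" unfolding \<theta>'_def[abs_def]
    by (intro continuous_intros continuous_on_compose2[OF continuous_dspline]) (use e in auto)
   have z: "\<theta>' r = 0" if "r \<le> - t2" for r
   proof -
    have "3 \<le> - r / \<epsilon> - 1" using that e t by (simp add: field_simps)
    then show ?thesis by (simp add: \<theta>'_def dspline_zero)
   qed
   have i: "(LBINT x. indicator \<Omega> x * (\<theta>' (\<rho> x) * norm (grad \<rho> x))) \<le> (surface_area \<Gamma> + 2 * \<kappa>) / (1 - \<kappa>)"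
    by (rule t2(2)[OF d c _ _ _ z]) (use e in \<open>auto simp: \<theta>'_def \<theta>_def dspline_nonneg spline_bounds\<close>)
   have "(LINT x|vol. beta \<epsilon> x * norm (grad \<rho> x)) = (LBINT x. if x \<in> \<Omega> then beta \<epsilon> x * norm (grad \<rho> x) else 0)"
   proof (rule lebesgue_on_lborel(1))
    show "(\<lambda>x. if x \<in> \<Omega> then beta \<epsilon> x * norm (grad \<rho> x) else 0) \<in> borel_measurable borel"
     by (intro borel_measurable_continuous_onI continuous_on_extend_0[OF open_Omega level_compact level_subset[OF e(1)]])
      (auto intro!: continuous_intros continuous_grad_rho C1_on_continuous[OF C1_beta[OF e(1)]] simp: support_beta[OF e(1)])
   qed (use open_Omega in \<open>auto intro: borel_open\<close>)
   also have "(\<lambda>x. if x \<in> \<Omega> then beta \<epsilon> x * norm (grad \<rho> x) else 0) = (\<lambda>x. indicator \<Omega> x * (\<theta>' (\<rho> x) * norm (grad \<rho> x)))"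
    by (auto simp: fun_eq_iff indicator_def beta_def \<theta>'_def)
   finally show ?thesis using i by simp
  qed
  have pw: "r x \<le> G * (beta \<epsilon> x * norm (grad \<rho> x))" if x: "x \<in> \<Omega>" for x
  proof (cases "- t < \<rho> x")
   case False
   then have "beta \<epsilon> x = 0" using eta_beta_values(3)[OF e(1), of x] e(2) by linarith
   then show ?thesis by (simp add: r_def E(3)[OF x])
  next
   case True
   define W where "W = norm (grad \<rho> x)"
   define P where "P = grad \<rho> x \<bullet> grad u x"
   define q where "q = pq x"
   have er: "\<bar>err x\<bar> \<le> \<kappa>" and W: "c0 / 2 \<le> W" using t1(2)[OF x] True t(2) by (auto simp: W_def)
   have W0: "W > 0" using W c0(1) by linarith
   have Pq: "P = q * W\<^sup>2" using W0 by (simp add: P_def q_def pq_def W_def)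
   have "x \<in> closure \<Omega>" using x closure_Omega by blast
   then obtain p where "p \<in> \<Gamma>" "dist x p < e3" using t3(2)[of x] True t(4) by auto
   then have "k' * W ^ 3 \<le> curv x" using e3(2) by (fastforce simp: V_def W_def)
   then have "q\<^sup>2 * (k' * W ^ 3) \<le> q\<^sup>2 * curv x" by (intro mult_left_mono) auto
   moreover have "2 * c * P - q\<^sup>2 * (k' * W ^ 3) \<le> c\<^sup>2 / k' * W"
   proof -
    \<comment> \<open>Completing the square in q, with P = q W^2; the quadratic polynomial is
      largest at q = c / (k' W).\<close>
    have "0 \<le> W / k' * (k' * W * q - c)\<^sup>2" using W0 k' by simp
    also have "\<dots> = c\<^sup>2 / k' * W - (2 * c * P - q\<^sup>2 * (k' * W ^ 3))"
     using k' by (simp add: Pq power2_eq_square power3_eq_cube field_simps)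
    finally show ?thesis by simp
   qed
   moreover have "err x \<le> 2 * \<kappa> / c0 * W"
   proof -
    have "\<kappa> = 2 * \<kappa> / c0 * (c0 / 2)" using c0(1) by simp
    also have "\<dots> \<le> 2 * \<kappa> / c0 * W" using W \<kappa>(1) c0(1) by (intro mult_left_mono) auto
    finally show ?thesis using er by linarith
   qed
   ultimately have "err x + 2 * c * P - q\<^sup>2 * curv x \<le> G * W" by (simp add: G_def distrib_right)
   then have "beta \<epsilon> x * (err x + 2 * c * P - q\<^sup>2 * curv x) \<le> beta \<epsilon> x * (G * W)"
    using eta_beta_values(7)[OF e(1)] by (intro mult_left_mono) auto
   then show ?thesis by (simp add: r_def E(3)[OF x] P_def[symmetric] q_def[symmetric] W_def[symmetric] c_def algebra_simps)
  qed
  have "(LINT x|vol. eta \<epsilon> x * (Hsq x + c * real DIM('a))) = integral\<^sup>L vol r"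
   unfolding fe r_def[abs_def] using FH FL E(1,2) by simp
  also have "\<dots> \<le> (LINT x|vol. G * (beta \<epsilon> x * norm (grad \<rho> x)))"
   by (rule integral_mono[OF ri integrable_mult_right[OF bW]]) (simp add: pw)
  also have "\<dots> = G * (LINT x|vol. beta \<epsilon> x * norm (grad \<rho> x))" by simp
  also have "\<dots> \<le> B" unfolding B_def G_def[symmetric] k'_def[symmetric] using area G by (rule mult_left_mono)
  finally show "(LINT x|vol. eta \<epsilon> x * (Hsq x + c * real DIM('a))) \<le> B" .
 qed
qed

lemma continuous_Hsq: "continuous_on \<Omega> Hsq"
 unfolding Hsq_def[abs_def] by (intro continuous_intros C1_on_continuous_grad C1_pd_hh)

lemma Hsq_nonneg: "Hsq x \<ge> 0"
 by (simp add: Hsq_def sum_nonneg)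

lemma finite_measure_Omega: "\<Omega> \<in> lmeasurable"
 using open_Omega bounded_Omega by (simp add: bounded_set_imp_lmeasurable)

text \<open>Integrability of |D^2 h|^2 over \<Omega> is not known beforehand. The integrand is
  nonnegative, so Fatou's lemma along cutoffs tending to 1 gives it together with the bound.\<close>

lemma hessian_flux_aux:
 assumes N: "DIM('a) \<ge> 2" and k: "k > 0" and curv: "\<And>p. p \<in> \<Gamma> ==> k * norm (grad \<rho> p) ^ 3 \<le> curv p"
  and \<kappa>: "0 < \<kappa>" "\<kappa> < k" "\<kappa> < 1"
 defines "c \<equiv> real DIM('a) - 1"
 defines "B \<equiv> (c\<^sup>2 / (k - \<kappa>) + 2 * \<kappa> / c0) * ((surface_area \<Gamma> + 2 * \<kappa>) / (1 - \<kappa>))"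
 shows "integrable vol (\<lambda>x. Hsq x + c * real DIM('a))"
  and "(LINT x|vol. Hsq x + c * real DIM('a)) \<le> B"
proof -
 define f where "f x = Hsq x + c * real DIM('a)" for x
 have c: "c > 0" using N by (simp add: c_def)
 have f0: "f x \<ge> 0" for x using Hsq_nonneg[of x] c by (simp add: f_def)
 have B: "B \<ge> 0" using \<kappa> c0(1) by (auto simp: B_def surface_area_def intro!: mult_nonneg_nonneg add_nonneg_nonneg divide_nonneg_nonneg)
 obtain t where t: "t > 0" "\<And>\<epsilon>. 0 < \<epsilon> ==> \<epsilon> < t ==> integrable vol (\<lambda>x. eta \<epsilon> x * f x)"
  "\<And>\<epsilon>. 0 < \<epsilon> ==> \<epsilon> < t ==> (LINT x|vol. eta \<epsilon> x * f x) \<le> B"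
  using flux_bound[OF N k curv \<kappa>] unfolding f_def B_def c_def by blast
 obtain e where e: "\<And>n::nat. e n > 0" "\<And>n. e n < t" and e1: "\<And>x. x \<in> \<Omega> ==> eventually (\<lambda>n. eta (e n) x = 1) sequentially"
  by (rule eta_sequence[OF t(1)]) (rule that)
 have lim: "liminf (\<lambda>n. ennreal (eta (e n) x * f x)) = ennreal (f x)" if x: "x \<in> \<Omega>" for x
 proof -
  have "eventually (\<lambda>n. ennreal (eta (e n) x * f x) = ennreal (f x)) sequentially"
   using e1[OF x] by eventually_elim simp
  then have "(\<lambda>n. ennreal (eta (e n) x * f x)) \<longlonglongrightarrow> ennreal (f x)" by (rule tendsto_eventually)
  then show ?thesis using lim_imp_Liminf[OF sequentially_bot] by blast
 qed
 have m: "(\<lambda>x. ennreal (eta (e n) x * f x)) \<in> borel_measurable vol" for n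
  using borel_measurable_integrable[OF t(2)[OF e]] by measurable
 have "(\<integral>\<^sup>+x. ennreal (f x) \<partial>vol) = (\<integral>\<^sup>+x. liminf (\<lambda>n. ennreal (eta (e n) x * f x)) \<partial>vol)"
  by (rule nn_integral_cong) (simp add: lim)
 also have "\<dots> \<le> liminf (\<lambda>n. \<integral>\<^sup>+x. ennreal (eta (e n) x * f x) \<partial>vol)" by (rule nn_integral_liminf[OF m])
 also have "\<dots> \<le> liminf (\<lambda>n::nat. ennreal B)"
 proof (rule Liminf_mono, rule always_eventually, rule allI)
  fix n
  have "(\<integral>\<^sup>+x. ennreal (eta (e n) x * f x) \<partial>vol) = ennreal (LINT x|vol. eta (e n) x * f x)"
   by (rule nn_integral_eq_integral[OF t(2)[OF e]]) (simp add: f0 eta_beta_values(5)[OF e(1)])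
  then show "(\<integral>\<^sup>+x. ennreal (eta (e n) x * f x) \<partial>vol) \<le> ennreal B" using t(3)[OF e] by (simp add: ennreal_leI)
 qed
 also have "\<dots> = ennreal B" by (simp add: Liminf_const)
 finally have b: "(\<integral>\<^sup>+x. ennreal (f x) \<partial>vol) \<le> ennreal B" .
 have fm: "f \<in> borel_measurable vol"
  unfolding f_def[abs_def] using open_Omega
  by (intro continuous_imp_measurable_on_sets_lebesgue continuous_intros continuous_Hsq) (auto intro: borel_open)
 have fi: "integrable vol f"
  by (rule integrableI_nonneg[OF fm]) (use f0 b in \<open>auto intro: le_less_trans[OF _ ennreal_less_top]\<close>)
 then show "integrable vol (\<lambda>x. Hsq x + c * real DIM('a))" by (simp add: f_def[abs_def])
 have "ennreal (integral\<^sup>L vol f) \<le> ennreal B"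
  using b nn_integral_eq_integral[OF fi] f0 by simp
 then show "(LINT x|vol. Hsq x + c * real DIM('a)) \<le> B" using B by (simp add: f_def[abs_def])
qed

text \<open>The limit \<kappa> to 0. For a ball with k equal to N - 1 over its radius, the volume
  term on the left equals the right-hand side and the Hessian integral vanishes, so nothing is
  lost.\<close>

lemma hessian_flux:
 assumes N: "DIM('a) \<ge> 2" and k: "k > 0" and curv: "\<And>p. p \<in> \<Gamma> ==> k * norm (grad \<rho> p) ^ 3 \<le> curv p"
 shows "integrable vol Hsq"
  and "integral\<^sup>L vol Hsq + (real DIM('a) - 1) * real DIM('a) * measure lebesgue \<Omega> \<le> (real DIM('a) - 1)\<^sup>2 / k * surface_area \<Gamma>"
proof -
 define c where "c = real DIM('a) - 1"
 have ci: "integrable vol (\<lambda>x. c * real DIM('a))" by (rule finite_measure.integrable_const[OF finite_measure_lebesgue_on[OF finite_measure_Omega]])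
 define B where "B \<kappa> = (c\<^sup>2 / (k - \<kappa>) + 2 * \<kappa> / c0) * ((surface_area \<Gamma> + 2 * \<kappa>) / (1 - \<kappa>))" for \<kappa>
 define m where "m = min k 1 / 2"
 have m: "0 < m" "m < k" "m < 1" using k by (auto simp: m_def min_def)
 note aux = hessian_flux_aux[OF N k curv, folded c_def, folded B_def]
 have "integrable vol (\<lambda>x. (Hsq x + c * real DIM('a)) - c * real DIM('a))"
  by (rule Bochner_Integration.integrable_diff[OF aux(1)[OF _ m] ci])
 then show hi: "integrable vol Hsq" by simp
 have e: "(LINT x|vol. Hsq x + c * real DIM('a)) = integral\<^sup>L vol Hsq + c * real DIM('a) * measure lebesgue \<Omega>"
  using hi ci finite_measure_Omega by (simp add: measure_restrict_space)
 have "(B \<longlongrightarrow> (c\<^sup>2 / (k - 0) + 2 * 0 / c0) * ((surface_area \<Gamma> + 2 * 0) / (1 - 0))) (at_right 0)"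
  unfolding B_def[abs_def] by (intro tendsto_intros) (use k c0(1) in auto)
 moreover have "eventually (\<lambda>\<kappa>. integral\<^sup>L vol Hsq + c * real DIM('a) * measure lebesgue \<Omega> \<le> B \<kappa>) (at_right 0)"
  using eventually_at_right_real[OF m(1)]
  by eventually_elim (use aux(2) m e in auto)
 ultimately have "integral\<^sup>L vol Hsq + c * real DIM('a) * measure lebesgue \<Omega> \<le> (c\<^sup>2 / (k - 0) + 2 * 0 / c0) * ((surface_area \<Gamma> + 2 * 0) / (1 - 0))"
  by (intro tendsto_lowerbound[OF _ _ trivial_limit_at_right_real])
 then show "integral\<^sup>L vol Hsq + (real DIM('a) - 1) * real DIM('a) * measure lebesgue \<Omega> \<le> (real DIM('a) - 1)\<^sup>2 / k * surface_area \<Gamma>"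
  by (simp add: c_def)
qed

end

section \<open>Poincare inequality\<close>

lemma integrable_dominated_open:
 fixes f g :: "'a::euclidean_space \<Rightarrow> real"
 assumes "open W" "continuous_on W f" "integrable (lebesgue_on W) g" "\<And>x. x \<in> W ==> \<bar>f x\<bar> \<le> g x"
 shows "integrable (lebesgue_on W) f"
proof (rule Bochner_Integration.integrable_bound[OF assms(3)])
 show "f \<in> borel_measurable (lebesgue_on W)"
  using assms(1,2) by (intro continuous_imp_measurable_on_sets_lebesgue) (auto intro: borel_open)
 show "AE x in lebesgue_on W. norm (f x) \<le> norm (g x)" by (rule AE_I2) (use assms(4) in fastforce)
qed

lemma norm_grad_sq: "(norm (grad v x))\<^sup>2 = (\<Sum>b\<in>Basis. (pd b v x)\<^sup>2)"
 unfolding power2_norm_eq_inner by (subst euclidean_inner) (simp add: pd_eq_grad power2_eq_square)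

lemma
 fixes v :: "'a::euclidean_space \<Rightarrow> real"
 assumes W: "open W" and v: "C1_on W v" and i: "finite_energy W v"
 shows sq_integrable_pd: "b \<in> Basis ==> sq_integrable W (pd b v)"
  and energy_sum: "energy W v = (\<Sum>b\<in>Basis. sq_integral W (pd b v))"
proof -
 show s: "sq_integrable W (pd b v)" if b: "b \<in> Basis" for b
 proof (rule integrable_dominated_open[OF W _ i])
  show "continuous_on W (\<lambda>x. (pd b v x)\<^sup>2)" by (intro continuous_intros C1_on_continuous_pd[OF v b])
  show "\<bar>(pd b v x)\<^sup>2\<bar> \<le> (norm (grad v x))\<^sup>2" for x
   unfolding norm_grad_sq using member_le_sum[OF b, of "\<lambda>b. (pd b v x)\<^sup>2"] by simp
 qed
 show "energy W v = (\<Sum>b\<in>Basis. sq_integral W (pd b v))"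
  unfolding norm_grad_sq by (rule Bochner_Integration.integral_sum[OF s])
qed

lemma harm_grad_bound:
 fixes v :: "'a::euclidean_space \<Rightarrow> real"
 assumes W: "open W" and v: "harm W v" and s: "0 < s" "cball x s \<subseteq> W" and i: "finite_energy W v"
 shows "(norm (grad v x))\<^sup>2 \<le> energy W v / (kerc TYPE('a) * s ^ DIM('a))"
 unfolding energy_sum[OF W harm_C1[OF W v] i] sum_divide_distrib unfolding norm_grad_sq
 by (intro sum_mono harm_L2_bound[OF W harm_pd[OF W v] s] sq_integrable_pd[OF W harm_C1[OF W v] i])

text \<open>On interior balls the energy bounds the gradient, so values at nearby points differ by
  at most a multiple of the root of the energy. Connectedness chains balls from z, where v vanishes,
  and compactness makes the constant uniform on K.\<close>

lemma harm_interior_bound: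
 fixes W :: "'a::euclidean_space set"
 assumes W: "open W" "connected W" and z: "z \<in> W" and K: "compact K" "K \<subseteq> W"
 shows "\<exists>C\<ge>0. \<forall>v. harm W v \<and> finite_energy W v \<and> v z = 0 \<longrightarrow> (\<forall>x\<in>K. \<bar>v x\<bar> \<le> C * sqrt (energy W v))"
proof -
 define adm where "adm v \<longleftrightarrow> harm W v \<and> finite_energy W v" for v
 define G where "G v = sqrt (energy W v)" for v
 have G: "G v \<ge> 0" for v by (simp add: G_def)
 \<comment> \<open>The constant is chosen before v, so composing the relation along a chain yields
   one constant for all admissible functions.\<close>
 define R where "R x y \<longleftrightarrow> (\<exists>C\<ge>0. \<forall>v. adm v \<longrightarrow> \<bar>v y - v x\<bar> \<le> C * G v)" for x y
 have loc: "\<exists>s>0. \<exists>C\<ge>0. ball x s \<subseteq> W \<and> (\<forall>y\<in>ball x s. \<forall>v. adm v \<longrightarrow> \<bar>v y - v x\<bar> \<le> C * G v)" if x: "x \<in> W" for x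
 proof -
  obtain r where r: "r > 0" "cball x r \<subseteq> W" using W(1) x open_contains_cball by blast
  define s where "s = r / 2"
  have s: "0 < s" "ball x s \<subseteq> W" using r by (auto simp: s_def subset_eq)
  define k where "k = sqrt (kerc TYPE('a) * s ^ DIM('a))"
  have k: "k > 0" using kerc_pos[where 'a='a] s by (simp add: k_def)
  have "\<bar>v y - v x\<bar> \<le> s / k * G v" if y: "y \<in> ball x s" and v: "adm v" for y v
  proof -
   have "\<bar>v y - v x\<bar> \<le> G v / k * norm (y - x)"
   proof (rule differentiable_bound_gderiv[OF convex_ball[of x s], of v "grad v"])
    fix w assume w: "w \<in> ball x s"
    have cb: "cball w s \<subseteq> W" using w by (intro cball_shift[OF r(2)]) (simp add: s_def)
    show "GDERIV v w :> grad v w" using C1_onD[OF harm_C1[OF W(1)]] v subsetD[OF s(2) w] by (simp add: adm_def)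
    have "norm (grad v w) \<le> sqrt (energy W v / (kerc TYPE('a) * s ^ DIM('a)))"
     by (rule real_le_rsqrt[OF harm_grad_bound[OF W(1) _ s(1) cb]]) (use v in \<open>auto simp: adm_def\<close>)
    then show "norm (grad v w) \<le> G v / k" by (simp add: G_def k_def real_sqrt_divide)
   qed (use y s in auto)
   also have "\<dots> \<le> G v / k * s" using y G[of v] k by (intro mult_left_mono) (auto simp: dist_norm norm_minus_commute)
   finally show ?thesis by (simp add: mult.commute)
  qed
  moreover have "s / k \<ge> 0" using s k by simp
  ultimately show ?thesis using s by blast
 qed
 have chain: "R z x" if x: "x \<in> W" for x
 proof (rule connected_equivalence_relation[OF W(2) z x])
  show "R y x" if "R x y" for x y using that unfolding R_def by (simp add: abs_minus_commute)
  show "R a c" if ab: "R a b" and bc: "R b c" for a b c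
  proof -
   obtain C C' where C: "C \<ge> 0" "C' \<ge> 0" "\<And>v. adm v ==> \<bar>v b - v a\<bar> \<le> C * G v" "\<And>v. adm v ==> \<bar>v c - v b\<bar> \<le> C' * G v"
    using ab bc unfolding R_def by blast
   have "\<bar>v c - v a\<bar> \<le> (C + C') * G v" if "adm v" for v using C(3,4)[OF that] by (simp add: distrib_right)
   then show ?thesis unfolding R_def using C(1,2) add_nonneg_nonneg by blast
  qed
  show "\<exists>T. openin (top_of_set W) T \<and> a \<in> T \<and> (\<forall>x\<in>T. R a x)" if a: "a \<in> W" for a
  proof -
   obtain s C where s: "s > 0" "C \<ge> 0" "ball a s \<subseteq> W" "\<forall>y\<in>ball a s. \<forall>v. adm v \<longrightarrow> \<bar>v y - v a\<bar> \<le> C * G v" using loc[OF a] by blast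
   then show ?thesis unfolding R_def by (intro exI[of _ "ball a s"] conjI open_subset centre_in_ball[THEN iffD2] open_ball) blast+
  qed
 qed
 obtain s C where s: "\<And>x. x \<in> W ==> s x > 0 \<and> C x \<ge> (0::real) \<and> (\<forall>y\<in>ball x (s x). \<forall>v. adm v \<longrightarrow> \<bar>v y - v x\<bar> \<le> C x * G v)"
  using loc by metis
 obtain C' where C': "\<And>x. x \<in> W ==> C' x \<ge> (0::real) \<and> (\<forall>v. adm v \<longrightarrow> \<bar>v x - v z\<bar> \<le> C' x * G v)"
  using chain unfolding R_def by metis
 have "K \<subseteq> (\<Union>x\<in>K. ball x (s x))" using s K(2) by (intro subsetI UN_I) (auto simp: subset_iff)
 then obtain D where D: "D \<subseteq> K" "finite D" "K \<subseteq> (\<Union>x\<in>D. ball x (s x))"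
  by (rule compactE_image[OF K(1), of K "\<lambda>x. ball x (s x)", rotated]) auto
 have DO: "x \<in> W" if "x \<in> D" for x using that D(1) K(2) by blast
 show ?thesis
 proof (intro exI[of _ "\<Sum>x\<in>D. C x + C' x"] conjI allI impI ballI)
  show "0 \<le> (\<Sum>x\<in>D. C x + C' x)" using s C' DO by (intro sum_nonneg) (simp add: add_nonneg_nonneg)
  fix v x assume v: "harm W v \<and> finite_energy W v \<and> v z = 0" and x: "x \<in> K"
  obtain y where y: "y \<in> D" "x \<in> ball y (s y)" using x D(3) by blast
  have "\<bar>v x - v y\<bar> \<le> C y * G v" "\<bar>v y - v z\<bar> \<le> C' y * G v" using s[OF DO[OF y(1)]] C'[OF DO[OF y(1)]] y(2) v unfolding adm_def by blast+
  then have "\<bar>v x\<bar> \<le> (C y + C' y) * G v" using v by (simp add: distrib_right)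
  also have "\<dots> \<le> (\<Sum>x\<in>D. C x + C' x) * G v"
   using G[of v] y(1) D(2) s C' DO by (intro mult_right_mono member_le_sum) (simp_all add: add_nonneg_nonneg)
  finally show "\<bar>v x\<bar> \<le> (\<Sum>x\<in>D. C x + C' x) * sqrt (energy W v)" by (simp add: G_def)
 qed
qed

context torsion begin

definition strip_div :: "('a \<Rightarrow> real) \<Rightarrow> 'a \<Rightarrow> real" where
 "strip_div v x = 2 * v x * \<rho> x * (grad v x \<bullet> grad \<rho> x) + (v x)\<^sup>2 * ((norm (grad \<rho> x))\<^sup>2 + \<rho> x * laplacian \<rho> x)"

text \<open>The divergence of v^2 rho grad rho is coercive near the boundary and the cutoff contributes with a sign.\<close>

lemma strip_parts:
 assumes e: "\<epsilon> > 0" and v: "C1_on \<Omega> v"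
 shows "(LINT x|vol. eta \<epsilon> x * strip_div v x) \<le> 0"
  and "integrable vol (\<lambda>x. eta \<epsilon> x * strip_div v x)"
proof -
 define F where "F b x = v x * v x * (\<rho> x * pd b \<rho> x)" for b x
 have F: "C1_on \<Omega> (F b)" if "b \<in> Basis" for b unfolding F_def[abs_def] by (intro C1_on_mult v C1_rho' C1_pd_rho' that)
 note P = parts[OF e C1_eta[OF e] support_eta[OF e], of F, OF ballI[OF F]]
 have s: "(\<Sum>b\<in>Basis. pd b (F b) x) = strip_div v x" if x: "x \<in> \<Omega>" for x
 proof -
  have "pd b (F b) x = 2 * v x * \<rho> x * (pd b v x * pd b \<rho> x) + (v x)\<^sup>2 * ((pd b \<rho> x)\<^sup>2 + \<rho> x * pd b (pd b \<rho>) x)" if b: "b \<in> Basis" for b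
  proof -
   have "GDERIV (F b) x :> (v x * v x) *\<^sub>R (\<rho> x *\<^sub>R grad (pd b \<rho>) x + pd b \<rho> x *\<^sub>R grad \<rho> x) + (\<rho> x * pd b \<rho> x) *\<^sub>R (v x *\<^sub>R grad v x + v x *\<^sub>R grad v x)"
    unfolding F_def[abs_def] by (intro GDERIV_mult C1_onD[OF v x] gderiv_rho C1_onD[OF C1_pd_rho[OF b] UNIV_I])
   from gderiv_pd[OF this, of b] b show ?thesis by (simp add: pd_eq_grad inner_add_left power2_eq_square algebra_simps)
  qed
  then have "(\<Sum>b\<in>Basis. pd b (F b) x) = 2 * v x * \<rho> x * (\<Sum>b\<in>Basis. pd b v x * pd b \<rho> x) + (v x)\<^sup>2 * ((\<Sum>b\<in>Basis. (pd b \<rho> x)\<^sup>2) + \<rho> x * laplacian \<rho> x)"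
   by (simp add: sum.distrib sum_distrib_left laplacian_def distrib_left)
  then show ?thesis by (simp add: strip_div_def norm_grad_sq inner_grad_sum pd_eq_grad)
 qed
 have i: "\<forall>x\<in>\<Omega>. eta \<epsilon> x * (\<Sum>b\<in>Basis. pd b (F b) x) = eta \<epsilon> x * strip_div v x"
  using s by simp
 show "integrable vol (\<lambda>x. eta \<epsilon> x * strip_div v x)"
  by (rule integrable_on_cong[OF i P(2)])
 have "(LINT x|vol. (\<Sum>b\<in>Basis. pd b (eta \<epsilon>) x * F b x)) \<ge> 0"
 proof (rule Bochner_Integration.integral_nonneg_AE, rule AE_I2)
  fix x assume "x \<in> space vol"
  then have r: "\<rho> x < 0" using rho_neg by simp
  have "pd b (eta \<epsilon>) x * F b x = (beta \<epsilon> x * (- \<rho> x)) * ((v x * pd b \<rho> x) * (v x * pd b \<rho> x))" if "b \<in> Basis" for b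
   using that by (simp add: gderiv_pd[OF gderiv_eta[OF e]] F_def pd_eq_grad)
  moreover have "0 \<le> (beta \<epsilon> x * (- \<rho> x)) * ((v x * pd b \<rho> x) * (v x * pd b \<rho> x))" for b
   using r eta_beta_values(7)[OF e, of x] zero_le_square[of "v x * pd b \<rho> x"]
   by (intro mult_nonneg_nonneg[of "beta \<epsilon> x * (- \<rho> x)"] mult_nonneg_nonneg[of "beta \<epsilon> x"]) auto
  ultimately show "0 \<le> (\<Sum>b\<in>Basis. pd b (eta \<epsilon>) x * F b x)" by (simp add: sum_nonneg)
 qed
 then show "(LINT x|vol. eta \<epsilon> x * strip_div v x) \<le> 0"
  using P(1) unfolding LINT_on_cong[OF i] by simp
qed

text \<open>Near the boundary v^2 is controlled by \<open>strip_div v\<close> and gradient terms, on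
  the compact rest by the energy through \<open>harm_interior_bound\<close>. The integral of
  \<open>strip_div v\<close> against the cutoffs is nonpositive and drops out. The constant is not
  explicit; it serves to show that \<open>mu0\<close> is positive.\<close>

lemma poincare:
 assumes con: "connected \<Omega>" and z: "z \<in> \<Omega>"
 shows "\<exists>m>0. \<forall>v. harm \<Omega> v \<and> sq_integrable \<Omega> v \<and> finite_energy \<Omega> v \<and> v z = 0 \<longrightarrow>
   m * sq_integral \<Omega> v \<le> energy \<Omega> v"
proof -
 obtain t0 where t0: "t0 > 0" "\<And>x. x \<in> closure \<Omega> ==> - t0 < \<rho> x ==> c0 / 2 \<le> norm (grad \<rho> x)"
  using strip_grad_lower by blast
 define \<Lambda> where "\<Lambda> = real DIM('a) * L2"
 have L: "\<Lambda> > 0" "\<And>x. \<bar>laplacian \<rho> x\<bar> \<le> \<Lambda>" using L2(1) laplacian_rho_bound by (auto simp: \<Lambda>_def)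
 \<comment> \<open>In the strip |grad \<rho>|^2 is at least 2 \<kappa>, and one \<kappa> is spent on
   \<rho> times the Laplacian of \<rho>.\<close>
 define \<kappa> where "\<kappa> = c0\<^sup>2 / 8"
 have \<kappa>: "\<kappa> > 0" using c0(1) by (simp add: \<kappa>_def)
 define t where "t = min t0 (\<kappa> / \<Lambda>)"
 have t: "t > 0" "t \<le> t0" "t * \<Lambda> \<le> \<kappa>" using t0 \<kappa> L by (auto simp: t_def min_def field_simps)
 define K where "K = closure \<Omega> \<inter> {x. \<rho> x \<le> - t}"
 have K: "compact K" "K \<subseteq> \<Omega>" unfolding K_def by (rule level_compact, rule level_subset[OF t(1)])
 obtain R where R: "R > 0" "\<And>x. x \<in> closure \<Omega> ==> norm (\<rho> x) \<le> R"
  using bounded_on_compact[OF continuous_rho compact_closure_Omega order_refl] by blast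
 obtain C where C: "C \<ge> 0" "\<And>v x. harm \<Omega> v ==> finite_energy \<Omega> v ==> v z = 0 ==> x \<in> K ==>
   \<bar>v x\<bar> \<le> C * sqrt (energy \<Omega> v)"
  using harm_interior_bound[OF open_Omega con z K] by blast
 \<comment> \<open>From Young's inequality for the mixed term of \<open>strip_div v\<close>, with
   weight \<kappa> / 2 on v^2, which is absorbed on the left.\<close>
 define A where "A = 2 * R\<^sup>2 * L1\<^sup>2 / \<kappa>"
 define B where "B = (\<kappa> + R * \<Lambda>) * C\<^sup>2"
 define V where "V = measure lebesgue \<Omega>"
 have AB: "A > 0" "B \<ge> 0" "V \<ge> 0" using R L1(1) \<kappa> L(1) by (auto simp: A_def B_def V_def)
 define m where "m = \<kappa> / 2 / (A + B * V)"
 have AV: "A + B * V > 0" using AB by (intro add_pos_nonneg) auto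
 have m: "m > 0" using \<kappa> AV by (simp add: m_def)
 obtain e where e: "\<And>n::nat. e n > 0" "\<And>x. x \<in> \<Omega> ==> eventually (\<lambda>n. eta (e n) x = 1) sequentially" by (rule eta_sequence[OF zero_less_one]) (rule that)
 have "m * sq_integral \<Omega> v \<le> energy \<Omega> v"
  if v: "harm \<Omega> v" and i0: "sq_integrable \<Omega> v" and i1: "finite_energy \<Omega> v" and vz: "v z = 0" for v
 proof -
  define D where "D = energy \<Omega> v"
  define I where "I = sq_integral \<Omega> v"
  have D: "D \<ge> 0" by (simp add: D_def)
  have C1v: "C1_on \<Omega> v" by (rule harm_C1[OF open_Omega v])
  have pw: "\<kappa> * (v x)\<^sup>2 \<le> strip_div v x + (\<kappa> / 2 * (v x)\<^sup>2 + A * (norm (grad v x))\<^sup>2 + B * D)" if x: "x \<in> \<Omega>" for x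
  proof -
   have xc: "x \<in> closure \<Omega>" using x closure_Omega by blast
   define w where "w = (norm (grad \<rho> x))\<^sup>2 + \<rho> x * laplacian \<rho> x"
   have rl: "\<bar>\<rho> x * laplacian \<rho> x\<bar> \<le> \<bar>\<rho> x\<bar> * \<Lambda>" unfolding abs_mult using L by (intro mult_left_mono) auto
   have main: "\<kappa> * (v x)\<^sup>2 \<le> (v x)\<^sup>2 * w + B * D"
   proof (cases "- t < \<rho> x")
    case True
    have "(c0 / 2)\<^sup>2 \<le> (norm (grad \<rho> x))\<^sup>2" using t0(2)[OF xc] True t(2) c0(1) by (intro power_mono) auto
    then have "2 * \<kappa> \<le> (norm (grad \<rho> x))\<^sup>2" by (simp add: \<kappa>_def power_divide)
    moreover have "\<bar>\<rho> x\<bar> * \<Lambda> \<le> t * \<Lambda>" using True rho_neg[OF x] L(1) by (intro mult_right_mono) auto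
    ultimately have "\<kappa> \<le> w" using rl t(3) unfolding w_def by linarith
    then have "(v x)\<^sup>2 * \<kappa> \<le> (v x)\<^sup>2 * w" by (intro mult_left_mono) auto
    moreover have "0 \<le> B * D" using AB D by simp
    ultimately show ?thesis by (simp add: mult.commute)
   next
    case False
    then have "\<bar>v x\<bar> \<le> C * sqrt D" unfolding D_def using xc by (intro C(2)[OF v i1 vz]) (auto simp: K_def)
    then have "(v x)\<^sup>2 \<le> (C * sqrt D)\<^sup>2" by (rule abs_le_square_iff[THEN iffD1, OF order_trans[OF _ abs_ge_self]])
    then have v2: "(v x)\<^sup>2 \<le> C\<^sup>2 * D" using D by (simp add: power_mult_distrib)
    have "\<bar>\<rho> x\<bar> * \<Lambda> \<le> R * \<Lambda>" using R(2)[OF xc] L(1) by (intro mult_right_mono) auto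
    then have w: "- w \<le> R * \<Lambda>" using rl zero_le_power2[of "norm (grad \<rho> x)"] unfolding w_def by linarith
    have "(\<kappa> - w) * (v x)\<^sup>2 \<le> (\<kappa> + R * \<Lambda>) * (v x)\<^sup>2" using w by (intro mult_right_mono) auto
    also have "\<dots> \<le> (\<kappa> + R * \<Lambda>) * (C\<^sup>2 * D)" using v2 \<kappa> R(1) L(1) by (intro mult_left_mono) auto
    finally show ?thesis by (simp add: B_def algebra_simps)
   qed
   define X where "X = \<bar>grad v x \<bullet> grad \<rho> x\<bar>"
   have X: "X \<le> norm (grad v x) * L1" using order_trans[OF Cauchy_Schwarz_ineq2 mult_left_mono[OF L1(2)[of x]]] by (simp add: X_def)
   have "\<bar>2 * v x * \<rho> x * (grad v x \<bullet> grad \<rho> x)\<bar> = 2 * \<bar>v x\<bar> * (\<bar>\<rho> x\<bar> * X)" by (simp add: abs_mult X_def)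
   also have "\<dots> \<le> 2 * \<bar>v x\<bar> * (R * (norm (grad v x) * L1))" using R X by (intro mult_left_mono mult_mono) (auto simp: R(2)[OF xc, simplified] X_def)
   also have "\<dots> \<le> \<kappa> / 2 * (v x)\<^sup>2 + A * (norm (grad v x))\<^sup>2"
   proof -
    have "0 \<le> 1 / (2 * \<kappa>) * (\<kappa> * \<bar>v x\<bar> - 2 * R * L1 * norm (grad v x))\<^sup>2" using \<kappa> by simp
    also have "\<dots> = \<kappa> / 2 * \<bar>v x\<bar>\<^sup>2 + A * (norm (grad v x))\<^sup>2 - 2 * \<bar>v x\<bar> * (R * (norm (grad v x) * L1))"
     using \<kappa> by (simp add: A_def field_simps power2_eq_square)
    finally show ?thesis by simp
   qed
   finally show ?thesis using main unfolding strip_div_def w_def[symmetric] by linarith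
  qed
  have ea: "\<bar>eta (e n) x\<bar> \<le> 1" for n x using eta_beta_values(5,6)[OF e(1), of n x] by simp
  have bound: "\<kappa> * (LINT x|vol. eta (e n) x * (v x)\<^sup>2) \<le> \<kappa> / 2 * I + A * D + B * D * V" for n
  proof -
   have ev: "integrable vol (\<lambda>x. eta (e n) x * (v x)\<^sup>2)"
    by (rule integrable_dominated_open[OF open_Omega _ i0])
     (auto intro!: continuous_intros C1_on_continuous[OF C1_eta] C1_on_continuous[OF C1v] mult_left_le_one_le ea e simp: abs_mult)
   have ci: "integrable vol (\<lambda>x. B * D)" by (rule finite_measure.integrable_const[OF finite_measure_lebesgue_on[OF finite_measure_Omega]])
   have E: "(LINT x|vol. eta (e n) x * strip_div v x) \<le> 0" "integrable vol (\<lambda>x. eta (e n) x * strip_div v x)"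
    using strip_parts[OF e(1) C1v] by auto
   have "(LINT x|vol. \<kappa> * (eta (e n) x * (v x)\<^sup>2)) \<le> (LINT x|vol. eta (e n) x * strip_div v x + (\<kappa> / 2 * (v x)\<^sup>2 + A * (norm (grad v x))\<^sup>2 + B * D))"
   proof (rule integral_mono)
    fix x assume "x \<in> space vol"
    then have x: "x \<in> \<Omega>" by simp
    define T where "T = \<kappa> / 2 * (v x)\<^sup>2 + A * (norm (grad v x))\<^sup>2 + B * D"
    have T: "T \<ge> 0" using \<kappa> AB D by (simp add: T_def)
    have "eta (e n) x * (\<kappa> * (v x)\<^sup>2) \<le> eta (e n) x * (strip_div v x + T)" unfolding T_def using pw[OF x] eta_beta_values(5)[OF e(1)] by (intro mult_left_mono) auto
    moreover have "eta (e n) x * T \<le> T" using T eta_beta_values(5,6)[OF e(1)] by (intro mult_left_le_one_le) auto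
    ultimately show "\<kappa> * (eta (e n) x * (v x)\<^sup>2) \<le> eta (e n) x * strip_div v x + (\<kappa> / 2 * (v x)\<^sup>2 + A * (norm (grad v x))\<^sup>2 + B * D)"
     unfolding T_def[symmetric] by (simp add: algebra_simps)
   qed (intro integrable_mult_right Bochner_Integration.integrable_add ev E i0 i1 ci)+
   also have "\<dots> = (LINT x|vol. eta (e n) x * strip_div v x) + (\<kappa> / 2 * I + A * D + B * D * V)"
    using E(2) i0 i1 ci finite_measure_Omega by (simp add: I_def D_def V_def measure_restrict_space)
   finally show ?thesis using E(1) by simp
  qed
  have "(\<lambda>n. LINT x|vol. eta (e n) x * (v x)\<^sup>2) \<longlonglongrightarrow> I" unfolding I_def
  proof (rule integral_dominated_convergence[OF _ _ i0])
   show "(\<lambda>x. (v x)\<^sup>2) \<in> borel_measurable vol" using i0 by (rule borel_measurable_integrable)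
   show "(\<lambda>x. eta (e n) x * (v x)\<^sup>2) \<in> borel_measurable vol" for n
    using open_Omega by (intro continuous_imp_measurable_on_sets_lebesgue continuous_intros C1_on_continuous[OF C1_eta[OF e(1)]] C1_on_continuous[OF C1v]) (auto intro: borel_open)
   show "AE x in vol. (\<lambda>n. eta (e n) x * (v x)\<^sup>2) \<longlonglongrightarrow> (v x)\<^sup>2"
   proof (rule AE_I2, rule tendsto_eventually)
    fix x assume "x \<in> space vol"
    then have "eventually (\<lambda>n. eta (e n) x = 1) sequentially" using e(2) by simp
    then show "eventually (\<lambda>n. eta (e n) x * (v x)\<^sup>2 = (v x)\<^sup>2) sequentially" by eventually_elim simp
   qed
   show "AE x in vol. norm (eta (e n) x * (v x)\<^sup>2) \<le> (v x)\<^sup>2" for n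
    by (rule AE_I2) (simp add: abs_mult ea mult_left_le_one_le)
  qed
  then have "(\<lambda>n. \<kappa> * (LINT x|vol. eta (e n) x * (v x)\<^sup>2)) \<longlonglongrightarrow> \<kappa> * I" by (intro tendsto_intros)
  from LIMSEQ_le_const2[OF this] bound have "\<kappa> * I \<le> \<kappa> / 2 * I + A * D + B * D * V" by blast
  then have "\<kappa> / 2 * I \<le> (A + B * V) * D" by (simp add: algebra_simps)
  then have "m * I \<le> D" using AV by (simp add: m_def field_simps)
  then show ?thesis by (simp add: I_def D_def)
 qed
 then show ?thesis using m by blast
qed

section \<open>Admissible functions and positivity of the infimum\<close>

lemma integrable_bounded_open:
 fixes f :: "'a \<Rightarrow> real"
 assumes "continuous_on \<Omega> f" "\<And>x. x \<in> \<Omega> ==> \<bar>f x\<bar> \<le> B"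
 shows "integrable vol f"
proof (rule integrable_dominated_open[OF open_Omega assms(1)])
 show "integrable vol (\<lambda>_. B)"
  by (rule finite_measure.integrable_const[OF finite_measure_lebesgue_on[OF finite_measure_Omega]])
qed (rule assms(2))

lemma bounded_Omega_norm: "\<exists>D>0. \<forall>x\<in>closure \<Omega>. norm x \<le> D"
 using compact_imp_bounded[OF compact_closure_Omega] unfolding bounded_pos by blast

lemma affine_admissible:
 fixes b p
 defines "w \<equiv> \<lambda>x. (x - p) \<bullet> b"
 shows "harm \<Omega> w" "GDERIV w x :> b" "sq_integrable \<Omega> w"
  "finite_energy \<Omega> w"
proof -
 have w: "w = (\<lambda>x. x \<bullet> b + - (p \<bullet> b))" by (simp add: w_def fun_eq_iff inner_diff_left)
 show "harm \<Omega> w" unfolding w by (rule harm_affine[OF open_Omega])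
 show g: "GDERIV w x :> b" for x unfolding w using GDERIV_add[OF gderiv_inner_left[of b x] GDERIV_const[of "- (p \<bullet> b)" x]] by simp
 obtain D where D: "\<And>x. x \<in> closure \<Omega> ==> norm x \<le> D" using bounded_Omega_norm by blast
 show "sq_integrable \<Omega> w"
 proof (rule integrable_bounded_open)
  show "continuous_on \<Omega> (\<lambda>x. (w x)\<^sup>2)" unfolding w_def by (intro continuous_intros)
  fix x assume "x \<in> \<Omega>"
  then have "norm (x - p) \<le> D + norm p" using D[of x] closure_Omega norm_triangle_ineq4[of x p] by force
  then have "\<bar>w x\<bar> \<le> (D + norm p) * norm b" unfolding w_def using Cauchy_Schwarz_ineq2[of "x - p" b] by (meson mult_right_mono norm_ge_zero order_trans)
  then have "\<bar>w x\<bar>\<^sup>2 \<le> ((D + norm p) * norm b)\<^sup>2" by (intro power_mono) auto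
  then show "\<bar>(w x)\<^sup>2\<bar> \<le> ((D + norm p) * norm b)\<^sup>2" by simp
 qed
 show "finite_energy \<Omega> w"
  unfolding gderiv_grad[OF g] by (rule integrable_bounded_open[OF continuous_on_const order_refl])
qed

text \<open>An infimum of reals is meaningful only over a nonempty set; a normalized affine function
  vanishing at z is the witness. Scaling then turns the infimum over normalized functions into an
  inequality for all of them.\<close>

lemma mu0:
 assumes con: "connected \<Omega>" and z: "z \<in> \<Omega>"
 shows "mu0 \<Omega> z > 0"
  and "\<And>w. harm \<Omega> w ==> w z = 0 ==> sq_integrable \<Omega> w ==> finite_energy \<Omega> w ==>
   mu0 \<Omega> z * sq_integral \<Omega> w \<le> energy \<Omega> w"
proof -
 define S where "S = {LINT x|vol. (norm (grad v x))\<^sup>2 | v.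
   C2_on \<Omega> v \<and> (\<forall>x\<in>\<Omega>. laplacian v x = 0) \<and> L2_on \<Omega> v
   \<and> finite_energy \<Omega> v
   \<and> sq_integral \<Omega> v = 1 \<and> v z = 0}"
 have mu: "mu0 \<Omega> z = Inf S" unfolding mu0_def S_def ..
 have bdd: "bdd_below S" by (rule bdd_belowI[of _ 0]) (auto simp: S_def)
 have scaled: "\<exists>s\<in>S. s * sq_integral \<Omega> w = energy \<Omega> w"
  if w: "harm \<Omega> w" "w z = 0" "sq_integrable \<Omega> w" "finite_energy \<Omega> w"
   and pos: "sq_integral \<Omega> w > 0" for w
 proof -
  define I where "I = sq_integral \<Omega> w"
  define k where "k = 1 / sqrt I"
  have k: "k\<^sup>2 * I = 1" using pos by (simp add: k_def I_def power_divide)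
  \<comment> \<open>The idle summand makes v an instance of \<open>harm_lincomb\<close>.\<close>
  define v where "v x = k * w x + 0 * w x" for x
  have hv: "harm \<Omega> v" unfolding v_def[abs_def] by (rule harm_lincomb[OF open_Omega w(1) w(1)])
  have gv: "grad v x = k *\<^sub>R grad w x" if "x \<in> \<Omega>" for x
   unfolding v_def[abs_def] C2_on_lincomb(3)[OF open_Omega harm_C2[OF w(1)] harm_C2[OF w(1)] that] by simp
  have ng: "\<forall>x\<in>\<Omega>. k\<^sup>2 * (norm (grad w x))\<^sup>2 = (norm (grad v x))\<^sup>2" using gv by (simp add: power_mult_distrib)
  have vv: "(\<lambda>x. (v x)\<^sup>2) = (\<lambda>x. k\<^sup>2 * (w x)\<^sup>2)" by (simp add: v_def power_mult_distrib fun_eq_iff)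
  have "v \<in> borel_measurable vol" using open_Omega C1_on_continuous[OF harm_C1[OF open_Omega hv]]
   by (intro continuous_imp_measurable_on_sets_lebesgue) (auto intro: borel_open)
  then have "L2_on \<Omega> v" unfolding L2_on_def vv using w(3) by simp
  moreover have "finite_energy \<Omega> v"
   by (rule integrable_on_cong[OF ng integrable_mult_right[OF w(4)]])
  moreover have "sq_integral \<Omega> v = 1" unfolding vv using k by (simp add: I_def)
  ultimately have mem: "energy \<Omega> v \<in> S"
   unfolding S_def using hv w(2) by (auto simp: harm_def v_def)
  have eq: "energy \<Omega> v = k\<^sup>2 * energy \<Omega> w"
   unfolding LINT_on_cong[OF ng, symmetric] by simp
  have "k\<^sup>2 * G * I = G" for G using k by (metis mult.commute mult.left_commute mult.right_neutral)
  then show ?thesis unfolding I_def[symmetric] by (intro bexI[OF _ mem]) (simp only: eq)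
 qed
 obtain b :: 'a where b: "b \<in> Basis" using nonempty_Basis by blast
 define w where "w x = (x - z) \<bullet> b" for x
 note aff = affine_admissible[where p=z and b=b, folded w_def]
 have pos: "sq_integral \<Omega> w > 0"
 proof -
  obtain r where r: "r > 0" "ball z r \<subseteq> \<Omega>" by (rule openE[OF open_Omega z])
  \<comment> \<open>The affine function is nonzero at y, so the mean value estimate on a ball about
    y forces a positive L2 norm.\<close>
  define y where "y = z + (r / 4) *\<^sub>R b"
  have "cball y (r / 4) \<subseteq> \<Omega>"
  proof
   fix q assume "q \<in> cball y (r / 4)"
   moreover have "dist z y = r / 4" using r(1) b by (simp add: y_def dist_norm)
   ultimately have "dist z q < r" using dist_triangle[of z q y] r(1) by simp
   then show "q \<in> \<Omega>" using r(2) by auto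
  qed
  from harm_L2_bound[OF open_Omega aff(1) _ this aff(3)]
  have "(w y)\<^sup>2 \<le> sq_integral \<Omega> w / (kerc TYPE('a) * (r / 4) ^ DIM('a))" using r(1) by simp
  moreover have "(w y)\<^sup>2 > 0" using b r(1) by (simp add: w_def y_def)
  moreover have "kerc TYPE('a) * (r / 4) ^ DIM('a) > 0" using kerc_pos[where 'a='a] r(1) by simp
  ultimately show ?thesis by (metis less_le_trans zero_less_divide_iff less_asym)
 qed
 obtain s where s: "s \<in> S" using scaled[OF aff(1) _ aff(3,4) pos] by (auto simp: w_def)
 obtain m where m: "m > 0" "\<And>v. harm \<Omega> v ==> sq_integrable \<Omega> v ==> finite_energy \<Omega> v ==> v z = 0 ==>
   m * sq_integral \<Omega> v \<le> energy \<Omega> v"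
  using poincare[OF con z] by blast
 have "m \<le> Inf S"
 proof (rule cInf_greatest)
  show "S \<noteq> {}" using s by blast
  fix s assume "s \<in> S"
  then obtain v where v: "harm \<Omega> v" "sq_integrable \<Omega> v" "finite_energy \<Omega> v" "v z = 0"
   "sq_integral \<Omega> v = 1" "s = energy \<Omega> v" by (auto simp: S_def L2_on_def harm_def)
  then show "m \<le> s" using m(2)[of v] by simp
 qed
 then show "mu0 \<Omega> z > 0" using m(1) mu by linarith
 fix w :: "'a \<Rightarrow> real"
 assume w: "harm \<Omega> w" "w z = 0" "sq_integrable \<Omega> w" "finite_energy \<Omega> w"
 show "mu0 \<Omega> z * sq_integral \<Omega> w \<le> energy \<Omega> w"
 proof (cases "sq_integral \<Omega> w > 0")
  case True
  obtain s where s: "s \<in> S" "s * sq_integral \<Omega> w = energy \<Omega> w"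
   using scaled[OF w True] by blast
  show ?thesis unfolding s(2)[symmetric] mu using True cInf_lower[OF s(1) bdd] by (intro mult_right_mono) auto
 next
  case False
  then have z: "sq_integral \<Omega> w = 0" by (simp add: not_less antisym)
  show ?thesis unfolding z by simp
 qed
qed

end

section \<open>Classical derivatives as weak derivatives, and the embedding constant\<close>

lemma smooth_on_C1:
 assumes "smooth_on UNIV \<phi>"
 shows "C1_on UNIV \<phi>" "b \<in> Basis ==> C1_on UNIV (pd b \<phi>)"
proof -
 have s: "continuous_on UNIV (ipd bs \<phi>)" "\<And>b x. b \<in> Basis ==> has_pd b (ipd bs \<phi>) x" if "set bs \<subseteq> Basis" for bs
  using assms that unfolding smooth_on_def by auto
 show "C1_on UNIV \<phi>" by (rule C1_on_pd[OF open_UNIV]) (use s[of "[]"] s(1)[of "[_]"] in auto)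
 show "b \<in> Basis ==> C1_on UNIV (pd b \<phi>)"
  by (rule C1_on_pd[OF open_UNIV]) (use s(2)[of "[b]"] s(1)[of "[_, b]"] in auto)
qed

text \<open>Derivatives are moved off the test function one at a time, the outermost first. As
  \<open>ipd [b, b']\<close> has b outermost, they arrive on v as
  \<open>pd b' (pd b v)\<close>.\<close>

lemma weak_pd_classical:
 assumes W: "open W" and v: "C1_on W v" and b: "b \<in> Basis"
 shows "weak_pd W [b] v (pd b v)"
  and "b' \<in> Basis ==> C1_on W (pd b v) ==> weak_pd W [b, b'] v (pd b' (pd b v))"
proof -
 note ibp = integral_by_parts[OF W _ _ C1_on_subset]
 have t: "smooth_on UNIV \<phi>" "compact (closure {x. \<phi> x \<noteq> 0})" "closure {x. \<phi> x \<noteq> 0} \<subseteq> W" "\<And>x. x \<in> W - closure {x. \<phi> x \<noteq> 0} ==> \<phi> x = 0"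
  if "test_fun W \<phi>" for \<phi>
  using that closure_subset[of "{x. \<phi> x \<noteq> 0}"] unfolding test_fun_def by auto
 have 1: "(LINT x|lebesgue_on W. \<phi> x * pd d w x) = - (LINT x|lebesgue_on W. pd d \<phi> x * w x)"
  if "test_fun W \<phi>" "C1_on W w" "d \<in> Basis" for \<phi> w d
  by (rule integral_by_parts[OF W t(2,3)[OF that(1)] C1_on_subset[OF smooth_on_C1(1)[OF t(1)[OF that(1)]] subset_UNIV] that(2) t(4)[OF that(1)] that(3)])
 show "weak_pd W [b] v (pd b v)" unfolding weak_pd_def using 1[OF _ v b] by (simp add: mult.commute)
 assume b': "b' \<in> Basis" and v2: "C1_on W (pd b v)"
 have "(LINT x|lebesgue_on W. pd b' \<phi> x * pd b v x) = - (LINT x|lebesgue_on W. pd b (pd b' \<phi>) x * v x)" if \<phi>: "test_fun W \<phi>" for \<phi>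
 proof (rule integral_by_parts[OF W t(2,3)[OF \<phi>] C1_on_subset[OF smooth_on_C1(2)[OF t(1)[OF \<phi>] b'] subset_UNIV] v _ b])
  show "pd b' \<phi> x = 0" if "x \<in> W - closure {x. \<phi> x \<noteq> 0}" for x
   by (rule integral_pd_compact_support(3)[OF W t(2,3)[OF \<phi>] C1_on_subset[OF smooth_on_C1(1)[OF t(1)[OF \<phi>]] subset_UNIV] t(4)[OF \<phi>] b' that])
 qed
 then show "weak_pd W [b, b'] v (pd b' (pd b v))" unfolding weak_pd_def using 1[OF _ v2 b'] by (simp add: mult.commute)
qed

definition hsq :: "('a::euclidean_space \<Rightarrow> real) \<Rightarrow> 'a \<Rightarrow> real" where
 "hsq v x = (\<Sum>b\<in>Basis. (norm (grad (pd b v) x))\<^sup>2)"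

context torsion begin

lemma sobolev_harmonic:
 assumes c: "sobolev_holder_const \<Omega> \<gamma> c" and v: "harm \<Omega> v" "continuous_on (closure \<Omega>) v"
  and i0: "sq_integrable \<Omega> v" and i1: "finite_energy \<Omega> v" and i2: "integrable vol (hsq v)"
  and xy: "x \<in> closure \<Omega>" "y \<in> closure \<Omega>"
 shows "\<bar>v x - v y\<bar> \<le> c * sqrt (sq_integral \<Omega> v + energy \<Omega> v + integral\<^sup>L vol (hsq v)) * dist x y powr \<gamma>"
proof -
 have C: "C1_on \<Omega> v" "\<And>b. b \<in> Basis ==> C1_on \<Omega> (pd b v)" using harm_C2[OF v(1)] C2_on_iff[OF open_Omega] by auto
 have me: "f \<in> borel_measurable vol" if "continuous_on \<Omega> f" for f :: "'a \<Rightarrow> real"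
  using open_Omega that by (intro continuous_imp_measurable_on_sets_lebesgue) (auto intro: borel_open)
 have L0: "L2_on \<Omega> v" unfolding L2_on_def using me C1_on_continuous[OF C(1)] i0 by auto
 note j1 = sq_integrable_pd[OF open_Omega C(1) i1]
 have j2: "integrable vol (\<lambda>x. (pd b' (pd b v) x)\<^sup>2)" if b: "b \<in> Basis" "b' \<in> Basis" for b b'
 proof (rule integrable_dominated_open[OF open_Omega _ i2])
  show "continuous_on \<Omega> (\<lambda>x. (pd b' (pd b v) x)\<^sup>2)" by (intro continuous_intros C1_on_continuous_pd[OF C(2)] b)
  show "\<bar>(pd b' (pd b v) x)\<^sup>2\<bar> \<le> hsq v x" for x
  proof -
   have "(pd b' (pd b v) x)\<^sup>2 \<le> (norm (grad (pd b v) x))\<^sup>2"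
    unfolding norm_grad_sq by (rule member_le_sum[OF b(2)]) auto
   also have "\<dots> \<le> hsq v x" unfolding hsq_def by (rule member_le_sum[OF b(1)]) auto
   finally show ?thesis by simp
  qed
 qed
 have "continuous_on (closure \<Omega>) v \<and> L2_on \<Omega> v
   \<and> (\<forall>b\<in>Basis. L2_on \<Omega> (pd b v) \<and> weak_pd \<Omega> [b] v (pd b v))
   \<and> (\<forall>b\<in>Basis. \<forall>b'\<in>Basis. L2_on \<Omega> (pd b' (pd b v)) \<and> weak_pd \<Omega> [b, b'] v (pd b' (pd b v)))"
  using v(2) L0 j1 j2 me C1_on_continuous_pd[OF C(1)] C1_on_continuous_pd[OF C(2)] weak_pd_classical[OF open_Omega C(1)] C(2)
  by (auto simp: L2_on_def)
 from c[unfolded sobolev_holder_const_def, rule_format, of v "\<lambda>b. pd b v" "\<lambda>b b'. pd b' (pd b v)", OF this xy]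
 have "\<bar>v x - v y\<bar> \<le> c * sqrt (sq_integral \<Omega> v + (\<Sum>b\<in>Basis. sq_integral \<Omega> (pd b v))
   + (\<Sum>b\<in>Basis. \<Sum>b'\<in>Basis. sq_integral \<Omega> (pd b' (pd b v)))) * dist x y powr \<gamma>" .
 moreover have "(\<Sum>b\<in>Basis. sq_integral \<Omega> (pd b v)) = energy \<Omega> v" by (rule energy_sum[OF open_Omega C(1) i1, symmetric])
 moreover have "(\<Sum>b\<in>Basis. \<Sum>b'\<in>Basis. sq_integral \<Omega> (pd b' (pd b v))) = integral\<^sup>L vol (hsq v)"
 proof -
  have "integral\<^sup>L vol (hsq v) = (LINT z|vol. (\<Sum>b\<in>Basis. \<Sum>b'\<in>Basis. (pd b' (pd b v) z)\<^sup>2))"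
   by (simp add: hsq_def[abs_def] norm_grad_sq)
  also have "\<dots> = (\<Sum>b\<in>Basis. LINT z|vol. (\<Sum>b'\<in>Basis. (pd b' (pd b v) z)\<^sup>2))"
   by (rule Bochner_Integration.integral_sum) (auto intro: j2)
  also have "\<dots> = (\<Sum>b\<in>Basis. \<Sum>b'\<in>Basis. sq_integral \<Omega> (pd b' (pd b v)))"
   by (intro sum.cong refl Bochner_Integration.integral_sum) (auto intro: j2)
  finally show ?thesis by simp
 qed
 ultimately show ?thesis by simp
qed

text \<open>The definition leaves the sign of c open; a nonconstant affine function excludes
  negative values, and monotone estimates with c become possible.\<close>

lemma sobolev_const_nonneg:
 assumes c: "sobolev_holder_const \<Omega> \<gamma> c"
 shows "c \<ge> 0"
proof (rule ccontr)
 assume n: "\<not> ?thesis"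
 obtain p where p: "p \<in> \<Omega>" using Omega_ne by blast
 obtain r where r: "r > 0" "ball p r \<subseteq> \<Omega>" by (rule openE[OF open_Omega p])
 obtain b :: 'a where b: "b \<in> Basis" using nonempty_Basis by blast
 note aff = affine_admissible[where p=p and b=b]
 define q where "q = p + (r / 2) *\<^sub>R b"
 have q: "q \<in> \<Omega>" using r b by (intro subsetD[OF r(2)]) (simp add: q_def dist_norm)
 have h0: "hsq (\<lambda>x. (x - p) \<bullet> b) = (\<lambda>x. 0)"
 proof -
  have "pd d (\<lambda>x. (x - p) \<bullet> b) = (\<lambda>x. b \<bullet> d)" for d by (rule ext) (rule gderiv_pd[OF aff(2)])
  then show ?thesis unfolding hsq_def by (simp add: gderiv_grad[OF GDERIV_const])
 qed
 have "\<bar>(q - p) \<bullet> b - (p - p) \<bullet> b\<bar> \<le> c * sqrt (integral\<^sup>L vol (\<lambda>x. ((x - p) \<bullet> b)\<^sup>2) + integral\<^sup>L vol (\<lambda>x. (norm (grad (\<lambda>x. (x - p) \<bullet> b) x))\<^sup>2) + integral\<^sup>L vol (hsq (\<lambda>x. (x - p) \<bullet> b))) * dist q p powr \<gamma>"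
  by (rule sobolev_harmonic[OF c aff(1) _ aff(3,4)]) (use p q closure_Omega h0 in \<open>auto intro!: continuous_intros\<close>)
 also have "\<dots> \<le> 0" using n by (intro mult_nonpos_nonneg) (auto intro!: add_nonneg_nonneg Bochner_Integration.integral_nonneg simp: h0)
 finally show False using r b by (simp add: q_def)
qed

section \<open>The critical point, the curvature and the deviation from a quadratic\<close>

lemma exists_minimum: "\<exists>z\<in>\<Omega>. grad u z = 0"
proof -
 obtain z where z: "z \<in> closure \<Omega>" "\<And>y. y \<in> closure \<Omega> ==> u z \<le> u y"
  using continuous_attains_inf[OF compact_closure_Omega _ cont_u] Omega_ne closure_Omega by auto
 obtain y where y: "y \<in> \<Omega>" using Omega_ne by blast
 have "u z < 0" using z(2)[of y] u_neg[OF y] y closure_Omega by auto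
 then have zO: "z \<in> \<Omega>" using z(1) closure_Omega u_zero by force
 obtain r where r: "r > 0" "ball z r \<subseteq> \<Omega>" by (rule openE[OF open_Omega zO])
 have "grad u z \<bullet> b = 0" if b: "b \<in> Basis" for b
 proof (rule DERIV_local_min)
  show "((\<lambda>t. u (z + t *\<^sub>R b)) has_real_derivative grad u z \<bullet> b) (at 0)"
   using gderiv_line[of u z 0 b "grad u z"] C1_onD[OF C1_u zO] by simp
  show "0 < r" by (rule r(1))
  show "\<forall>t. \<bar>0 - t\<bar> < r \<longrightarrow> u (z + 0 *\<^sub>R b) \<le> u (z + t *\<^sub>R b)"
  proof (intro allI impI)
   fix t assume t: "\<bar>0 - t\<bar> < r"
   have "z + t *\<^sub>R b \<in> \<Omega>" using t b by (intro subsetD[OF r(2)]) (simp add: dist_norm)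
   then show "u (z + 0 *\<^sub>R b) \<le> u (z + t *\<^sub>R b)" using z(2) closure_Omega by auto
  qed
 qed
 then have "grad u z = 0" by (simp add: euclidean_eq_iff[of "grad u z" 0])
 then show ?thesis using zO by blast
qed

text \<open>The product rule for the normalized gradient. \<rho> is admissible in
  \<open>is_mean_curvature\<close> exactly because it is a local defining function at p.\<close>

lemma curvature_formula:
 assumes "is_mean_curvature \<alpha> \<Omega> H" "p \<in> \<Gamma>" "local_defining_fun \<alpha> \<Omega> p r \<rho>" and N: "DIM('a) \<ge> 2"
 shows "curv p = (real DIM('a) - 1) * H p * norm (grad \<rho> p) ^ 3"
proof -
 define m where "m = grad \<rho> p"
 define n where "n = norm m"
 have n: "n > 0" using c0(1) c0(2)[OF assms(2)] unfolding n_def m_def by linarith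
 define W where "W x = grad \<rho> x \<bullet> grad \<rho> x" for x
 have gW: "GDERIV W p :> 2 *\<^sub>R hess \<rho> p m" unfolding W_def[abs_def] m_def scaleR_2
  by (rule gderiv_grad_inner[OF C1_pd_rho C1_pd_rho UNIV_I])
 have W: "W p = n\<^sup>2" by (simp add: W_def n_def m_def power2_norm_eq_inner)
 have d: "((\<lambda>w. inverse (sqrt w)) has_real_derivative - 1 / (2 * n ^ 3)) (at (W p))"
  using n unfolding W by (auto intro!: derivative_eq_intros simp: field_simps power2_eq_square power3_eq_cube)
 have gI: "GDERIV (\<lambda>x. inverse (sqrt (W x))) p :> (- 1 / (2 * n ^ 3)) *\<^sub>R (2 *\<^sub>R hess \<rho> p m)"
  by (rule GDERIV_DERIV_compose[OF gW d])
 have "pd b (\<lambda>x. ((1 / norm (grad \<rho> x)) *\<^sub>R grad \<rho> x) \<bullet> b) p = (1 / n) * pd b (pd b \<rho>) p - 1 / n ^ 3 * ((m \<bullet> b) * (hess \<rho> p m \<bullet> b))" if b: "b \<in> Basis" for b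
 proof -
  have e: "(\<lambda>x. ((1 / norm (grad \<rho> x)) *\<^sub>R grad \<rho> x) \<bullet> b) = (\<lambda>x. inverse (sqrt (W x)) * pd b \<rho> x)"
   by (simp add: W_def norm_eq_sqrt_inner divide_inverse pd_eq_grad b fun_eq_iff)
  have "GDERIV (\<lambda>x. inverse (sqrt (W x)) * pd b \<rho> x) p :> inverse (sqrt (W p)) *\<^sub>R grad (pd b \<rho>) p + pd b \<rho> p *\<^sub>R ((- 1 / (2 * n ^ 3)) *\<^sub>R (2 *\<^sub>R hess \<rho> p m))"
   by (intro GDERIV_mult gI C1_onD[OF C1_pd_rho[OF b] UNIV_I])
  note gd = gderiv_pd[OF this, of b]
  have s: "inverse (sqrt (W p)) = 1 / n" using n by (simp add: W inverse_eq_divide)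
  have pb: "pd b \<rho> p = m \<bullet> b" "grad (pd b \<rho>) p \<bullet> b = pd b (pd b \<rho>) p" using b by (simp_all add: pd_eq_grad m_def)
  show ?thesis unfolding e unfolding gd s inner_add_left inner_scaleR_left pb by simp
 qed
 then have "divergence (\<lambda>x. (1 / norm (grad \<rho> x)) *\<^sub>R grad \<rho> x) p = (1 / n) * laplacian \<rho> p - 1 / n ^ 3 * (m \<bullet> hess \<rho> p m)"
  unfolding divergence_def laplacian_def by (subst euclidean_inner) (simp add: sum_subtractf sum_distrib_left)
 also have "\<dots> = curv p / n ^ 3" using n by (simp add: curv_def m_def[symmetric] n_def[symmetric] field_simps power2_eq_square power3_eq_cube)
 finally have "H p = curv p / n ^ 3 / (real DIM('a) - 1)"
  using assms(1,2,3) unfolding is_mean_curvature_def by metis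
 then show ?thesis using n N by (simp add: n_def m_def)
qed

text \<open>The infimum is used at two orders: for each \<open>pd b g\<close>, which vanishes at z
  because z is a critical point of u, and for g itself. Each use costs a factor 1 / \<mu>.\<close>

lemma deviation:
 assumes con: "connected \<Omega>" and z: "z \<in> \<Omega>" "grad u z = 0" and hi: "integrable vol Hsq"
 defines "g \<equiv> \<lambda>x. hh z x - hh z z" and "\<mu> \<equiv> mu0 \<Omega> z"
 shows "harm \<Omega> g" "sq_integrable \<Omega> g" "finite_energy \<Omega> g" "integrable vol (hsq g)"
  "integral\<^sup>L vol (hsq g) = integral\<^sup>L vol Hsq"
  "\<mu> * energy \<Omega> g \<le> integral\<^sup>L vol Hsq"
  "\<mu> * sq_integral \<Omega> g \<le> energy \<Omega> g"
  "\<And>x. x \<in> \<Omega> ==> grad g x = (x - z) - grad u x" "continuous_on (closure \<Omega>) g"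
proof -
 have "harm \<Omega> (\<lambda>x. 1 * hh z x + (- hh z z) * (x \<bullet> 0 + 1))" by (intro harm_lincomb harm_hh harm_affine open_Omega)
 then show hg: "harm \<Omega> g" by (simp add: g_def)
 have hC: "C1_on \<Omega> (hh z)" by (rule harm_C1[OF open_Omega harm_hh])
 have gg: "grad g x = grad (hh z) x" if "x \<in> \<Omega>" for x
  unfolding g_def using gderiv_grad[OF GDERIV_diff[OF C1_onD[OF hC that] GDERIV_const]] by simp
 show gx: "grad g x = (x - z) - grad u x" if "x \<in> \<Omega>" for x unfolding gg[OF that] by (rule grad_hh[OF that])
 have gp: "grad (pd b g) x = grad (pd b (hh 0)) x" if b: "b \<in> Basis" and x: "x \<in> \<Omega>" for b x
 proof -
  have "grad (pd b g) x = grad (pd b (hh z)) x" by (rule grad_cong[OF open_Omega x]) (simp add: pd_eq_grad b gg)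
  also have "\<dots> = grad (pd b (hh 0)) x" by (simp add: grad_pd_hh x b)
  finally show ?thesis .
 qed
 then have hs: "\<forall>x\<in>\<Omega>. hsq g x = Hsq x" by (simp add: hsq_def Hsq_def)
 show "integral\<^sup>L vol (hsq g) = integral\<^sup>L vol Hsq" by (rule LINT_on_cong[OF hs])
 show "integrable vol (hsq g)" by (rule integrable_on_cong[OF _ hi]) (use hs in auto)
 show gc: "continuous_on (closure \<Omega>) g" unfolding g_def hh_def by (intro continuous_intros cont_u)
 obtain B where B: "B > 0" "\<And>x. x \<in> closure \<Omega> ==> norm (g x) \<le> B"
  using bounded_on_compact[OF gc compact_closure_Omega order_refl] by blast
 have gC: "C1_on \<Omega> g" by (rule harm_C1[OF open_Omega hg])
 have "\<bar>(g x)\<^sup>2\<bar> \<le> B\<^sup>2" if "x \<in> \<Omega>" for x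
 proof -
  have "\<bar>g x\<bar> \<le> B" using B(2)[of x] that closure_Omega by auto
  then have "\<bar>g x\<bar>\<^sup>2 \<le> B\<^sup>2" by (intro power_mono) auto
  then show ?thesis by simp
 qed
 then show i0: "sq_integrable \<Omega> g"
  by (intro integrable_bounded_open continuous_intros C1_on_continuous[OF gC])
 obtain D where D: "\<And>x. x \<in> closure \<Omega> ==> norm x \<le> D" using bounded_Omega_norm by blast
 have gb: "norm (grad g x) \<le> D + norm z + M0" if x: "x \<in> \<Omega>" for x
  unfolding gx[OF x] using norm_triangle_ineq4[of "x - z" "grad u x"] norm_triangle_ineq4[of x z] D[of x] M0(2)[OF x] x closure_Omega by fastforce
 have gb2: "(norm (grad g x))\<^sup>2 \<le> (D + norm z + M0)\<^sup>2" if x: "x \<in> \<Omega>" for x using gb[OF x] by (intro power_mono) auto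
 show i1: "finite_energy \<Omega> g"
  by (intro integrable_bounded_open[of _ "(D + norm z + M0)\<^sup>2"] continuous_intros C1_on_continuous_grad[OF gC]) (use gb2 in simp)
 show "\<mu> * sq_integral \<Omega> g \<le> energy \<Omega> g"
  unfolding \<mu>_def by (rule mu0(2)[OF con z(1) hg _ i0 i1]) (simp add: g_def)
 have hp: "harm \<Omega> (pd b g)" if "b \<in> Basis" for b by (rule harm_pd[OF open_Omega hg that])
 note j0 = sq_integrable_pd[OF open_Omega gC i1]
 have j1: "finite_energy \<Omega> (pd b g)" if b: "b \<in> Basis" for b
 proof (rule integrable_dominated_open[OF open_Omega _ hi])
  show "continuous_on \<Omega> (\<lambda>x. (norm (grad (pd b g) x))\<^sup>2)" by (intro continuous_intros C1_on_continuous_grad harm_C1[OF open_Omega hp] b)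
  show "\<bar>(norm (grad (pd b g) x))\<^sup>2\<bar> \<le> Hsq x" if "x \<in> \<Omega>" for x
   using hs that member_le_sum[OF b, of "\<lambda>b. (norm (grad (pd b g) x))\<^sup>2"] by (simp add: hsq_def)
 qed
 have "\<mu> * energy \<Omega> g = (\<Sum>b\<in>Basis. \<mu> * sq_integral \<Omega> (pd b g))"
  unfolding energy_sum[OF open_Omega gC i1] sum_distrib_left ..
 also have "\<dots> \<le> (\<Sum>b\<in>Basis. energy \<Omega> (pd b g))"
 proof (rule sum_mono)
  fix b :: 'a assume b: "b \<in> Basis"
  have "pd b g z = 0" using gx[OF z(1)] z(2) b by (simp add: pd_eq_grad)
  then show "\<mu> * sq_integral \<Omega> (pd b g) \<le> energy \<Omega> (pd b g)"
   unfolding \<mu>_def by (intro mu0(2)[OF con z(1) hp] j0 j1 b)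
 qed
 also have "\<dots> = integral\<^sup>L vol (hsq g)"
  unfolding hsq_def[abs_def] by (rule Bochner_Integration.integral_sum[symmetric]) (rule j1)
 also have "\<dots> = integral\<^sup>L vol Hsq" by (rule LINT_on_cong[OF hs])
 finally show "\<mu> * energy \<Omega> g \<le> integral\<^sup>L vol Hsq" .
qed

end

section \<open>Stability\<close>

text \<open>E stands for the difference of the radii and R for the outer one. The analysis bounds
  the difference of squares, hence E R, and V^(1/N) \<le> w R trades R for the volume, which
  produces the exponent - 1/N.\<close>

lemma stability_low_dim_real:
 fixes N V Hl \<mu> \<delta> c d E R w :: real
 assumes N: "N \<ge> 2" and pos: "V > 0" "Hl > 0" "\<mu> > 0" "w > 0" and nn: "\<delta> \<ge> 0" "c \<ge> 0" "d \<ge> 0" "E \<ge> 0"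
  and main: "E * R \<le> 2 * (c * (sqrt (N * (N - 1) * V * \<delta> / Hl) * ((1 + \<mu>) / \<mu>)) * d)" and V: "V powr (1 / N) \<le> w * R"
 shows "E \<le> (2 * N * w * c * (d * V powr (1 / 2 - 1 / N)) / Hl powr (1 / 2) * ((1 + \<mu>) / \<mu>)) * \<delta> powr (1 / 2)"
proof -
 define X where "X = (1 + \<mu>) / \<mu>"
 have X: "X \<ge> 0" using pos by (simp add: X_def)
 define P where "P = V powr (1 / 2) * \<delta> powr (1 / 2) / Hl powr (1 / 2)"
 have sN: "sqrt (N * (N - 1)) \<le> N" by (rule real_le_lsqrt) (use N in \<open>auto simp: power2_eq_square\<close>)
 have "sqrt (N * (N - 1) * V * \<delta> / Hl) = sqrt (N * (N - 1)) * (sqrt V * sqrt \<delta> / sqrt Hl)"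
  by (simp only: real_sqrt_mult real_sqrt_divide mult.assoc times_divide_eq_right)
 also have "\<dots> \<le> N * (sqrt V * sqrt \<delta> / sqrt Hl)" using sN pos nn by (intro mult_right_mono) auto
 finally have s: "sqrt (N * (N - 1) * V * \<delta> / Hl) \<le> N * P"
  using pos nn by (simp add: P_def powr_half_sqrt)
 have "V powr (1 / N) * E \<le> w * (E * R)" using mult_right_mono[OF V nn(4)] by (simp add: ac_simps)
 also have "\<dots> \<le> w * (2 * (c * (sqrt (N * (N - 1) * V * \<delta> / Hl) * X) * d))" using main pos by (intro mult_left_mono) (auto simp: X_def)
 also have "\<dots> \<le> w * (2 * (c * (N * P * X) * d))"
  using s X pos nn by (intro mult_left_mono mult_right_mono) auto
 finally have "E \<le> w * (2 * (c * (N * P * X) * d)) / V powr (1 / N)"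
  using pos by (simp add: field_simps)
 also have "\<dots> = (2 * N * w * c * (d * (V powr (1 / 2) / V powr (1 / N))) / Hl powr (1 / 2) * X) * \<delta> powr (1 / 2)" by (simp add: P_def field_simps)
 also have "V powr (1 / 2) / V powr (1 / N) = V powr (1 / 2 - 1 / N)" by (simp add: powr_diff)
 finally show ?thesis by (simp add: X_def)
qed

text \<open>The bound in \<sigma> is optimal up to constants where its two terms are comparable,
  that is for \<sigma>^(N + 2) = D / (\<mu>^2 M^2). The upper bound assumed for D says that this
  \<sigma> does not exceed \<open>ri\<close>.\<close>

lemma stability_high_dim_real:
 fixes N V Hl \<mu> \<delta> M ri A E R w :: real
 assumes N: "N \<ge> 2" and pos: "V > 0" "Hl > 0" "\<mu> > 0" "w > 0" "M > 0" "ri > 0" "R > 0" and nn: "\<delta> \<ge> 0" "E \<ge> 0" "A \<ge> 0"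
  and D: "D = N * (N - 1) * V * \<delta> / Hl" "D \<le> \<mu>\<^sup>2 * M\<^sup>2 * ri powr (N + 2)"
  and main: "\<And>\<sigma>. 0 < \<sigma> ==> \<sigma> \<le> ri ==> E * R / 2 \<le> A * (sqrt D / \<mu>) * \<sigma> powr (- N / 2) + 14 * M * \<sigma>"
  and V: "V powr (1 / N) \<le> w * R"
 shows "E \<le> (2 * (A + 14) * w * N\<^sup>2 * M powr (N / (N + 2)) / (\<mu> powr (2 / (N + 2)) * V powr (1 / N - 1 / (N + 2)) * Hl powr (1 / (N + 2)))) * \<delta> powr (1 / (N + 2))"
proof (cases "\<delta> = 0")
 \<comment> \<open>Without deficit the optimal radius would be 0, which is not allowed, so \<sigma>
   is made arbitrarily small instead.\<close>
 case True
 have "E * R / 2 \<le> 0 + e" if e: "e > 0" for e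
 proof -
  define \<sigma> where "\<sigma> = min ri (e / (14 * M))"
  have s: "0 < \<sigma>" "\<sigma> \<le> ri" "\<sigma> \<le> e / (14 * M)" using pos e by (auto simp: \<sigma>_def)
  have "E * R / 2 \<le> 14 * M * \<sigma>" using main[OF s(1,2)] True D(1) by simp
  also have "\<dots> \<le> e" using s(3) pos by (simp add: field_simps)
  finally show ?thesis by simp
 qed
 then have "E * R / 2 \<le> 0" by (rule field_le_epsilon)
 then have "E \<le> 0" using pos(7) by (simp add: mult_le_0_iff)
 then show ?thesis using True by simp
next
 case False
 define e where "e = 1 / (N + 2)"
 have e: "e > 0" "e \<le> 1" using N by (auto simp: e_def)
 have D0: "D > 0" unfolding D(1) using False nn pos N by simp
 define \<tau> where "\<tau> = D / (\<mu>\<^sup>2 * M\<^sup>2)"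
 have t: "\<tau> > 0" "\<tau> \<le> ri powr (N + 2)" using D0 D(2) pos by (auto simp: \<tau>_def field_simps)
 define \<sigma> where "\<sigma> = \<tau> powr e"
 have "\<sigma> \<le> (ri powr (N + 2)) powr e" unfolding \<sigma>_def using t e by (intro powr_mono2) auto
 also have "\<dots> = ri" using N pos by (simp add: powr_powr e_def)
 finally have s: "0 < \<sigma>" "\<sigma> \<le> ri" using t by (auto simp: \<sigma>_def)
 have "sqrt D / \<mu> = M * sqrt \<tau>" using pos by (simp add: \<tau>_def real_sqrt_divide real_sqrt_mult)
 also have "\<dots> = M * \<tau> powr (1 / 2)" using t by (simp add: powr_half_sqrt)
 finally have "sqrt D / \<mu> * \<sigma> powr (- N / 2) = M * (\<tau> powr (1 / 2) * \<tau> powr (e * (- N / 2)))" by (simp add: \<sigma>_def powr_powr)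
 also have "\<dots> = M * \<tau> powr (1 / 2 + e * (- N / 2))" by (simp only: powr_add)
 also have "1 / 2 + e * (- N / 2) = e" using N by (simp add: e_def field_simps)
 finally have "A * (sqrt D / \<mu>) * \<sigma> powr (- N / 2) = A * (M * \<sigma>)" unfolding \<sigma>_def[symmetric] mult.assoc by (rule arg_cong)
 then have ER: "E * R \<le> 2 * (A + 14) * (M * \<sigma>)" using main[OF s] by (simp add: algebra_simps)
 define Q where "Q = M powr (N * e) * (V powr e * \<delta> powr e / Hl powr e) / \<mu> powr (2 * e)"
 have Ms: "M * \<sigma> \<le> N\<^sup>2 * Q"
 proof -
  have "\<sigma> = (N * (N - 1)) powr e * (V powr e * \<delta> powr e / Hl powr e) / (\<mu> powr (2 * e) * M powr (2 * e))"
  proof -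
   have "(\<mu>\<^sup>2) powr e = \<mu> powr (2 * e)" "(M\<^sup>2) powr e = M powr (2 * e)"
    using powr_powr[of \<mu> 2 e] powr_powr[of M 2 e] pos by simp_all
   then show ?thesis unfolding \<sigma>_def \<tau>_def D(1) powr_mult powr_divide by simp
  qed
  then have "M * \<sigma> = (N * (N - 1)) powr e * ((M powr 1 / M powr (2 * e)) * (V powr e * \<delta> powr e / Hl powr e) / \<mu> powr (2 * e))"
   using pos by (simp add: field_simps)
  also have "M powr 1 / M powr (2 * e) = M powr (1 - 2 * e)" by (simp only: powr_diff)
  also have "1 - 2 * e = N * e" using N by (simp add: e_def field_simps)
  finally have "M * \<sigma> = (N * (N - 1)) powr e * Q" by (simp add: Q_def)
  also have "\<dots> \<le> N\<^sup>2 * Q"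
  proof (rule mult_right_mono)
   have "1 \<le> N * (N - 1)" using mult_mono[of 2 N 1 "N - 1"] N by simp
   then have "(N * (N - 1)) powr e \<le> (N * (N - 1)) powr 1" using e by (intro powr_mono) auto
   also have "\<dots> \<le> N\<^sup>2" using N by (simp add: power2_eq_square)
   finally show "(N * (N - 1)) powr e \<le> N\<^sup>2" .
  qed (use pos in \<open>simp add: Q_def\<close>)
  finally show ?thesis .
 qed
 have "V powr (1 / N) * E \<le> w * (E * R)" using mult_right_mono[OF V nn(2)] by (simp add: ac_simps)
 also have "\<dots> \<le> w * (2 * (A + 14) * (M * \<sigma>))" using ER pos by (intro mult_left_mono) auto
 also have "\<dots> \<le> w * (2 * (A + 14) * (N\<^sup>2 * Q))"
  using Ms pos nn by (intro mult_left_mono) auto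
 finally have "E \<le> w * (2 * (A + 14) * (N\<^sup>2 * Q)) / V powr (1 / N)"
  using pos by (simp add: field_simps)
 also have "\<dots> = (2 * (A + 14) * w * N\<^sup>2 * M powr (N * e) / (\<mu> powr (2 * e) * (V powr (1 / N) / V powr e) * Hl powr e)) * \<delta> powr e"
  using pos by (simp add: Q_def field_simps)
 also have "V powr (1 / N) / V powr e = V powr (1 / N - e)" by (simp add: powr_diff)
 finally show ?thesis by (simp add: e_def)
qed

context torsion begin

lemma volume_pos: "measure lebesgue \<Omega> > 0"
proof -
 obtain p where p: "p \<in> \<Omega>" using Omega_ne by blast
 obtain r where r: "r > 0" "ball p r \<subseteq> \<Omega>" by (rule openE[OF open_Omega p])
 have "0 < measure lebesgue (ball p r)" using content_ball_pos[OF r(1), of p] by simp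
 also have "\<dots> \<le> measure lebesgue \<Omega>" by (rule measure_mono_fmeasurable[OF r(2) _ finite_measure_Omega]) simp
 finally show ?thesis .
qed

text \<open>The surface area is N V H0. With h the larger of the two available lower bounds of H,
  \<open>hessian_flux\<close> therefore gives N (N - 1) V (H0 - h) / h, where H0 - h is at most
  \<delta> and h at least \<open>Hl\<close>.\<close>

lemma deficit:
 assumes N: "DIM('a) \<ge> 2" and H: "is_mean_curvature \<alpha> \<Omega> H" and l: "\<forall>p\<in>\<Gamma>. \<exists>r. local_defining_fun \<alpha> \<Omega> p r \<rho>"
  and Hl: "Hl > 0" "\<forall>p\<in>\<Gamma>. Hl \<le> H p"
 defines "V \<equiv> measure lebesgue \<Omega>"
 defines "H0 \<equiv> surface_area \<Gamma> / (real DIM('a) * V)"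
 defines "\<delta> \<equiv> Sup ((\<lambda>p. \<bar>H0 - H p\<bar>) ` \<Gamma>)"
 shows "\<delta> \<ge> 0" "integrable vol Hsq"
  "integral\<^sup>L vol Hsq \<le> real DIM('a) * (real DIM('a) - 1) * V * \<delta> / Hl"
proof -
 define n where "n = real DIM('a)"
 have n: "n \<ge> 2" using N by (simp add: n_def)
 have V: "V > 0" unfolding V_def by (rule volume_pos)
 have cf: "curv p = (n - 1) * H p * norm (grad \<rho> p) ^ 3" if "p \<in> \<Gamma>" for p
  using curvature_formula[OF H that _ N] bspec[OF l that] by (auto simp: n_def)
 have m0: "norm (grad \<rho> p) > 0" if "p \<in> \<Gamma>" for p using c0(1) c0(2)[OF that] by linarith
 have Hf: "H p = curv p / ((n - 1) * norm (grad \<rho> p) ^ 3)" if "p \<in> \<Gamma>" for p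
  using cf[OF that] m0[OF that] n by (simp add: field_simps)
 \<comment> \<open>\<delta> is a supremum of reals, so boundedness has to be shown first; on the
   boundary H agrees with a continuous expression in \<rho>.\<close>
 have "continuous_on \<Gamma> (\<lambda>p. H0 - curv p / ((n - 1) * norm (grad \<rho> p) ^ 3))"
  by (intro continuous_intros continuous_curv continuous_grad_rho) (use m0 n in force)
 then obtain B where B: "\<And>p. p \<in> \<Gamma> ==> norm (H0 - curv p / ((n - 1) * norm (grad \<rho> p) ^ 3)) \<le> B"
  using bounded_on_compact[OF _ compact_frontier_Omega order_refl] by blast
 have bdd: "bdd_above ((\<lambda>p. \<bar>H0 - H p\<bar>) ` \<Gamma>)"
  by (rule bdd_aboveI2[of _ _ B]) (use B Hf in simp)
 have d: "\<bar>H0 - H p\<bar> \<le> \<delta>" if "p \<in> \<Gamma>" for p unfolding \<delta>_def by (rule cSUP_upper[OF that bdd])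
 obtain p0 where p0: "p0 \<in> \<Gamma>" using frontier_ne by blast
 show d0: "\<delta> \<ge> 0" using d[OF p0] by simp
 define h where "h = max Hl (H0 - \<delta>)"
 have h: "h > 0" "Hl \<le> h" "H0 - h \<le> \<delta>" using Hl(1) by (auto simp: h_def)
 have hp: "h \<le> H p" if "p \<in> \<Gamma>" for p using d[OF that] bspec[OF Hl(2) that] by (simp add: h_def)
 have k: "(n - 1) * h * norm (grad \<rho> p) ^ 3 \<le> curv p" if "p \<in> \<Gamma>" for p
  unfolding cf[OF that] using hp[OF that] n by (intro mult_right_mono mult_left_mono) auto
 have kp: "(n - 1) * h > 0" using n h by simp
 note F = hessian_flux[OF N kp k, folded n_def V_def]
 show "integrable vol Hsq" using F(1) .
 have S: "surface_area \<Gamma> = n * V * H0" using V n by (simp add: H0_def n_def)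
 have "(n - 1)\<^sup>2 / ((n - 1) * h) * surface_area \<Gamma> = (n - 1) * n * V * H0 / h"
  unfolding S using n by (simp add: power2_eq_square)
 then have "integral\<^sup>L vol Hsq \<le> (n - 1) * n * V * H0 / h - (n - 1) * n * V" using F(2) by linarith
 also have "\<dots> = n * (n - 1) * V * ((H0 - h) / h)" using h by (simp add: field_simps)
 also have "\<dots> \<le> n * (n - 1) * V * (\<delta> / Hl)"
 proof (rule mult_left_mono)
  have "(H0 - h) / h \<le> \<delta> / h" using h by (intro divide_right_mono) auto
  also have "\<dots> \<le> \<delta> / Hl" using h Hl d0 by (intro divide_left_mono) auto
  finally show "(H0 - h) / h \<le> \<delta> / Hl" .
 qed (use n V in auto)
 finally show "integral\<^sup>L vol Hsq \<le> real DIM('a) * (real DIM('a) - 1) * V * \<delta> / Hl" by (simp add: n_def)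
qed

text \<open>|x - z|^2 is strictly subharmonic, so its maximum is attained on the boundary.\<close>

lemma Omega_subset_cball:
 assumes "\<And>p. p \<in> \<Gamma> ==> dist p z \<le> R" and x: "x \<in> closure \<Omega>"
 shows "dist x z \<le> R"
proof -
 have sq: "norm (x - z) \<le> R \<longleftrightarrow> (x - z) \<bullet> (x - z) \<le> R\<^sup>2" if "R \<ge> 0" for x
  using that by (simp add: power2_norm_eq_inner[symmetric] power2_le_iff_abs_le)
 obtain p where "p \<in> \<Gamma>" using frontier_ne by blast
 then have R: "R \<ge> 0" using assms(1) zero_le_dist order_trans by blast
 have "(x - z) \<bullet> (x - z) \<le> R\<^sup>2"
 proof (rule max_principle[OF open_Omega bounded_Omega sqdist_C2_Omega _ _ _ x])
  show "continuous_on (closure \<Omega>) (\<lambda>x. (x - z) \<bullet> (x - z))" by (intro continuous_intros)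
  show "(y - z) \<bullet> (y - z) \<le> R\<^sup>2" if "y \<in> closure \<Omega> - \<Omega>" for y
   using that closure_Omega assms(1)[of y] sq[OF R] by (auto simp: dist_norm)
 qed (simp add: sqdist_C2)
 then show ?thesis using sq[OF R] by (simp add: dist_norm)
qed

lemma volume_radius:
 assumes "\<And>p. p \<in> \<Gamma> ==> dist p z \<le> R"
 shows "measure lebesgue \<Omega> powr (1 / real DIM('a)) \<le> unit_ball_vol (real DIM('a)) powr (1 / real DIM('a)) * R"
proof -
 obtain p where "p \<in> \<Gamma>" using frontier_ne by blast
 then have R: "R \<ge> 0" using assms zero_le_dist order_trans by blast
 have "\<Omega> \<subseteq> cball z R" using Omega_subset_cball[OF assms] closure_Omega by (auto simp: dist_commute)
 then have "measure lebesgue \<Omega> \<le> measure lebesgue (cball z R)" using open_Omega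
  by (intro measure_mono_fmeasurable) (auto intro: lmeasurable_cball borel_open)
 also have "\<dots> = unit_ball_vol (real DIM('a)) * R ^ DIM('a)" using content_cball[OF R, of z] by simp
 finally have "measure lebesgue \<Omega> powr (1 / real DIM('a)) \<le> (unit_ball_vol (real DIM('a)) * R ^ DIM('a)) powr (1 / real DIM('a))"
  by (intro powr_mono2) auto
 also have "\<dots> = unit_ball_vol (real DIM('a)) powr (1 / real DIM('a)) * R"
 proof (cases "R = 0")
  case False
  then show ?thesis using R by (simp add: powr_mult powr_powr flip: powr_realpow)
 qed simp
 finally show ?thesis .
qed

lemma stability_low_dim:
 assumes con: "connected \<Omega>" and z: "z \<in> \<Omega>" "grad u z = 0" and hi: "integrable vol Hsq"
  and D: "integral\<^sup>L vol Hsq \<le> D" and c: "sobolev_holder_const \<Omega> \<gamma> c" and \<gamma>: "\<gamma> > 0"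
  and x: "x \<in> \<Gamma>" "y \<in> \<Gamma>"
 defines "\<mu> \<equiv> mu0 \<Omega> z"
 shows "((dist x z)\<^sup>2 - (dist y z)\<^sup>2) / 2 \<le> c * (sqrt D * ((1 + \<mu>) / \<mu>)) * diameter \<Omega> powr \<gamma>"
proof -
 note dev = deviation[OF con z hi, folded \<mu>_def]
 define I1 where "I1 = integral\<^sup>L vol (\<lambda>x. (norm (grad (\<lambda>x. hh z x - hh z z) x))\<^sup>2)"
 define I0 where "I0 = integral\<^sup>L vol (\<lambda>x. (hh z x - hh z z)\<^sup>2)"
 define I2 where "I2 = integral\<^sup>L vol (hsq (\<lambda>x. hh z x - hh z z))"
 have \<mu>: "\<mu> > 0" unfolding \<mu>_def by (rule mu0(1)[OF con z(1)])
 have I2: "I2 \<le> D" using dev(5) D by (simp add: I2_def)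
 have I1: "I1 \<le> D / \<mu>" using dev(6) D \<mu> by (simp add: I1_def field_simps)
 have I0: "I0 \<le> D / \<mu> / \<mu>"
 proof -
  have "\<mu> * I0 \<le> D / \<mu>" using dev(7) I1 unfolding I0_def I1_def by (rule order_trans)
  then show ?thesis using \<mu> by (simp add: pos_le_divide_eq ac_simps)
 qed
 have D0: "D \<ge> 0"
 proof -
  have "0 \<le> I1" by (simp add: I1_def)
  then have "0 \<le> D / \<mu>" using I1 by linarith
  then show ?thesis using \<mu> by (simp add: zero_le_divide_iff)
 qed
 have c0: "c \<ge> 0" by (rule sobolev_const_nonneg[OF c])
 have xc: "x \<in> closure \<Omega>" "y \<in> closure \<Omega>" using x closure_Omega by auto
 have "((dist x z)\<^sup>2 - (dist y z)\<^sup>2) / 2 = (hh z x - hh z z) - (hh z y - hh z z)"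
  using u_zero x by (simp add: hh_def dist_norm power2_norm_eq_inner)
 also have "\<dots> \<le> c * sqrt (I0 + I1 + I2) * dist x y powr \<gamma>"
  using sobolev_harmonic[OF c dev(1) dev(9) dev(2-4) xc] unfolding I0_def I1_def I2_def by linarith
 also have "\<dots> \<le> c * (sqrt D * ((1 + \<mu>) / \<mu>)) * diameter \<Omega> powr \<gamma>"
 proof -
  \<comment> \<open>The three integrals carry the factors 1/\<mu>^2, 1/\<mu> and 1; one further D /
    \<mu> completes the square, which is the origin of (1 + \<mu>) / \<mu>.\<close>
  have "I0 + I1 + I2 \<le> D * (1 + 1 / \<mu>)\<^sup>2"
  proof -
   have "D * (1 + 1 / \<mu>)\<^sup>2 = D / \<mu> / \<mu> + D / \<mu> + D + D / \<mu>" using \<mu> by (simp add: power2_eq_square field_simps)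
   moreover have "D / \<mu> \<ge> 0" using D0 \<mu> by simp
   ultimately show ?thesis using I0 I1 I2 by linarith
  qed
  then have "sqrt (I0 + I1 + I2) \<le> sqrt (D * (1 + 1 / \<mu>)\<^sup>2)" by simp
  also have "\<dots> = sqrt D * ((1 + \<mu>) / \<mu>)" using \<mu> by (simp add: real_sqrt_mult add_divide_distrib)
  finally have s: "c * sqrt (I0 + I1 + I2) \<le> c * (sqrt D * ((1 + \<mu>) / \<mu>))" using c0 by (rule mult_left_mono)
  have "dist x y \<le> diameter (closure \<Omega>)" by (rule diameter_bounded_bound[OF bounded_closure[OF bounded_Omega] xc])
  then have d: "dist x y powr \<gamma> \<le> diameter \<Omega> powr \<gamma>" using \<gamma> bounded_Omega by (intro powr_mono2) (auto simp: diameter_closure)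
  show ?thesis by (rule mult_mono[OF s d]) (use c0 D0 \<mu> in auto)
 qed
 finally show ?thesis .
qed

text \<open>y lies on the segment from p to the centre q, and balls tangent at p are nested. The
  segment from y to p meets the boundary only at p, where u vanishes, so the mean value theorem
  bounds u at y.\<close>

lemma interior_ball_estimates:
 assumes cb: "ball q r \<subseteq> \<Omega>" "r > 0" and p: "p \<in> \<Gamma>" "dist q p = r"
  and M: "M \<ge> 0" "\<forall>x\<in>\<Omega>. norm (grad u x) \<le> M" and s: "0 < \<sigma>" "\<sigma> \<le> r"
 defines "y \<equiv> p + (\<sigma> / r) *\<^sub>R (q - p)"
 shows "dist y p = \<sigma>" "ball y \<sigma> \<subseteq> \<Omega>" "y \<in> \<Omega>" "\<bar>u y\<bar> \<le> M * \<sigma>"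
proof -
 have nq: "norm (q - p) = r" using p(2) by (simp add: dist_norm)
 have d: "dist q (p + (\<tau> / r) *\<^sub>R (q - p)) = r - \<tau>" if "0 \<le> \<tau>" "\<tau> \<le> r" for \<tau>
 proof -
  have "q - (p + (\<tau> / r) *\<^sub>R (q - p)) = (1 - \<tau> / r) *\<^sub>R (q - p)" by (simp add: algebra_simps)
  then have "dist q (p + (\<tau> / r) *\<^sub>R (q - p)) = \<bar>1 - \<tau> / r\<bar> * r" by (simp only: dist_norm norm_scaleR nq)
  also have "\<dots> = r - \<tau>" using that cb(2) by (simp add: field_simps)
  finally show ?thesis .
 qed
 show yp: "dist y p = \<sigma>" using s cb(2) nq by (simp add: y_def dist_norm)
 show sub: "ball y \<sigma> \<subseteq> \<Omega>"
 proof
  fix x assume "x \<in> ball y \<sigma>"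
  then have "dist q x < r" using dist_triangle[of q x y] d[of \<sigma>] s by (simp add: y_def)
  then show "x \<in> \<Omega>" using cb(1) by auto
 qed
 show yO: "y \<in> \<Omega>" using s by (intro subsetD[OF sub]) simp
 define f where "f t = u (y + t *\<^sub>R (p - y))" for t
 have eq: "y + t *\<^sub>R (p - y) = p + ((1 - t) * \<sigma> / r) *\<^sub>R (q - p)" for t
  using cb(2) by (simp add: y_def algebra_simps add_divide_distrib diff_divide_distrib)
 have inO: "y + t *\<^sub>R (p - y) \<in> \<Omega>" if "0 \<le> t" "t < 1" for t
 proof -
  have "(1 - t) * \<sigma> \<le> 1 * \<sigma>" by (rule mult_right_mono) (use that s in auto)
  then have "(1 - t) * \<sigma> \<le> r" using s by linarith
  then have "dist q (y + t *\<^sub>R (p - y)) < r" unfolding eq using d[of "(1 - t) * \<sigma>"] that s by simp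
  then show ?thesis using cb(1) by auto
 qed
 have inC: "y + t *\<^sub>R (p - y) \<in> closure \<Omega>" if "0 \<le> t" "t \<le> 1" for t
  using inO[of t] that p(1) closure_Omega by (cases "t = 1") auto
 have df: "(f has_real_derivative grad u (y + t *\<^sub>R (p - y)) \<bullet> (p - y)) (at t)" if "0 < t" "t < 1" for t
  unfolding f_def using gderiv_line[OF C1_onD[OF C1_u inO]] that by simp
 obtain l t where t: "0 < t" "t < 1" "(f has_real_derivative l) (at t)" "f 1 - f 0 = (1 - 0) * l"
 proof (rule exE[OF MVT[of 0 1 f]])
  show "continuous_on {0..1} f" unfolding f_def
   by (intro continuous_on_compose2[OF cont_u]) (auto intro!: continuous_intros inC)
  show "f differentiable (at x)" if "0 < x" "x < 1" for x unfolding real_differentiable_def using df[OF that] by blast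
 qed auto
 have "l = grad u (y + t *\<^sub>R (p - y)) \<bullet> (p - y)" using DERIV_unique[OF t(3) df[OF t(1,2)]] .
 then have "\<bar>l\<bar> \<le> M * norm (p - y)"
  using order_trans[OF Cauchy_Schwarz_ineq2 mult_right_mono[OF bspec[OF M(2) inO[of t]]]] t by simp
 moreover have "f 1 = 0" "f 0 = u y" using u_zero[OF p(1)] by (simp_all add: f_def)
 ultimately show "\<bar>u y\<bar> \<le> M * \<sigma>" using t(4) yp by (simp add: dist_norm norm_minus_commute)
qed

text \<open>Comparison with |x - q|^2 / 4. The torsion function of the ball has the coefficient 1/2;
  halving it leaves a positive Laplacian for the strict maximum principle.\<close>

lemma torsion_ball_lower:
 assumes cb: "ball q r \<subseteq> \<Omega>" "r > 0"
 shows "u q \<le> - (r\<^sup>2 / 4)"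
proof -
 have o: "open (ball q r)" "bounded (ball q r)" by auto
 define w where "w x = 1 * u x + (- 1 / 4) * ((x - q) \<bullet> (x - q))" for x
 have C: "C2_on (ball q r) u" "C2_on (ball q r) (\<lambda>x. (x - q) \<bullet> (x - q))"
  by (rule C2_on_subset[OF open_Omega o(1) C2_u cb(1)], rule C2_on_subset[OF open_UNIV o(1) sqdist_C2(1)]) simp
 have cl: "closure (ball q r) \<subseteq> closure \<Omega>" by (rule closure_mono[OF cb(1)])
 have "w q \<le> - (r\<^sup>2 / 4)"
 proof (rule max_principle[OF o])
  show "C2_on (ball q r) w" unfolding w_def[abs_def] by (rule C2_on_lincomb(1)[OF o(1) C])
  show "continuous_on (closure (ball q r)) w" unfolding w_def[abs_def]
   by (intro continuous_intros continuous_on_subset[OF cont_u cl])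
  show "laplacian w x > 0" if x: "x \<in> ball q r" for x
   unfolding w_def[abs_def] C2_on_lincomb(2)[OF o(1) C x] using lap_u[of x] x cb(1) by (auto simp: sqdist_C2)
  show "w x \<le> - (r\<^sup>2 / 4)" if "x \<in> closure (ball q r) - ball q r" for x
  proof -
   have "norm (x - q) = r" using that cb(2) by (auto simp: dist_norm norm_minus_commute)
   moreover have "u x \<le> 0" using that cl by (intro u_nonpos) auto
   ultimately show ?thesis by (simp add: w_def power2_norm_eq_inner[symmetric])
  qed
  show "q \<in> closure (ball q r)" using cb(2) by simp
 qed
 then show ?thesis by (simp add: w_def)
qed

lemma interior_sphere_ball:
 assumes "interior_sphere_cond \<Omega> r" "r > 0" "p \<in> \<Gamma>"
 obtains q where "ball q r \<subseteq> \<Omega>" "dist q p = r"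
proof -
 obtain q where q: "ball q r \<subseteq> \<Omega>" "cball q r \<inter> \<Gamma> = {p}" using assms unfolding interior_sphere_cond_def by blast
 have "p \<in> cball q r" using q(2) by blast
 moreover have "p \<notin> ball q r" using q(1) assms(3) frontier_disjoint by blast
 ultimately show thesis using that q(1) by auto
qed

text \<open>R has to be bounded by M first, because |x - z|^2 changes by order R \<sigma> over a
  distance \<sigma>. At a centre q of an interior sphere touching at x,
  \<open>torsion_ball_lower\<close> gives \<open>ri\<close> \<le> 4 M, and q - z is the sum of
  \<open>grad g q\<close> and \<open>grad u q\<close>, hence of norm at most 2 M; so R \<le> 6
  M.\<close>

lemma stability_high_dim:
 assumes con: "connected \<Omega>" and z: "z \<in> \<Omega>" "grad u z = 0" and hi: "integrable vol Hsq"
  and D: "integral\<^sup>L vol Hsq \<le> D" and M': "\<forall>x\<in>\<Omega>. norm (grad u x) \<le> M"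
  and ri: "ri > 0" "interior_sphere_cond \<Omega> ri"
  and D2: "D \<le> kerc TYPE('a) / (16 * (gradc TYPE('a))\<^sup>2 * 4 ^ DIM('a)) * ((mu0 \<Omega> z)\<^sup>2 * M\<^sup>2 * ri powr (real DIM('a) + 2))"
  and R': "\<forall>p\<in>\<Gamma>. dist p z \<le> R" and x: "x \<in> \<Gamma>" "dist x z = R" "y \<in> \<Gamma>"
 shows "M > 0" "R > 0"
  "\<And>\<sigma>. 0 < \<sigma> ==> \<sigma> \<le> ri ==> (R\<^sup>2 - (dist y z)\<^sup>2) / 2 \<le> 2 * 2 powr (real DIM('a) / 2) / sqrt (kerc TYPE('a)) * (sqrt D / mu0 \<Omega> z) * \<sigma> powr (- real DIM('a) / 2) + 14 * M * \<sigma>"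
proof -
 note M = M'[rule_format] and R = R'[rule_format]
 define n where "n = real DIM('a)"
 define K where "K = kerc TYPE('a)"
 define G where "G = gradc TYPE('a)"
 have KG: "K > 0" "G > 0" unfolding K_def G_def by (rule kerc_pos gradc_pos)+
 define \<mu> where "\<mu> = mu0 \<Omega> z"
 have \<mu>: "\<mu> > 0" unfolding \<mu>_def by (rule mu0(1)[OF con z(1)])
 define g where "g = (\<lambda>x. hh z x - hh z z)"
 note dev = deviation[OF con z hi, folded \<mu>_def g_def]
 have g2: "sq_integrable \<Omega> g" "\<mu> * sq_integral \<Omega> g \<le> energy \<Omega> g"
  using dev(2,7) unfolding g_def by auto
 define I where "I = sq_integral \<Omega> g"
 have I: "0 \<le> I" "\<mu>\<^sup>2 * I \<le> D"
 proof -
  show "0 \<le> I" by (simp add: I_def)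
  have "\<mu> * (\<mu> * I) \<le> \<mu> * energy \<Omega> g" using g2(2) \<mu> by (simp add: I_def)
  then show "\<mu>\<^sup>2 * I \<le> D" using dev(6) D by (simp add: power2_eq_square mult.assoc)
 qed
 have M0: "M \<ge> 0" using order_trans[OF norm_ge_zero M[OF z(1)]] .
 have "z \<notin> \<Gamma>" using z(1) frontier_disjoint by blast
 then show R0: "R > 0" using x(1,2) by auto
 obtain q where q: "ball q ri \<subseteq> \<Omega>" "dist q x = ri" by (rule interior_sphere_ball[OF ri(2,1) x(1)])
 have qO: "q \<in> \<Omega>" using ri(1) by (intro subsetD[OF q(1)]) simp
 have "\<bar>u q\<bar> \<le> M * ri" using interior_ball_estimates(4)[OF q(1) ri(1) x(1) q(2) M0 M' ri(1) order_refl] ri(1) by simp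
 then have "ri\<^sup>2 / 4 \<le> M * ri" using torsion_ball_lower[OF q(1) ri(1)] by linarith
 then have rM: "ri \<le> 4 * M" using ri(1) by (simp add: power2_eq_square)
 then show Mp: "M > 0" using ri(1) by linarith
 \<comment> \<open>The smallness of D enters here, through the L2 gradient estimate on the ball of
   radius \<open>ri / 2\<close> about q.\<close>
 have "norm (grad g q) \<le> M"
 proof (rule power2_le_imp_le[OF _ M0])
  have sub: "cball q (ri / 2) \<subseteq> \<Omega>" using q(1) ri(1) by (auto simp: subset_eq)
  have "(norm (grad g q))\<^sup>2 \<le> (2 * G / (ri / 2))\<^sup>2 * (I / (K * (ri / 2 / 2) ^ DIM('a)))"
   unfolding G_def K_def I_def by (rule harm_grad_L2_bound[OF open_Omega dev(1) _ sub g2(1)]) (use ri(1) in simp)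
  also have "\<dots> = 16 * G\<^sup>2 * 4 ^ DIM('a) / K * I / (ri\<^sup>2 * ri ^ DIM('a))"
   using ri(1) KG by (simp add: power_divide power_mult_distrib field_simps)
  also have "\<dots> \<le> M\<^sup>2"
  proof -
   have rp: "ri powr (real DIM('a) + 2) = ri\<^sup>2 * ri ^ DIM('a)" using ri(1) by (simp add: powr_add powr_realpow mult.commute)
   define c where "c = 16 * G\<^sup>2 * 4 ^ DIM('a)"
   have c: "c > 0" using KG by (simp add: c_def)
   have "\<mu>\<^sup>2 * I \<le> K / c * (\<mu>\<^sup>2 * M\<^sup>2 * (ri\<^sup>2 * ri ^ DIM('a)))" using I(2) D2 unfolding rp \<mu>_def K_def c_def G_def by linarith
   then have "\<mu>\<^sup>2 * I \<le> \<mu>\<^sup>2 * (K / c * (M\<^sup>2 * (ri\<^sup>2 * ri ^ DIM('a))))" by (simp only: ac_simps)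
   then have "I \<le> K / c * (M\<^sup>2 * (ri\<^sup>2 * ri ^ DIM('a)))" by (rule mult_left_le_imp_le) (use \<mu> in simp)
   then have h: "c / K * I \<le> M\<^sup>2 * (ri\<^sup>2 * ri ^ DIM('a))" using c KG by (simp add: field_simps)
   show ?thesis unfolding c_def[symmetric] by (subst pos_divide_le_eq) (use ri(1) h in auto)
  qed
  finally show "(norm (grad g q))\<^sup>2 \<le> M\<^sup>2" .
 qed
 then have "norm (q - z) \<le> 2 * M"
  using norm_triangle_ineq[of "grad g q" "grad u q"] M[OF qO] dev(8)[OF qO] by simp
 then have RM: "R \<le> 6 * M" using x(2) q(2) rM dist_triangle[of x z q] by (simp add: dist_norm norm_minus_commute)
 fix \<sigma> :: real assume s: "0 < \<sigma>" "\<sigma> \<le> ri"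
 define b where "b = 2 powr (n / 2) / sqrt K * (sqrt D / \<mu>) * \<sigma> powr (- n / 2)"
 \<comment> \<open>Each boundary point is compared with the centre v of a tangent ball of radius
   \<sigma>: there the mean value bound b holds, and moving to the boundary costs 6 M \<sigma> for
   the quadratic part and M \<sigma> for u. Two boundary points make 14.\<close>
 have near: "\<exists>v. \<bar>g v\<bar> \<le> b \<and> \<bar>g p - g v\<bar> \<le> 7 * M * \<sigma>" if p: "p \<in> \<Gamma>" for p
 proof -
  obtain q where q: "ball q ri \<subseteq> \<Omega>" "dist q p = ri" by (rule interior_sphere_ball[OF ri(2,1) p])
  define v where "v = p + (\<sigma> / ri) *\<^sub>R (q - p)"
  note v = interior_ball_estimates[OF q(1) ri(1) p q(2) M0 M' s, folded v_def]
  have sub: "cball v (\<sigma> / 2) \<subseteq> \<Omega>" using v(2) s(1) by (auto simp: subset_eq)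
  have "(g v)\<^sup>2 \<le> I / (K * (\<sigma> / 2) ^ DIM('a))"
   unfolding K_def I_def by (rule harm_L2_bound[OF open_Omega dev(1) _ sub g2(1)]) (use s in simp)
  also have "\<dots> \<le> D / \<mu>\<^sup>2 / (K * (\<sigma> / 2) ^ DIM('a))"
   using I(2) \<mu> KG s by (intro divide_right_mono) (auto simp: pos_le_divide_eq mult.commute)
  finally have "\<bar>g v\<bar> \<le> sqrt (D / \<mu>\<^sup>2 / (K * (\<sigma> / 2) ^ DIM('a)))" by (simp add: real_le_rsqrt)
  also have "\<dots> = sqrt D / \<mu> / (sqrt K * (\<sigma> / 2) powr (n / 2))"
  proof -
   have "sqrt ((\<sigma> / 2) ^ DIM('a)) = (\<sigma> / 2) powr (n / 2)"
    using s by (simp add: n_def powr_half_sqrt[symmetric] powr_realpow[symmetric] powr_powr)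
   then show ?thesis using \<mu> by (simp add: real_sqrt_divide real_sqrt_mult)
  qed
  also have "\<dots> = b" using s by (simp add: b_def powr_divide powr_minus_divide ac_simps)
  finally have gv: "\<bar>g v\<bar> \<le> b" .
  define a where "a = norm (p - z)"
  define c where "c = norm (v - z)"
  have ac: "a \<le> R" "c \<le> R" "\<bar>a - c\<bar> \<le> \<sigma>" "a \<ge> 0" "c \<ge> 0"
  proof -
   show "a \<le> R" using R[OF p] by (simp add: a_def dist_norm)
   show "c \<le> R" using Omega_subset_cball[OF R, of v] v(3) closure_Omega by (simp add: c_def dist_norm)
   show "\<bar>a - c\<bar> \<le> \<sigma>" using norm_triangle_ineq3[of "p - z" "v - z"] v(1) by (simp add: a_def c_def dist_norm norm_minus_commute)
  qed (auto simp: a_def c_def)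
  have "a\<^sup>2 - c\<^sup>2 = (a - c) * (a + c)" by (simp add: power2_eq_square algebra_simps)
  then have "\<bar>a\<^sup>2 - c\<^sup>2\<bar> = \<bar>a - c\<bar> * (a + c)" using ac(4,5) by (simp add: abs_mult)
  also have "\<dots> \<le> \<sigma> * (12 * M)" using ac RM s by (intro mult_mono) auto
  finally have ac2: "\<bar>a\<^sup>2 - c\<^sup>2\<bar> \<le> 12 * (M * \<sigma>)" by (simp only: ac_simps)
  have gpv: "g p - g v = (a\<^sup>2 - c\<^sup>2) / 2 + u v" using u_zero[OF p] by (simp add: g_def hh_def a_def c_def power2_norm_eq_inner)
  have "\<bar>(a\<^sup>2 - c\<^sup>2) / 2\<bar> \<le> 6 * (M * \<sigma>)" using ac2 by simp
  then have "\<bar>g p - g v\<bar> \<le> 6 * (M * \<sigma>) + M * \<sigma>" unfolding gpv by (rule order_trans[OF abs_triangle_ineq add_mono[OF _ v(4)]])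
  then have "\<bar>g p - g v\<bar> \<le> 7 * M * \<sigma>" by (simp add: mult.assoc)
  then show ?thesis using gv by blast
 qed
 have "(R\<^sup>2 - (dist y z)\<^sup>2) / 2 = g x - g y"
  using u_zero[OF x(1)] u_zero[OF x(3)] x(2) by (simp add: g_def hh_def dist_norm power2_norm_eq_inner[symmetric])
 moreover obtain v1 where "\<bar>g v1\<bar> \<le> b \<and> \<bar>g x - g v1\<bar> \<le> 7 * M * \<sigma>" using near[OF x(1)] by blast
 moreover obtain v2 where "\<bar>g v2\<bar> \<le> b \<and> \<bar>g y - g v2\<bar> \<le> 7 * M * \<sigma>" using near[OF x(3)] by blast
 ultimately have "(R\<^sup>2 - (dist y z)\<^sup>2) / 2 \<le> 2 * b + 14 * M * \<sigma>" by linarith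
 then show "(R\<^sup>2 - (dist y z)\<^sup>2) / 2 \<le> 2 * 2 powr (real DIM('a) / 2) / sqrt (kerc TYPE('a)) * (sqrt D / mu0 \<Omega> z) * \<sigma> powr (- real DIM('a) / 2) + 14 * M * \<sigma>"
  by (simp add: b_def n_def K_def \<mu>_def)
qed

end

theorem theorem4p6:
  assumes "DIM('a::euclidean_space) \<ge> 2"
  shows "\<exists>kN \<alpha>N :: real. kN > 0 \<and> \<alpha>N > 0 \<and>
    (\<forall>(\<Omega>::'a set) \<alpha> H Hl u.
       open \<Omega> \<and> connected \<Omega> \<and> bounded \<Omega> \<and> \<Omega> \<noteq> {} \<and> connected (frontier \<Omega>)
       \<and> 0 < \<alpha> \<and> \<alpha> < 1 \<and> C2alpha_boundary \<alpha> \<Omega>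
       \<and> is_mean_curvature \<alpha> \<Omega> H \<and> Hl > 0 \<and> (\<forall>p\<in>frontier \<Omega>. H p \<ge> Hl)
       \<and> C2_on \<Omega> u \<and> continuous_on (closure \<Omega>) u
       \<and> (\<forall>x\<in>\<Omega>. laplacian u x = real DIM('a)) \<and> (\<forall>x\<in>frontier \<Omega>. u x = 0)
     \<longrightarrow>
      (let N = real DIM('a);
           V = measure lebesgue \<Omega>;
           H0 = surface_area (frontier \<Omega>) / (N * V);
           M = Sup ((\<lambda>x. norm (grad u x)) ` \<Omega>);
           \<delta> = Sup ((\<lambda>p. \<bar>H0 - H p\<bar>) ` frontier \<Omega>)
       in \<exists>z\<in>\<Omega>.
          (let \<rho>i = Inf ((\<lambda>x. dist x z) ` frontier \<Omega>);
               \<rho>e = Sup ((\<lambda>x. dist x z) ` frontier \<Omega>);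
               \<mu> = mu0 \<Omega> z
           in ((DIM('a) = 2 \<or> DIM('a) = 3) \<longrightarrow>
                 (\<forall>\<gamma> c. (DIM('a) = 2 \<longrightarrow> 0 < \<gamma> \<and> \<gamma> < 1) \<and> (DIM('a) = 3 \<longrightarrow> \<gamma> = 1/2)
                     \<and> sobolev_holder_const \<Omega> \<gamma> c \<longrightarrow>
                   \<rho>e - \<rho>i \<le> (kN * c * (diameter \<Omega> powr \<gamma> * V powr (1/2 - 1/N)) / Hl powr (1/2)
                                * ((1 + \<mu>) / \<mu>)) * \<delta> powr (1/2)))
            \<and> (DIM('a) \<ge> 4 \<longrightarrow>
                 (\<forall>ri. ri > 0 \<and> interior_sphere_cond \<Omega> ri
                     \<and> \<delta> < \<alpha>N * (Hl / V) * \<mu>\<^sup>2 * M\<^sup>2 * ri powr (N + 2) \<longrightarrow>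
                   \<rho>e - \<rho>i \<le> (kN * M powr (N / (N + 2))
                      / (\<mu> powr (2 / (N + 2)) * V powr (1/N - 1/(N + 2)) * Hl powr (1 / (N + 2))))
                      * \<delta> powr (1 / (N + 2)))))))"
  proof -
 define n where "n = real DIM('a)"
 define K where "K = kerc TYPE('a)"
 define G where "G = gradc TYPE('a)"
 define w where "w = unit_ball_vol n powr (1 / n)"
 define A where "A = 2 * 2 powr (n / 2) / sqrt K"
 \<comment> \<open>One constant has to serve all dimensions, so \<open>k1\<close> for the low and
   \<open>k2\<close> for the high ones are added in the end.\<close>
 define k1 where "k1 = 2 * n * w"
 define k2 where "k2 = 2 * (A + 14) * w * n\<^sup>2"
 define b where "b = K / (16 * G\<^sup>2 * 4 ^ DIM('a))"
 \<comment> \<open>Division by n^2 absorbs N (N - 1). The 1 in the minimum keeps the optimal radius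
   at most \<open>ri\<close>, and b is what the gradient estimate at the centres of interior spheres
   requires.\<close>
 define aN where "aN = min 1 b / n\<^sup>2"
 have n: "n \<ge> 2" using assms by (simp add: n_def)
 have KG: "K > 0" "G > 0" unfolding K_def G_def by (rule kerc_pos gradc_pos)+
 have w: "w > 0"
 proof -
  have "unit_ball_vol n > 0" by (rule unit_ball_vol_pos) (use n in simp)
  then show ?thesis by (simp add: w_def)
 qed
 have A: "A > 0" using KG by (simp add: A_def)
 have k: "k1 > 0" "k2 > 0" using n w A by (auto simp: k1_def k2_def intro!: mult_pos_pos)
 have b: "b > 0" using KG by (simp add: b_def)
 have aN: "aN > 0" using b n by (simp add: aN_def)
 show ?thesis
 proof (rule exI[of _ "k1 + k2"], rule exI[of _ aN], intro conjI allI impI, goal_cases)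
  case 1 show ?case using k by simp
 next
  case 2 show ?case by (rule aN)
 next
  case hyp: (3 \<Omega> \<alpha> H Hl u)
  then have con: "connected \<Omega>" and Hl: "Hl > 0" and mc: "is_mean_curvature \<alpha> \<Omega> H"
   and HHl: "\<forall>p\<in>frontier \<Omega>. Hl \<le> H p" by auto
  obtain \<rho> C where gdf: "C2_on UNIV \<rho>" "compact C" "\<forall>x. x \<notin> C \<longrightarrow> \<rho> x = 0"
   "\<forall>x\<in>\<Omega>. \<rho> x < 0" "\<forall>x\<in>frontier \<Omega>. \<rho> x = 0" "\<forall>x\<in>frontier \<Omega>. grad \<rho> x \<noteq> 0"
   and loc: "\<forall>p\<in>frontier \<Omega>. \<exists>r. local_defining_fun \<alpha> \<Omega> p r \<rho>"
   using global_defining_function[of \<Omega> \<alpha>] hyp by blast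
  interpret torsion \<Omega> C \<rho> u
   by unfold_locales (use hyp gdf in auto)
  define V where "V = measure lebesgue \<Omega>"
  define H0 where "H0 = surface_area (frontier \<Omega>) / (n * V)"
  define M where "M = Sup ((\<lambda>x. norm (grad u x)) ` \<Omega>)"
  define \<delta> where "\<delta> = Sup ((\<lambda>p. \<bar>H0 - H p\<bar>) ` frontier \<Omega>)"
  define D where "D = n * (n - 1) * V * \<delta> / Hl"
  have V: "V > 0" unfolding V_def by (rule volume_pos)
  note def = deficit[OF assms mc loc Hl HHl, folded n_def V_def, folded H0_def, folded \<delta>_def, folded D_def]
  have MM: "\<forall>x\<in>\<Omega>. norm (grad u x) \<le> M"
  proof
   fix x assume x: "x \<in> \<Omega>"
   have "bdd_above ((\<lambda>x. norm (grad u x)) ` \<Omega>)" by (rule bdd_aboveI2[OF M0(2)])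
   then show "norm (grad u x) \<le> M" unfolding M_def by (rule cSUP_upper[OF x])
  qed
  obtain z where z: "z \<in> \<Omega>" "grad u z = 0" using exists_minimum by blast
  define \<mu> where "\<mu> = mu0 \<Omega> z"
  have \<mu>: "\<mu> > 0" unfolding \<mu>_def by (rule mu0(1)[OF con z(1)])
  have dc: "continuous_on (frontier \<Omega>) (\<lambda>x. dist x z)" by (intro continuous_intros)
  obtain xe where xe: "xe \<in> frontier \<Omega>" "\<And>p. p \<in> frontier \<Omega> ==> dist p z \<le> dist xe z"
   using continuous_attains_sup[OF compact_frontier_Omega frontier_ne dc] by blast
  obtain xi where xi: "xi \<in> frontier \<Omega>" "\<And>p. p \<in> frontier \<Omega> ==> dist xi z \<le> dist p z"
   using continuous_attains_inf[OF compact_frontier_Omega frontier_ne dc] by blast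
  define R where "R = dist xe z"
  define r where "r = dist xi z"
  have re: "Sup ((\<lambda>x. dist x z) ` frontier \<Omega>) = R" unfolding R_def
   by (rule cSup_eq_maximum) (use xe in auto)
  have rr: "Inf ((\<lambda>x. dist x z) ` frontier \<Omega>) = r" unfolding r_def
   by (rule cInf_eq_minimum) (use xi in auto)
  have Rr: "0 \<le> r" "r \<le> R" using xe xi by (auto simp: R_def r_def)
  \<comment> \<open>Dropping the inner radius from R + r leaves R, the quantity that the volume
    controls from below.\<close>
  have ER: "(R - r) * R \<le> R\<^sup>2 - r\<^sup>2"
  proof -
   have "(R - r) * R \<le> (R - r) * (R + r)" using Rr by (intro mult_left_mono) auto
   then show ?thesis by (simp add: power2_eq_square algebra_simps)
  qed
  have half: "(R - r) * R / 2 \<le> Y" if "(R\<^sup>2 - r\<^sup>2) / 2 \<le> Y" for Y using ER that by (simp add: field_simps)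
  have VR: "V powr (1 / n) \<le> w * R"
   unfolding V_def w_def n_def by (rule volume_radius[of z]) (simp add: R_def xe(2))
  have low: "R - r \<le> ((k1 + k2) * c * (diameter \<Omega> powr \<gamma> * V powr (1 / 2 - 1 / n)) / Hl powr (1 / 2) * ((1 + \<mu>) / \<mu>)) * \<delta> powr (1 / 2)"
   if \<gamma>: "\<gamma> > 0" and c: "sobolev_holder_const \<Omega> \<gamma> c" for \<gamma> c
  proof -
   have c0: "c \<ge> 0" by (rule sobolev_const_nonneg[OF c])
   have "(R\<^sup>2 - r\<^sup>2) / 2 \<le> c * (sqrt D * ((1 + \<mu>) / \<mu>)) * diameter \<Omega> powr \<gamma>"
    unfolding R_def r_def \<mu>_def by (rule stability_low_dim[OF con z def(2,3) c \<gamma> xe(1) xi(1)])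
   from half[OF this] have "(R - r) * R \<le> 2 * (c * (sqrt D * ((1 + \<mu>) / \<mu>)) * diameter \<Omega> powr \<gamma>)" by (simp only: pos_divide_le_eq zero_less_numeral mult.commute)
   then have "R - r \<le> (2 * n * w * c * (diameter \<Omega> powr \<gamma> * V powr (1 / 2 - 1 / n)) / Hl powr (1 / 2) * ((1 + \<mu>) / \<mu>)) * \<delta> powr (1 / 2)"
    unfolding D_def by (intro stability_low_dim_real[OF n V Hl \<mu> w def(1) c0 _ _ _ VR]) (use Rr in auto)
   also have "\<dots> \<le> ((k1 + k2) * c * (diameter \<Omega> powr \<gamma> * V powr (1 / 2 - 1 / n)) / Hl powr (1 / 2) * ((1 + \<mu>) / \<mu>)) * \<delta> powr (1 / 2)"
    unfolding k1_def[symmetric] using k c0 \<mu> by (intro mult_right_mono divide_right_mono) auto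
   finally show ?thesis .
  qed
  have high: "R - r \<le> ((k1 + k2) * M powr (n / (n + 2)) / (\<mu> powr (2 / (n + 2)) * V powr (1 / n - 1 / (n + 2)) * Hl powr (1 / (n + 2)))) * \<delta> powr (1 / (n + 2))"
   if ri: "ri > 0" "interior_sphere_cond \<Omega> ri" and small: "\<delta> < aN * (Hl / V) * \<mu>\<^sup>2 * M\<^sup>2 * ri powr (n + 2)" for ri
  proof -
   define X where "X = \<mu>\<^sup>2 * M\<^sup>2 * ri powr (n + 2)"
   have X: "X \<ge> 0" by (simp add: X_def)
   have "D = n * (n - 1) * V / Hl * \<delta>" by (simp add: D_def)
   also have "\<dots> \<le> n * (n - 1) * V / Hl * (aN * (Hl / V) * X)" using small V Hl n
    by (intro mult_left_mono) (auto simp: X_def mult.assoc)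
   also have "\<dots> = n * (n - 1) * aN * X" using V Hl by simp
   also have "\<dots> \<le> n\<^sup>2 * aN * X" using n aN X by (intro mult_right_mono) (auto simp: power2_eq_square)
   also have "\<dots> = min 1 b * X" using n by (simp add: aN_def)
   finally have DX: "D \<le> min 1 b * X" .
   have D1: "D \<le> X" "D \<le> b * X" using DX mult_right_mono[OF min.cobounded1[of 1 b] X] mult_right_mono[OF min.cobounded2[of 1 b] X] by auto
   note hd = stability_high_dim[OF con z def(2,3) MM ri D1(2)[unfolded b_def K_def G_def X_def \<mu>_def n_def], of R xe xi]
   have Rx: "\<forall>p\<in>frontier \<Omega>. dist p z \<le> R" using xe(2) by (simp add: R_def)
   have M: "M > 0" "R > 0" using hd(1,2)[OF Rx xe(1) R_def[symmetric] xi(1)] by auto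
   have "R - r \<le> (2 * (A + 14) * w * n\<^sup>2 * M powr (n / (n + 2)) / (\<mu> powr (2 / (n + 2)) * V powr (1 / n - 1 / (n + 2)) * Hl powr (1 / (n + 2)))) * \<delta> powr (1 / (n + 2))"
   proof (rule stability_high_dim_real[OF n V Hl \<mu> w M(1) ri(1) M(2) def(1) _ _ D_def D1(1)[unfolded X_def] _ VR])
    fix \<sigma> :: real assume s: "0 < \<sigma>" "\<sigma> \<le> ri"
    have "(R\<^sup>2 - r\<^sup>2) / 2 \<le> A * (sqrt D / \<mu>) * \<sigma> powr (- n / 2) + 14 * M * \<sigma>"
     using hd(3)[OF Rx xe(1) R_def[symmetric] xi(1) s] unfolding A_def n_def K_def \<mu>_def r_def by simp
    from half[OF this] show "(R - r) * R / 2 \<le> A * (sqrt D / \<mu>) * \<sigma> powr (- n / 2) + 14 * M * \<sigma>" .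
   qed (use Rr A in auto)
   also have "\<dots> \<le> ((k1 + k2) * M powr (n / (n + 2)) / (\<mu> powr (2 / (n + 2)) * V powr (1 / n - 1 / (n + 2)) * Hl powr (1 / (n + 2)))) * \<delta> powr (1 / (n + 2))"
    unfolding k2_def[symmetric] using k by (intro mult_right_mono divide_right_mono) auto
   finally show ?thesis .
  qed
  show ?case
   unfolding Let_def n_def[symmetric] V_def[symmetric] H0_def[symmetric] M_def[symmetric] \<delta>_def[symmetric]
  proof (rule bexI[OF _ z(1)], unfold re rr \<mu>_def[symmetric], intro conjI impI allI, goal_cases)
   case (1 \<gamma> c)
   then have "\<gamma> > 0" by auto
   then show ?case using low 1 by blast
  next
   case (2 ri)
   then show ?case using high by blast
  qed
 qed
qed

end
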